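(* Let $k$ be an integral domain and $X$ a torsion-free cancellative monoid scheme. Let $\mathcal{U}=(U_i)_{i\in I}$ be an open cover of $X$ by affine monoid schemes, let $\mathcal{U}_k=((U_i)_k)_{i\in I}$ be the induced affine open cover of the $k$-scheme $X_k$, and let $E_2^{10}=H^1(\mathcal{U}_k,\mathcal{O}_{X_k}^* )$ be the first Čech cohomology group of this cover. Then $E_2^{10}=\mathsf{Pic}(X)$, and hence the natural map $$\mathsf{Pic}(X)\to\mathsf{Pic}(X_k)$$ is a monomorphism.
   Context: All monoids are commutative, multiplicative, with unit (no zero element is required). An ideal of a monoid $M$ is a (possibly empty) subset $I$ with $IM\subset I$; it is prime if $M\setminus I$ is a submonoid (so $\emptyset$ is prime). $\mathrm{Spec}(M)$ is the set of prime ideals with basis of open sets $D(f)=\{\mathfrak p : f\notin\mathfrak p\}$, $f\in M$, and sheaf of monoids $\mathcal{O}_M$ with $\mathcal{O}_M(D(f))=M_f$ (the localization inverting $f$). A monoid scheme is a topological space $X$ with a sheaf of monoids $\mathcal{O}_X$ that is locally isomorphic to some $(\mathrm{Spec}(M),\mathcal{O}_M)$ (affine monoid schemes); morphisms are local, as for usual schemes. Finite products exist, with $\mathrm{Spec}(M)\times\mathrm{Spec}(N)=\mathrm{Spec}(M\times N)$. $X$ is separated if the diagonal $X\to X\times X$ is a closed immersion; here $f:Z\to Y$ is a closed immersion if for every affine open $U=\mathrm{Spec}(M)\subset Y$ the preimage $f^{-1}(U)$ is affine, $f^{-1}(U)=\mathrm{Spec}(N)$, and $M\to N$ is surjective. (In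 particular the intersection of two affine open subschemes of a separated monoid scheme is affine.) A separated monoid scheme $X$ is cancellative if for every affine open $\mathrm{Spec}(M)\subset X$ the monoid $M$ is cancellative ($ax=ay\Rightarrow x=y$). $X$ is torsion-free if for every affine open $\mathrm{Spec}(M)\subset X$ the monoid $M$ is torsion-free, i.e. $x^n=y^n$ for some $n>0$ implies $x=y$. For a commutative ring $k$, $X_k$ is the $k$-scheme functorially assigned to $X$: for $X=\mathrm{Spec}(M)$ it is the affine scheme of the monoid algebra $k[M]$, and in general it is obtained by gluing. $E_2^{10}$ is the first cohomology of the Čech cochain complex $\prod_i k[M_i]^*\to\prod_{i,j}k[M_{ij}]^*\to\cdots$, where $U_i=\mathrm{Spec}(M_i)$, $U_i\cap U_j=\mathrm{Spec}(M_{ij})$, etc. $\mathsf{Pic}(X)=H^1(X,\mathcal{O}_X^* )$ is the group of isomorphism classes of line bundles on $X$ (sheaves of $\mathcal{O}_X$-sets locally isomorphic to $\mathcal{O}_X$), and $\mathsf{Pic}(X_k)$ is the usual Picard group. The natural map is induced by sending a free $M$-set $S$ to the free $k[M]$-module $k[S]$, sheafified. *)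

theory Defs
  imports
    "HOL-Analysis.Product_Topology"
    "HOL-Algebra.Product_Groups"
    "HOL-Algebra.Ideal"
    "HOL-Algebra.Module"
begin

text \<open>
  Spaces are abstract topologies, monoids and rings are records with a carrier.  A (pre)sheaf is
  given by its values on sets and its restriction functions; \<open>r U V\<close> is the restriction from \<open>U\<close>
  to \<open>V \<subseteq> U\<close>.  Only the values on open sets are meaningful.
\<close>

section \<open>Sheaves\<close>

definition sheaf :: "'p topology \<Rightarrow> ('p set \<Rightarrow> 's set) \<Rightarrow> ('p set \<Rightarrow> 'p set \<Rightarrow> 's \<Rightarrow> 's) \<Rightarrow> bool" where
  "sheaf T F r \<longleftrightarrow>
     (\<forall>U V. openin T U \<and> openin T V \<and> V \<subseteq> U \<longrightarrow> r U V \<in> F U \<rightarrow> F V) \<and>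
     (\<forall>U. openin T U \<longrightarrow> (\<forall>s\<in>F U. r U U s = s)) \<and>
     (\<forall>U V W. openin T U \<and> openin T V \<and> openin T W \<and> W \<subseteq> V \<and> V \<subseteq> U \<longrightarrow>
        (\<forall>s\<in>F U. r V W (r U V s) = r U W s)) \<and>
     (\<forall>\<U> s. (\<forall>U\<in>\<U>. openin T U \<and> s U \<in> F U) \<and>
        (\<forall>U\<in>\<U>. \<forall>V\<in>\<U>. r U (U \<inter> V) (s U) = r V (U \<inter> V) (s V)) \<longrightarrow>
        (\<exists>!t. t \<in> F (\<Union>\<U>) \<and> (\<forall>U\<in>\<U>. r (\<Union>\<U>) U t = s U)))"

record ('p, 'a) monoidal_space =
  mtop :: "'p topology"
  msec :: "'p set \<Rightarrow> 'a monoid"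
  mres :: "'p set \<Rightarrow> 'p set \<Rightarrow> 'a \<Rightarrow> 'a"

definition monoidal_space :: "('p, 'a) monoidal_space \<Rightarrow> bool" where
  "monoidal_space X \<longleftrightarrow>
     sheaf (mtop X) (\<lambda>U. carrier (msec X U)) (mres X) \<and>
     (\<forall>U. openin (mtop X) U \<longrightarrow> comm_monoid (msec X U)) \<and>
     (\<forall>U V. openin (mtop X) U \<and> openin (mtop X) V \<and> V \<subseteq> U \<longrightarrow>
        mres X U V \<in> hom (msec X U) (msec X V) \<and>
        mres X U V \<one>\<^bsub>msec X U\<^esub> = \<one>\<^bsub>msec X V\<^esub>)"

record ('y, 'r) ringed_space =
  rtop :: "'y topology"
  rsec :: "'y set \<Rightarrow> 'r ring"
  rres :: "'y set \<Rightarrow> 'y set \<Rightarrow> 'r \<Rightarrow> 'r"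

definition ringed_space :: "('y, 'r) ringed_space \<Rightarrow> bool" where
  "ringed_space Y \<longleftrightarrow>
     sheaf (rtop Y) (\<lambda>U. carrier (rsec Y U)) (rres Y) \<and>
     (\<forall>U. openin (rtop Y) U \<longrightarrow> cring (rsec Y U)) \<and>
     (\<forall>U V. openin (rtop Y) U \<and> openin (rtop Y) V \<and> V \<subseteq> U \<longrightarrow>
        rres Y U V \<in> ring_hom (rsec Y U) (rsec Y V))"

section \<open>Localization\<close>

text \<open>
  \<open>\<phi>\<close> exhibits \<open>N\<close> as the monoid of fractions \<open>a / f ^ m\<close>.  The localization \<open>R\<^sub>f\<close> of a commutative
  ring is the localization of its multiplicative monoid, so the same predicate is used for rings
  (together with the requirement that \<open>\<phi>\<close> be a ring homomorphism).
\<close>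

definition is_localization ::
    "('a, 'm) monoid_scheme \<Rightarrow> 'a \<Rightarrow> ('b, 'n) monoid_scheme \<Rightarrow> ('a \<Rightarrow> 'b) \<Rightarrow> bool" where
  "is_localization M f N \<phi> \<longleftrightarrow>
     \<phi> \<in> hom M N \<and> \<phi> \<one>\<^bsub>M\<^esub> = \<one>\<^bsub>N\<^esub> \<and> \<phi> f \<in> Units N \<and>
     (\<forall>n\<in>carrier N. \<exists>a\<in>carrier M. \<exists>m::nat. \<phi> f [^]\<^bsub>N\<^esub> m \<otimes>\<^bsub>N\<^esub> n = \<phi> a) \<and>
     (\<forall>a\<in>carrier M. \<forall>b\<in>carrier M. \<phi> a = \<phi> b \<longrightarrow>
        (\<exists>m::nat. f [^]\<^bsub>M\<^esub> m \<otimes>\<^bsub>M\<^esub> a = f [^]\<^bsub>M\<^esub> m \<otimes>\<^bsub>M\<^esub> b))"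

section \<open>Monoid schemes\<close>

definition mideal :: "'a set \<Rightarrow> ('a, 'm) monoid_scheme \<Rightarrow> bool" where
  "mideal I M \<longleftrightarrow> I \<subseteq> carrier M \<and> (\<forall>x\<in>I. \<forall>a\<in>carrier M. x \<otimes>\<^bsub>M\<^esub> a \<in> I)"

definition mprime :: "'a set \<Rightarrow> ('a, 'm) monoid_scheme \<Rightarrow> bool" where
  "mprime P M \<longleftrightarrow> mideal P M \<and> submonoid (carrier M - P) M"

definition mbasic :: "('a, 'm) monoid_scheme \<Rightarrow> 'a \<Rightarrow> 'a set set" where
  "mbasic M f = {P. mprime P M \<and> f \<notin> P}"

definition mspec :: "('a, 'm) monoid_scheme \<Rightarrow> 'a set topology" where
  "mspec M = topology (arbitrary union_of (\<lambda>S. S \<in> mbasic M ` carrier M))"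

text \<open>
  \<open>(h, \<theta>)\<close> is an isomorphism of \<open>(Spec M, O\<^sub>M)\<close> with the open subspace \<open>U\<close>: the sheaf \<open>O\<^sub>M\<close> is the one
  with \<open>O\<^sub>M (D f) = M\<^sub>f\<close> on the basis, the restrictions being the maps of localizations under \<open>M\<close>.
\<close>

definition mchart ::
    "('p, 'a) monoidal_space \<Rightarrow> 'p set \<Rightarrow> 'b monoid \<Rightarrow> ('b set \<Rightarrow> 'p) \<Rightarrow> ('b \<Rightarrow> 'a) \<Rightarrow> bool" where
  "mchart X U M h \<theta> \<longleftrightarrow>
     openin (mtop X) U \<and> comm_monoid M \<and>
     homeomorphic_map (mspec M) (subtopology (mtop X) U) h \<and>
     \<theta> \<in> hom M (msec X U) \<and> \<theta> \<one>\<^bsub>M\<^esub> = \<one>\<^bsub>msec X U\<^esub> \<and>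
     (\<forall>f\<in>carrier M. is_localization M f (msec X (h ` mbasic M f)) (mres X U (h ` mbasic M f) \<circ> \<theta>))"

text \<open>
  The case \<open>f = 1\<close> of a chart says that \<open>\<theta>\<close> is an isomorphism from \<open>M\<close> onto the sections over \<open>U\<close>.
  Hence taking \<open>M\<close> of the type of the sections loses nothing, and the monoid \<open>M\<close> of an affine open
  \<open>U = Spec M\<close> may be taken to be \<open>msec X U\<close>.
\<close>

definition maffine :: "('p, 'a) monoidal_space \<Rightarrow> 'p set \<Rightarrow> bool" where
  "maffine X U \<longleftrightarrow> (\<exists>(M::'a monoid) h \<theta>. mchart X U M h \<theta>)"

definition monoid_scheme_space :: "('p, 'a) monoidal_space \<Rightarrow> bool" where
  "monoid_scheme_space X \<longleftrightarrow>
     monoidal_space X \<and> (\<forall>x\<in>topspace (mtop X). \<exists>U. maffine X U \<and> x \<in> U)"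

subsection \<open>Products and separatedness\<close>

definition germ :: "('p, 'a) monoidal_space \<Rightarrow> 'p \<Rightarrow> 'p set \<Rightarrow> 'a \<Rightarrow> ('p set \<times> 'a) set" where
  "germ X x U a =
     {(V, b). openin (mtop X) V \<and> x \<in> V \<and> b \<in> carrier (msec X V) \<and>
        (\<exists>W. openin (mtop X) W \<and> x \<in> W \<and> W \<subseteq> U \<inter> V \<and> mres X U W a = mres X V W b)}"

definition stalk :: "('p, 'a) monoidal_space \<Rightarrow> 'p \<Rightarrow> ('p set \<times> 'a) set monoid" where
  "stalk X x =
     \<lparr>carrier = {germ X x U a |U a. openin (mtop X) U \<and> x \<in> U \<and> a \<in> carrier (msec X U)},
      monoid.mult = (\<lambda>A B. {(V, c). openin (mtop X) V \<and> x \<in> V \<and> c \<in> carrier (msec X V) \<and>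
         (\<exists>(U, a)\<in>A. \<exists>(U', b)\<in>B. \<exists>W. openin (mtop X) W \<and> x \<in> W \<and> W \<subseteq> U \<inter> U' \<inter> V \<and>
            mres X V W c = mres X U W a \<otimes>\<^bsub>msec X W\<^esub> mres X U' W b)}),
      one = germ X x (topspace (mtop X)) \<one>\<^bsub>msec X (topspace (mtop X))\<^esub>\<rparr>"

text \<open>
  The product of monoid schemes.  Since \<open>Spec M \<times> Spec N = Spec (M \<times> N)\<close>, and the primes of \<open>M \<times> N\<close>
  correspond to pairs of primes with \<open>D (f, g) = D f \<times> D g\<close>, the underlying space is the product
  space.  The stalks are the products of the stalks; a section is a family of germs that locally
  comes from a pair of sections on an open rectangle.
\<close>

definition mprod :: "('p, 'a) monoidal_space \<Rightarrow> ('q, 'b) monoidal_space \<Rightarrow>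
    ('p \<times> 'q, 'p \<times> 'q \<Rightarrow> ('p set \<times> 'a) set \<times> ('q set \<times> 'b) set) monoidal_space" where
  "mprod X Y =
     \<lparr>mtop = prod_topology (mtop X) (mtop Y),
      msec = (\<lambda>W.
        \<lparr>carrier = {s \<in> extensional W. \<forall>p\<in>W. \<exists>U V a b.
             openin (mtop X) U \<and> openin (mtop Y) V \<and> p \<in> U \<times> V \<and> U \<times> V \<subseteq> W \<and>
             a \<in> carrier (msec X U) \<and> b \<in> carrier (msec Y V) \<and>
             (\<forall>(x, y)\<in>U \<times> V. s (x, y) = (germ X x U a, germ Y y V b))},
         monoid.mult = (\<lambda>s t. \<lambda>p\<in>W. s p \<otimes>\<^bsub>stalk X (fst p) \<times>\<times> stalk Y (snd p)\<^esub> t p),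
         one = (\<lambda>p\<in>W. \<one>\<^bsub>stalk X (fst p) \<times>\<times> stalk Y (snd p)\<^esub>)\<rparr>),
      mres = (\<lambda>W W' s. restrict s W')\<rparr>"

text \<open>A morphism \<open>Z \<rightarrow> Y\<close> is given by \<open>\<phi>\<close> on points and by \<open>\<psi> W\<close> from sections over \<open>W\<close> to sections
  over the preimage of \<open>W\<close>.\<close>

definition closed_immersion :: "('p, 'a) monoidal_space \<Rightarrow> ('q, 'b) monoidal_space \<Rightarrow>
    ('p \<Rightarrow> 'q) \<Rightarrow> ('q set \<Rightarrow> 'b \<Rightarrow> 'a) \<Rightarrow> bool" where
  "closed_immersion Z Y \<phi> \<psi> \<longleftrightarrow>
     (\<forall>W. maffine Y W \<longrightarrow>
        maffine Z {z \<in> topspace (mtop Z). \<phi> z \<in> W} \<and>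
        \<psi> W ` carrier (msec Y W) = carrier (msec Z {z \<in> topspace (mtop Z). \<phi> z \<in> W}))"

text \<open>The comorphism of the diagonal; on \<open>Spec M\<close> it is the multiplication \<open>M \<times> M \<rightarrow> M\<close>.\<close>

definition diag_comorphism ::
    "('p, 'a) monoidal_space \<Rightarrow> ('p \<times> 'p) set \<Rightarrow>
     ('p \<times> 'p \<Rightarrow> ('p set \<times> 'a) set \<times> ('p set \<times> 'a) set) \<Rightarrow> 'a" where
  "diag_comorphism X W s =
     (let U = {x \<in> topspace (mtop X). (x, x) \<in> W} in
      THE t. t \<in> carrier (msec X U) \<and>
        (\<forall>x\<in>U. germ X x U t = fst (s (x, x)) \<otimes>\<^bsub>stalk X x\<^esub> snd (s (x, x))))"

definition separated :: "('p, 'a) monoidal_space \<Rightarrow> bool" where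
  "separated X \<longleftrightarrow> closed_immersion X (mprod X X) (\<lambda>x. (x, x)) (diag_comorphism X)"

definition cancellative_scheme :: "('p, 'a) monoidal_space \<Rightarrow> bool" where
  "cancellative_scheme X \<longleftrightarrow>
     monoid_scheme_space X \<and> separated X \<and>
     (\<forall>U. maffine X U \<longrightarrow>
        (\<forall>a\<in>carrier (msec X U). \<forall>x\<in>carrier (msec X U). \<forall>y\<in>carrier (msec X U).
           a \<otimes>\<^bsub>msec X U\<^esub> x = a \<otimes>\<^bsub>msec X U\<^esub> y \<longrightarrow> x = y))"

definition torsion_free_scheme :: "('p, 'a) monoidal_space \<Rightarrow> bool" where
  "torsion_free_scheme X \<longleftrightarrow>
     monoid_scheme_space X \<and>
     (\<forall>U. maffine X U \<longrightarrow>
        (\<forall>x\<in>carrier (msec X U). \<forall>y\<in>carrier (msec X U). \<forall>n::nat.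
           n > 0 \<and> x [^]\<^bsub>msec X U\<^esub> n = y [^]\<^bsub>msec X U\<^esub> n \<longrightarrow> x = y))"

definition maffine_cover :: "('p, 'a) monoidal_space \<Rightarrow> 'i set \<Rightarrow> ('i \<Rightarrow> 'p set) \<Rightarrow> bool" where
  "maffine_cover X I U \<longleftrightarrow> (\<forall>i\<in>I. maffine X (U i)) \<and> (\<Union>i\<in>I. U i) = topspace (mtop X)"

section \<open>The scheme $X_k$\<close>

text \<open>Finitely supported functions \<open>S \<rightarrow> k\<close>, extended by zero, and the product on them induced by
  an operation \<open>p\<close> (used for the ring \<open>k[M]\<close> and for its action on \<open>k[S]\<close>, \<open>S\<close> an \<open>M\<close>-set).\<close>

definition fin_supp :: "('k, 'm) ring_scheme \<Rightarrow> 's set \<Rightarrow> ('s \<Rightarrow> 'k) set" where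
  "fin_supp k S = {f. (\<forall>x. f x \<in> carrier k) \<and> finite {x. f x \<noteq> \<zero>\<^bsub>k\<^esub>} \<and> {x. f x \<noteq> \<zero>\<^bsub>k\<^esub>} \<subseteq> S}"

definition convolve ::
    "('k, 'm) ring_scheme \<Rightarrow> ('a \<Rightarrow> 's \<Rightarrow> 't) \<Rightarrow> ('a \<Rightarrow> 'k) \<Rightarrow> ('s \<Rightarrow> 'k) \<Rightarrow> 't \<Rightarrow> 'k" where
  "convolve k p f g =
     (\<lambda>z. finsum k (\<lambda>(a, x). f a \<otimes>\<^bsub>k\<^esub> g x)
            {(a, x). f a \<noteq> \<zero>\<^bsub>k\<^esub> \<and> g x \<noteq> \<zero>\<^bsub>k\<^esub> \<and> p a x = z})"

definition single :: "('k, 'm) ring_scheme \<Rightarrow> 's \<Rightarrow> 's \<Rightarrow> 'k" where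
  "single k x = (\<lambda>y. if y = x then \<one>\<^bsub>k\<^esub> else \<zero>\<^bsub>k\<^esub>)"

definition push_forward :: "('k, 'm) ring_scheme \<Rightarrow> ('s \<Rightarrow> 't) \<Rightarrow> ('s \<Rightarrow> 'k) \<Rightarrow> 't \<Rightarrow> 'k" where
  "push_forward k \<phi> f = (\<lambda>y. finsum k f {x. f x \<noteq> \<zero>\<^bsub>k\<^esub> \<and> \<phi> x = y})"

definition monoid_algebra :: "('k, 'm) ring_scheme \<Rightarrow> ('a, 'n) monoid_scheme \<Rightarrow> ('a \<Rightarrow> 'k) ring" where
  "monoid_algebra k M =
     \<lparr>carrier = fin_supp k (carrier M),
      monoid.mult = convolve k (monoid.mult M),
      one = single k \<one>\<^bsub>M\<^esub>,
      zero = (\<lambda>_. \<zero>\<^bsub>k\<^esub>),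
      add = (\<lambda>f g x. f x \<oplus>\<^bsub>k\<^esub> g x)\<rparr>"

definition rbasic :: "('r, 'm) ring_scheme \<Rightarrow> 'r \<Rightarrow> 'r set set" where
  "rbasic R f = {P. primeideal P R \<and> f \<notin> P}"

definition rspec :: "('r, 'm) ring_scheme \<Rightarrow> 'r set topology" where
  "rspec R = topology (arbitrary union_of (\<lambda>S. S \<in> rbasic R ` carrier R))"

text \<open>\<open>(h, \<theta>)\<close> is an isomorphism of the affine scheme \<open>Spec R\<close> with the open subspace \<open>V\<close>; the
  structure sheaf of \<open>Spec R\<close> is the one with value \<open>R\<^sub>f\<close> on \<open>D f\<close>.\<close>

definition rchart ::
    "('y, 'r) ringed_space \<Rightarrow> 'y set \<Rightarrow> 's ring \<Rightarrow> ('s set \<Rightarrow> 'y) \<Rightarrow> ('s \<Rightarrow> 'r) \<Rightarrow> bool" where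
  "rchart Y V R h \<theta> \<longleftrightarrow>
     openin (rtop Y) V \<and> cring R \<and>
     homeomorphic_map (rspec R) (subtopology (rtop Y) V) h \<and>
     \<theta> \<in> ring_hom R (rsec Y V) \<and>
     (\<forall>f\<in>carrier R. is_localization R f (rsec Y (h ` rbasic R f)) (rres Y V (h ` rbasic R f) \<circ> \<theta>))"

text \<open>
  Gluing data presenting a ringed space \<open>Y\<close> as \<open>X\<^sub>k\<close>: for every affine open \<open>U\<close> of \<open>X\<close> an isomorphism
  \<open>(h U, \<theta> U)\<close> of \<open>Spec k[O\<^sub>X U]\<close> with an open subspace \<open>U\<^sub>k\<close> of \<open>Y\<close>.  The \<open>U\<^sub>k\<close> cover \<open>Y\<close>, the
  isomorphisms are compatible with the inclusions of affine opens, and \<open>U\<^sub>k\<close> and \<open>V\<^sub>k\<close> meet exactly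
  along the \<open>W\<^sub>k\<close> with \<open>W \<subseteq> U \<inter> V\<close>.  This determines \<open>Y\<close> up to unique isomorphism.
\<close>

record ('p, 'a, 'k, 'y, 'r) gluing =
  gpt :: "'p set \<Rightarrow> ('a \<Rightarrow> 'k) set \<Rightarrow> 'y"
  gsec :: "'p set \<Rightarrow> ('a \<Rightarrow> 'k) \<Rightarrow> 'r"

definition over_k ::
    "'k ring \<Rightarrow> ('p, 'a) monoidal_space \<Rightarrow> ('p, 'a, 'k, 'y, 'r) gluing \<Rightarrow> 'p set \<Rightarrow> 'y set" where
  "over_k k X \<gamma> U = gpt \<gamma> U ` topspace (rspec (monoid_algebra k (msec X U)))"

definition base_change ::
    "'k ring \<Rightarrow> ('p, 'a) monoidal_space \<Rightarrow> ('y, 'r) ringed_space \<Rightarrow>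
     ('p, 'a, 'k, 'y, 'r) gluing \<Rightarrow> bool" where
  "base_change k X Y \<gamma> \<longleftrightarrow>
     ringed_space Y \<and>
     (\<forall>U. maffine X U \<longrightarrow>
        rchart Y (over_k k X \<gamma> U) (monoid_algebra k (msec X U)) (gpt \<gamma> U) (gsec \<gamma> U)) \<and>
     topspace (rtop Y) = \<Union>(over_k k X \<gamma> ` {U. maffine X U}) \<and>
     (\<forall>U V. maffine X U \<and> maffine X V \<and> V \<subseteq> U \<longrightarrow>
        (\<forall>P. primeideal P (monoid_algebra k (msec X V)) \<longrightarrow>
           gpt \<gamma> V P = gpt \<gamma> U {f \<in> carrier (monoid_algebra k (msec X U)).
                                  push_forward k (mres X U V) f \<in> P}) \<and>
        (\<forall>f\<in>carrier (monoid_algebra k (msec X U)).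
           gsec \<gamma> V (push_forward k (mres X U V) f) =
           rres Y (over_k k X \<gamma> U) (over_k k X \<gamma> V) (gsec \<gamma> U f))) \<and>
     (\<forall>U V. maffine X U \<and> maffine X V \<longrightarrow>
        over_k k X \<gamma> U \<inter> over_k k X \<gamma> V =
        \<Union>(over_k k X \<gamma> ` {W. maffine X W \<and> W \<subseteq> U \<inter> V}))"

section \<open>Line bundles on a monoid scheme\<close>

record ('p, 'a, 'l) oset =
  osec :: "'p set \<Rightarrow> 'l set"
  oact :: "'p set \<Rightarrow> 'a \<Rightarrow> 'l \<Rightarrow> 'l"
  ores :: "'p set \<Rightarrow> 'p set \<Rightarrow> 'l \<Rightarrow> 'l"

definition oset_sheaf :: "('p, 'a) monoidal_space \<Rightarrow> ('p, 'a, 'l) oset \<Rightarrow> bool" where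
  "oset_sheaf X L \<longleftrightarrow>
     sheaf (mtop X) (osec L) (ores L) \<and>
     (\<forall>U. openin (mtop X) U \<longrightarrow> (\<forall>l\<in>osec L U.
        oact L U \<one>\<^bsub>msec X U\<^esub> l = l \<and>
        (\<forall>a\<in>carrier (msec X U). oact L U a l \<in> osec L U \<and>
           (\<forall>b\<in>carrier (msec X U). oact L U (a \<otimes>\<^bsub>msec X U\<^esub> b) l = oact L U a (oact L U b l))))) \<and>
     (\<forall>U V. openin (mtop X) U \<and> openin (mtop X) V \<and> V \<subseteq> U \<longrightarrow>
        (\<forall>a\<in>carrier (msec X U). \<forall>l\<in>osec L U.
           ores L U V (oact L U a l) = oact L V (mres X U V a) (ores L U V l)))"

definition oset_iso_on ::
    "('p, 'a) monoidal_space \<Rightarrow> 'p set \<Rightarrow> ('p, 'a, 'l) oset \<Rightarrow> ('p, 'a, 'n) oset \<Rightarrow> bool" where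
  "oset_iso_on X U L N \<longleftrightarrow>
     (\<exists>\<phi>. (\<forall>V. openin (mtop X) V \<and> V \<subseteq> U \<longrightarrow>
             bij_betw (\<phi> V) (osec L V) (osec N V) \<and>
             (\<forall>a\<in>carrier (msec X V). \<forall>l\<in>osec L V. \<phi> V (oact L V a l) = oact N V a (\<phi> V l))) \<and>
          (\<forall>V W. openin (mtop X) V \<and> openin (mtop X) W \<and> W \<subseteq> V \<and> V \<subseteq> U \<longrightarrow>
             (\<forall>l\<in>osec L V. \<phi> W (ores L V W l) = ores N V W (\<phi> V l))))"

definition structure_oset :: "('p, 'a) monoidal_space \<Rightarrow> ('p, 'a, 'a) oset" where
  "structure_oset X =
     \<lparr>osec = (\<lambda>U. carrier (msec X U)), oact = (\<lambda>U. monoid.mult (msec X U)), ores = mres X\<rparr>"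

definition mline_bundle :: "('p, 'a) monoidal_space \<Rightarrow> ('p, 'a, 'l) oset \<Rightarrow> bool" where
  "mline_bundle X L \<longleftrightarrow>
     oset_sheaf X L \<and>
     (\<forall>x\<in>topspace (mtop X). \<exists>U. openin (mtop X) U \<and> x \<in> U \<and> oset_iso_on X U (structure_oset X) L)"

definition mgenerator ::
    "('p, 'a) monoidal_space \<Rightarrow> ('p, 'a, 'l) oset \<Rightarrow> 'p set \<Rightarrow> 'l \<Rightarrow> bool" where
  "mgenerator X L U e \<longleftrightarrow>
     e \<in> osec L U \<and>
     (\<forall>V. openin (mtop X) V \<and> V \<subseteq> U \<longrightarrow>
        bij_betw (\<lambda>a. oact L V a (ores L U V e)) (carrier (msec X V)) (osec L V))"

text \<open>\<open>N\<close> is the tensor product of the line bundles \<open>L\<close> and \<open>L'\<close>: a bilinear pairing into \<open>N\<close> for which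
  \<open>e \<otimes> e'\<close> is a local generator whenever \<open>e\<close> and \<open>e'\<close> are.\<close>

definition mtensor ::
    "('p, 'a) monoidal_space \<Rightarrow> ('p, 'a, 'l) oset \<Rightarrow> ('p, 'a, 'l') oset \<Rightarrow> ('p, 'a, 'n) oset \<Rightarrow> bool" where
  "mtensor X L L' N \<longleftrightarrow>
     (\<exists>\<beta>. (\<forall>U. openin (mtop X) U \<longrightarrow> (\<forall>l\<in>osec L U. \<forall>l'\<in>osec L' U.
             \<beta> U l l' \<in> osec N U \<and>
             (\<forall>a\<in>carrier (msec X U).
                \<beta> U (oact L U a l) l' = oact N U a (\<beta> U l l') \<and>
                \<beta> U l (oact L' U a l') = oact N U a (\<beta> U l l')) \<and>
             (\<forall>V. openin (mtop X) V \<and> V \<subseteq> U \<longrightarrow>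
                ores N U V (\<beta> U l l') = \<beta> V (ores L U V l) (ores L' U V l')) \<and>
             (mgenerator X L U l \<and> mgenerator X L' U l' \<longrightarrow> mgenerator X N U (\<beta> U l l')))))"

text \<open>
  Isomorphism classes are taken among line bundles whose sections are of type \<open>'p \<Rightarrow> 'a\<close>.  Every line
  bundle \<open>L\<close>, of whatever type, is isomorphic to such a one: choose \<open>U\<^sub>x\<close> with a generator \<open>e\<^sub>x\<close> for
  every point \<open>x\<close> and send a section over \<open>V\<close> to the family of its coordinates on \<open>V \<inter> U\<^sub>x\<close>.
  \<open>mclass X L\<close> makes sense for \<open>L\<close> of any type.
\<close>

definition mclass :: "('p, 'a) monoidal_space \<Rightarrow> ('p, 'a, 'l) oset \<Rightarrow> ('p, 'a, 'p \<Rightarrow> 'a) oset set" where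
  "mclass X L = {N. mline_bundle X N \<and> oset_iso_on X (topspace (mtop X)) L N}"

definition mPic :: "('p, 'a) monoidal_space \<Rightarrow> ('p, 'a, 'p \<Rightarrow> 'a) oset set monoid" where
  "mPic X =
     \<lparr>carrier = {mclass X L |L :: ('p, 'a, 'p \<Rightarrow> 'a) oset. mline_bundle X L},
      monoid.mult = (\<lambda>c c'. {N. mline_bundle X N \<and> (\<exists>L\<in>c. \<exists>L'\<in>c'. mtensor X L L' N)}),
      one = mclass X (structure_oset X)\<rparr>"

section \<open>Line bundles on a ringed space\<close>

record ('y, 'r, 'l) omod =
  lsec :: "'y set \<Rightarrow> ('r, 'l) module"
  lres :: "'y set \<Rightarrow> 'y set \<Rightarrow> 'l \<Rightarrow> 'l"

definition omod_sheaf :: "('y, 'r) ringed_space \<Rightarrow> ('y, 'r, 'l) omod \<Rightarrow> bool" where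
  "omod_sheaf Y L \<longleftrightarrow>
     sheaf (rtop Y) (\<lambda>U. carrier (lsec L U)) (lres L) \<and>
     (\<forall>U. openin (rtop Y) U \<longrightarrow> Module.module (rsec Y U) (lsec L U)) \<and>
     (\<forall>U V. openin (rtop Y) U \<and> openin (rtop Y) V \<and> V \<subseteq> U \<longrightarrow>
        (\<forall>l\<in>carrier (lsec L U). \<forall>l'\<in>carrier (lsec L U).
           lres L U V (l \<oplus>\<^bsub>lsec L U\<^esub> l') = lres L U V l \<oplus>\<^bsub>lsec L V\<^esub> lres L U V l') \<and>
        (\<forall>a\<in>carrier (rsec Y U). \<forall>l\<in>carrier (lsec L U).
           lres L U V (a \<odot>\<^bsub>lsec L U\<^esub> l) = rres Y U V a \<odot>\<^bsub>lsec L V\<^esub> lres L U V l))"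

definition omod_iso_on ::
    "('y, 'r) ringed_space \<Rightarrow> 'y set \<Rightarrow> ('y, 'r, 'l) omod \<Rightarrow> ('y, 'r, 'n) omod \<Rightarrow> bool" where
  "omod_iso_on Y U L N \<longleftrightarrow>
     (\<exists>\<phi>. (\<forall>V. openin (rtop Y) V \<and> V \<subseteq> U \<longrightarrow>
             bij_betw (\<phi> V) (carrier (lsec L V)) (carrier (lsec N V)) \<and>
             (\<forall>l\<in>carrier (lsec L V). \<forall>l'\<in>carrier (lsec L V).
                \<phi> V (l \<oplus>\<^bsub>lsec L V\<^esub> l') = \<phi> V l \<oplus>\<^bsub>lsec N V\<^esub> \<phi> V l') \<and>
             (\<forall>a\<in>carrier (rsec Y V). \<forall>l\<in>carrier (lsec L V).
                \<phi> V (a \<odot>\<^bsub>lsec L V\<^esub> l) = a \<odot>\<^bsub>lsec N V\<^esub> \<phi> V l)) \<and>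
          (\<forall>V W. openin (rtop Y) V \<and> openin (rtop Y) W \<and> W \<subseteq> V \<and> V \<subseteq> U \<longrightarrow>
             (\<forall>l\<in>carrier (lsec L V). \<phi> W (lres L V W l) = lres N V W (\<phi> V l))))"

definition structure_omod :: "('y, 'r) ringed_space \<Rightarrow> ('y, 'r, 'r) omod" where
  "structure_omod Y =
     \<lparr>lsec = (\<lambda>U. \<lparr>carrier = carrier (rsec Y U), monoid.mult = monoid.mult (rsec Y U),
                    one = \<one>\<^bsub>rsec Y U\<^esub>, zero = \<zero>\<^bsub>rsec Y U\<^esub>, add = add (rsec Y U),
                    smult = monoid.mult (rsec Y U)\<rparr>),
      lres = rres Y\<rparr>"

definition rline_bundle :: "('y, 'r) ringed_space \<Rightarrow> ('y, 'r, 'l) omod \<Rightarrow> bool" where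
  "rline_bundle Y L \<longleftrightarrow>
     omod_sheaf Y L \<and>
     (\<forall>y\<in>topspace (rtop Y). \<exists>U. openin (rtop Y) U \<and> y \<in> U \<and> omod_iso_on Y U (structure_omod Y) L)"

definition rgenerator ::
    "('y, 'r) ringed_space \<Rightarrow> ('y, 'r, 'l) omod \<Rightarrow> 'y set \<Rightarrow> 'l \<Rightarrow> bool" where
  "rgenerator Y L U e \<longleftrightarrow>
     e \<in> carrier (lsec L U) \<and>
     (\<forall>V. openin (rtop Y) V \<and> V \<subseteq> U \<longrightarrow>
        bij_betw (\<lambda>a. a \<odot>\<^bsub>lsec L V\<^esub> lres L U V e) (carrier (rsec Y V)) (carrier (lsec L V)))"

definition rtensor ::
    "('y, 'r) ringed_space \<Rightarrow> ('y, 'r, 'l) omod \<Rightarrow> ('y, 'r, 'l') omod \<Rightarrow> ('y, 'r, 'n) omod \<Rightarrow> bool" where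
  "rtensor Y L L' N \<longleftrightarrow>
     (\<exists>\<beta>. (\<forall>U. openin (rtop Y) U \<longrightarrow>
             (\<forall>l\<in>carrier (lsec L U). \<forall>m\<in>carrier (lsec L U). \<forall>l'\<in>carrier (lsec L' U).
                \<beta> U (l \<oplus>\<^bsub>lsec L U\<^esub> m) l' = \<beta> U l l' \<oplus>\<^bsub>lsec N U\<^esub> \<beta> U m l') \<and>
             (\<forall>l\<in>carrier (lsec L U). \<forall>l'\<in>carrier (lsec L' U). \<forall>m'\<in>carrier (lsec L' U).
                \<beta> U l (l' \<oplus>\<^bsub>lsec L' U\<^esub> m') = \<beta> U l l' \<oplus>\<^bsub>lsec N U\<^esub> \<beta> U l m') \<and>
             (\<forall>l\<in>carrier (lsec L U). \<forall>l'\<in>carrier (lsec L' U).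
                \<beta> U l l' \<in> carrier (lsec N U) \<and>
                (\<forall>a\<in>carrier (rsec Y U).
                   \<beta> U (a \<odot>\<^bsub>lsec L U\<^esub> l) l' = a \<odot>\<^bsub>lsec N U\<^esub> \<beta> U l l' \<and>
                   \<beta> U l (a \<odot>\<^bsub>lsec L' U\<^esub> l') = a \<odot>\<^bsub>lsec N U\<^esub> \<beta> U l l') \<and>
                (\<forall>V. openin (rtop Y) V \<and> V \<subseteq> U \<longrightarrow>
                   lres N U V (\<beta> U l l') = \<beta> V (lres L U V l) (lres L' U V l')) \<and>
                (rgenerator Y L U l \<and> rgenerator Y L' U l' \<longrightarrow> rgenerator Y N U (\<beta> U l l')))))"

definition rclass :: "('y, 'r) ringed_space \<Rightarrow> ('y, 'r, 'l) omod \<Rightarrow> ('y, 'r, 'y \<Rightarrow> 'r) omod set" where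
  "rclass Y L = {N. rline_bundle Y N \<and> omod_iso_on Y (topspace (rtop Y)) L N}"

definition rPic :: "('y, 'r) ringed_space \<Rightarrow> ('y, 'r, 'y \<Rightarrow> 'r) omod set monoid" where
  "rPic Y =
     \<lparr>carrier = {rclass Y L |L :: ('y, 'r, 'y \<Rightarrow> 'r) omod. rline_bundle Y L},
      monoid.mult = (\<lambda>c c'. {N. rline_bundle Y N \<and> (\<exists>L\<in>c. \<exists>L'\<in>c'. rtensor Y L L' N)}),
      one = rclass Y (structure_omod Y)\<rparr>"

section \<open>The natural map on Picard groups\<close>

text \<open>\<open>\<kappa>\<close> exhibits \<open>E'\<close>, a module over the \<open>R\<close>-algebra given by \<open>\<rho> : R \<rightarrow> A\<close> (with \<open>\<rho> f\<close> invertible), as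
  the localization of the \<open>R\<close>-module \<open>E\<close> at \<open>f\<close>.\<close>

definition is_module_localization ::
    "'s ring \<Rightarrow> 's \<Rightarrow> ('s, 'e) module \<Rightarrow> 'r ring \<Rightarrow> ('s \<Rightarrow> 'r) \<Rightarrow> ('r, 'n) module \<Rightarrow>
     ('e \<Rightarrow> 'n) \<Rightarrow> bool" where
  "is_module_localization R f E A \<rho> E' \<kappa> \<longleftrightarrow>
     (\<forall>s\<in>carrier E. \<kappa> s \<in> carrier E' \<and>
        (\<forall>t\<in>carrier E. \<kappa> (s \<oplus>\<^bsub>E\<^esub> t) = \<kappa> s \<oplus>\<^bsub>E'\<^esub> \<kappa> t) \<and>
        (\<forall>a\<in>carrier R. \<kappa> (a \<odot>\<^bsub>E\<^esub> s) = \<rho> a \<odot>\<^bsub>E'\<^esub> \<kappa> s)) \<and>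
     (\<forall>n\<in>carrier E'. \<exists>s\<in>carrier E. \<exists>m::nat. (\<rho> f [^]\<^bsub>A\<^esub> m) \<odot>\<^bsub>E'\<^esub> n = \<kappa> s) \<and>
     (\<forall>s\<in>carrier E. \<kappa> s = \<zero>\<^bsub>E'\<^esub> \<longrightarrow> (\<exists>m::nat. (f [^]\<^bsub>R\<^esub> m) \<odot>\<^bsub>E\<^esub> s = \<zero>\<^bsub>E\<^esub>))"

text \<open>The \<open>k[M]\<close>-module \<open>k[S]\<close>; the multiplicative part of the module record is irrelevant.\<close>

definition free_module :: "('k, 'm) ring_scheme \<Rightarrow> 's set \<Rightarrow> ('a \<Rightarrow> 's \<Rightarrow> 's) \<Rightarrow> ('a \<Rightarrow> 'k, 's \<Rightarrow> 'k) module" where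
  "free_module k S act =
     \<lparr>carrier = fin_supp k S, monoid.mult = undefined, one = undefined,
      zero = (\<lambda>_. \<zero>\<^bsub>k\<^esub>), add = (\<lambda>f g x. f x \<oplus>\<^bsub>k\<^esub> g x),
      smult = convolve k act\<rparr>"

text \<open>
  \<open>N\<close> is the line bundle \<open>L\<^sub>k\<close> on \<open>X\<^sub>k\<close>: over each affine open \<open>U\<close> of \<open>X\<close> (where \<open>L\<close> is free, since
  \<open>Spec M\<close> has a closed point lying in no smaller open subset) it is the sheaf associated to the
  \<open>k[O\<^sub>X U]\<close>-module \<open>k[L U]\<close>, i.e. its value on \<open>D f\<close> is the localization of \<open>k[L U]\<close> at \<open>f\<close>; and these
  identifications are compatible with restriction.
\<close>

definition linearization ::
    "'k ring \<Rightarrow> ('p, 'a) monoidal_space \<Rightarrow> ('y, 'r) ringed_space \<Rightarrow>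
     ('p, 'a, 'k, 'y, 'r) gluing \<Rightarrow> ('p, 'a, 'l) oset \<Rightarrow> ('y, 'r, 'n) omod \<Rightarrow> bool" where
  "linearization k X Y \<gamma> L N \<longleftrightarrow>
     (\<exists>\<kappa>. (\<forall>U. maffine X U \<longrightarrow>
             (\<forall>s\<in>fin_supp k (osec L U). \<kappa> U s \<in> carrier (lsec N (over_k k X \<gamma> U))) \<and>
             (\<forall>f\<in>carrier (monoid_algebra k (msec X U)).
                let D = gpt \<gamma> U ` rbasic (monoid_algebra k (msec X U)) f in
                is_module_localization (monoid_algebra k (msec X U)) f
                  (free_module k (osec L U) (oact L U))
                  (rsec Y D) (rres Y (over_k k X \<gamma> U) D \<circ> gsec \<gamma> U)
                  (lsec N D) (lres N (over_k k X \<gamma> U) D \<circ> \<kappa> U))) \<and>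
          (\<forall>U V. maffine X U \<and> maffine X V \<and> V \<subseteq> U \<longrightarrow>
             (\<forall>s\<in>fin_supp k (osec L U).
                \<kappa> V (push_forward k (ores L U V) s) =
                lres N (over_k k X \<gamma> U) (over_k k X \<gamma> V) (\<kappa> U s))))"

definition pic_map ::
    "'k ring \<Rightarrow> ('p, 'a) monoidal_space \<Rightarrow> ('y, 'r) ringed_space \<Rightarrow>
     ('p, 'a, 'k, 'y, 'r) gluing \<Rightarrow> ('p, 'a, 'p \<Rightarrow> 'a) oset set \<Rightarrow> ('y, 'r, 'y \<Rightarrow> 'r) omod set" where
  "pic_map k X Y \<gamma> c = {N. rline_bundle Y N \<and> (\<exists>L\<in>c. linearization k X Y \<gamma> L N)}"

section \<open>Cech cohomology of the sheaf of units\<close>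

definition unit_group :: "('y, 'r) ringed_space \<Rightarrow> 'y set \<Rightarrow> 'r monoid" where
  "unit_group Y V = units_of (rsec Y V)"

definition cech_C0 :: "('y, 'r) ringed_space \<Rightarrow> 'i set \<Rightarrow> ('i \<Rightarrow> 'y set) \<Rightarrow> ('i \<Rightarrow> 'r) monoid" where
  "cech_C0 Y I V = product_group I (\<lambda>i. unit_group Y (V i))"

definition cech_C1 :: "('y, 'r) ringed_space \<Rightarrow> 'i set \<Rightarrow> ('i \<Rightarrow> 'y set) \<Rightarrow> ('i \<times> 'i \<Rightarrow> 'r) monoid" where
  "cech_C1 Y I V = product_group (I \<times> I) (\<lambda>(i, j). unit_group Y (V i \<inter> V j))"

definition cech_C2 ::
    "('y, 'r) ringed_space \<Rightarrow> 'i set \<Rightarrow> ('i \<Rightarrow> 'y set) \<Rightarrow> ('i \<times> 'i \<times> 'i \<Rightarrow> 'r) monoid" where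
  "cech_C2 Y I V = product_group (I \<times> I \<times> I) (\<lambda>(i, j, l). unit_group Y (V i \<inter> V j \<inter> V l))"

definition cech_d0 ::
    "('y, 'r) ringed_space \<Rightarrow> 'i set \<Rightarrow> ('i \<Rightarrow> 'y set) \<Rightarrow> ('i \<Rightarrow> 'r) \<Rightarrow> 'i \<times> 'i \<Rightarrow> 'r" where
  "cech_d0 Y I V u = (\<lambda>(i, j)\<in>I \<times> I.
     let W = V i \<inter> V j; G = unit_group Y W in
     rres Y (V j) W (u j) \<otimes>\<^bsub>G\<^esub> inv\<^bsub>G\<^esub> rres Y (V i) W (u i))"

definition cech_d1 ::
    "('y, 'r) ringed_space \<Rightarrow> 'i set \<Rightarrow> ('i \<Rightarrow> 'y set) \<Rightarrow> ('i \<times> 'i \<Rightarrow> 'r) \<Rightarrow> 'i \<times> 'i \<times> 'i \<Rightarrow> 'r" where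
  "cech_d1 Y I V g = (\<lambda>(i, j, l)\<in>I \<times> I \<times> I.
     let W = V i \<inter> V j \<inter> V l; G = unit_group Y W in
     rres Y (V j \<inter> V l) W (g (j, l)) \<otimes>\<^bsub>G\<^esub> inv\<^bsub>G\<^esub> rres Y (V i \<inter> V l) W (g (i, l))
       \<otimes>\<^bsub>G\<^esub> rres Y (V i \<inter> V j) W (g (i, j)))"

definition cech_H1 ::
    "('y, 'r) ringed_space \<Rightarrow> 'i set \<Rightarrow> ('i \<Rightarrow> 'y set) \<Rightarrow> ('i \<times> 'i \<Rightarrow> 'r) set monoid" where
  "cech_H1 Y I V =
     (cech_C1 Y I V)\<lparr>carrier := kernel (cech_C1 Y I V) (cech_C2 Y I V) (cech_d1 Y I V)\<rparr>
       Mod (cech_d0 Y I V ` carrier (cech_C0 Y I V))"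

text \<open>The canonical map to the Picard group: the class of a cocycle \<open>g\<close> goes to the class of the line
  bundles having generators \<open>e i\<close> over the \<open>V i\<close> with transition functions \<open>e j = g (i, j) \<cdot> e i\<close>.\<close>

definition cech_to_pic ::
    "('y, 'r) ringed_space \<Rightarrow> 'i set \<Rightarrow> ('i \<Rightarrow> 'y set) \<Rightarrow> ('i \<times> 'i \<Rightarrow> 'r) set \<Rightarrow>
     ('y, 'r, 'y \<Rightarrow> 'r) omod set" where
  "cech_to_pic Y I V Q =
     {N. rline_bundle Y N \<and> (\<exists>g\<in>Q. \<exists>e. (\<forall>i\<in>I. rgenerator Y N (V i) (e i)) \<and>
        (\<forall>i\<in>I. \<forall>j\<in>I. lres N (V j) (V i \<inter> V j) (e j) =
           g (i, j) \<odot>\<^bsub>lsec N (V i \<inter> V j)\<^esub> lres N (V i) (V i \<inter> V j) (e i)))}"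

end

theory Submission
  imports Defs
begin

text \<open>
  For a cancellative torsion-free monoid \<open>M\<close> and a domain \<open>k\<close>, the units of \<open>k[M]\<close> are the monomials
  \<open>c \<cdot> m\<close> with \<open>c\<close> a unit of \<open>k\<close> and \<open>m\<close> a unit of \<open>M\<close>.  Gluing, the units of \<open>O\<^bsub>X\<^sub>k\<^esub>\<close> over \<open>W\<^sub>k\<close> are the products
  of a scalar and a unit of \<open>O\<^sub>X W\<close>, for every open \<open>W\<close> inside an affine open of \<open>X\<close>.  So a Cech
  1-cocycle on \<open>X\<^sub>k\<close> is a cocycle of scalars times a cocycle on \<open>X\<close>.  Affine monoid schemes are irreducible, hence
  cocycles of scalars are coboundaries on every connected component, and the Cech group on \<open>X\<^sub>k\<close> is the one on
  \<open>X\<close>.  The latter is \<open>Pic X\<close>, because line bundles are trivial on an affine monoid scheme: it has a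
  closed point that lies in no smaller open set.  Injectivity of \<open>Pic X \<rightarrow> Pic X\<^sub>k\<close> follows as the Cech group of a
  cover embeds in the Picard group.
\<close>

section \<open>Sheaves and line bundles given by cocycles\<close>

text \<open>The theory of line bundles is developed once, for sheaves of sets acted on by a sheaf of
  commutative monoids, and applied to X_k by forgetting addition. Nothing is lost: a homogeneous map
  between line bundles is additive, since locally any two sections are multiples of one generator.
  The obstacles lie in the intersections. A scalar is determined by its section only over a
  non-empty open set, so the scalar identity of a cocycle is available only for triples with
  \<open>U i \<inter> U j \<inter> U l\<close> non-empty. Irreducibility of the middle set
  \<open>U j\<close> supplies these triples and makes meeting an equivalence relation on the
  indices. Units have to be known on \<open>U i \<inter> U j\<close> as well as on affine opens, so
  monomial sections are glued over arbitrary open subsets of \<open>X\<close>. The natural map is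
  defined through all affine opens, the Cech group through the given cover. They are compared by
  letting the family of all affine opens be a second cover: a trivialization on it restricts to one
  on the given cover, up to cohomologous cocycles.\<close>

lemma sheaf_closed:
  assumes "sheaf T F r" "openin T U" "openin T V" "V \<subseteq> U" "s \<in> F U"
  shows "r U V s \<in> F V"
proof -
  have "\<forall>U V. openin T U \<and> openin T V \<and> V \<subseteq> U \<longrightarrow> r U V \<in> F U \<rightarrow> F V"
    using assms(1) unfolding sheaf_def by (elim conjE)
  then show ?thesis using assms(2-) by (simp add: Pi_iff)
qed

lemma sheaf_id:
  assumes "sheaf T F r" "openin T U" "s \<in> F U"
  shows "r U U s = s"
proof -
  have "\<forall>U. openin T U \<longrightarrow> (\<forall>s\<in>F U. r U U s = s)"
    using assms(1) unfolding sheaf_def by (elim conjE)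
  then show ?thesis using assms(2-) by simp
qed

lemma sheaf_comp:
  assumes "sheaf T F r" "openin T U" "openin T V" "openin T W" "W \<subseteq> V" "V \<subseteq> U" "s \<in> F U"
  shows "r V W (r U V s) = r U W s"
proof -
  have "\<forall>U V W. openin T U \<and> openin T V \<and> openin T W \<and> W \<subseteq> V \<and> V \<subseteq> U \<longrightarrow>
        (\<forall>s\<in>F U. r V W (r U V s) = r U W s)"
    using assms(1) unfolding sheaf_def by (elim conjE)
  then show ?thesis using assms(2-) by simp
qed

lemma sheaf_amalgamation:
  assumes "sheaf T F r" "\<And>U. U \<in> \<U> \<Longrightarrow> openin T U" "\<And>U. U \<in> \<U> \<Longrightarrow> s U \<in> F U"
    and "\<And>U V. U \<in> \<U> \<Longrightarrow> V \<in> \<U> \<Longrightarrow> r U (U \<inter> V) (s U) = r V (U \<inter> V) (s V)"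
  shows "\<exists>!t. t \<in> F (\<Union>\<U>) \<and> (\<forall>U\<in>\<U>. r (\<Union>\<U>) U t = s U)"
proof -
  have "\<forall>\<U> s. (\<forall>U\<in>\<U>. openin T U \<and> s U \<in> F U) \<and>
        (\<forall>U\<in>\<U>. \<forall>V\<in>\<U>. r U (U \<inter> V) (s U) = r V (U \<inter> V) (s V)) \<longrightarrow>
        (\<exists>!t. t \<in> F (\<Union>\<U>) \<and> (\<forall>U\<in>\<U>. r (\<Union>\<U>) U t = s U))"
    using assms(1) unfolding sheaf_def by (elim conjE)
  moreover have "(\<forall>U\<in>\<U>. openin T U \<and> s U \<in> F U) \<and>
        (\<forall>U\<in>\<U>. \<forall>V\<in>\<U>. r U (U \<inter> V) (s U) = r V (U \<inter> V) (s V))"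
    by (intro conjI ballI assms(2-))
  ultimately show ?thesis by (elim allE[of _ \<U>] allE[of _ s] impE)
qed

text \<open>Both sections amalgamate the family of restrictions of \<open>s\<close>, and the amalgam
  is unique. Covers are indexed families here, while \<open>sheaf\<close> quantifies over sets of
  open sets.\<close>

lemma sheaf_eqI:
  assumes sh: "sheaf T F r" and op: "\<And>i. i \<in> I \<Longrightarrow> openin T (B i)" and W: "W = (\<Union>i\<in>I. B i)"
    and s: "s \<in> F W" and t: "t \<in> F W" and eq: "\<And>i. i \<in> I \<Longrightarrow> r W (B i) s = r W (B i) t"
  shows "s = t"
proof -
  have oW: "openin T W" unfolding W using op by blast
  have W': "\<Union>(B ` I) = W" using W by simp
  have "\<exists>!u. u \<in> F (\<Union>(B ` I)) \<and> (\<forall>U\<in>B ` I. r (\<Union>(B ` I)) U u = r W U s)"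
  proof (rule sheaf_amalgamation[OF sh])
    fix U V assume "U \<in> B ` I" "V \<in> B ` I"
    then have "openin T U" "openin T V" "U \<subseteq> W" "V \<subseteq> W" using op W by auto
    then show "openin T U" "r W U s \<in> F U" "r U (U \<inter> V) (r W U s) = r V (U \<inter> V) (r W V s)"
      using sheaf_closed[OF sh oW _ _ s] by (auto simp: sheaf_comp[OF sh oW _ _ _ _ s] openin_Int)
  qed
  then show ?thesis unfolding W' using s t eq by (metis imageE)
qed

lemma sheaf_glue:
  assumes sh: "sheaf T F r" and op: "\<And>i. i \<in> I \<Longrightarrow> openin T (B i)" and W: "W = (\<Union>i\<in>I. B i)"
    and s: "\<And>i. i \<in> I \<Longrightarrow> s i \<in> F (B i)"
    and eq: "\<And>i j. i \<in> I \<Longrightarrow> j \<in> I \<Longrightarrow> r (B i) (B i \<inter> B j) (s i) = r (B j) (B i \<inter> B j) (s j)"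
  shows "\<exists>t\<in>F W. \<forall>i\<in>I. r W (B i) t = s i"
proof -
  \<comment> \<open>\<open>sheaf\<close> expects one section for each open set, so one index is
    picked for every member of the cover.\<close>
  define p where "p U = (SOME i. i \<in> I \<and> B i = U)" for U
  have p: "p (B i) \<in> I \<and> B (p (B i)) = B i" if "i \<in> I" for i
    unfolding p_def by (rule someI[of "\<lambda>j. j \<in> I \<and> B j = B i" i]) (use that in auto)
  \<comment> \<open>Two indices with the same open set carry the same section: compatibility on
    \<open>B i \<inter> B j = B i\<close> compares their restrictions to that set itself.\<close>
  have sp: "s (p (B i)) = s i" if i: "i \<in> I" for i
    using eq[of "p (B i)" i] p[OF i] i sheaf_id[OF sh op[OF i] s[OF i]]
      sheaf_id[OF sh op[OF i]] s[of "p (B i)"] by auto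
  have W': "\<Union>(B ` I) = W" using W by simp
  have "\<exists>!t. t \<in> F (\<Union>(B ` I)) \<and> (\<forall>U\<in>B ` I. r (\<Union>(B ` I)) U t = s (p U))"
  proof (rule sheaf_amalgamation[OF sh])
    fix U assume "U \<in> B ` I"
    then show "openin T U" "s (p U) \<in> F U" using op s sp by auto
  next
    fix U V assume "U \<in> B ` I" "V \<in> B ` I"
    then obtain i j where "i \<in> I" "j \<in> I" "U = B i" "V = B j" by blast
    then show "r U (U \<inter> V) (s (p U)) = r V (U \<inter> V) (s (p V))" using eq sp by simp
  qed
  then obtain t where "t \<in> F W" "\<forall>U\<in>B ` I. r W U t = s (p U)" unfolding W' by (elim ex1E conjE)
  then show ?thesis using sp by (intro bexI[of _ t]) simp_all
qed

section \<open>Sheaves of commutative monoids\<close>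

locale mono_space =
  fixes X :: "('p, 'a) monoidal_space"
  assumes monoidal_space: "monoidal_space X"
begin

abbreviation "opn \<equiv> openin (mtop X)"
abbreviation "\<O> \<equiv> msec X"
abbreviation "pts \<equiv> topspace (mtop X)"

lemma sheaf_sections: "sheaf (mtop X) (\<lambda>U. carrier (\<O> U)) (mres X)"
  using monoidal_space by (simp add: monoidal_space_def)

lemma comm_monoid_sections: "opn U \<Longrightarrow> comm_monoid (\<O> U)"
  using monoidal_space by (simp add: monoidal_space_def)

lemma monoid_sections: "opn U \<Longrightarrow> monoid (\<O> U)"
  by (rule comm_monoid.axioms(1)[OF comm_monoid_sections])

lemmas mult_closed = monoid.m_closed[OF monoid_sections]
  and one_closed = monoid.one_closed[OF monoid_sections]
  and one_left = monoid.l_one[OF monoid_sections]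
  and one_right = monoid.r_one[OF monoid_sections]
  and mult_assoc = monoid.m_assoc[OF monoid_sections]
  and mult_comm = comm_monoid.m_comm[OF comm_monoid_sections]
  and mult_lcomm = comm_monoid.m_lcomm[OF comm_monoid_sections]
  and Units_inv_closed' = monoid.Units_inv_closed[OF monoid_sections]
  and Units_inv_Units' = monoid.Units_inv_Units[OF monoid_sections]
  and Units_mult = monoid.Units_m_closed[OF monoid_sections]
  and Units_inv_left = monoid.Units_l_inv[OF monoid_sections]
  and Units_inv_right = monoid.Units_r_inv[OF monoid_sections]
  and Units_one = monoid.Units_one_closed[OF monoid_sections]

lemma Units_section: "a \<in> Units (\<O> U) \<Longrightarrow> a \<in> carrier (\<O> U)"
  by (simp add: Units_def)

lemma Units_cancel:
  "\<lbrakk>opn U; a \<in> Units (\<O> U); x \<in> carrier (\<O> U); y \<in> carrier (\<O> U)\<rbrakk>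
    \<Longrightarrow> a \<otimes>\<^bsub>\<O> U\<^esub> x = a \<otimes>\<^bsub>\<O> U\<^esub> y \<longleftrightarrow> x = y"
  using monoid.Units_l_cancel[OF monoid_sections] by metis

lemma res_closed: "\<lbrakk>opn U; opn V; V \<subseteq> U; a \<in> carrier (\<O> U)\<rbrakk> \<Longrightarrow> mres X U V a \<in> carrier (\<O> V)"
  using sheaf_closed[OF sheaf_sections] by simp

lemma res_id: "\<lbrakk>opn U; a \<in> carrier (\<O> U)\<rbrakk> \<Longrightarrow> mres X U U a = a"
  using sheaf_id[OF sheaf_sections] by simp

lemma res_res:
  "\<lbrakk>opn U; opn V; opn W; W \<subseteq> V; V \<subseteq> U; a \<in> carrier (\<O> U)\<rbrakk>
    \<Longrightarrow> mres X V W (mres X U V a) = mres X U W a"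
  using sheaf_comp[OF sheaf_sections] by simp

lemma res_mult:
  "\<lbrakk>opn U; opn V; V \<subseteq> U; a \<in> carrier (\<O> U); b \<in> carrier (\<O> U)\<rbrakk>
    \<Longrightarrow> mres X U V (a \<otimes>\<^bsub>\<O> U\<^esub> b) = mres X U V a \<otimes>\<^bsub>\<O> V\<^esub> mres X U V b"
  using monoidal_space by (auto simp: monoidal_space_def hom_def)

lemma res_one: "\<lbrakk>opn U; opn V; V \<subseteq> U\<rbrakk> \<Longrightarrow> mres X U V \<one>\<^bsub>\<O> U\<^esub> = \<one>\<^bsub>\<O> V\<^esub>"
  using monoidal_space by (auto simp: monoidal_space_def)

lemma res_Units:
  assumes "opn U" "opn V" "V \<subseteq> U" "a \<in> Units (\<O> U)"
  shows "mres X U V a \<in> Units (\<O> V)"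
proof -
  obtain b where "b \<in> carrier (\<O> U)" "b \<otimes>\<^bsub>\<O> U\<^esub> a = \<one>\<^bsub>\<O> U\<^esub>" "a \<otimes>\<^bsub>\<O> U\<^esub> b = \<one>\<^bsub>\<O> U\<^esub>" "a \<in> carrier (\<O> U)"
    using assms(4) by (auto simp: Units_def)
  note b = this
  have "mres X U V b \<otimes>\<^bsub>\<O> V\<^esub> mres X U V a = \<one>\<^bsub>\<O> V\<^esub>"
    by (simp add: res_mult[OF assms(1-3), symmetric] b res_one[OF assms(1-3)])
  moreover have "mres X U V a \<otimes>\<^bsub>\<O> V\<^esub> mres X U V b = \<one>\<^bsub>\<O> V\<^esub>"
    by (simp add: res_mult[OF assms(1-3), symmetric] b res_one[OF assms(1-3)])
  ultimately show ?thesis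
    unfolding Units_def using res_closed[OF assms(1-3)] b by blast
qed

lemma res_inv:
  assumes "opn U" "opn V" "V \<subseteq> U" "a \<in> Units (\<O> U)"
  shows "mres X U V (inv\<^bsub>\<O> U\<^esub> a) = inv\<^bsub>\<O> V\<^esub> (mres X U V a)"
proof -
  have *: "mres X U V a \<in> Units (\<O> V)" using res_Units[OF assms] .
  have "mres X U V a \<otimes>\<^bsub>\<O> V\<^esub> mres X U V (inv\<^bsub>\<O> U\<^esub> a) = mres X U V a \<otimes>\<^bsub>\<O> V\<^esub> inv\<^bsub>\<O> V\<^esub> (mres X U V a)"
    using res_mult[OF assms(1-3) Units_section[OF assms(4)] Units_inv_closed'[OF assms(1,4)]]
    by (simp add: Units_inv_right[OF assms(1,4)] Units_inv_right[OF assms(2) *] res_one[OF assms(1-3)])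
  then show ?thesis
    using Units_cancel[OF assms(2) *] assms * by (simp add: Units_inv_closed' res_closed)
qed

lemma section_eqI:
  assumes "\<And>i. i \<in> I \<Longrightarrow> opn (B i)" "W = (\<Union>i\<in>I. B i)" "s \<in> carrier (\<O> W)" "t \<in> carrier (\<O> W)"
    "\<And>i. i \<in> I \<Longrightarrow> mres X W (B i) s = mres X W (B i) t"
  shows "s = t"
  by (rule sheaf_eqI[OF sheaf_sections assms])

lemma section_glue:
  assumes "\<And>i. i \<in> I \<Longrightarrow> opn (B i)" "W = (\<Union>i\<in>I. B i)" "\<And>i. i \<in> I \<Longrightarrow> s i \<in> carrier (\<O> (B i))"
    "\<And>i j. i \<in> I \<Longrightarrow> j \<in> I \<Longrightarrow> mres X (B i) (B i \<inter> B j) (s i) = mres X (B j) (B i \<inter> B j) (s j)"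
  shows "\<exists>t\<in>carrier (\<O> W). \<forall>i\<in>I. mres X W (B i) t = s i"
  by (rule sheaf_glue[OF sheaf_sections assms])

text \<open>Inverses are unique, so the local ones agree on overlaps and glue. The product of
  \<open>a\<close> with the glued section is one because it is one locally.\<close>

lemma Units_local:
  assumes op: "\<And>i. i \<in> I \<Longrightarrow> opn (B i)" and W: "W = (\<Union>i\<in>I. B i)" and a: "a \<in> carrier (\<O> W)"
    and u: "\<And>i. i \<in> I \<Longrightarrow> mres X W (B i) a \<in> Units (\<O> (B i))"
  shows "a \<in> Units (\<O> W)"
proof -
  have oW: "opn W" unfolding W using op by blast
  have sub: "B i \<subseteq> W" if "i \<in> I" for i using W that by blast
  let ?b = "\<lambda>i. inv\<^bsub>\<O> (B i)\<^esub> (mres X W (B i) a)"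
  have eq: "mres X (B i) (B i \<inter> B j) (?b i) = inv\<^bsub>\<O> (B i \<inter> B j)\<^esub> (mres X W (B i \<inter> B j) a)"
    if "i \<in> I" "j \<in> I" for i j
    using that op sub oW a u by (simp add: res_inv res_res openin_Int)
  have eq': "mres X (B j) (B i \<inter> B j) (?b j) = inv\<^bsub>\<O> (B i \<inter> B j)\<^esub> (mres X W (B i \<inter> B j) a)"
    if "i \<in> I" "j \<in> I" for i j
    using that op sub oW a u by (simp add: res_inv res_res openin_Int)
  have "\<exists>b\<in>carrier (\<O> W). \<forall>i\<in>I. mres X W (B i) b = ?b i"
  proof (rule section_glue[of I B W ?b])
    show "?b i \<in> carrier (\<O> (B i))" if "i \<in> I" for i
      using Units_inv_closed'[OF op[OF that] u[OF that]] .
  qed (use op W eq eq' in simp_all)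
  then obtain b where b: "b \<in> carrier (\<O> W)" "\<And>i. i \<in> I \<Longrightarrow> mres X W (B i) b = ?b i" by blast
  have "a \<otimes>\<^bsub>\<O> W\<^esub> b = \<one>\<^bsub>\<O> W\<^esub>"
  proof (rule section_eqI[of I B W])
    show "mres X W (B i) (a \<otimes>\<^bsub>\<O> W\<^esub> b) = mres X W (B i) \<one>\<^bsub>\<O> W\<^esub>" if i: "i \<in> I" for i
      using Units_inv_right[OF op[OF i] u[OF i]]
      by (simp add: res_mult[OF oW op[OF i] sub[OF i] a b(1)] b(2)[OF i] res_one[OF oW op[OF i] sub[OF i]])
  qed (use op W a b oW in \<open>simp_all add: mult_closed one_closed\<close>)
  moreover then have "b \<otimes>\<^bsub>\<O> W\<^esub> a = \<one>\<^bsub>\<O> W\<^esub>" by (simp add: mult_comm[OF oW b(1) a])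
  ultimately show ?thesis unfolding Units_def using a b(1) by blast
qed

section \<open>Sheaves of O-sets and their generators\<close>

lemma oset_sheaf_sheaf: "oset_sheaf X L \<Longrightarrow> sheaf (mtop X) (osec L) (ores L)"
  by (simp add: oset_sheaf_def)

lemma ores_closed:
  "\<lbrakk>oset_sheaf X L; opn U; opn V; V \<subseteq> U; s \<in> osec L U\<rbrakk> \<Longrightarrow> ores L U V s \<in> osec L V"
  by (rule sheaf_closed[OF oset_sheaf_sheaf])

lemma ores_id: "\<lbrakk>oset_sheaf X L; opn U; s \<in> osec L U\<rbrakk> \<Longrightarrow> ores L U U s = s"
  by (rule sheaf_id[OF oset_sheaf_sheaf])

lemma ores_ores:
  "\<lbrakk>oset_sheaf X L; opn U; opn V; opn W; W \<subseteq> V; V \<subseteq> U; s \<in> osec L U\<rbrakk>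
    \<Longrightarrow> ores L V W (ores L U V s) = ores L U W s"
  by (rule sheaf_comp[OF oset_sheaf_sheaf])

lemmas oset_eqI = sheaf_eqI[OF oset_sheaf_sheaf]
  and oset_glue = sheaf_glue[OF oset_sheaf_sheaf]

lemma oact_closed:
  "\<lbrakk>oset_sheaf X L; opn U; a \<in> carrier (\<O> U); s \<in> osec L U\<rbrakk> \<Longrightarrow> oact L U a s \<in> osec L U"
  by (simp add: oset_sheaf_def)

lemma oact_one: "\<lbrakk>oset_sheaf X L; opn U; s \<in> osec L U\<rbrakk> \<Longrightarrow> oact L U \<one>\<^bsub>\<O> U\<^esub> s = s"
  by (simp add: oset_sheaf_def)

lemma oact_mult:
  "\<lbrakk>oset_sheaf X L; opn U; a \<in> carrier (\<O> U); b \<in> carrier (\<O> U); s \<in> osec L U\<rbrakk>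
    \<Longrightarrow> oact L U (a \<otimes>\<^bsub>\<O> U\<^esub> b) s = oact L U a (oact L U b s)"
  by (simp add: oset_sheaf_def)

lemma ores_oact:
  "\<lbrakk>oset_sheaf X L; opn U; opn V; V \<subseteq> U; a \<in> carrier (\<O> U); s \<in> osec L U\<rbrakk>
    \<Longrightarrow> ores L U V (oact L U a s) = oact L V (mres X U V a) (ores L U V s)"
  by (simp add: oset_sheaf_def)

lemma mgenerator_section: "mgenerator X L U e \<Longrightarrow> e \<in> osec L U"
  by (simp add: mgenerator_def)

lemma mgenerator_restrict:
  assumes L: "oset_sheaf X L" and U: "opn U" and V: "opn V" "V \<subseteq> U" and e: "mgenerator X L U e"
  shows "mgenerator X L V (ores L U V e)"
  unfolding mgenerator_def
proof (intro conjI allI impI)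
  have e': "e \<in> osec L U" using e by (rule mgenerator_section)
  then show "ores L U V e \<in> osec L V" by (rule ores_closed[OF L U V])
  fix W assume W: "opn W \<and> W \<subseteq> V"
  then have "bij_betw (\<lambda>a. oact L W a (ores L U W e)) (carrier (\<O> W)) (osec L W)"
    using e V unfolding mgenerator_def by blast
  then show "bij_betw (\<lambda>a. oact L W a (ores L V W (ores L U V e))) (carrier (\<O> W)) (osec L W)"
    using W by (simp add: ores_ores[OF L U V(1) _ _ V(2) e'])
qed

text \<open>The coordinate of a section in a generator. The description is unique as soon as
  \<open>e\<close> is a generator, because acting on \<open>e\<close> is then a bijection onto the
  sections over \<open>U\<close>.\<close>

definition coord where
  "coord L U e s = (THE a. a \<in> carrier (\<O> U) \<and> oact L U a e = s)"

lemma mgenerator_bij: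
  assumes "oset_sheaf X L" "opn U" "mgenerator X L U e"
  shows "bij_betw (\<lambda>a. oact L U a e) (carrier (\<O> U)) (osec L U)"
proof -
  have "\<forall>V. opn V \<and> V \<subseteq> U \<longrightarrow> bij_betw (\<lambda>a. oact L V a (ores L U V e)) (carrier (\<O> V)) (osec L V)"
    using assms(3) unfolding mgenerator_def by (rule conjunct2)
  from this[THEN spec[of _ U]] show ?thesis
    using assms(2) by (simp add: ores_id[OF assms(1,2) mgenerator_section[OF assms(3)]])
qed

lemma mgenerator_cancel:
  assumes "oset_sheaf X L" "opn U" "mgenerator X L U e" "a \<in> carrier (\<O> U)" "b \<in> carrier (\<O> U)"
    and "oact L U a e = oact L U b e"
  shows "a = b"
  by (rule inj_onD[OF bij_betw_imp_inj_on[OF mgenerator_bij[OF assms(1-3)]] assms(6,4,5)])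

lemma coord:
  assumes "oset_sheaf X L" "opn U" "mgenerator X L U e" "s \<in> osec L U"
  shows "coord L U e s \<in> carrier (\<O> U)" "oact L U (coord L U e s) e = s"
proof -
  obtain a where a: "a \<in> carrier (\<O> U)" "oact L U a e = s"
    using assms(4) by (auto simp flip: bij_betw_imp_surj_on[OF mgenerator_bij[OF assms(1-3)]])
  have "coord L U e s \<in> carrier (\<O> U) \<and> oact L U (coord L U e s) e = s"
    unfolding coord_def
  proof (rule theI[of _ a])
    show "b = a" if "b \<in> carrier (\<O> U) \<and> oact L U b e = s" for b
      using mgenerator_cancel[OF assms(1-3), of b a] a that by simp
  qed (simp add: a)
  then show "coord L U e s \<in> carrier (\<O> U)" "oact L U (coord L U e s) e = s" by simp_all
qed

lemma coord_eqI:
  assumes "oset_sheaf X L" "opn U" "mgenerator X L U e" "a \<in> carrier (\<O> U)" "oact L U a e = s"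
  shows "coord L U e s = a"
proof -
  have "s \<in> osec L U"
    using oact_closed[OF assms(1,2,4) mgenerator_section[OF assms(3)]] assms(5) by simp
  then show ?thesis
    using coord[OF assms(1-3)] mgenerator_cancel[OF assms(1-3) _ assms(4)] assms(5) by simp
qed

text \<open>Multiplication by a unit permutes the sections of the structure sheaf over every smaller
  open set, so the coordinate bijections of \<open>e\<close> and of its multiple differ by a
  permutation.\<close>

lemma mgenerator_unit_mult:
  assumes L: "oset_sheaf X L" and U: "opn U" and e: "mgenerator X L U e" and a: "a \<in> Units (\<O> U)"
  shows "mgenerator X L U (oact L U a e)"
  unfolding mgenerator_def
proof (intro conjI allI impI)
  have e': "e \<in> osec L U" using e by (rule mgenerator_section)
  have a': "a \<in> carrier (\<O> U)" using a by (rule Units_section)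
  show "oact L U a e \<in> osec L U" by (rule oact_closed[OF L U a' e'])
  fix V assume "opn V \<and> V \<subseteq> U"
  then have V: "opn V" "V \<subseteq> U" by simp_all
  let ?u = "mres X U V a" and ?e = "ores L U V e"
  have u: "?u \<in> Units (\<O> V)" by (rule res_Units[OF U V a])
  have u': "?u \<in> carrier (\<O> V)" using u by (rule Units_section)
  have i: "inv\<^bsub>\<O> V\<^esub> ?u \<in> carrier (\<O> V)" by (rule Units_inv_closed'[OF V(1) u])
  have "bij_betw (\<lambda>b. b \<otimes>\<^bsub>\<O> V\<^esub> ?u) (carrier (\<O> V)) (carrier (\<O> V))"
    by (rule bij_betw_byWitness[where f' = "\<lambda>b. b \<otimes>\<^bsub>\<O> V\<^esub> inv\<^bsub>\<O> V\<^esub> ?u"])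
      (auto simp: mult_assoc[OF V(1)] mult_closed[OF V(1)] one_right[OF V(1)] u' i
        Units_inv_left[OF V(1) u] Units_inv_right[OF V(1) u])
  moreover have "bij_betw (\<lambda>b. oact L V b ?e) (carrier (\<O> V)) (osec L V)"
    by (rule mgenerator_bij[OF L V(1) mgenerator_restrict[OF L U V e]])
  ultimately have "bij_betw ((\<lambda>b. oact L V b ?e) \<circ> (\<lambda>b. b \<otimes>\<^bsub>\<O> V\<^esub> ?u)) (carrier (\<O> V)) (osec L V)"
    by (rule bij_betw_trans)
  then show "bij_betw (\<lambda>b. oact L V b (ores L U V (oact L U a e))) (carrier (\<O> V)) (osec L V)"
    by (rule iffD1[OF bij_betw_cong, rotated])
      (simp add: ores_oact[OF L U V a' e'] oact_mult[OF L V(1) _ u' ores_closed[OF L U V e']])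
qed

text \<open>The coordinates of each generator in the other are inverse to each other, as one sees by
  cancelling the generator.\<close>

lemma mgenerator_unit_change:
  assumes L: "oset_sheaf X L" and U: "opn U" and e: "mgenerator X L U e" and e': "mgenerator X L U e'"
  obtains a where "a \<in> Units (\<O> U)" "e' = oact L U a e"
proof -
  let ?a = "coord L U e e'" and ?b = "coord L U e' e"
  have s: "e \<in> osec L U" "e' \<in> osec L U" using e e' by (simp_all add: mgenerator_section)
  note a = coord[OF L U e s(2)] and b = coord[OF L U e' s(1)]
  have "oact L U (?b \<otimes>\<^bsub>\<O> U\<^esub> ?a) e = oact L U \<one>\<^bsub>\<O> U\<^esub> e"
    by (simp add: oact_mult[OF L U] oact_one[OF L U] a b s)
  then have "?b \<otimes>\<^bsub>\<O> U\<^esub> ?a = \<one>\<^bsub>\<O> U\<^esub>"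
    by (rule mgenerator_cancel[OF L U e, rotated -1])
      (simp_all add: mult_closed[OF U] one_closed[OF U] a b)
  moreover then have "?a \<otimes>\<^bsub>\<O> U\<^esub> ?b = \<one>\<^bsub>\<O> U\<^esub>" by (simp add: mult_comm[OF U] a b)
  ultimately have "?a \<in> Units (\<O> U)" unfolding Units_def using a b by blast
  then show thesis by (rule that) (simp add: a)
qed

text \<open>\<open>mgenerator_unit_change\<close> provides a unit with the same effect on
  \<open>e\<close>, and coordinates are unique.\<close>

lemma mgenerator_oact_unit:
  assumes L: "oset_sheaf X L" and U: "opn U" and e: "mgenerator X L U e"
    and a: "a \<in> carrier (\<O> U)" and g: "mgenerator X L U (oact L U a e)"
  shows "a \<in> Units (\<O> U)"
proof -
  obtain b where b: "b \<in> Units (\<O> U)" "oact L U a e = oact L U b e"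
    using mgenerator_unit_change[OF L U e g] by metis
  then have "a = b"
    using mgenerator_cancel[OF L U e a _ b(2)] Units_section by blast
  then show ?thesis using b by simp
qed

text \<open>On the overlap of two basis members, again a member, coordinates are unique; so the
  coordinates of a section on the members glue. The lemma is applied to the open sets lying below a
  cover, and to the basic open sets of the spectrum of a monoid algebra.\<close>

lemma mgenerator_basis:
  assumes L: "oset_sheaf X L" and U: "opn U" and e: "e \<in> osec L U"
    and op: "\<And>B. B \<in> \<B> \<Longrightarrow> opn B \<and> B \<subseteq> U"
    and int: "\<And>B C. B \<in> \<B> \<Longrightarrow> C \<in> \<B> \<Longrightarrow> B \<inter> C \<in> \<B>"
    and basis: "\<And>V. opn V \<Longrightarrow> V \<subseteq> U \<Longrightarrow> \<exists>\<C>\<subseteq>\<B>. V = \<Union>\<C>"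
    and bij: "\<And>B. B \<in> \<B> \<Longrightarrow> bij_betw (\<lambda>a. oact L B a (ores L U B e)) (carrier (\<O> B)) (osec L B)"
  shows "mgenerator X L U e"
  unfolding mgenerator_def
proof (intro conjI allI impI)
  fix V assume "opn V \<and> V \<subseteq> U"
  then have V: "opn V" "V \<subseteq> U" by simp_all
  let ?e = "\<lambda>W. ores L U W e"
  obtain \<C> where C: "\<C> \<subseteq> \<B>" "V = \<Union>\<C>" using basis[OF V] by blast
  have opC: "opn B" and subU: "B \<subseteq> U" and sub: "B \<subseteq> V" and CB: "B \<in> \<B>" if "B \<in> \<C>" for B
    using that C op by blast+
  have V': "V = (\<Union>B\<in>\<C>. B)" using C by simp
  have act: "ores L V B (oact L V a (?e V)) = oact L B (mres X V B a) (?e B)"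
    if "B \<in> \<C>" "a \<in> carrier (\<O> V)" for a B
    by (simp add: that V opC sub ores_oact[OF L] ores_closed[OF L U V e] ores_ores[OF L U V(1) _ _ V(2) e])
  show "bij_betw (\<lambda>a. oact L V a (?e V)) (carrier (\<O> V)) (osec L V)"
  proof (rule bij_betwI')
    fix a b assume a: "a \<in> carrier (\<O> V)" and b: "b \<in> carrier (\<O> V)"
    show "oact L V a (?e V) = oact L V b (?e V) \<longleftrightarrow> a = b"
    proof
      assume eq: "oact L V a (?e V) = oact L V b (?e V)"
      show "a = b"
      proof (rule section_eqI[OF opC V' a b])
        fix B assume B: "B \<in> \<C>"
        have "oact L B (mres X V B a) (?e B) = oact L B (mres X V B b) (?e B)"
          using eq act[OF B a] act[OF B b] by simp
        then show "mres X V B a = mres X V B b"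
          by (rule inj_onD[OF bij_betw_imp_inj_on[OF bij[OF CB[OF B]]]])
            (intro res_closed[OF V(1) opC[OF B] sub[OF B]] a b)+
      qed
    qed simp
  next
    fix a assume "a \<in> carrier (\<O> V)"
    then show "oact L V a (?e V) \<in> osec L V"
      by (rule oact_closed[OF L V(1)]) (rule ores_closed[OF L U V e])
  next
    fix s assume s: "s \<in> osec L V"
    have "\<exists>a\<in>carrier (\<O> B). oact L B a (?e B) = ores L V B s" if "B \<in> \<C>" for B
      using ores_closed[OF L V(1) opC[OF that] sub[OF that] s]
      by (auto simp flip: bij_betw_imp_surj_on[OF bij[OF CB[OF that]]])
    then obtain m where m: "\<And>B. B \<in> \<C> \<Longrightarrow> m B \<in> carrier (\<O> B)"
      "\<And>B. B \<in> \<C> \<Longrightarrow> oact L B (m B) (?e B) = ores L V B s" by metis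
    have mB: "oact L (B \<inter> C) (mres X B (B \<inter> C) (m B)) (?e (B \<inter> C)) = ores L V (B \<inter> C) s"
      if "B \<in> \<C>" "opn (B \<inter> C)" for B C
      using arg_cong[OF m(2)[OF that(1)], of "ores L B (B \<inter> C)"] that
      by (simp add: ores_oact[OF L] m(1) ores_closed[OF L] U e opC subU ores_ores[OF L] V s sub le_infI1)
    have "\<exists>a\<in>carrier (\<O> V). \<forall>B\<in>\<C>. mres X V B a = m B"
    proof (rule section_glue[OF opC V' m(1)])
      fix B C assume BC: "B \<in> \<C>" "C \<in> \<C>"
      then have o: "opn (B \<inter> C)" and i: "B \<inter> C \<in> \<B>" using opC int CB by auto
      have "oact L (B \<inter> C) (mres X B (B \<inter> C) (m B)) (?e (B \<inter> C)) =
          oact L (B \<inter> C) (mres X C (B \<inter> C) (m C)) (?e (B \<inter> C))"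
        using mB[of B C] mB[of C B] BC o by (simp add: Int_commute)
      moreover have "mres X B (B \<inter> C) (m B) \<in> carrier (\<O> (B \<inter> C))"
        "mres X C (B \<inter> C) (m C) \<in> carrier (\<O> (B \<inter> C))"
        using BC o opC m by (auto intro!: res_closed)
      ultimately show "mres X B (B \<inter> C) (m B) = mres X C (B \<inter> C) (m C)"
        by (rule inj_onD[OF bij_betw_imp_inj_on[OF bij[OF i]]])
    qed
    then obtain a where a: "a \<in> carrier (\<O> V)" "\<And>B. B \<in> \<C> \<Longrightarrow> mres X V B a = m B" by blast
    have "s = oact L V a (?e V)"
    proof (rule oset_eqI[OF L opC V' s])
      show "oact L V a (?e V) \<in> osec L V"
        by (rule oact_closed[OF L V(1) a(1)]) (rule ores_closed[OF L U V e])
      show "ores L V B s = ores L V B (oact L V a (?e V))" if "B \<in> \<C>" for B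
        using that by (simp add: act a m)
    qed
    then show "\<exists>a\<in>carrier (\<O> V). s = oact L V a (?e V)" using a by blast
  qed
qed (rule e)

lemma mgenerator_local:
  assumes L: "oset_sheaf X L" and e: "e \<in> osec L U" and op: "\<And>i. i \<in> I \<Longrightarrow> opn (B i)"
    and U: "U = (\<Union>i\<in>I. B i)" and gen: "\<And>i. i \<in> I \<Longrightarrow> mgenerator X L (B i) (ores L U (B i) e)"
  shows "mgenerator X L U e"
proof -
  have oU: "opn U" unfolding U using op by blast
  have sub: "B i \<subseteq> U" if "i \<in> I" for i using U that by blast
  show ?thesis
  proof (rule mgenerator_basis[OF L oU e, of "{V. opn V \<and> (\<exists>i\<in>I. V \<subseteq> B i)}"])
    fix V assume V: "opn V" "V \<subseteq> U"
    show "\<exists>\<C>\<subseteq>{V. opn V \<and> (\<exists>i\<in>I. V \<subseteq> B i)}. V = \<Union>\<C>"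
      by (rule exI[of _ "(\<lambda>i. V \<inter> B i) ` I"]) (use V U op in auto)
  next
    fix V assume "V \<in> {V. opn V \<and> (\<exists>i\<in>I. V \<subseteq> B i)}"
    then obtain i where V: "opn V" "i \<in> I" "V \<subseteq> B i" by blast
    show "bij_betw (\<lambda>a. oact L V a (ores L U V e)) (carrier (\<O> V)) (osec L V)"
      using mgenerator_bij[OF L V(1) mgenerator_restrict[OF L op[OF V(2)] V(1,3) gen[OF V(2)]]]
        ores_ores[OF L oU op[OF V(2)] V(1) V(3) sub[OF V(2)] e] by simp
  qed (use sub in auto)
qed

end

section \<open>Cocycles, trivializations and local coordinates\<close>

definition cocycle :: "('p, 'a) monoidal_space \<Rightarrow> 'i set \<Rightarrow> ('i \<Rightarrow> 'p set) \<Rightarrow> ('i \<times> 'i \<Rightarrow> 'a) \<Rightarrow> bool" where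
  "cocycle X I V a \<longleftrightarrow>
     (\<forall>i\<in>I. \<forall>j\<in>I. a (i, j) \<in> Units (msec X (V i \<inter> V j))) \<and>
     (\<forall>i\<in>I. \<forall>j\<in>I. \<forall>l\<in>I.
        mres X (V j \<inter> V l) (V i \<inter> V j \<inter> V l) (a (j, l)) \<otimes>\<^bsub>msec X (V i \<inter> V j \<inter> V l)\<^esub>
          mres X (V i \<inter> V j) (V i \<inter> V j \<inter> V l) (a (i, j)) =
        mres X (V i \<inter> V l) (V i \<inter> V j \<inter> V l) (a (i, l)))"

text \<open>Division-free form of a coboundary relation: if \<open>a\<close> and \<open>b\<close>
  are the transition functions of generators \<open>e i\<close> and
  \<open>f i = u i \<cdot> e i\<close>, both sides of the equation are the coordinate of
  \<open>f j\<close> with respect to \<open>e i\<close>.\<close>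

definition cohomologous ::
    "('p, 'a) monoidal_space \<Rightarrow> 'i set \<Rightarrow> ('i \<Rightarrow> 'p set) \<Rightarrow> ('i \<times> 'i \<Rightarrow> 'a) \<Rightarrow> ('i \<times> 'i \<Rightarrow> 'a) \<Rightarrow> bool" where
  "cohomologous X I V a b \<longleftrightarrow>
     (\<exists>u. (\<forall>i\<in>I. u i \<in> Units (msec X (V i))) \<and>
        (\<forall>i\<in>I. \<forall>j\<in>I. b (i, j) \<otimes>\<^bsub>msec X (V i \<inter> V j)\<^esub> mres X (V i) (V i \<inter> V j) (u i) =
           a (i, j) \<otimes>\<^bsub>msec X (V i \<inter> V j)\<^esub> mres X (V j) (V i \<inter> V j) (u j)))"

text \<open>The orientation \<open>e j = a (i, j) \<cdot> e i\<close> is the one of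
  \<open>cech_to_pic\<close>; with it the cocycle identity reads
  \<open>a (j, l) \<cdot> a (i, j) = a (i, l)\<close>.\<close>

definition trivialization ::
    "('p, 'a) monoidal_space \<Rightarrow> 'i set \<Rightarrow> ('i \<Rightarrow> 'p set) \<Rightarrow> ('p, 'a, 'l) oset \<Rightarrow>
     ('i \<times> 'i \<Rightarrow> 'a) \<Rightarrow> ('i \<Rightarrow> 'l) \<Rightarrow> bool" where
  "trivialization X I V L a e \<longleftrightarrow>
     (\<forall>i\<in>I. mgenerator X L (V i) (e i)) \<and>
     (\<forall>i\<in>I. \<forall>j\<in>I. ores L (V j) (V i \<inter> V j) (e j) =
        oact L (V i \<inter> V j) (a (i, j)) (ores L (V i) (V i \<inter> V j) (e i)))"

locale covered_space = mono_space X for X :: "('p, 'a) monoidal_space" +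
  fixes I :: "'i set" and V :: "'i \<Rightarrow> 'p set"
  assumes opn_cover: "\<And>i. i \<in> I \<Longrightarrow> opn (V i)"
    and cover: "(\<Union>i\<in>I. V i) = pts"
begin

lemma opn_Int_cover: "opn W \<Longrightarrow> i \<in> I \<Longrightarrow> opn (W \<inter> V i)"
  by (simp add: opn_cover openin_Int)

lemma opn_cover2: "i \<in> I \<Longrightarrow> j \<in> I \<Longrightarrow> opn (V i \<inter> V j)"
  by (simp add: opn_cover openin_Int)

lemma opn_cover3: "i \<in> I \<Longrightarrow> j \<in> I \<Longrightarrow> l \<in> I \<Longrightarrow> opn (V i \<inter> V j \<inter> V l)"
  by (simp add: opn_cover openin_Int)

lemma opn_decompose: "opn W \<Longrightarrow> W = (\<Union>i\<in>I. W \<inter> V i)"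
  using cover openin_subset by blast

lemma cocycle_Units: "\<lbrakk>cocycle X I V a; i \<in> I; j \<in> I\<rbrakk> \<Longrightarrow> a (i, j) \<in> Units (\<O> (V i \<inter> V j))"
  by (simp add: cocycle_def)

lemma cocycle_section: "\<lbrakk>cocycle X I V a; i \<in> I; j \<in> I\<rbrakk> \<Longrightarrow> a (i, j) \<in> carrier (\<O> (V i \<inter> V j))"
  by (rule Units_section[OF cocycle_Units])

lemma cocycle_on:
  assumes a: "cocycle X I V a" and i: "i \<in> I" "j \<in> I" "l \<in> I" and W: "opn W" "W \<subseteq> V i" "W \<subseteq> V j" "W \<subseteq> V l"
  shows "mres X (V j \<inter> V l) W (a (j, l)) \<otimes>\<^bsub>\<O> W\<^esub> mres X (V i \<inter> V j) W (a (i, j)) = mres X (V i \<inter> V l) W (a (i, l))"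
proof -
  let ?T = "V i \<inter> V j \<inter> V l"
  have T: "opn ?T" "W \<subseteq> ?T" using i W by (auto simp: opn_cover3)
  have "mres X ?T W (mres X (V j \<inter> V l) ?T (a (j, l)) \<otimes>\<^bsub>\<O> ?T\<^esub> mres X (V i \<inter> V j) ?T (a (i, j))) =
      mres X ?T W (mres X (V i \<inter> V l) ?T (a (i, l)))"
    using a i unfolding cocycle_def by simp
  moreover have "mres X (V j \<inter> V l) ?T (a (j, l)) \<in> carrier (\<O> ?T)" "mres X (V i \<inter> V j) ?T (a (i, j)) \<in> carrier (\<O> ?T)"
    using i T by (auto intro!: res_closed opn_cover2 cocycle_section[OF a])
  moreover have "V i \<inter> V j \<inter> V l \<subseteq> V j \<inter> V l" "V i \<inter> V j \<inter> V l \<subseteq> V i \<inter> V j" "V i \<inter> V j \<inter> V l \<subseteq> V i \<inter> V l" by blast+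
  ultimately show ?thesis
    using W(1) T i by (simp add: res_mult res_res opn_cover2 cocycle_section[OF a])
qed

text \<open>The cocycle identity at \<open>(i, i, i)\<close> makes this unit idempotent.\<close>

lemma cocycle_refl:
  assumes a: "cocycle X I V a" and i: "i \<in> I"
  shows "a (i, i) = \<one>\<^bsub>\<O> (V i)\<^esub>"
proof -
  have u: "a (i, i) \<in> Units (\<O> (V i))" using cocycle_Units[OF a i i] by simp
  note o = opn_cover[OF i]
  have "a (i, i) \<otimes>\<^bsub>\<O> (V i)\<^esub> a (i, i) = a (i, i) \<otimes>\<^bsub>\<O> (V i)\<^esub> \<one>\<^bsub>\<O> (V i)\<^esub>"
    using cocycle_on[OF a i i i o] by (simp add: res_id[OF o Units_section[OF u]] one_right[OF o Units_section[OF u]])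
  then show ?thesis
    by (simp add: Units_cancel[OF o u] Units_section[OF u] one_closed[OF o])
qed

lemma cocycle_symm_on:
  assumes a: "cocycle X I V a" and i: "i \<in> I" "j \<in> I" and W: "opn W" "W \<subseteq> V i" "W \<subseteq> V j"
  shows "mres X (V j \<inter> V i) W (a (j, i)) \<otimes>\<^bsub>\<O> W\<^esub> mres X (V i \<inter> V j) W (a (i, j)) = \<one>\<^bsub>\<O> W\<^esub>"
  using cocycle_on[OF a i(1,2,1) W W(2)]
  by (simp add: cocycle_refl[OF a i(1)] res_one[OF opn_cover[OF i(1)] W(1,2)])

lemma trivialization_mgenerator: "trivialization X I V L a e \<Longrightarrow> i \<in> I \<Longrightarrow> mgenerator X L (V i) (e i)"
  by (simp add: trivialization_def)

lemma trivialization_section: "trivialization X I V L a e \<Longrightarrow> i \<in> I \<Longrightarrow> e i \<in> osec L (V i)"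
  by (rule mgenerator_section[OF trivialization_mgenerator])

lemma trivialization_on:
  assumes L: "oset_sheaf X L" and e: "trivialization X I V L a e" and i: "i \<in> I" "j \<in> I"
    and a: "a (i, j) \<in> carrier (\<O> (V i \<inter> V j))" and W: "opn W" "W \<subseteq> V i" "W \<subseteq> V j"
  shows "ores L (V j) W (e j) = oact L W (mres X (V i \<inter> V j) W (a (i, j))) (ores L (V i) W (e i))"
proof -
  let ?T = "V i \<inter> V j"
  have T: "opn ?T" "W \<subseteq> ?T" using i W by (auto simp: opn_cover2)
  have "ores L ?T W (ores L (V j) ?T (e j)) = ores L ?T W (oact L ?T (a (i, j)) (ores L (V i) ?T (e i)))"
    using e i unfolding trivialization_def by simp
  then show ?thesis
    using W i T trivialization_section[OF e] a
    by (simp add: ores_ores[OF L] ores_oact[OF L] ores_closed[OF L] opn_cover)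
qed

text \<open>Each coefficient carries a generator to a generator, which forces it to be a unit; the
  cocycle identity follows by cancelling \<open>e i\<close> over the triple intersection. So it
  suffices to know that the coefficients are sections.\<close>

lemma trivialization_cocycle:
  assumes L: "oset_sheaf X L" and e: "trivialization X I V L a e"
    and a: "\<And>i j. i \<in> I \<Longrightarrow> j \<in> I \<Longrightarrow> a (i, j) \<in> carrier (\<O> (V i \<inter> V j))"
  shows "cocycle X I V a"
  unfolding cocycle_def
proof (intro conjI ballI)
  fix i j assume i: "i \<in> I" "j \<in> I"
  let ?T = "V i \<inter> V j"
  have "mgenerator X L ?T (oact L ?T (a (i, j)) (ores L (V i) ?T (e i)))"
    using e i mgenerator_restrict[OF L opn_cover opn_cover2, of j i j "e j"]
    unfolding trivialization_def by simp
  then show "a (i, j) \<in> Units (\<O> ?T)"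
    by (rule mgenerator_oact_unit[OF L opn_cover2[OF i] _ a[OF i], rotated])
      (use mgenerator_restrict[OF L opn_cover opn_cover2, of i i j "e i"] i trivialization_mgenerator[OF e] in simp)
next
  fix i j l assume i: "i \<in> I" "j \<in> I" "l \<in> I"
  let ?T = "V i \<inter> V j \<inter> V l"
  have T: "opn ?T" "?T \<subseteq> V i" "?T \<subseteq> V j" "?T \<subseteq> V l" using i by (auto simp: opn_cover3)
  have g: "mgenerator X L ?T (ores L (V i) ?T (e i))"
    by (rule mgenerator_restrict[OF L opn_cover[OF i(1)] T(1,2) trivialization_mgenerator[OF e i(1)]])
  let ?jl = "mres X (V j \<inter> V l) ?T (a (j, l))" and ?ij = "mres X (V i \<inter> V j) ?T (a (i, j))"
    and ?il = "mres X (V i \<inter> V l) ?T (a (i, l))"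
  have c: "?jl \<in> carrier (\<O> ?T)" "?ij \<in> carrier (\<O> ?T)" "?il \<in> carrier (\<O> ?T)"
    using i T by (auto intro!: res_closed a opn_cover2)
  show "?jl \<otimes>\<^bsub>\<O> ?T\<^esub> ?ij = ?il"
  proof (rule mgenerator_cancel[OF L T(1) g])
    show "oact L ?T (?jl \<otimes>\<^bsub>\<O> ?T\<^esub> ?ij) (ores L (V i) ?T (e i)) = oact L ?T ?il (ores L (V i) ?T (e i))"
      by (simp add: oact_mult[OF L T(1) c(1,2) mgenerator_section[OF g]]
          trivialization_on[OF L e i(1,2) a[OF i(1,2)] T(1-3), symmetric]
          trivialization_on[OF L e i(2,3) a[OF i(2,3)] T(1,3,4), symmetric]
          trivialization_on[OF L e i(1,3) a[OF i(1,3)] T(1,2,4), symmetric])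
  qed (simp_all add: mult_closed[OF T(1)] c)
qed

lemma exists_trivialization:
  assumes L: "oset_sheaf X L" and e: "\<And>i. i \<in> I \<Longrightarrow> mgenerator X L (V i) (e i)"
  obtains a where "cocycle X I V a" "trivialization X I V L a e"
proof -
  have "\<exists>a\<in>Units (\<O> (V i \<inter> V j)). ores L (V j) (V i \<inter> V j) (e j) = oact L (V i \<inter> V j) a (ores L (V i) (V i \<inter> V j) (e i))"
    if i: "i \<in> I" "j \<in> I" for i j
  proof -
    have "mgenerator X L (V i \<inter> V j) (ores L (V i) (V i \<inter> V j) (e i))"
      "mgenerator X L (V i \<inter> V j) (ores L (V j) (V i \<inter> V j) (e j))"
      using i by (simp_all add: mgenerator_restrict[OF L] e opn_cover opn_cover2)
    then show ?thesis by (rule mgenerator_unit_change[OF L opn_cover2[OF i]]) blast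
  qed
  then obtain a where a: "\<And>i j. i \<in> I \<Longrightarrow> j \<in> I \<Longrightarrow> a i j \<in> Units (\<O> (V i \<inter> V j))"
    "\<And>i j. i \<in> I \<Longrightarrow> j \<in> I \<Longrightarrow>
      ores L (V j) (V i \<inter> V j) (e j) = oact L (V i \<inter> V j) (a i j) (ores L (V i) (V i \<inter> V j) (e i))"
    by metis
  have t: "trivialization X I V L (\<lambda>(i, j). a i j) e"
    unfolding trivialization_def using e a by simp
  then have "cocycle X I V (\<lambda>(i, j). a i j)"
    by (rule trivialization_cocycle[OF L]) (simp add: Units_section a)
  then show thesis using t by (rule that)
qed

text \<open>Turns a section into the family of its coordinates in the generators \<open>e i\<close>.
  The lemmas below show that over each open set this is a bijection onto the families that are
  compatible up to the factors \<open>a (i, j)\<close>; hence the cocycle alone determines the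
  bundle.\<close>

definition crd where
  "crd L e W s i = coord L (W \<inter> V i) (ores L (V i) (W \<inter> V i) (e i)) (ores L W (W \<inter> V i) s)"

context
  fixes L :: "('p, 'a, 'l) oset" and a e
  assumes L: "oset_sheaf X L" and a: "cocycle X I V a" and e: "trivialization X I V L a e"
begin

lemma local_generator: "opn W \<Longrightarrow> i \<in> I \<Longrightarrow> mgenerator X L (W \<inter> V i) (ores L (V i) (W \<inter> V i) (e i))"
  by (simp add: mgenerator_restrict[OF L] opn_cover opn_Int_cover trivialization_mgenerator[OF e])

lemma crd:
  assumes "opn W" "s \<in> osec L W" "i \<in> I"
  shows "crd L e W s i \<in> carrier (\<O> (W \<inter> V i))"
    "oact L (W \<inter> V i) (crd L e W s i) (ores L (V i) (W \<inter> V i) (e i)) = ores L W (W \<inter> V i) s"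
  using coord[OF L opn_Int_cover[OF assms(1,3)] local_generator[OF assms(1,3)]
      ores_closed[OF L assms(1) opn_Int_cover[OF assms(1,3)] _ assms(2)]]
  by (simp_all add: crd_def)

lemma crd_eqI:
  assumes "opn W" "s \<in> osec L W" "i \<in> I" "m \<in> carrier (\<O> (W \<inter> V i))"
    and "oact L (W \<inter> V i) m (ores L (V i) (W \<inter> V i) (e i)) = ores L W (W \<inter> V i) s"
  shows "crd L e W s i = m"
  unfolding crd_def
  by (rule coord_eqI[OF L opn_Int_cover[OF assms(1,3)] local_generator[OF assms(1,3)] assms(4,5)])

lemma crd_restrict:
  assumes W: "opn W" and s: "s \<in> osec L W" and i: "i \<in> I" and W': "opn W'" "W' \<subseteq> W"
  shows "crd L e W' (ores L W W' s) i = mres X (W \<inter> V i) (W' \<inter> V i) (crd L e W s i)"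
proof (rule crd_eqI[OF W'(1) _ i])
  have o: "opn (W \<inter> V i)" "opn (W' \<inter> V i)" "W' \<inter> V i \<subseteq> W \<inter> V i" "opn (V i)"
    using W W' i by (auto simp: opn_cover openin_Int)
  note c = crd[OF W s i]
  show "ores L W W' s \<in> osec L W'" by (rule ores_closed[OF L W W' s])
  show "mres X (W \<inter> V i) (W' \<inter> V i) (crd L e W s i) \<in> carrier (\<O> (W' \<inter> V i))"
    by (rule res_closed[OF o(1,2,3) c(1)])
  have "ores L (W \<inter> V i) (W' \<inter> V i) (ores L W (W \<inter> V i) s) = ores L W' (W' \<inter> V i) (ores L W W' s)"
    using o W W' s by (simp add: ores_ores[OF L] le_infI1)
  then show "oact L (W' \<inter> V i) (mres X (W \<inter> V i) (W' \<inter> V i) (crd L e W s i)) (ores L (V i) (W' \<inter> V i) (e i)) =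
      ores L W' (W' \<inter> V i) (ores L W W' s)"
    using arg_cong[OF c(2), of "ores L (W \<inter> V i) (W' \<inter> V i)"] o c(1) i trivialization_section[OF e i]
    by (simp add: ores_oact[OF L] ores_closed[OF L] ores_ores[OF L])
qed

lemma crd_oact:
  assumes W: "opn W" and s: "s \<in> osec L W" and i: "i \<in> I" and b: "b \<in> carrier (\<O> W)"
  shows "crd L e W (oact L W b s) i = mres X W (W \<inter> V i) b \<otimes>\<^bsub>\<O> (W \<inter> V i)\<^esub> crd L e W s i"
proof (rule crd_eqI[OF W _ i])
  have o: "opn (W \<inter> V i)" "opn (V i)"
    using W i by (auto simp: opn_cover openin_Int)
  note c = crd[OF W s i]
  show "oact L W b s \<in> osec L W" by (rule oact_closed[OF L W b s])
  have b': "mres X W (W \<inter> V i) b \<in> carrier (\<O> (W \<inter> V i))" by (rule res_closed[OF W o(1) _ b]) simp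
  then show "mres X W (W \<inter> V i) b \<otimes>\<^bsub>\<O> (W \<inter> V i)\<^esub> crd L e W s i \<in> carrier (\<O> (W \<inter> V i))"
    by (rule mult_closed[OF o(1) _ c(1)])
  show "oact L (W \<inter> V i) (mres X W (W \<inter> V i) b \<otimes>\<^bsub>\<O> (W \<inter> V i)\<^esub> crd L e W s i) (ores L (V i) (W \<inter> V i) (e i)) =
      ores L W (W \<inter> V i) (oact L W b s)"
    using o b' c i W b s trivialization_section[OF e i]
    by (simp add: ores_oact[OF L] ores_closed[OF L] oact_mult[OF L])
qed

text \<open>With coordinates \<open>m i\<close> and \<open>m j\<close>, the section equals on
  \<open>Z\<close> both \<open>m i \<cdot> e i\<close> and
  \<open>m j \<cdot> e j = m j \<cdot> a (i, j) \<cdot> e i\<close>; cancel the generator.\<close>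

lemma crd_compat:
  assumes W: "opn W" and s: "s \<in> osec L W" and i: "i \<in> I" "j \<in> I"
  defines "Z \<equiv> W \<inter> V i \<inter> V j"
  shows "mres X (W \<inter> V i) Z (crd L e W s i) =
    mres X (V i \<inter> V j) Z (a (i, j)) \<otimes>\<^bsub>\<O> Z\<^esub> mres X (W \<inter> V j) Z (crd L e W s j)"
proof -
  have Z: "opn Z" "Z \<subseteq> V i" "Z \<subseteq> V j" "Z \<subseteq> W" using W i by (auto simp: Z_def opn_cover openin_Int)
  have o: "opn (W \<inter> V i)" "opn (W \<inter> V j)" "opn (V i)" "opn (V j)" "opn (V i \<inter> V j)"
    using W i by (auto simp: opn_cover openin_Int)
  note ci = crd[OF W s i(1)] and cj = crd[OF W s i(2)]
  note ei = trivialization_section[OF e i(1)] and ej = trivialization_section[OF e i(2)]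
  let ?mi = "mres X (W \<inter> V i) Z (crd L e W s i)" and ?mj = "mres X (W \<inter> V j) Z (crd L e W s j)"
  let ?a = "mres X (V i \<inter> V j) Z (a (i, j))"
  have aij: "a (i, j) \<in> carrier (\<O> (V i \<inter> V j))" by (rule cocycle_section[OF a i])
  have m: "?mi \<in> carrier (\<O> Z)" "?mj \<in> carrier (\<O> Z)" "?a \<in> carrier (\<O> Z)"
    using o Z ci(1) cj(1) aij by (auto intro!: res_closed)
  have g: "mgenerator X L Z (ores L (V i) Z (e i))"
    by (rule mgenerator_restrict[OF L o(3) Z(1,2) trivialization_mgenerator[OF e i(1)]])
  have "oact L Z ?mi (ores L (V i) Z (e i)) = ores L W Z s"
    using arg_cong[OF ci(2), of "ores L (W \<inter> V i) Z"] W o Z s ci(1) ei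
    by (simp add: ores_oact[OF L] ores_closed[OF L] ores_ores[OF L])
  moreover have "oact L Z ?mj (ores L (V j) Z (e j)) = ores L W Z s"
    using arg_cong[OF cj(2), of "ores L (W \<inter> V j) Z"] W o Z s cj(1) ej
    by (simp add: ores_oact[OF L] ores_closed[OF L] ores_ores[OF L])
  moreover have "oact L Z ?mj (ores L (V j) Z (e j)) = oact L Z (?a \<otimes>\<^bsub>\<O> Z\<^esub> ?mj) (ores L (V i) Z (e i))"
    by (simp add: trivialization_on[OF L e i aij Z(1-3)] mult_comm[OF Z(1) m(3,2)]
        oact_mult[OF L Z(1) m(2,3) mgenerator_section[OF g]])
  ultimately show ?thesis
    by (intro mgenerator_cancel[OF L Z(1) g]) (simp_all add: m mult_closed[OF Z(1)])
qed

lemma crd_inject: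
  assumes W: "opn W" and s: "s \<in> osec L W" "t \<in> osec L W" and eq: "\<And>i. i \<in> I \<Longrightarrow> crd L e W s i = crd L e W t i"
  shows "s = t"
proof (rule oset_eqI[OF L opn_Int_cover[OF W] opn_decompose[OF W] s])
  show "ores L W (W \<inter> V i) s = ores L W (W \<inter> V i) t" if "i \<in> I" for i
    using crd(2)[OF W s(1) that] crd(2)[OF W s(2) that] eq[OF that] by simp
qed

text \<open>The sections \<open>m i \<cdot> e i\<close> agree on overlaps by the twisted
  compatibility, hence glue.\<close>

lemma crd_surj:
  assumes W: "opn W" and m: "\<And>i. i \<in> I \<Longrightarrow> m i \<in> carrier (\<O> (W \<inter> V i))"
    and compat: "\<And>i j. i \<in> I \<Longrightarrow> j \<in> I \<Longrightarrow> mres X (W \<inter> V i) (W \<inter> V i \<inter> V j) (m i) =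
      mres X (V i \<inter> V j) (W \<inter> V i \<inter> V j) (a (i, j)) \<otimes>\<^bsub>\<O> (W \<inter> V i \<inter> V j)\<^esub>
        mres X (W \<inter> V j) (W \<inter> V i \<inter> V j) (m j)"
  shows "\<exists>s\<in>osec L W. \<forall>i\<in>I. crd L e W s i = m i"
proof -
  let ?s = "\<lambda>i. oact L (W \<inter> V i) (m i) (ores L (V i) (W \<inter> V i) (e i))"
  have sc: "?s i \<in> osec L (W \<inter> V i)" if "i \<in> I" for i
    using that W trivialization_section[OF e that]
    by (simp add: oact_closed[OF L] ores_closed[OF L] m opn_cover opn_Int_cover)
  have "\<exists>s\<in>osec L W. \<forall>i\<in>I. ores L W (W \<inter> V i) s = ?s i"
  proof (rule oset_glue[OF L opn_Int_cover[OF W] opn_decompose[OF W] sc])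
    fix i j assume i: "i \<in> I" "j \<in> I"
    define Z where "Z = W \<inter> V i \<inter> V j"
    have ZZ: "(W \<inter> V i) \<inter> (W \<inter> V j) = Z" by (auto simp: Z_def)
    have Z: "opn Z" "Z \<subseteq> V i" "Z \<subseteq> V j" "Z \<subseteq> W" using W i by (auto simp: Z_def opn_cover openin_Int)
    have o: "opn (W \<inter> V i)" "opn (W \<inter> V j)" "opn (V i)" "opn (V j)" "opn (V i \<inter> V j)"
      using W i by (auto simp: opn_cover openin_Int)
    note ei = trivialization_section[OF e i(1)] and ej = trivialization_section[OF e i(2)]
    let ?mj = "mres X (W \<inter> V j) Z (m j)" and ?a = "mres X (V i \<inter> V j) Z (a (i, j))"
    have aij: "a (i, j) \<in> carrier (\<O> (V i \<inter> V j))" by (rule cocycle_section[OF a i])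
    have c: "?mj \<in> carrier (\<O> Z)" "?a \<in> carrier (\<O> Z)"
      using o Z m i aij by (auto intro!: res_closed)
    have "ores L (W \<inter> V i) Z (?s i) = oact L Z (?a \<otimes>\<^bsub>\<O> Z\<^esub> ?mj) (ores L (V i) Z (e i))"
      using o Z m i ei compat[OF i] by (simp add: ores_oact[OF L] ores_closed[OF L] ores_ores[OF L] Z_def[symmetric])
    also have "\<dots> = oact L Z ?mj (ores L (V j) Z (e j))"
      by (simp add: trivialization_on[OF L e i aij Z(1-3)] mult_comm[OF Z(1) c(2,1)]
          oact_mult[OF L Z(1) c(1,2) ores_closed[OF L o(3) Z(1,2) ei]])
    also have "\<dots> = ores L (W \<inter> V j) Z (?s j)"
      using o Z m i ej by (simp add: ores_oact[OF L] ores_closed[OF L] ores_ores[OF L])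
    finally show "ores L (W \<inter> V i) ((W \<inter> V i) \<inter> (W \<inter> V j)) (?s i) = ores L (W \<inter> V j) ((W \<inter> V i) \<inter> (W \<inter> V j)) (?s j)"
      unfolding ZZ .
  qed
  then obtain s where s: "s \<in> osec L W" "\<And>i. i \<in> I \<Longrightarrow> ores L W (W \<inter> V i) s = ?s i" by blast
  have "crd L e W s i = m i" if "i \<in> I" for i
    by (rule crd_eqI[OF W s(1) that m[OF that]]) (simp add: s(2)[OF that])
  then show ?thesis using s(1) by blast
qed

text \<open>Reduces generators to units. In a tensor product, where coordinates are multiplied, a
  pair of generators then yields a generator because products of units are units.\<close>

lemma mgenerator_iff_crd:
  assumes W: "opn W" and s: "s \<in> osec L W"
  shows "mgenerator X L W s \<longleftrightarrow> (\<forall>i\<in>I. crd L e W s i \<in> Units (\<O> (W \<inter> V i)))"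
proof
  assume g: "mgenerator X L W s"
  show "\<forall>i\<in>I. crd L e W s i \<in> Units (\<O> (W \<inter> V i))"
  proof
    fix i assume i: "i \<in> I"
    have "mgenerator X L (W \<inter> V i) (ores L W (W \<inter> V i) s)"
      by (rule mgenerator_restrict[OF L W opn_Int_cover[OF W i] _ g]) simp
    then show "crd L e W s i \<in> Units (\<O> (W \<inter> V i))"
      using mgenerator_oact_unit[OF L opn_Int_cover[OF W i] local_generator[OF W i] crd(1)[OF W s i]]
      by (simp add: crd(2)[OF W s i])
  qed
next
  assume u: "\<forall>i\<in>I. crd L e W s i \<in> Units (\<O> (W \<inter> V i))"
  show "mgenerator X L W s"
  proof (rule mgenerator_local[OF L s opn_Int_cover[OF W] opn_decompose[OF W]])
    fix i assume i: "i \<in> I"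
    show "mgenerator X L (W \<inter> V i) (ores L W (W \<inter> V i) s)"
      using mgenerator_unit_mult[OF L opn_Int_cover[OF W i] local_generator[OF W i] bspec[OF u i]]
      by (simp add: crd(2)[OF W s i])
  qed
qed

end

end

section \<open>Bundles compared through their cocycles\<close>

context mono_space
begin

lemma oset_iso_onE:
  assumes "oset_iso_on X U L N"
  obtains \<phi> where
    "\<And>W. opn W \<Longrightarrow> W \<subseteq> U \<Longrightarrow> bij_betw (\<phi> W) (osec L W) (osec N W)"
    "\<And>W a l. opn W \<Longrightarrow> W \<subseteq> U \<Longrightarrow> a \<in> carrier (\<O> W) \<Longrightarrow> l \<in> osec L W \<Longrightarrow> \<phi> W (oact L W a l) = oact N W a (\<phi> W l)"
    "\<And>W W' l. opn W \<Longrightarrow> opn W' \<Longrightarrow> W' \<subseteq> W \<Longrightarrow> W \<subseteq> U \<Longrightarrow> l \<in> osec L W \<Longrightarrow> \<phi> W' (ores L W W' l) = ores N W W' (\<phi> W l)"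
proof -
  obtain \<phi> where \<phi>: "(\<forall>V. opn V \<and> V \<subseteq> U \<longrightarrow>
             bij_betw (\<phi> V) (osec L V) (osec N V) \<and>
             (\<forall>a\<in>carrier (\<O> V). \<forall>l\<in>osec L V. \<phi> V (oact L V a l) = oact N V a (\<phi> V l)))"
    "(\<forall>V W. opn V \<and> opn W \<and> W \<subseteq> V \<and> V \<subseteq> U \<longrightarrow>
             (\<forall>l\<in>osec L V. \<phi> W (ores L V W l) = ores N V W (\<phi> V l)))"
    using assms unfolding oset_iso_on_def by (elim exE conjE)
  show thesis by (rule that[of \<phi>]) (use \<phi> in simp_all)
qed

lemma mgenerator_iso:
  assumes L: "oset_sheaf X L" and \<phi>: "\<And>W. opn W \<Longrightarrow> W \<subseteq> U \<Longrightarrow> bij_betw (\<phi> W) (osec L W) (osec N W)"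
    "\<And>W a l. opn W \<Longrightarrow> W \<subseteq> U \<Longrightarrow> a \<in> carrier (\<O> W) \<Longrightarrow> l \<in> osec L W \<Longrightarrow> \<phi> W (oact L W a l) = oact N W a (\<phi> W l)"
    "\<And>W l. opn W \<Longrightarrow> W \<subseteq> U \<Longrightarrow> l \<in> osec L U \<Longrightarrow> \<phi> W (ores L U W l) = ores N U W (\<phi> U l)"
    and U: "opn U" and e: "mgenerator X L U e"
  shows "mgenerator X N U (\<phi> U e)"
  unfolding mgenerator_def
proof (intro conjI allI impI)
  have es: "e \<in> osec L U" by (rule mgenerator_section[OF e])
  show "\<phi> U e \<in> osec N U" using \<phi>(1)[OF U order_refl] es by (rule bij_betwE[rule_format])
  fix W assume "opn W \<and> W \<subseteq> U"
  then have W: "opn W" "W \<subseteq> U" by simp_all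
  have "bij_betw (\<phi> W \<circ> (\<lambda>a. oact L W a (ores L U W e))) (carrier (\<O> W)) (osec N W)"
    by (rule bij_betw_trans[OF mgenerator_bij[OF L W(1) mgenerator_restrict[OF L U W e]] \<phi>(1)[OF W]])
  then show "bij_betw (\<lambda>a. oact N W a (ores N U W (\<phi> U e))) (carrier (\<O> W)) (osec N W)"
    by (rule iffD1[OF bij_betw_cong, rotated]) (simp add: \<phi>(2)[OF W] \<phi>(3)[OF W es] ores_closed[OF L U W es])
qed

end

context covered_space
begin

text \<open>Both bundles are described by the same families of coordinates. The isomorphism pairs
  sections with equal coordinates; it respects the action and restriction because taking coordinates
  does.\<close>

lemma oset_iso_on_same_cocycle:
  assumes L: "oset_sheaf X L" and N: "oset_sheaf X N" and a: "cocycle X I V a"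
    and e: "trivialization X I V L a e" and e': "trivialization X I V N a e'"
  shows "oset_iso_on X pts L N"
proof -
  \<comment> \<open>A relation keeps the two bundles on the same footing: existence and uniqueness
    hold in both directions, and linearity and naturality are closure properties of
    \<open>R\<close>.\<close>
  define R where "R W s t \<longleftrightarrow> s \<in> osec L W \<and> t \<in> osec N W \<and> (\<forall>i\<in>I. crd L e W s i = crd N e' W t i)" for W s t
  have ex: "\<exists>t. R W s t" if W: "opn W" and s: "s \<in> osec L W" for W s
    using crd_surj[OF N a e' W, of "crd L e W s"] crd(1)[OF L a e W s] crd_compat[OF L a e W s]
    unfolding R_def using s by fastforce
  have ex': "\<exists>s. R W s t" if W: "opn W" and t: "t \<in> osec N W" for W t
    using crd_surj[OF L a e W, of "crd N e' W t"] crd(1)[OF N a e' W t] crd_compat[OF N a e' W t]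
    unfolding R_def using t by fastforce
  have u: "t = t'" if "opn W" "R W s t" "R W s t'" for W s t t'
    using crd_inject[OF N a e' that(1), of t t'] that(2,3) unfolding R_def by simp
  have u': "s = s'" if "opn W" "R W s t" "R W s' t" for W s s' t
    using crd_inject[OF L a e that(1), of s s'] that(2,3) unfolding R_def by simp
  have act: "R W (oact L W b s) (oact N W b t)" if "opn W" "R W s t" "b \<in> carrier (\<O> W)" for W s t b
    using that unfolding R_def
    by (simp add: oact_closed[OF L] oact_closed[OF N] crd_oact[OF L a e] crd_oact[OF N a e'])
  have res: "R W' (ores L W W' s) (ores N W W' t)" if "opn W" "R W s t" "opn W'" "W' \<subseteq> W" for W W' s t
    using that unfolding R_def
    by (simp add: ores_closed[OF L] ores_closed[OF N] crd_restrict[OF L a e] crd_restrict[OF N a e'])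
  define \<phi> where "\<phi> W s = (SOME t. R W s t)" for W s
  have \<phi>: "R W s (\<phi> W s)" if "opn W" "s \<in> osec L W" for W s
    unfolding \<phi>_def by (rule someI_ex[OF ex[OF that]])
  show ?thesis
    unfolding oset_iso_on_def
  proof (intro exI[of _ \<phi>] conjI allI impI ballI)
    fix W assume "opn W \<and> W \<subseteq> pts"
    then have W: "opn W" by simp
    show "bij_betw (\<phi> W) (osec L W) (osec N W)"
    proof (rule bij_betwI')
      fix s s' assume s: "s \<in> osec L W" "s' \<in> osec L W"
      show "\<phi> W s = \<phi> W s' \<longleftrightarrow> s = s'"
        using u'[OF W \<phi>[OF W s(1)]] \<phi>[OF W s(2)] by metis
    next
      fix s assume s: "s \<in> osec L W"
      show "\<phi> W s \<in> osec N W" using \<phi>[OF W s] by (simp add: R_def)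
    next
      fix t assume "t \<in> osec N W"
      then obtain s where s: "R W s t" using ex'[OF W] by blast
      then have "s \<in> osec L W" by (simp add: R_def)
      then show "\<exists>s\<in>osec L W. t = \<phi> W s" using u[OF W s] \<phi>[OF W] by blast
    qed
    fix b s assume "b \<in> carrier (\<O> W)" "s \<in> osec L W"
    then show "\<phi> W (oact L W b s) = oact N W b (\<phi> W s)"
      using u[OF W \<phi>[OF W] act[OF W \<phi>[OF W]]] by (simp add: oact_closed[OF L W])
  next
    fix W W' s assume "opn W \<and> opn W' \<and> W' \<subseteq> W \<and> W \<subseteq> pts" and s: "s \<in> osec L W"
    then have W: "opn W" "opn W'" "W' \<subseteq> W" by simp_all
    show "\<phi> W' (ores L W W' s) = ores N W W' (\<phi> W s)"
      by (rule u[OF W(2) \<phi>[OF W(2) ores_closed[OF L W s]] res[OF W(1) \<phi>[OF W(1) s] W(2,3)]])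
  qed
qed

text \<open>The pairing multiplies coordinates. The products are compatible up to the factors of
  \<open>c\<close>, so they are the coordinates of a unique section of \<open>N\<close>.\<close>

lemma mtensor_mult_cocycle:
  assumes L: "oset_sheaf X L" and L': "oset_sheaf X L'" and N: "oset_sheaf X N"
    and a: "cocycle X I V a" and a': "cocycle X I V a'" and c: "cocycle X I V c"
    and e: "trivialization X I V L a e" and e': "trivialization X I V L' a' e'" and f: "trivialization X I V N c f"
    and mult: "\<And>i j. i \<in> I \<Longrightarrow> j \<in> I \<Longrightarrow> c (i, j) = a (i, j) \<otimes>\<^bsub>\<O> (V i \<inter> V j)\<^esub> a' (i, j)"
  shows "mtensor X L L' N"
proof -
  define R where "R W s s' t \<longleftrightarrow> t \<in> osec N W \<and>
    (\<forall>i\<in>I. crd N f W t i = crd L e W s i \<otimes>\<^bsub>\<O> (W \<inter> V i)\<^esub> crd L' e' W s' i)" for W s s' t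
  have ex: "\<exists>t. R W s s' t" if W: "opn W" and s: "s \<in> osec L W" and s': "s' \<in> osec L' W" for W s s'
  proof -
    note cs = crd(1)[OF L a e W s] and cs' = crd(1)[OF L' a' e' W s']
    have "\<exists>t\<in>osec N W. \<forall>i\<in>I. crd N f W t i = crd L e W s i \<otimes>\<^bsub>\<O> (W \<inter> V i)\<^esub> crd L' e' W s' i"
    proof (rule crd_surj[OF N c f W])
      fix i assume i: "i \<in> I"
      show "crd L e W s i \<otimes>\<^bsub>\<O> (W \<inter> V i)\<^esub> crd L' e' W s' i \<in> carrier (\<O> (W \<inter> V i))"
        by (rule mult_closed[OF opn_Int_cover[OF W i] cs[OF i] cs'[OF i]])
      fix j assume j: "j \<in> I"
      define Z where "Z = W \<inter> V i \<inter> V j"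
      have Z: "opn Z" "Z \<subseteq> V i \<inter> V j" "Z \<subseteq> W \<inter> V i" "Z \<subseteq> W \<inter> V j"
        using W i j by (auto simp: Z_def opn_cover openin_Int)
      have o: "opn (W \<inter> V i)" "opn (W \<inter> V j)" "opn (V i \<inter> V j)"
        using W i j by (auto simp: opn_cover openin_Int)
      have aij: "a (i, j) \<in> carrier (\<O> (V i \<inter> V j))" "a' (i, j) \<in> carrier (\<O> (V i \<inter> V j))"
        using cocycle_section[OF a i j] cocycle_section[OF a' i j] .
      note m = crd_compat[OF L a e W s i j, folded Z_def] and m' = crd_compat[OF L' a' e' W s' i j, folded Z_def]
      have k: "mres X (W \<inter> V j) Z (crd L e W s j) \<in> carrier (\<O> Z)" "mres X (W \<inter> V j) Z (crd L' e' W s' j) \<in> carrier (\<O> Z)"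
        "mres X (V i \<inter> V j) Z (a (i, j)) \<in> carrier (\<O> Z)" "mres X (V i \<inter> V j) Z (a' (i, j)) \<in> carrier (\<O> Z)"
        by (intro res_closed o Z cs[OF j] cs'[OF j] aij)+
      show "mres X (W \<inter> V i) (W \<inter> V i \<inter> V j) (crd L e W s i \<otimes>\<^bsub>\<O> (W \<inter> V i)\<^esub> crd L' e' W s' i) =
        mres X (V i \<inter> V j) (W \<inter> V i \<inter> V j) (c (i, j)) \<otimes>\<^bsub>\<O> (W \<inter> V i \<inter> V j)\<^esub>
        mres X (W \<inter> V j) (W \<inter> V i \<inter> V j) (crd L e W s j \<otimes>\<^bsub>\<O> (W \<inter> V j)\<^esub> crd L' e' W s' j)"
        unfolding Z_def[symmetric] mult[OF i j]
        by (simp add: res_mult[OF o(1) Z(1,3) cs[OF i] cs'[OF i]] res_mult[OF o(2) Z(1,4) cs[OF j] cs'[OF j]]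
            res_mult[OF o(3) Z(1,2) aij] m m' mult_assoc[OF Z(1)] mult_closed[OF Z(1)] k mult_lcomm[OF Z(1) k(4,1)])
    qed
    then show ?thesis unfolding R_def by blast
  qed
  have u: "t = t'" if "opn W" "R W s s' t" "R W s s' t'" for W s s' t t'
    using crd_inject[OF N c f that(1), of t t'] that(2,3) unfolding R_def by simp
  define \<beta> where "\<beta> W s s' = (SOME t. R W s s' t)" for W s s'
  have \<beta>: "R W s s' (\<beta> W s s')" if "opn W" "s \<in> osec L W" "s' \<in> osec L' W" for W s s'
    unfolding \<beta>_def by (rule someI_ex[OF ex[OF that]])
  show ?thesis
    unfolding mtensor_def
  proof (intro exI[of _ \<beta>] conjI allI impI ballI)
    fix W s s' assume W: "opn W" and s: "s \<in> osec L W" and s': "s' \<in> osec L' W"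
    note b = \<beta>[OF W s s'] and cs = crd(1)[OF L a e W s] and cs' = crd(1)[OF L' a' e' W s']
    show bW: "\<beta> W s s' \<in> osec N W" using b by (simp add: R_def)
    {
      fix x assume x: "x \<in> carrier (\<O> W)"
      have xr: "mres X W (W \<inter> V i) x \<in> carrier (\<O> (W \<inter> V i))" if "i \<in> I" for i
        by (rule res_closed[OF W opn_Int_cover[OF W that] _ x]) simp
      show "\<beta> W (oact L W x s) s' = oact N W x (\<beta> W s s')"
        by (rule u[OF W \<beta>[OF W oact_closed[OF L W x s] s']]) (use b in
          \<open>simp add: R_def oact_closed[OF N W x] crd_oact[OF N c f W _ _ x] crd_oact[OF L a e W s _ x]
             mult_assoc opn_Int_cover[OF W] xr cs cs'\<close>)
      show "\<beta> W s (oact L' W x s') = oact N W x (\<beta> W s s')"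
        by (rule u[OF W \<beta>[OF W s oact_closed[OF L' W x s']]]) (use b in
          \<open>simp add: R_def oact_closed[OF N W x] crd_oact[OF N c f W _ _ x] crd_oact[OF L' a' e' W s' _ x]
             mult_lcomm opn_Int_cover[OF W] xr cs cs'\<close>)
    next
      fix W' assume "opn W' \<and> W' \<subseteq> W"
      then have W': "opn W'" "W' \<subseteq> W" by simp_all
      have sub: "W' \<inter> V i \<subseteq> W \<inter> V i" for i using W' by blast
      show "ores N W W' (\<beta> W s s') = \<beta> W' (ores L W W' s) (ores L' W W' s')"
        by (rule u[OF W'(1) _ \<beta>[OF W'(1) ores_closed[OF L W W' s] ores_closed[OF L' W W' s']]]) (use b in
          \<open>simp add: R_def ores_closed[OF N W W'] crd_restrict[OF N c f W _ _ W'] crd_restrict[OF L a e W s _ W']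
            crd_restrict[OF L' a' e' W s' _ W'] res_mult opn_Int_cover W W' le_infI1 cs cs'\<close>)
    next
      assume "mgenerator X L W s \<and> mgenerator X L' W s'"
      then show "mgenerator X N W (\<beta> W s s')"
        using b unfolding mgenerator_iff_crd[OF N c f W bW]
        by (simp add: R_def mgenerator_iff_crd[OF L a e W s] mgenerator_iff_crd[OF L' a' e' W s'] Units_mult opn_Int_cover[OF W])
    }
  qed
qed

text \<open>The sections \<open>\<beta> (V i) (e i) (e' i)\<close> are generators by the definition
  of \<open>mtensor\<close>, and bilinearity moves both transition factors outside.\<close>

lemma trivialization_tensor:
  assumes L: "oset_sheaf X L" and L': "oset_sheaf X L'" and N: "oset_sheaf X N"
    and a: "cocycle X I V a" and a': "cocycle X I V a'"
    and e: "trivialization X I V L a e" and e': "trivialization X I V L' a' e'"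
    and tens: "mtensor X L L' N"
  obtains f where "trivialization X I V N (\<lambda>(i, j). a (i, j) \<otimes>\<^bsub>\<O> (V i \<inter> V j)\<^esub> a' (i, j)) f"
proof -
  obtain \<beta> where \<beta>: "\<forall>U. opn U \<longrightarrow> (\<forall>l\<in>osec L U. \<forall>l'\<in>osec L' U.
             \<beta> U l l' \<in> osec N U \<and>
             (\<forall>a\<in>carrier (\<O> U).
                \<beta> U (oact L U a l) l' = oact N U a (\<beta> U l l') \<and>
                \<beta> U l (oact L' U a l') = oact N U a (\<beta> U l l')) \<and>
             (\<forall>V. opn V \<and> V \<subseteq> U \<longrightarrow>
                ores N U V (\<beta> U l l') = \<beta> V (ores L U V l) (ores L' U V l')) \<and>
             (mgenerator X L U l \<and> mgenerator X L' U l' \<longrightarrow> mgenerator X N U (\<beta> U l l')))"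
    using tens unfolding mtensor_def by blast
  have b: "\<beta> U l l' \<in> osec N U" "\<And>a. a \<in> carrier (\<O> U) \<Longrightarrow> \<beta> U (oact L U a l) l' = oact N U a (\<beta> U l l')"
    "\<And>a. a \<in> carrier (\<O> U) \<Longrightarrow> \<beta> U l (oact L' U a l') = oact N U a (\<beta> U l l')"
    "\<And>V. opn V \<Longrightarrow> V \<subseteq> U \<Longrightarrow> ores N U V (\<beta> U l l') = \<beta> V (ores L U V l) (ores L' U V l')"
    "mgenerator X L U l \<Longrightarrow> mgenerator X L' U l' \<Longrightarrow> mgenerator X N U (\<beta> U l l')"
    if "opn U" "l \<in> osec L U" "l' \<in> osec L' U" for U l l'
    using \<beta> that by auto
  have "trivialization X I V N (\<lambda>(i, j). a (i, j) \<otimes>\<^bsub>\<O> (V i \<inter> V j)\<^esub> a' (i, j)) (\<lambda>i. \<beta> (V i) (e i) (e' i))"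
    unfolding trivialization_def
  proof (intro conjI ballI)
    fix i assume i: "i \<in> I"
    note ei = trivialization_section[OF e i] trivialization_section[OF e' i]
    show "mgenerator X N (V i) (\<beta> (V i) (e i) (e' i))"
      by (rule b(5)[OF opn_cover[OF i] ei trivialization_mgenerator[OF e i] trivialization_mgenerator[OF e' i]])
    fix j assume j: "j \<in> I"
    let ?Z = "V i \<inter> V j"
    note ej = trivialization_section[OF e j] trivialization_section[OF e' j]
    note aij = cocycle_section[OF a i j] cocycle_section[OF a' i j]
    have Z: "opn ?Z" "?Z \<subseteq> V i" "?Z \<subseteq> V j" using opn_cover2[OF i j] by auto
    note zi = ores_closed[OF L opn_cover[OF i] Z(1,2) ei(1)] ores_closed[OF L' opn_cover[OF i] Z(1,2) ei(2)]
    have "ores N (V j) ?Z (\<beta> (V j) (e j) (e' j)) = \<beta> ?Z (ores L (V j) ?Z (e j)) (ores L' (V j) ?Z (e' j))"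
      by (rule b(4)[OF opn_cover[OF j] ej Z(1,3)])
    also have "\<dots> = \<beta> ?Z (oact L ?Z (a (i, j)) (ores L (V i) ?Z (e i))) (oact L' ?Z (a' (i, j)) (ores L' (V i) ?Z (e' i)))"
      using e e' i j unfolding trivialization_def by simp
    also have "\<dots> = oact N ?Z (a (i, j)) (oact N ?Z (a' (i, j)) (\<beta> ?Z (ores L (V i) ?Z (e i)) (ores L' (V i) ?Z (e' i))))"
      by (simp add: b(2)[OF Z(1)] b(3)[OF Z(1)] zi aij oact_closed[OF L' Z(1)])
    also have "\<dots> = oact N ?Z (a (i, j) \<otimes>\<^bsub>\<O> ?Z\<^esub> a' (i, j)) (ores N (V i) ?Z (\<beta> (V i) (e i) (e' i)))"
      by (simp add: b(4)[OF opn_cover[OF i] ei Z(1,2)] oact_mult[OF N Z(1) aij] b(1)[OF Z(1) zi])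
    finally show "ores N (V j) ?Z (\<beta> (V j) (e j) (e' j)) =
        oact N ?Z (case (i, j) of (i, j) \<Rightarrow> a (i, j) \<otimes>\<^bsub>\<O> (V i \<inter> V j)\<^esub> a' (i, j)) (ores N (V i) ?Z (\<beta> (V i) (e i) (e' i)))"
      by simp
  qed
  then show thesis by (rule that)
qed

lemma trivialization_iso:
  assumes L: "oset_sheaf X L" and a: "cocycle X I V a" and e: "trivialization X I V L a e"
    and iso: "oset_iso_on X pts L N"
  obtains f where "trivialization X I V N a f"
proof -
  obtain \<phi> where \<phi>: "\<And>W. opn W \<Longrightarrow> W \<subseteq> pts \<Longrightarrow> bij_betw (\<phi> W) (osec L W) (osec N W)"
    "\<And>W a l. opn W \<Longrightarrow> W \<subseteq> pts \<Longrightarrow> a \<in> carrier (\<O> W) \<Longrightarrow> l \<in> osec L W \<Longrightarrow> \<phi> W (oact L W a l) = oact N W a (\<phi> W l)"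
    "\<And>W W' l. opn W \<Longrightarrow> opn W' \<Longrightarrow> W' \<subseteq> W \<Longrightarrow> W \<subseteq> pts \<Longrightarrow> l \<in> osec L W \<Longrightarrow> \<phi> W' (ores L W W' l) = ores N W W' (\<phi> W l)"
    using iso by (rule oset_iso_onE) blast
  have pts: "W \<subseteq> pts" if "opn W" for W using openin_subset[OF that] .
  have "trivialization X I V N a (\<lambda>i. \<phi> (V i) (e i))"
    unfolding trivialization_def
  proof (intro conjI ballI)
    fix i assume i: "i \<in> I"
    show "mgenerator X N (V i) (\<phi> (V i) (e i))"
      by (rule mgenerator_iso[OF L \<phi>(1)[OF _ pts] \<phi>(2)[OF _ pts] \<phi>(3)[OF opn_cover[OF i] _ _ pts] opn_cover[OF i] trivialization_mgenerator[OF e i]])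
        (simp_all add: opn_cover i)
    fix j assume j: "j \<in> I"
    let ?Z = "V i \<inter> V j"
    have Z: "opn ?Z" "?Z \<subseteq> V i" "?Z \<subseteq> V j" using opn_cover2[OF i j] by auto
    note ei = trivialization_section[OF e i] and ej = trivialization_section[OF e j]
    have "ores L (V j) ?Z (e j) = oact L ?Z (a (i, j)) (ores L (V i) ?Z (e i))"
      using e i j unfolding trivialization_def by simp
    then show "ores N (V j) ?Z (\<phi> (V j) (e j)) = oact N ?Z (a (i, j)) (ores N (V i) ?Z (\<phi> (V i) (e i)))"
      by (simp add: \<phi>(3)[OF opn_cover[OF i] Z(1,2) pts[OF opn_cover[OF i]] ei, symmetric]
          \<phi>(3)[OF opn_cover[OF j] Z(1,3) pts[OF opn_cover[OF j]] ej, symmetric]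
          \<phi>(2)[OF Z(1) pts[OF Z(1)] cocycle_section[OF a i j] ores_closed[OF L opn_cover[OF i] Z(1,2) ei]])
  qed
  then show thesis by (rule that)
qed

text \<open>Two systems of generators of one bundle differ by units \<open>u i\<close>. Expressing
  the restriction of \<open>f j\<close> through \<open>e i\<close> in two ways and cancelling
  \<open>e i\<close> gives the relation.\<close>

lemma cohomologous_of_trivializations:
  assumes L: "oset_sheaf X L" and a: "cocycle X I V a" and b: "cocycle X I V b"
    and e: "trivialization X I V L a e" and f: "trivialization X I V L b f"
  shows "cohomologous X I V a b"
proof -
  have "\<exists>u\<in>Units (\<O> (V i)). f i = oact L (V i) u (e i)" if "i \<in> I" for i
    using mgenerator_unit_change[OF L opn_cover[OF that] trivialization_mgenerator[OF e that]
      trivialization_mgenerator[OF f that]] by metis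
  then obtain u where u: "\<And>i. i \<in> I \<Longrightarrow> u i \<in> Units (\<O> (V i))" "\<And>i. i \<in> I \<Longrightarrow> f i = oact L (V i) (u i) (e i)"
    by metis
  show ?thesis
    unfolding cohomologous_def
  proof (intro exI[of _ u] conjI ballI u(1))
    fix i j assume i: "i \<in> I" and j: "j \<in> I"
    let ?Z = "V i \<inter> V j"
    have Z: "opn ?Z" "?Z \<subseteq> V i" "?Z \<subseteq> V j" using opn_cover2[OF i j] by auto
    note ei = trivialization_section[OF e i] and ej = trivialization_section[OF e j]
    note aij = cocycle_section[OF a i j] and bij = cocycle_section[OF b i j]
    note ui = Units_section[OF u(1)[OF i]] and uj = Units_section[OF u(1)[OF j]]
    let ?ui = "mres X (V i) ?Z (u i)" and ?uj = "mres X (V j) ?Z (u j)" and ?e = "ores L (V i) ?Z (e i)"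
    have c: "?ui \<in> carrier (\<O> ?Z)" "?uj \<in> carrier (\<O> ?Z)"
      using res_closed[OF opn_cover[OF i] Z(1,2) ui] res_closed[OF opn_cover[OF j] Z(1,3) uj] .
    have g: "mgenerator X L ?Z ?e"
      by (rule mgenerator_restrict[OF L opn_cover[OF i] Z(1,2) trivialization_mgenerator[OF e i]])
    note gs = mgenerator_section[OF g]
    have te: "ores L (V j) ?Z (e j) = oact L ?Z (a (i, j)) ?e"
      using e i j unfolding trivialization_def by simp
    have tf: "ores L (V j) ?Z (f j) = oact L ?Z (b (i, j)) (ores L (V i) ?Z (f i))"
      using f i j unfolding trivialization_def by simp
    have "oact L ?Z (b (i, j) \<otimes>\<^bsub>\<O> ?Z\<^esub> ?ui) ?e = ores L (V j) ?Z (f j)"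
      unfolding tf u(2)[OF i]
      by (simp add: ores_oact[OF L opn_cover[OF i] Z(1,2) ui ei] oact_mult[OF L Z(1) bij c(1) gs])
    also have "\<dots> = oact L ?Z (a (i, j) \<otimes>\<^bsub>\<O> ?Z\<^esub> ?uj) ?e"
      unfolding u(2)[OF j] mult_comm[OF Z(1) aij c(2)]
      by (simp add: ores_oact[OF L opn_cover[OF j] Z(1,3) uj ej] oact_mult[OF L Z(1) c(2) aij gs] te)
    finally show "b (i, j) \<otimes>\<^bsub>\<O> ?Z\<^esub> ?ui = a (i, j) \<otimes>\<^bsub>\<O> ?Z\<^esub> ?uj"
      by (intro mgenerator_cancel[OF L Z(1) g]) (simp_all add: mult_closed[OF Z(1)] aij bij c)
  qed
qed

text \<open>Rescaling the generator \<open>e i\<close> by the unit \<open>u i\<close> changes the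
  transition functions from \<open>a\<close> to \<open>b\<close>.\<close>

lemma trivialization_cohomologous:
  assumes L: "oset_sheaf X L" and a: "cocycle X I V a" and b: "cocycle X I V b"
    and e: "trivialization X I V L a e" and ab: "cohomologous X I V a b"
  obtains f where "trivialization X I V L b f"
proof -
  obtain u where u: "\<And>i. i \<in> I \<Longrightarrow> u i \<in> Units (\<O> (V i))"
    "\<And>i j. i \<in> I \<Longrightarrow> j \<in> I \<Longrightarrow> b (i, j) \<otimes>\<^bsub>\<O> (V i \<inter> V j)\<^esub> mres X (V i) (V i \<inter> V j) (u i) =
           a (i, j) \<otimes>\<^bsub>\<O> (V i \<inter> V j)\<^esub> mres X (V j) (V i \<inter> V j) (u j)"
    using ab unfolding cohomologous_def by blast
  have "trivialization X I V L b (\<lambda>i. oact L (V i) (u i) (e i))"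
    unfolding trivialization_def
  proof (intro conjI ballI)
    fix i assume i: "i \<in> I"
    show "mgenerator X L (V i) (oact L (V i) (u i) (e i))"
      by (rule mgenerator_unit_mult[OF L opn_cover[OF i] trivialization_mgenerator[OF e i] u(1)[OF i]])
    fix j assume j: "j \<in> I"
    let ?Z = "V i \<inter> V j"
    have Z: "opn ?Z" "?Z \<subseteq> V i" "?Z \<subseteq> V j" using opn_cover2[OF i j] by auto
    note ei = trivialization_section[OF e i] and ej = trivialization_section[OF e j]
    note aij = cocycle_section[OF a i j] and bij = cocycle_section[OF b i j]
    note ui = Units_section[OF u(1)[OF i]] and uj = Units_section[OF u(1)[OF j]]
    let ?ui = "mres X (V i) ?Z (u i)" and ?uj = "mres X (V j) ?Z (u j)" and ?e = "ores L (V i) ?Z (e i)"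
    have c: "?ui \<in> carrier (\<O> ?Z)" "?uj \<in> carrier (\<O> ?Z)"
      using res_closed[OF opn_cover[OF i] Z(1,2) ui] res_closed[OF opn_cover[OF j] Z(1,3) uj] .
    note gs = ores_closed[OF L opn_cover[OF i] Z(1,2) ei]
    have te: "ores L (V j) ?Z (e j) = oact L ?Z (a (i, j)) ?e"
      using e i j unfolding trivialization_def by simp
    have "ores L (V j) ?Z (oact L (V j) (u j) (e j)) = oact L ?Z (a (i, j) \<otimes>\<^bsub>\<O> ?Z\<^esub> ?uj) ?e"
      unfolding mult_comm[OF Z(1) aij c(2)]
      by (simp add: ores_oact[OF L opn_cover[OF j] Z(1,3) uj ej] oact_mult[OF L Z(1) c(2) aij gs] te)
    also have "\<dots> = oact L ?Z (b (i, j)) (ores L (V i) ?Z (oact L (V i) (u i) (e i)))"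
      by (simp add: u(2)[OF i j, symmetric] ores_oact[OF L opn_cover[OF i] Z(1,2) ui ei] oact_mult[OF L Z(1) bij c(1) gs])
    finally show "ores L (V j) ?Z (oact L (V j) (u j) (e j)) = oact L ?Z (b (i, j)) (ores L (V i) ?Z (oact L (V i) (u i) (e i)))" .
  qed
  then show thesis by (rule that)
qed

end

section \<open>The line bundle glued from a cocycle\<close>

lemma sheafI:
  assumes closed: "\<And>U V s. openin T U \<Longrightarrow> openin T V \<Longrightarrow> V \<subseteq> U \<Longrightarrow> s \<in> F U \<Longrightarrow> r U V s \<in> F V"
    and id: "\<And>U s. openin T U \<Longrightarrow> s \<in> F U \<Longrightarrow> r U U s = s"
    and comp: "\<And>U V W s. openin T U \<Longrightarrow> openin T V \<Longrightarrow> openin T W \<Longrightarrow> W \<subseteq> V \<Longrightarrow> V \<subseteq> U \<Longrightarrow> s \<in> F U \<Longrightarrow>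
      r V W (r U V s) = r U W s"
    and sep: "\<And>\<U> s t. \<forall>U\<in>\<U>. openin T U \<Longrightarrow> s \<in> F (\<Union>\<U>) \<Longrightarrow> t \<in> F (\<Union>\<U>) \<Longrightarrow>
      \<forall>U\<in>\<U>. r (\<Union>\<U>) U s = r (\<Union>\<U>) U t \<Longrightarrow> s = t"
    and glue: "\<And>\<U> s. \<forall>U\<in>\<U>. openin T U \<Longrightarrow> \<forall>U\<in>\<U>. s U \<in> F U \<Longrightarrow>
      \<forall>U\<in>\<U>. \<forall>V\<in>\<U>. r U (U \<inter> V) (s U) = r V (U \<inter> V) (s V) \<Longrightarrow>
      \<exists>t\<in>F (\<Union>\<U>). \<forall>U\<in>\<U>. r (\<Union>\<U>) U t = s U"
  shows "sheaf T F r"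
  unfolding sheaf_def
proof (intro conjI allI impI ballI funcsetI)
  fix \<U> s assume A: "(\<forall>U\<in>\<U>. openin T U \<and> s U \<in> F U) \<and> (\<forall>U\<in>\<U>. \<forall>V\<in>\<U>. r U (U \<inter> V) (s U) = r V (U \<inter> V) (s V))"
  then have *: "\<forall>U\<in>\<U>. openin T U" "\<forall>U\<in>\<U>. s U \<in> F U" by simp_all
  obtain t where t: "t \<in> F (\<Union>\<U>)" "\<forall>U\<in>\<U>. r (\<Union>\<U>) U t = s U" using glue[OF * conjunct2[OF A]] by (elim bexE)
  show "\<exists>!t. t \<in> F (\<Union>\<U>) \<and> (\<forall>U\<in>\<U>. r (\<Union>\<U>) U t = s U)"
  proof (rule ex1I[of _ t])
    show "t' = t" if "t' \<in> F (\<Union>\<U>) \<and> (\<forall>U\<in>\<U>. r (\<Union>\<U>) U t' = s U)" for t'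
      by (rule sep[OF *(1)]) (use that t in simp_all)
  qed (use t in simp)
qed (use closed id comp in simp_all)

context mono_space
begin

lemma oset_sheaf_structure: "oset_sheaf X (structure_oset X)"
  unfolding oset_sheaf_def structure_oset_def
  by (simp add: sheaf_sections one_left mult_closed mult_assoc res_mult)

lemma mgenerator_structure_one:
  assumes "opn U"
  shows "mgenerator X (structure_oset X) U \<one>\<^bsub>\<O> U\<^esub>"
  unfolding mgenerator_def
proof (intro conjI allI impI)
  fix V assume V: "opn V \<and> V \<subseteq> U"
  have "bij_betw id (carrier (\<O> V)) (carrier (\<O> V))" by simp
  then show "bij_betw (\<lambda>a. oact (structure_oset X) V a (ores (structure_oset X) U V \<one>\<^bsub>\<O> U\<^esub>))
      (carrier (\<O> V)) (osec (structure_oset X) V)"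
    unfolding structure_oset_def oset.simps
    by (rule iffD1[OF bij_betw_cong, rotated]) (simp add: res_one[OF assms] V one_right)
qed (simp add: structure_oset_def one_closed assms)

lemma mline_bundle_sheaf: "mline_bundle X L \<Longrightarrow> oset_sheaf X L"
  by (simp add: mline_bundle_def)

lemma mline_bundle_local_generator:
  assumes "mline_bundle X L" "x \<in> pts"
  obtains U e where "opn U" "x \<in> U" "mgenerator X L U e"
proof -
  obtain U where U: "opn U" "x \<in> U" "oset_iso_on X U (structure_oset X) L"
    using assms unfolding mline_bundle_def by blast
  from U(3) obtain \<phi> where \<phi>:
    "\<And>W. opn W \<Longrightarrow> W \<subseteq> U \<Longrightarrow> bij_betw (\<phi> W) (osec (structure_oset X) W) (osec L W)"
    "\<And>W a l. opn W \<Longrightarrow> W \<subseteq> U \<Longrightarrow> a \<in> carrier (\<O> W) \<Longrightarrow> l \<in> osec (structure_oset X) W \<Longrightarrow>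
      \<phi> W (oact (structure_oset X) W a l) = oact L W a (\<phi> W l)"
    "\<And>W W' l. opn W \<Longrightarrow> opn W' \<Longrightarrow> W' \<subseteq> W \<Longrightarrow> W \<subseteq> U \<Longrightarrow> l \<in> osec (structure_oset X) W \<Longrightarrow>
      \<phi> W' (ores (structure_oset X) W W' l) = ores L W W' (\<phi> W l)"
    by (rule oset_iso_onE) blast
  have "mgenerator X L U (\<phi> U \<one>\<^bsub>\<O> U\<^esub>)"
    by (rule mgenerator_iso[OF oset_sheaf_structure \<phi>(1,2) \<phi>(3)[OF U(1)] U(1) mgenerator_structure_one[OF U(1)]])
      simp_all
  then show thesis by (rule that[OF U(1,2)])
qed

lemma mgenerator_imp_iso:
  assumes L: "oset_sheaf X L" and U: "opn U" and e: "mgenerator X L U e"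
  shows "oset_iso_on X U (structure_oset X) L"
  unfolding oset_iso_on_def
proof (intro exI[of _ "\<lambda>W a. oact L W a (ores L U W e)"] conjI allI impI ballI)
  note es = mgenerator_section[OF e]
  fix V assume V: "opn V \<and> V \<subseteq> U"
  then have e': "ores L U V e \<in> osec L V" by (simp add: ores_closed[OF L U _ _ es])
  show "bij_betw (\<lambda>a. oact L V a (ores L U V e)) (osec (structure_oset X) V) (osec L V)"
    using mgenerator_bij[OF L _ mgenerator_restrict[OF L U _ _ e], of V] V by (simp add: structure_oset_def)
  show "oact L V (oact (structure_oset X) V a l) (ores L U V e) = oact L V a (oact L V l (ores L U V e))"
    if "a \<in> carrier (\<O> V)" "l \<in> osec (structure_oset X) V" for a l
    using that V e' by (simp add: structure_oset_def oact_mult[OF L])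
next
  note es = mgenerator_section[OF e]
  fix V W l assume "opn V \<and> opn W \<and> W \<subseteq> V \<and> V \<subseteq> U" "l \<in> osec (structure_oset X) V"
  then show "oact L W (ores (structure_oset X) V W l) (ores L U W e) = ores L V W (oact L V l (ores L U V e))"
    using ores_closed[OF L U _ _ es, of V]
    by (simp add: structure_oset_def ores_oact[OF L] ores_ores[OF L U _ _ _ _ es])
qed

end

context covered_space
begin

lemma trivialization_mline_bundle:
  assumes L: "oset_sheaf X L" and e: "trivialization X I V L a e"
  shows "mline_bundle X L"
  unfolding mline_bundle_def
proof (intro conjI ballI L)
  fix x assume "x \<in> pts"
  then obtain i where i: "i \<in> I" "x \<in> V i" using cover by blast
  show "\<exists>U. opn U \<and> x \<in> U \<and> oset_iso_on X U (structure_oset X) L"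
    using mgenerator_imp_iso[OF L opn_cover[OF i(1)] trivialization_mgenerator[OF e i(1)]] i opn_cover by blast
qed

text \<open>Sections are families of local coordinates, indexed by the points of \<open>X\<close>
  instead of by \<open>I\<close>: the function \<open>\<tau>\<close> chooses for every point an
  index whose open set contains it. This gives them the type \<open>'p \<Rightarrow> 'a\<close> in
  which \<open>mPic\<close> collects its representatives, whatever the type of the indices. The
  families are \<open>extensional\<close>, so that they are determined by their values at points of
  the space.\<close>

definition bundle_of :: "('i \<times> 'i \<Rightarrow> 'a) \<Rightarrow> ('p \<Rightarrow> 'i) \<Rightarrow> ('p, 'a, 'p \<Rightarrow> 'a) oset" where
  "bundle_of a \<tau> =
     \<lparr>osec = (\<lambda>W. {s \<in> extensional pts. (\<forall>x\<in>pts. s x \<in> carrier (\<O> (W \<inter> V (\<tau> x)))) \<and>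
        (\<forall>x\<in>pts. \<forall>y\<in>pts. mres X (W \<inter> V (\<tau> x)) (W \<inter> V (\<tau> x) \<inter> V (\<tau> y)) (s x) =
           mres X (V (\<tau> x) \<inter> V (\<tau> y)) (W \<inter> V (\<tau> x) \<inter> V (\<tau> y)) (a (\<tau> x, \<tau> y))
             \<otimes>\<^bsub>\<O> (W \<inter> V (\<tau> x) \<inter> V (\<tau> y))\<^esub> mres X (W \<inter> V (\<tau> y)) (W \<inter> V (\<tau> x) \<inter> V (\<tau> y)) (s y))}),
      oact = (\<lambda>W b s. \<lambda>x\<in>pts. mres X W (W \<inter> V (\<tau> x)) b \<otimes>\<^bsub>\<O> (W \<inter> V (\<tau> x))\<^esub> s x),
      ores = (\<lambda>W W' s. \<lambda>x\<in>pts. mres X (W \<inter> V (\<tau> x)) (W' \<inter> V (\<tau> x)) (s x))\<rparr>"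

context
  fixes a :: "'i \<times> 'i \<Rightarrow> 'a" and \<tau> :: "'p \<Rightarrow> 'i"
  assumes a: "cocycle X I V a" and idx: "\<forall>x\<in>pts. \<tau> x \<in> I \<and> x \<in> V (\<tau> x)"
begin

private lemma \<tau>: "x \<in> pts \<Longrightarrow> \<tau> x \<in> I" and \<tau>': "x \<in> pts \<Longrightarrow> x \<in> V (\<tau> x)"
  using idx by simp_all

lemma bundle_sec:
  "s \<in> osec (bundle_of a \<tau>) W \<longleftrightarrow> s \<in> extensional pts \<and> (\<forall>x\<in>pts. s x \<in> carrier (\<O> (W \<inter> V (\<tau> x)))) \<and>
        (\<forall>x\<in>pts. \<forall>y\<in>pts. mres X (W \<inter> V (\<tau> x)) (W \<inter> V (\<tau> x) \<inter> V (\<tau> y)) (s x) =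
           mres X (V (\<tau> x) \<inter> V (\<tau> y)) (W \<inter> V (\<tau> x) \<inter> V (\<tau> y)) (a (\<tau> x, \<tau> y))
             \<otimes>\<^bsub>\<O> (W \<inter> V (\<tau> x) \<inter> V (\<tau> y))\<^esub> mres X (W \<inter> V (\<tau> y)) (W \<inter> V (\<tau> x) \<inter> V (\<tau> y)) (s y))"
  by (simp add: bundle_of_def)

lemma bundle_act: "oact (bundle_of a \<tau>) W b s = (\<lambda>x\<in>pts. mres X W (W \<inter> V (\<tau> x)) b \<otimes>\<^bsub>\<O> (W \<inter> V (\<tau> x))\<^esub> s x)"
  by (simp add: bundle_of_def)

lemma bundle_res: "ores (bundle_of a \<tau>) W W' s = (\<lambda>x\<in>pts. mres X (W \<inter> V (\<tau> x)) (W' \<inter> V (\<tau> x)) (s x))"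
  by (simp add: bundle_of_def)

lemma bundle_compat_on:
  assumes W: "opn W" and s: "s \<in> osec (bundle_of a \<tau>) W" and x: "x \<in> pts" "y \<in> pts"
    and Z: "opn Z" "Z \<subseteq> W" "Z \<subseteq> V (\<tau> x)" "Z \<subseteq> V (\<tau> y)"
  shows "mres X (W \<inter> V (\<tau> x)) Z (s x) = mres X (V (\<tau> x) \<inter> V (\<tau> y)) Z (a (\<tau> x, \<tau> y)) \<otimes>\<^bsub>\<O> Z\<^esub> mres X (W \<inter> V (\<tau> y)) Z (s y)"
proof -
  let ?T = "W \<inter> V (\<tau> x) \<inter> V (\<tau> y)"
  have o: "opn ?T" "opn (W \<inter> V (\<tau> x))" "opn (W \<inter> V (\<tau> y))" "opn (V (\<tau> x) \<inter> V (\<tau> y))"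
    using W \<tau> x by (auto simp: opn_cover openin_Int)
  have sub: "Z \<subseteq> ?T" "?T \<subseteq> W \<inter> V (\<tau> x)" "?T \<subseteq> W \<inter> V (\<tau> y)" "?T \<subseteq> V (\<tau> x) \<inter> V (\<tau> y)" using Z by blast+
  have c: "s x \<in> carrier (\<O> (W \<inter> V (\<tau> x)))" "s y \<in> carrier (\<O> (W \<inter> V (\<tau> y)))"
    "a (\<tau> x, \<tau> y) \<in> carrier (\<O> (V (\<tau> x) \<inter> V (\<tau> y)))"
    using s x \<tau> cocycle_section[OF a] by (simp_all add: bundle_sec)
  have "mres X ?T Z (mres X (W \<inter> V (\<tau> x)) ?T (s x)) = mres X ?T Z (mres X (V (\<tau> x) \<inter> V (\<tau> y)) ?T (a (\<tau> x, \<tau> y))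
             \<otimes>\<^bsub>\<O> ?T\<^esub> mres X (W \<inter> V (\<tau> y)) ?T (s y))"
    using s x by (simp add: bundle_sec)
  then show ?thesis
    using res_mult[OF o(1) Z(1) sub(1) res_closed[OF o(4,1) sub(4) c(3)] res_closed[OF o(3,1) sub(3) c(2)]]
      res_res[OF o(2,1) Z(1) sub(1,2) c(1)] res_res[OF o(3,1) Z(1) sub(1,3) c(2)] res_res[OF o(4,1) Z(1) sub(1,4) c(3)]
    by simp
qed

text \<open>The compatibility of two coordinates is an equality of sections, so it may be tested on
  the members of a cover of \<open>W\<close>. Gluing needs it in this form, since the given sections
  are compatible only there.\<close>

lemma bundle_secI:
  assumes W: "opn W" and s: "s \<in> extensional pts" "\<And>x. x \<in> pts \<Longrightarrow> s x \<in> carrier (\<O> (W \<inter> V (\<tau> x)))"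
    and op: "\<And>k. k \<in> K \<Longrightarrow> opn (B k)" and WB: "W = (\<Union>k\<in>K. B k)"
    and eq: "\<And>x y k Z. x \<in> pts \<Longrightarrow> y \<in> pts \<Longrightarrow> k \<in> K \<Longrightarrow> Z = B k \<inter> V (\<tau> x) \<inter> V (\<tau> y) \<Longrightarrow> opn Z \<Longrightarrow> mres X (W \<inter> V (\<tau> x)) Z (s x) =
      mres X (V (\<tau> x) \<inter> V (\<tau> y)) Z (a (\<tau> x, \<tau> y)) \<otimes>\<^bsub>\<O> Z\<^esub> mres X (W \<inter> V (\<tau> y)) Z (s y)"
  shows "s \<in> osec (bundle_of a \<tau>) W"
  unfolding bundle_sec
proof (intro conjI ballI s)
  fix x y assume x: "x \<in> pts" "y \<in> pts"
  let ?T = "W \<inter> V (\<tau> x) \<inter> V (\<tau> y)"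
  have o: "opn ?T" "opn (W \<inter> V (\<tau> x))" "opn (W \<inter> V (\<tau> y))" "opn (V (\<tau> x) \<inter> V (\<tau> y))"
    using W \<tau> x by (auto simp: opn_cover openin_Int)
  have sub: "?T \<subseteq> W \<inter> V (\<tau> x)" "?T \<subseteq> W \<inter> V (\<tau> y)" "?T \<subseteq> V (\<tau> x) \<inter> V (\<tau> y)" by blast+
  have c: "s x \<in> carrier (\<O> (W \<inter> V (\<tau> x)))" "s y \<in> carrier (\<O> (W \<inter> V (\<tau> y)))"
    "a (\<tau> x, \<tau> y) \<in> carrier (\<O> (V (\<tau> x) \<inter> V (\<tau> y)))"
    using s(2) x \<tau> cocycle_section[OF a] by simp_all
  show "mres X (W \<inter> V (\<tau> x)) ?T (s x) =
           mres X (V (\<tau> x) \<inter> V (\<tau> y)) ?T (a (\<tau> x, \<tau> y)) \<otimes>\<^bsub>\<O> ?T\<^esub> mres X (W \<inter> V (\<tau> y)) ?T (s y)"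
  proof (rule section_eqI[of K "\<lambda>k. B k \<inter> V (\<tau> x) \<inter> V (\<tau> y)"])
    fix k assume k: "k \<in> K"
    let ?Z = "B k \<inter> V (\<tau> x) \<inter> V (\<tau> y)"
    show Z: "opn ?Z" using op[OF k] \<tau> x by (auto simp: opn_cover openin_Int)
    have sZ: "?Z \<subseteq> ?T" using WB k by blast
    show "mres X ?T ?Z (mres X (W \<inter> V (\<tau> x)) ?T (s x)) = mres X ?T ?Z (mres X (V (\<tau> x) \<inter> V (\<tau> y)) ?T (a (\<tau> x, \<tau> y))
             \<otimes>\<^bsub>\<O> ?T\<^esub> mres X (W \<inter> V (\<tau> y)) ?T (s y))"
      using eq[OF x k refl Z]
        res_mult[OF o(1) Z(1) sZ res_closed[OF o(4,1) sub(3) c(3)] res_closed[OF o(3,1) sub(2) c(2)]]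
        res_res[OF o(2,1) Z(1) sZ sub(1) c(1)] res_res[OF o(3,1) Z(1) sZ sub(2) c(2)] res_res[OF o(4,1) Z(1) sZ sub(3) c(3)]
      by simp
  next
    show "?T = (\<Union>k\<in>K. B k \<inter> V (\<tau> x) \<inter> V (\<tau> y))" using WB by blast
    show "mres X (W \<inter> V (\<tau> x)) ?T (s x) \<in> carrier (\<O> ?T)" by (rule res_closed[OF o(2,1) sub(1) c(1)])
    show "mres X (V (\<tau> x) \<inter> V (\<tau> y)) ?T (a (\<tau> x, \<tau> y)) \<otimes>\<^bsub>\<O> ?T\<^esub> mres X (W \<inter> V (\<tau> y)) ?T (s y) \<in> carrier (\<O> ?T)"
      by (rule mult_closed[OF o(1) res_closed[OF o(4,1) sub(3) c(3)] res_closed[OF o(3,1) sub(2) c(2)]])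
  qed
qed

lemma bundle_secI':
  assumes W: "opn W" and s: "s \<in> extensional pts" "\<And>x. x \<in> pts \<Longrightarrow> s x \<in> carrier (\<O> (W \<inter> V (\<tau> x)))"
    and eq: "\<And>x y Z. x \<in> pts \<Longrightarrow> y \<in> pts \<Longrightarrow> Z = W \<inter> V (\<tau> x) \<inter> V (\<tau> y) \<Longrightarrow> opn Z \<Longrightarrow> mres X (W \<inter> V (\<tau> x)) Z (s x) =
      mres X (V (\<tau> x) \<inter> V (\<tau> y)) Z (a (\<tau> x, \<tau> y)) \<otimes>\<^bsub>\<O> Z\<^esub> mres X (W \<inter> V (\<tau> y)) Z (s y)"
  shows "s \<in> osec (bundle_of a \<tau>) W"
  by (rule bundle_secI[OF W s, of "{()}" "\<lambda>_. W"]) (use W eq in simp_all)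

lemma bundle_sheaf: "sheaf (mtop X) (osec (bundle_of a \<tau>)) (ores (bundle_of a \<tau>))"
proof (rule sheafI)
  let ?L = "bundle_of a \<tau>"
  have o: "opn (W \<inter> V (\<tau> x))" if "opn W" "x \<in> pts" for W x
    using that \<tau> by (simp add: opn_Int_cover)
  have sec: "s x \<in> carrier (\<O> (W \<inter> V (\<tau> x)))" if "s \<in> osec ?L W" "x \<in> pts" for s x W
    using that by (simp add: bundle_sec)
  have ext: "s \<in> extensional pts" if "s \<in> osec ?L W" for s W
    using that by (simp add: bundle_sec)
  show "ores ?L U W s \<in> osec ?L W" if U: "opn U" "opn W" "W \<subseteq> U" "s \<in> osec ?L U" for U W s
  proof (rule bundle_secI'[OF U(2)])
    have sub: "W \<inter> V (\<tau> x) \<subseteq> U \<inter> V (\<tau> x)" for x using U by blast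
    show "ores ?L U W s x \<in> carrier (\<O> (W \<inter> V (\<tau> x)))" if x: "x \<in> pts" for x
      using x by (simp add: bundle_res res_closed[OF o[OF U(1) x] o[OF U(2) x] sub sec[OF U(4) x]])
    fix x y Z assume x: "x \<in> pts" "y \<in> pts" and Z: "Z = W \<inter> V (\<tau> x) \<inter> V (\<tau> y)" "opn Z"
    have Z': "Z \<subseteq> W \<inter> V (\<tau> x)" "Z \<subseteq> W \<inter> V (\<tau> y)" "Z \<subseteq> U" "Z \<subseteq> V (\<tau> x)" "Z \<subseteq> V (\<tau> y)" using Z U by blast+
    show "mres X (W \<inter> V (\<tau> x)) Z (ores ?L U W s x) =
      mres X (V (\<tau> x) \<inter> V (\<tau> y)) Z (a (\<tau> x, \<tau> y)) \<otimes>\<^bsub>\<O> Z\<^esub> mres X (W \<inter> V (\<tau> y)) Z (ores ?L U W s y)"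
      using x bundle_compat_on[OF U(1,4) x Z(2) Z'(3-5)]
      by (simp add: bundle_res res_res[OF o[OF U(1) x(1)] o[OF U(2) x(1)] Z(2) Z'(1) sub sec[OF U(4) x(1)]]
        res_res[OF o[OF U(1) x(2)] o[OF U(2) x(2)] Z(2) Z'(2) sub sec[OF U(4) x(2)]])
  qed (simp add: bundle_res)
  show "ores ?L U U s = s" if U: "opn U" "s \<in> osec ?L U" for U s
    by (rule extensionalityI[of _ pts])
      (use ext[OF U(2)] in \<open>simp_all add: bundle_res res_id[OF o[OF U(1)] sec[OF U(2)]]\<close>)
  show "ores ?L U' W (ores ?L U U' s) = ores ?L U W s"
    if U: "opn U" "opn U'" "opn W" "W \<subseteq> U'" "U' \<subseteq> U" "s \<in> osec ?L U" for U U' W s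
  proof (rule extensionalityI[of _ pts])
    fix x assume x: "x \<in> pts"
    have "W \<inter> V (\<tau> x) \<subseteq> U' \<inter> V (\<tau> x)" "U' \<inter> V (\<tau> x) \<subseteq> U \<inter> V (\<tau> x)" using U by blast+
    from res_res[OF o[OF U(1) x] o[OF U(2) x] o[OF U(3) x] this sec[OF U(6) x]]
    show "ores ?L U' W (ores ?L U U' s) x = ores ?L U W s x" using x by (simp add: bundle_res)
  qed (simp_all add: bundle_res)
  fix \<U> assume op: "\<forall>U\<in>\<U>. opn U"
  define W where "W = \<Union>\<U>"
  have W: "opn W" unfolding W_def using op by blast
  have opx: "opn (U \<inter> V (\<tau> x))" if "U \<in> \<U>" "x \<in> pts" for U x using o op that by simp
  have cov: "W \<inter> V (\<tau> x) = (\<Union>U\<in>\<U>. U \<inter> V (\<tau> x))" for x unfolding W_def by blast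
  have subx: "U \<inter> V (\<tau> x) \<subseteq> W \<inter> V (\<tau> x)" if "U \<in> \<U>" for U x using that unfolding W_def by blast
  show "s = t" if s: "s \<in> osec ?L (\<Union>\<U>)" and t: "t \<in> osec ?L (\<Union>\<U>)"
    and eq: "\<forall>U\<in>\<U>. ores ?L (\<Union>\<U>) U s = ores ?L (\<Union>\<U>) U t" for s t
  proof (rule extensionalityI[OF ext[OF s] ext[OF t]])
    fix x assume x: "x \<in> pts"
    show "s x = t x"
    proof (rule section_eqI[of \<U> "\<lambda>U. U \<inter> V (\<tau> x)", OF opx[OF _ x] cov sec[OF s[folded W_def] x] sec[OF t[folded W_def] x]])
      fix U assume U: "U \<in> \<U>"
      have "ores ?L W U s x = ores ?L W U t x" using eq U by (simp add: W_def)
      then show "mres X (W \<inter> V (\<tau> x)) (U \<inter> V (\<tau> x)) (s x) = mres X (W \<inter> V (\<tau> x)) (U \<inter> V (\<tau> x)) (t x)"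
        using x by (simp add: bundle_res)
    qed
  qed
  show "\<exists>t\<in>osec ?L (\<Union>\<U>). \<forall>U\<in>\<U>. ores ?L (\<Union>\<U>) U t = s U"
    if s: "\<forall>U\<in>\<U>. s U \<in> osec ?L U" and compat: "\<forall>U\<in>\<U>. \<forall>W\<in>\<U>. ores ?L U (U \<inter> W) (s U) = ores ?L W (U \<inter> W) (s W)" for s
  proof -
    \<comment> \<open>Gluing is done coordinate by coordinate; the compatibility between different
      points is checked afterwards on each member of \<open>\<U>\<close>.\<close>
    have "\<exists>t\<in>carrier (\<O> (W \<inter> V (\<tau> x))). \<forall>U\<in>\<U>. mres X (W \<inter> V (\<tau> x)) (U \<inter> V (\<tau> x)) t = s U x" if x: "x \<in> pts" for x
    proof (rule section_glue[OF opx[OF _ x] cov])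
      show "s U x \<in> carrier (\<O> (U \<inter> V (\<tau> x)))" if "U \<in> \<U>" for U by (rule sec[OF _ x]) (use s that in simp)
      fix U U' assume U: "U \<in> \<U>" "U' \<in> \<U>"
      have "ores ?L U (U \<inter> U') (s U) x = ores ?L U' (U \<inter> U') (s U') x" using compat U by simp
      moreover have "U \<inter> V (\<tau> x) \<inter> (U' \<inter> V (\<tau> x)) = U \<inter> U' \<inter> V (\<tau> x)" by blast
      ultimately show "mres X (U \<inter> V (\<tau> x)) (U \<inter> V (\<tau> x) \<inter> (U' \<inter> V (\<tau> x))) (s U x) =
        mres X (U' \<inter> V (\<tau> x)) (U \<inter> V (\<tau> x) \<inter> (U' \<inter> V (\<tau> x))) (s U' x)"
        using x by (simp add: bundle_res)
    qed
    then obtain t0 where t0: "\<And>x. x \<in> pts \<Longrightarrow> t0 x \<in> carrier (\<O> (W \<inter> V (\<tau> x)))"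
      "\<And>x U. x \<in> pts \<Longrightarrow> U \<in> \<U> \<Longrightarrow> mres X (W \<inter> V (\<tau> x)) (U \<inter> V (\<tau> x)) (t0 x) = s U x" by metis
    define t where "t = restrict t0 pts"
    have tx: "t x = t0 x" if "x \<in> pts" for x using that by (simp add: t_def)
    have WU: "W = (\<Union>U\<in>\<U>. U)" by (simp add: W_def)
    have "t \<in> osec ?L W"
    proof (rule bundle_secI[of W t \<U> "\<lambda>U. U", OF W _ _ _ WU])
      show "t x \<in> carrier (\<O> (W \<inter> V (\<tau> x)))" if "x \<in> pts" for x using t0(1) tx that by simp
      show "opn U" if "U \<in> \<U>" for U using op that by simp
      fix x y U Z assume x: "x \<in> pts" "y \<in> pts" and U: "U \<in> \<U>" and Z: "Z = U \<inter> V (\<tau> x) \<inter> V (\<tau> y)" "opn Z"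
      have Z': "Z \<subseteq> U \<inter> V (\<tau> x)" "Z \<subseteq> U \<inter> V (\<tau> y)" "Z \<subseteq> U" "Z \<subseteq> V (\<tau> x)" "Z \<subseteq> V (\<tau> y)" using Z by blast+
      have oU: "opn U" and sU: "s U \<in> osec ?L U" using op s U by simp_all
      show "mres X (W \<inter> V (\<tau> x)) Z (t x) = mres X (V (\<tau> x) \<inter> V (\<tau> y)) Z (a (\<tau> x, \<tau> y)) \<otimes>\<^bsub>\<O> Z\<^esub> mres X (W \<inter> V (\<tau> y)) Z (t y)"
        using bundle_compat_on[OF oU sU x Z(2) Z'(3-5)]
          res_res[OF o[OF W x(1)] opx[OF U x(1)] Z(2) Z'(1) subx[OF U] t0(1)[OF x(1)]]
          res_res[OF o[OF W x(2)] opx[OF U x(2)] Z(2) Z'(2) subx[OF U] t0(1)[OF x(2)]]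
        by (simp add: tx x t0(2)[OF _ U])
    qed (simp add: t_def)
    moreover have "ores ?L W U t = s U" if U: "U \<in> \<U>" for U
    proof (rule extensionalityI[of _ pts])
      show "s U \<in> extensional pts" by (rule ext[of _ U]) (use s U in simp)
    qed (simp_all add: bundle_res tx t0(2)[OF _ U])
    ultimately show ?thesis unfolding W_def by blast
  qed
qed

lemma oset_sheaf_bundle: "oset_sheaf X (bundle_of a \<tau>)"
  unfolding oset_sheaf_def
proof (intro conjI allI impI ballI bundle_sheaf)
  let ?L = "bundle_of a \<tau>"
  have o: "opn (W \<inter> V (\<tau> x))" if "opn W" "x \<in> pts" for W x
    using that \<tau> by (simp add: opn_Int_cover)
  have sec: "s x \<in> carrier (\<O> (W \<inter> V (\<tau> x)))" if "s \<in> osec ?L W" "x \<in> pts" for s x W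
    using that by (simp add: bundle_sec)
  have ext: "s \<in> extensional pts" if "s \<in> osec ?L W" for s W
    using that by (simp add: bundle_sec)
  have rc: "mres X W (W \<inter> V (\<tau> x)) b \<in> carrier (\<O> (W \<inter> V (\<tau> x)))" if "opn W" "x \<in> pts" "b \<in> carrier (\<O> W)" for W x b
    by (rule res_closed[OF that(1) o[OF that(1,2)] _ that(3)]) simp
  {
    fix W s assume W: "opn W" and s: "s \<in> osec ?L W"
    show "oact ?L W \<one>\<^bsub>\<O> W\<^esub> s = s"
      by (rule extensionalityI[of _ pts])
        (use ext[OF s] in \<open>simp_all add: bundle_act res_one[OF W o[OF W]] one_left[OF o[OF W] sec[OF s]]\<close>)
    fix b assume b: "b \<in> carrier (\<O> W)"
    show "oact ?L W b s \<in> osec ?L W"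
    proof (rule bundle_secI'[OF W])
      show "oact ?L W b s x \<in> carrier (\<O> (W \<inter> V (\<tau> x)))" if x: "x \<in> pts" for x
        using x by (simp add: bundle_act mult_closed[OF o[OF W x] rc[OF W x b] sec[OF s x]])
      fix x y Z assume x: "x \<in> pts" "y \<in> pts" and Z: "Z = W \<inter> V (\<tau> x) \<inter> V (\<tau> y)" "opn Z"
      have Z': "Z \<subseteq> W \<inter> V (\<tau> x)" "Z \<subseteq> W \<inter> V (\<tau> y)" "Z \<subseteq> W" "Z \<subseteq> V (\<tau> x)" "Z \<subseteq> V (\<tau> y)" using Z by blast+
      have oxy: "opn (V (\<tau> x) \<inter> V (\<tau> y))" "Z \<subseteq> V (\<tau> x) \<inter> V (\<tau> y)" using \<tau> x Z' by (auto simp: opn_cover2)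
      have axy: "a (\<tau> x, \<tau> y) \<in> carrier (\<O> (V (\<tau> x) \<inter> V (\<tau> y)))" using \<tau> x cocycle_section[OF a] by simp
      have r: "mres X (W \<inter> V (\<tau> z)) Z (mres X W (W \<inter> V (\<tau> z)) b) = mres X W Z b" if "Z \<subseteq> W \<inter> V (\<tau> z)" "z \<in> pts" for z
        by (rule res_res[OF W o[OF W that(2)] Z(2) that(1) _ b]) simp
      show "mres X (W \<inter> V (\<tau> x)) Z (oact ?L W b s x) =
        mres X (V (\<tau> x) \<inter> V (\<tau> y)) Z (a (\<tau> x, \<tau> y)) \<otimes>\<^bsub>\<O> Z\<^esub> mres X (W \<inter> V (\<tau> y)) Z (oact ?L W b s y)"
        using x bundle_compat_on[OF W s x Z(2) Z'(3-5)]
        by (simp add: bundle_act res_mult[OF o[OF W x(1)] Z(2) Z'(1) rc[OF W x(1) b] sec[OF s x(1)]]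
          res_mult[OF o[OF W x(2)] Z(2) Z'(2) rc[OF W x(2) b] sec[OF s x(2)]] r[OF Z'(1)] r[OF Z'(2)]
          mult_lcomm[OF Z(2)] res_closed[OF W Z(2) Z'(3) b] res_closed[OF oxy(1) Z(2) oxy(2) axy]
          res_closed[OF o[OF W x(2)] Z(2) Z'(2) sec[OF s x(2)]])
    qed (simp add: bundle_act)
    fix b' assume b': "b' \<in> carrier (\<O> W)"
    show "oact ?L W (b \<otimes>\<^bsub>\<O> W\<^esub> b') s = oact ?L W b (oact ?L W b' s)"
      by (rule extensionalityI[of _ pts])
        (simp_all add: bundle_act res_mult[OF W o[OF W] _ b b'] mult_assoc[OF o[OF W]] rc[OF W _ b] rc[OF W _ b'] sec[OF s])
  }
  fix W W' b s assume "opn W \<and> opn W' \<and> W' \<subseteq> W" and b: "b \<in> carrier (\<O> W)" and s: "s \<in> osec ?L W"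
  then have W: "opn W" "opn W'" "W' \<subseteq> W" by simp_all
  show "ores ?L W W' (oact ?L W b s) = oact ?L W' (mres X W W' b) (ores ?L W W' s)"
  proof (rule extensionalityI[of _ pts])
    fix x assume x: "x \<in> pts"
    have sub: "W' \<inter> V (\<tau> x) \<subseteq> W \<inter> V (\<tau> x)" "W' \<inter> V (\<tau> x) \<subseteq> W'" "W \<inter> V (\<tau> x) \<subseteq> W" using W by blast+
    show "ores ?L W W' (oact ?L W b s) x = oact ?L W' (mres X W W' b) (ores ?L W W' s) x"
      using x by (simp add: bundle_act bundle_res res_mult[OF o[OF W(1) x] o[OF W(2) x] sub(1) rc[OF W(1) x b] sec[OF s x]]
        res_res[OF W(1) o[OF W(1) x] o[OF W(2) x] sub(1,3) b] res_res[OF W(1,2) o[OF W(2) x] sub(2) W(3) b])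
  qed (simp_all add: bundle_act bundle_res)
qed

text \<open>Since \<open>e i\<close> has to be \<open>a (\<tau> x, i)\<close> times the generator
  with index \<open>\<tau> x\<close>, that section is its coordinate at \<open>x\<close>. The
  restriction from \<open>V (\<tau> x) \<inter> V i\<close> to
  \<open>V i \<inter> V (\<tau> x)\<close> only matches the order in which the two sets are
  written.\<close>

lemma trivialization_bundle: "trivialization X I V (bundle_of a \<tau>) a (\<lambda>i. \<lambda>x\<in>pts. mres X (V (\<tau> x) \<inter> V i) (V i \<inter> V (\<tau> x)) (a (\<tau> x, i)))"
  unfolding trivialization_def
proof (intro conjI ballI)
  let ?L = "bundle_of a \<tau>"
  let ?e = "\<lambda>i. \<lambda>x\<in>pts. mres X (V (\<tau> x) \<inter> V i) (V i \<inter> V (\<tau> x)) (a (\<tau> x, i))"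
  have o: "opn (W \<inter> V (\<tau> x))" if "opn W" "x \<in> pts" for W x
    using that \<tau> by (simp add: opn_Int_cover)
  have sec: "s x \<in> carrier (\<O> (W \<inter> V (\<tau> x)))" if "s \<in> osec ?L W" "x \<in> pts" for s x W
    using that by (simp add: bundle_sec)
  have ai: "a (\<tau> x, i) \<in> carrier (\<O> (V (\<tau> x) \<inter> V i))" "opn (V (\<tau> x) \<inter> V i)" "opn (V i \<inter> V (\<tau> x))"
    "V i \<inter> V (\<tau> x) \<subseteq> V (\<tau> x) \<inter> V i" "mres X (V (\<tau> x) \<inter> V i) (V i \<inter> V (\<tau> x)) (a (\<tau> x, i)) \<in> carrier (\<O> (V i \<inter> V (\<tau> x)))"
    if "x \<in> pts" "i \<in> I" for x i
    using that \<tau> cocycle_section[OF a, of "\<tau> x" i] opn_cover2 by (auto simp: Int_commute intro!: res_closed)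
  have e_sec: "?e i \<in> osec ?L (V i)" if i: "i \<in> I" for i
  proof (rule bundle_secI'[OF opn_cover[OF i]])
    show "?e i x \<in> carrier (\<O> (V i \<inter> V (\<tau> x)))" if x: "x \<in> pts" for x
      using ai[OF x i] x by simp
    fix x y Z assume x: "x \<in> pts" "y \<in> pts" and Z: "Z = V i \<inter> V (\<tau> x) \<inter> V (\<tau> y)" "opn Z"
    have Z': "Z \<subseteq> V i \<inter> V (\<tau> x)" "Z \<subseteq> V i \<inter> V (\<tau> y)" "Z \<subseteq> V (\<tau> x) \<inter> V (\<tau> y)" "Z \<subseteq> V i" "Z \<subseteq> V (\<tau> x)" "Z \<subseteq> V (\<tau> y)" using Z by blast+
    have axy: "mres X (V (\<tau> x) \<inter> V (\<tau> y)) Z (a (\<tau> x, \<tau> y)) \<in> carrier (\<O> Z)"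
      by (rule res_closed[OF _ Z(2) Z'(3) cocycle_section[OF a]]) (use \<tau> x opn_cover2 in simp_all)
    have ayi: "mres X (V (\<tau> y) \<inter> V i) Z (a (\<tau> y, i)) \<in> carrier (\<O> Z)"
      by (rule res_closed[OF ai(2)[OF x(2) i] Z(2) _ ai(1)[OF x(2) i]]) (use Z in blast)
    show "mres X (V i \<inter> V (\<tau> x)) Z (?e i x) =
      mres X (V (\<tau> x) \<inter> V (\<tau> y)) Z (a (\<tau> x, \<tau> y)) \<otimes>\<^bsub>\<O> Z\<^esub> mres X (V i \<inter> V (\<tau> y)) Z (?e i y)"
      using x cocycle_on[OF a \<tau>[OF x(1)] \<tau>[OF x(2)] i Z(2) Z'(5,6,4)]
        res_res[OF ai(2,3)[OF x(1) i] Z(2) Z'(1) ai(4)[OF x(1) i] ai(1)[OF x(1) i]]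
        res_res[OF ai(2,3)[OF x(2) i] Z(2) Z'(2) ai(4)[OF x(2) i] ai(1)[OF x(2) i]]
      by (simp add: mult_comm[OF Z(2) axy ayi])
  qed simp
  have act: "oact ?L W m (ores ?L (V i) W (?e i)) =
      (\<lambda>x\<in>pts. mres X W (W \<inter> V (\<tau> x)) m \<otimes>\<^bsub>\<O> (W \<inter> V (\<tau> x))\<^esub> mres X (V (\<tau> x) \<inter> V i) (W \<inter> V (\<tau> x)) (a (\<tau> x, i)))"
    if i: "i \<in> I" and W: "opn W" "W \<subseteq> V i" for i W m
  proof (rule extensionalityI[of _ pts])
    fix x assume x: "x \<in> pts"
    have sub: "W \<inter> V (\<tau> x) \<subseteq> V i \<inter> V (\<tau> x)" using W by blast
    show "oact ?L W m (ores ?L (V i) W (?e i)) x =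
      (\<lambda>x\<in>pts. mres X W (W \<inter> V (\<tau> x)) m \<otimes>\<^bsub>\<O> (W \<inter> V (\<tau> x))\<^esub> mres X (V (\<tau> x) \<inter> V i) (W \<inter> V (\<tau> x)) (a (\<tau> x, i))) x"
      using x res_res[OF ai(2,3)[OF x i] o[OF W(1) x] sub ai(4)[OF x i] ai(1)[OF x i]]
      by (simp add: bundle_act bundle_res)
  qed (simp_all add: bundle_act)
  fix i assume i: "i \<in> I"
  show "mgenerator X ?L (V i) (?e i)"
    unfolding mgenerator_def
  proof (intro conjI allI impI e_sec[OF i])
    fix W assume "opn W \<and> W \<subseteq> V i"
    then have W: "opn W" "W \<subseteq> V i" by simp_all
    have u: "mres X (V (\<tau> x) \<inter> V i) (W \<inter> V (\<tau> x)) (a (\<tau> x, i)) \<in> Units (\<O> (W \<inter> V (\<tau> x)))" if x: "x \<in> pts" for x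
      by (rule res_Units[OF ai(2)[OF x i] o[OF W(1) x] _ cocycle_Units[OF a \<tau>[OF x] i]]) (use W in blast)
    have mr: "mres X W (W \<inter> V (\<tau> x)) m \<in> carrier (\<O> (W \<inter> V (\<tau> x)))" if "x \<in> pts" "m \<in> carrier (\<O> W)" for x m
      by (rule res_closed[OF W(1) o[OF W(1) that(1)] _ that(2)]) simp
    \<comment> \<open>Because \<open>x \<in> V (\<tau> x)\<close>, the sets chosen by
      \<open>\<tau>\<close> cover \<open>W\<close> even if not every index is chosen.\<close>
    have cov: "W = (\<Union>x\<in>pts. W \<inter> V (\<tau> x))" using \<tau>' openin_subset[OF W(1)] by blast
    show "bij_betw (\<lambda>m. oact ?L W m (ores ?L (V i) W (?e i))) (carrier (\<O> W)) (osec ?L W)"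
    proof (rule bij_betwI')
      fix m m' assume m: "m \<in> carrier (\<O> W)" and m': "m' \<in> carrier (\<O> W)"
      show "oact ?L W m (ores ?L (V i) W (?e i)) = oact ?L W m' (ores ?L (V i) W (?e i)) \<longleftrightarrow> m = m'"
      proof
        assume eq: "oact ?L W m (ores ?L (V i) W (?e i)) = oact ?L W m' (ores ?L (V i) W (?e i))"
        show "m = m'"
        proof (rule section_eqI[OF o[OF W(1)] cov m m'])
          fix x assume x: "x \<in> pts"
          let ?a = "mres X (V (\<tau> x) \<inter> V i) (W \<inter> V (\<tau> x)) (a (\<tau> x, i))"
          have "mres X W (W \<inter> V (\<tau> x)) m \<otimes>\<^bsub>\<O> (W \<inter> V (\<tau> x))\<^esub> ?a = mres X W (W \<inter> V (\<tau> x)) m' \<otimes>\<^bsub>\<O> (W \<inter> V (\<tau> x))\<^esub> ?a"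
            using fun_cong[OF eq, of x] x by (simp add: act[OF i W])
          then show "mres X W (W \<inter> V (\<tau> x)) m = mres X W (W \<inter> V (\<tau> x)) m'"
            using Units_cancel[OF o[OF W(1) x] u[OF x] mr[OF x m] mr[OF x m']]
            by (simp add: mult_comm[OF o[OF W(1) x] _ Units_section[OF u[OF x]]] mr[OF x m] mr[OF x m'])
        qed
      qed simp
    next
      fix m assume m: "m \<in> carrier (\<O> W)"
      show "oact ?L W m (ores ?L (V i) W (?e i)) \<in> osec ?L W"
        by (rule oact_closed[OF oset_sheaf_bundle W(1) m ores_closed[OF oset_sheaf_bundle opn_cover[OF i] W e_sec[OF i]]])
    next
      fix s assume s: "s \<in> osec ?L W"
      \<comment> \<open>The unit \<open>a (i, \<tau> x)\<close> inverts
        \<open>a (\<tau> x, i)\<close>, so the coordinate of \<open>s\<close> in \<open>e i\<close>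
        has to be \<open>?b x\<close> times \<open>s x\<close> over
        \<open>W \<inter> V (\<tau> x)\<close>; these products glue.\<close>
      let ?b = "\<lambda>x. mres X (V i \<inter> V (\<tau> x)) (W \<inter> V (\<tau> x)) (a (i, \<tau> x))"
      have bi: "a (i, \<tau> x) \<in> carrier (\<O> (V i \<inter> V (\<tau> x)))" if "x \<in> pts" for x
        using cocycle_section[OF a i \<tau>[OF that]] .
      have bc: "?b x \<in> carrier (\<O> (W \<inter> V (\<tau> x)))" if x: "x \<in> pts" for x
        by (rule res_closed[OF ai(3)[OF x i] o[OF W(1) x] _ bi[OF x]]) (use W in blast)
      have "\<exists>m\<in>carrier (\<O> W). \<forall>x\<in>pts. mres X W (W \<inter> V (\<tau> x)) m = ?b x \<otimes>\<^bsub>\<O> (W \<inter> V (\<tau> x))\<^esub> s x"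
      proof (rule section_glue[OF o[OF W(1)] cov])
        show "?b x \<otimes>\<^bsub>\<O> (W \<inter> V (\<tau> x))\<^esub> s x \<in> carrier (\<O> (W \<inter> V (\<tau> x)))" if x: "x \<in> pts" for x
          by (rule mult_closed[OF o[OF W(1) x] bc[OF x] sec[OF s x]])
        fix x y assume x: "x \<in> pts" and y: "y \<in> pts"
        define Z where "Z = (W \<inter> V (\<tau> x)) \<inter> (W \<inter> V (\<tau> y))"
        have Z: "opn Z" unfolding Z_def using o[OF W(1) x] o[OF W(1) y] by (rule openin_Int)
        have Z': "Z \<subseteq> W" "Z \<subseteq> V (\<tau> x)" "Z \<subseteq> V (\<tau> y)" "Z \<subseteq> V i" "Z \<subseteq> W \<inter> V (\<tau> x)" "Z \<subseteq> W \<inter> V (\<tau> y)"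
          unfolding Z_def using W by blast+
        have sub: "W \<inter> V (\<tau> z) \<subseteq> V i \<inter> V (\<tau> z)" for z using W by blast
        let ?bx = "mres X (V i \<inter> V (\<tau> x)) Z (a (i, \<tau> x))" and ?by = "mres X (V i \<inter> V (\<tau> y)) Z (a (i, \<tau> y))"
        let ?axy = "mres X (V (\<tau> x) \<inter> V (\<tau> y)) Z (a (\<tau> x, \<tau> y))"
        let ?sx = "mres X (W \<inter> V (\<tau> x)) Z (s x)" and ?sy = "mres X (W \<inter> V (\<tau> y)) Z (s y)"
        have c: "?bx \<in> carrier (\<O> Z)" "?by \<in> carrier (\<O> Z)" "?axy \<in> carrier (\<O> Z)" "?sx \<in> carrier (\<O> Z)" "?sy \<in> carrier (\<O> Z)"
          using Z Z' x y i by (auto intro!: res_closed bi o W sec[OF s] ai opn_cover2 \<tau> cocycle_section[OF a])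
        have "mres X (W \<inter> V (\<tau> x)) Z (?b x \<otimes>\<^bsub>\<O> (W \<inter> V (\<tau> x))\<^esub> s x) = ?bx \<otimes>\<^bsub>\<O> Z\<^esub> ?sx"
          by (simp add: res_mult[OF o[OF W(1) x] Z Z'(5) bc[OF x] sec[OF s x]]
            res_res[OF ai(3)[OF x i] o[OF W(1) x] Z Z'(5) sub bi[OF x]])
        also have "\<dots> = (?axy \<otimes>\<^bsub>\<O> Z\<^esub> ?bx) \<otimes>\<^bsub>\<O> Z\<^esub> ?sy"
          using bundle_compat_on[OF W(1) s x y Z Z'(1-3)] by (simp add: mult_assoc[OF Z] mult_lcomm[OF Z] c)
        also have "\<dots> = ?by \<otimes>\<^bsub>\<O> Z\<^esub> ?sy"
          using cocycle_on[OF a i \<tau>[OF x] \<tau>[OF y] Z Z'(4,2,3)] by simp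
        also have "\<dots> = mres X (W \<inter> V (\<tau> y)) Z (?b y \<otimes>\<^bsub>\<O> (W \<inter> V (\<tau> y))\<^esub> s y)"
          by (simp add: res_mult[OF o[OF W(1) y] Z Z'(6) bc[OF y] sec[OF s y]]
            res_res[OF ai(3)[OF y i] o[OF W(1) y] Z Z'(6) sub bi[OF y]])
        finally show "mres X (W \<inter> V (\<tau> x)) (W \<inter> V (\<tau> x) \<inter> (W \<inter> V (\<tau> y))) (?b x \<otimes>\<^bsub>\<O> (W \<inter> V (\<tau> x))\<^esub> s x) =
          mres X (W \<inter> V (\<tau> y)) (W \<inter> V (\<tau> x) \<inter> (W \<inter> V (\<tau> y))) (?b y \<otimes>\<^bsub>\<O> (W \<inter> V (\<tau> y))\<^esub> s y)"
          unfolding Z_def .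
      qed
      then obtain m where m: "m \<in> carrier (\<O> W)"
        "\<And>x. x \<in> pts \<Longrightarrow> mres X W (W \<inter> V (\<tau> x)) m = ?b x \<otimes>\<^bsub>\<O> (W \<inter> V (\<tau> x))\<^esub> s x" by blast
      have "s = oact ?L W m (ores ?L (V i) W (?e i))"
      proof (rule extensionalityI[of _ pts])
        show "s \<in> extensional pts" using s by (simp add: bundle_sec)
        fix x assume x: "x \<in> pts"
        let ?W = "W \<inter> V (\<tau> x)" and ?a = "mres X (V (\<tau> x) \<inter> V i) (W \<inter> V (\<tau> x)) (a (\<tau> x, i))"
        have ac: "?a \<in> carrier (\<O> ?W)" by (rule Units_section[OF u[OF x]])
        have oW: "opn ?W" by (rule o[OF W(1) x])
        have "?a \<otimes>\<^bsub>\<O> ?W\<^esub> ?b x = \<one>\<^bsub>\<O> ?W\<^esub>"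
          by (rule cocycle_symm_on[OF a i \<tau>[OF x] oW]) (use W in auto)
        then have "?b x \<otimes>\<^bsub>\<O> ?W\<^esub> s x \<otimes>\<^bsub>\<O> ?W\<^esub> ?a = s x"
          by (metis mult_comm[OF oW] mult_assoc[OF oW] mult_closed[OF oW] one_left[OF oW] ac bc[OF x] sec[OF s x])
        then show "s x = oact ?L W m (ores ?L (V i) W (?e i)) x"
          using x by (simp add: act[OF i W] m(2))
      qed (simp add: bundle_act)
      then show "\<exists>m\<in>carrier (\<O> W). s = oact ?L W m (ores ?L (V i) W (?e i))" using m(1) by blast
    qed
  qed
  fix j assume j: "j \<in> I"
  let ?Z = "V i \<inter> V j"
  have Z: "opn ?Z" "?Z \<subseteq> V i" "?Z \<subseteq> V j" using opn_cover2[OF i j] by auto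
  show "ores ?L (V j) ?Z (?e j) = oact ?L ?Z (a (i, j)) (ores ?L (V i) ?Z (?e i))"
  proof (rule extensionalityI[of _ pts])
    fix x assume x: "x \<in> pts"
    have sub: "?Z \<inter> V (\<tau> x) \<subseteq> V j \<inter> V (\<tau> x)" by blast
    have "mres X ?Z (?Z \<inter> V (\<tau> x)) (a (i, j)) \<otimes>\<^bsub>\<O> (?Z \<inter> V (\<tau> x))\<^esub> mres X (V (\<tau> x) \<inter> V i) (?Z \<inter> V (\<tau> x)) (a (\<tau> x, i)) =
        mres X (V (\<tau> x) \<inter> V j) (?Z \<inter> V (\<tau> x)) (a (\<tau> x, j))"
      by (rule cocycle_on[OF a \<tau>[OF x] i j o[OF Z(1) x]]) auto
    then show "ores ?L (V j) ?Z (?e j) x = oact ?L ?Z (a (i, j)) (ores ?L (V i) ?Z (?e i)) x"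
      unfolding act[OF i Z(1,2)]
      using x res_res[OF ai(2,3)[OF x j] o[OF Z(1) x] sub ai(4)[OF x j] ai(1)[OF x j]]
      by (simp add: bundle_res)
  qed (simp_all add: bundle_act bundle_res)
qed

end

lemma exists_bundle:
  assumes a: "cocycle X I V a"
  obtains L :: "('p, 'a, 'p \<Rightarrow> 'a) oset" and e where "oset_sheaf X L" "trivialization X I V L a e"
proof -
  have "\<forall>x\<in>pts. \<exists>i. i \<in> I \<and> x \<in> V i" using cover by blast
  then obtain \<tau> where \<tau>: "\<forall>x\<in>pts. \<tau> x \<in> I \<and> x \<in> V (\<tau> x)" by (rule bchoice[THEN exE])
  show thesis
    by (rule that[OF oset_sheaf_bundle[OF a \<tau>] trivialization_bundle[OF a \<tau>]])
qed

end

section \<open>Isomorphism classes of line bundles as classes of cocycles\<close>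

context covered_space
begin

lemma cocycle_mult:
  assumes a: "cocycle X I V a" and b: "cocycle X I V b"
  shows "cocycle X I V (\<lambda>(i, j). a (i, j) \<otimes>\<^bsub>\<O> (V i \<inter> V j)\<^esub> b (i, j))"
  unfolding cocycle_def
proof (intro conjI ballI)
  fix i j assume i: "i \<in> I" "j \<in> I"
  show "(case (i, j) of (i, j) \<Rightarrow> a (i, j) \<otimes>\<^bsub>\<O> (V i \<inter> V j)\<^esub> b (i, j)) \<in> Units (\<O> (V i \<inter> V j))"
    using Units_mult[OF opn_cover2[OF i] cocycle_Units[OF a i] cocycle_Units[OF b i]] by simp
next
  fix i j l assume i: "i \<in> I" "j \<in> I" "l \<in> I"
  let ?Z = "V i \<inter> V j \<inter> V l"
  have Z: "opn ?Z" "?Z \<subseteq> V i" "?Z \<subseteq> V j" "?Z \<subseteq> V l" using i by (auto simp: opn_cover3)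
  have sub: "?Z \<subseteq> V i \<inter> V j" "?Z \<subseteq> V j \<inter> V l" "?Z \<subseteq> V i \<inter> V l" by blast+
  note r = res_closed[OF opn_cover2[OF i(1,2)] Z(1) sub(1)] res_closed[OF opn_cover2[OF i(2,3)] Z(1) sub(2)]
  note ca = cocycle_section[OF a] and cb = cocycle_section[OF b]
  have *: "(x \<otimes>\<^bsub>\<O> ?Z\<^esub> y) \<otimes>\<^bsub>\<O> ?Z\<^esub> (z \<otimes>\<^bsub>\<O> ?Z\<^esub> w) = (x \<otimes>\<^bsub>\<O> ?Z\<^esub> z) \<otimes>\<^bsub>\<O> ?Z\<^esub> (y \<otimes>\<^bsub>\<O> ?Z\<^esub> w)"
    if "x \<in> carrier (\<O> ?Z)" "y \<in> carrier (\<O> ?Z)" "z \<in> carrier (\<O> ?Z)" "w \<in> carrier (\<O> ?Z)" for x y z w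
    using that by (simp add: mult_assoc[OF Z(1)] mult_closed[OF Z(1)] mult_lcomm[OF Z(1), of y])
  let ?a = "\<lambda>i j. mres X (V i \<inter> V j) ?Z (a (i, j))" and ?b = "\<lambda>i j. mres X (V i \<inter> V j) ?Z (b (i, j))"
  have rm: "mres X (V i \<inter> V j) ?Z (case (i, j) of (i, j) \<Rightarrow> a (i, j) \<otimes>\<^bsub>\<O> (V i \<inter> V j)\<^esub> b (i, j)) = ?a i j \<otimes>\<^bsub>\<O> ?Z\<^esub> ?b i j"
    "mres X (V j \<inter> V l) ?Z (case (j, l) of (i, j) \<Rightarrow> a (i, j) \<otimes>\<^bsub>\<O> (V i \<inter> V j)\<^esub> b (i, j)) = ?a j l \<otimes>\<^bsub>\<O> ?Z\<^esub> ?b j l"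
    "mres X (V i \<inter> V l) ?Z (case (i, l) of (i, j) \<Rightarrow> a (i, j) \<otimes>\<^bsub>\<O> (V i \<inter> V j)\<^esub> b (i, j)) = ?a i l \<otimes>\<^bsub>\<O> ?Z\<^esub> ?b i l"
    by (simp_all add: res_mult[OF opn_cover2[OF i(1,2)] Z(1) sub(1) ca[OF i(1,2)] cb[OF i(1,2)]]
        res_mult[OF opn_cover2[OF i(2,3)] Z(1) sub(2) ca[OF i(2,3)] cb[OF i(2,3)]]
        res_mult[OF opn_cover2[OF i(1,3)] Z(1) sub(3) ca[OF i(1,3)] cb[OF i(1,3)]])
  have cz: "?a i j \<in> carrier (\<O> ?Z)" "?b i j \<in> carrier (\<O> ?Z)" "?a j l \<in> carrier (\<O> ?Z)" "?b j l \<in> carrier (\<O> ?Z)"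
    using i by (auto intro!: r ca cb)
  show "mres X (V j \<inter> V l) ?Z (case (j, l) of (i, j) \<Rightarrow> a (i, j) \<otimes>\<^bsub>\<O> (V i \<inter> V j)\<^esub> b (i, j)) \<otimes>\<^bsub>\<O> ?Z\<^esub>
      mres X (V i \<inter> V j) ?Z (case (i, j) of (i, j) \<Rightarrow> a (i, j) \<otimes>\<^bsub>\<O> (V i \<inter> V j)\<^esub> b (i, j)) =
      mres X (V i \<inter> V l) ?Z (case (i, l) of (i, j) \<Rightarrow> a (i, j) \<otimes>\<^bsub>\<O> (V i \<inter> V j)\<^esub> b (i, j))"
    unfolding rm *[OF cz(3,4,1,2)] cocycle_on[OF a i Z] cocycle_on[OF b i Z] ..
qed

text \<open>The class is cut out by the trivializations that its members admit. Equality, products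
  and linearization of classes thereby become statements about cocycles on the fixed cover.\<close>

definition line_class :: "('i \<times> 'i \<Rightarrow> 'a) \<Rightarrow> ('p, 'a, 'p \<Rightarrow> 'a) oset set" where
  "line_class a = {N. mline_bundle X N \<and> (\<exists>f. trivialization X I V N a f)}"

lemma mclass_eq_line_class:
  assumes L: "oset_sheaf X L" and a: "cocycle X I V a" and e: "trivialization X I V L a e"
  shows "mclass X L = line_class a"
proof (intro subset_antisym subsetI)
  fix N assume "N \<in> mclass X L"
  then have N: "mline_bundle X N" "oset_iso_on X pts L N" by (simp_all add: mclass_def)
  obtain f where "trivialization X I V N a f" using L a e N(2) by (rule trivialization_iso)
  then show "N \<in> line_class a" using N(1) by (auto simp: line_class_def)
next
  fix N assume "N \<in> line_class a"
  then obtain f where N: "mline_bundle X N" and f: "trivialization X I V N a f" by (auto simp: line_class_def)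
  have "oset_iso_on X pts L N" by (rule oset_iso_on_same_cocycle[OF L mline_bundle_sheaf[OF N] a e f])
  then show "N \<in> mclass X L" using N by (simp add: mclass_def)
qed

lemma line_class_nonempty:
  assumes a: "cocycle X I V a"
  obtains N where "N \<in> line_class a"
proof -
  obtain L :: "('p, 'a, 'p \<Rightarrow> 'a) oset" and e where L: "oset_sheaf X L" and e: "trivialization X I V L a e"
    using a by (rule exists_bundle)
  have "L \<in> line_class a" using trivialization_mline_bundle[OF L e] e by (auto simp: line_class_def)
  then show thesis by (rule that)
qed

lemma line_class_cohomologous:
  assumes a: "cocycle X I V a" "cocycle X I V b" and N: "N \<in> line_class a" "N \<in> line_class b"
  shows "cohomologous X I V a b"
proof -
  from N obtain e f where "mline_bundle X N" "trivialization X I V N a e" "trivialization X I V N b f"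
    by (auto simp: line_class_def)
  then show ?thesis by (intro cohomologous_of_trivializations[OF mline_bundle_sheaf a])
qed

lemma line_class_subset:
  assumes a: "cocycle X I V a" "cocycle X I V b" "cohomologous X I V a b"
  shows "line_class a \<subseteq> line_class b"
proof
  fix N assume "N \<in> line_class a"
  then obtain e where N: "mline_bundle X N" and e: "trivialization X I V N a e" by (auto simp: line_class_def)
  obtain f where "trivialization X I V N b f"
    using mline_bundle_sheaf[OF N] a(1,2) e a(3) by (rule trivialization_cohomologous)
  then show "N \<in> line_class b" using N by (auto simp: line_class_def)
qed

lemma line_class_eq_iff:
  assumes a: "cocycle X I V a" and b: "cocycle X I V b"
  shows "line_class a = line_class b \<longleftrightarrow> cohomologous X I V a b"
proof
  assume eq: "line_class a = line_class b"
  obtain N where "N \<in> line_class a" using line_class_nonempty[OF a] .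
  then show "cohomologous X I V a b" using line_class_cohomologous[OF a b] eq by blast
next
  assume ab: "cohomologous X I V a b"
  note sub = line_class_subset[OF a b ab]
  obtain N where N: "N \<in> line_class a" using line_class_nonempty[OF a] .
  \<comment> \<open>Symmetry of \<open>cohomologous\<close> comes from the common member
    \<open>N\<close>, without inverting units.\<close>
  then have "cohomologous X I V b a" using line_class_cohomologous[OF b a] sub by blast
  then show "line_class a = line_class b" using sub line_class_subset[OF b a] by blast
qed

text \<open>One inclusion computes the transition functions of a tensor product. For the other one,
  arbitrary members of the two factors serve, because the pairing of
  \<open>mtensor_mult_cocycle\<close> is built from trivializations alone.\<close>

lemma line_class_tensor:
  assumes a: "cocycle X I V a" and b: "cocycle X I V b"
  shows "{N. mline_bundle X N \<and> (\<exists>L\<in>line_class a. \<exists>L'\<in>line_class b. mtensor X L L' N)} =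
    line_class (\<lambda>(i, j). a (i, j) \<otimes>\<^bsub>\<O> (V i \<inter> V j)\<^esub> b (i, j))" (is "?T = line_class ?ab")
proof (intro subset_antisym subsetI)
  fix N assume "N \<in> ?T"
  then obtain L L' :: "('p, 'a, 'p \<Rightarrow> 'a) oset" and e e' where N: "mline_bundle X N" and t: "mtensor X L L' N" and L: "mline_bundle X L" "mline_bundle X L'"
    and e: "trivialization X I V L a e" "trivialization X I V L' b e'"
    by (auto simp: line_class_def)
  obtain f where "trivialization X I V N ?ab f"
    by (rule trivialization_tensor[OF mline_bundle_sheaf[OF L(1)] mline_bundle_sheaf[OF L(2)] mline_bundle_sheaf[OF N] a b e t])
  then show "N \<in> line_class ?ab" using N by (auto simp: line_class_def)
next
  fix N assume "N \<in> line_class ?ab"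
  then obtain f where N: "mline_bundle X N" and f: "trivialization X I V N ?ab f" by (auto simp: line_class_def)
  obtain L where LL: "L \<in> line_class a" using line_class_nonempty[OF a] .
  obtain L' where LL': "L' \<in> line_class b" using line_class_nonempty[OF b] .
  obtain e e' where L: "mline_bundle X L" "mline_bundle X L'"
    and e: "trivialization X I V L a e" "trivialization X I V L' b e'"
    using LL LL' by (auto simp: line_class_def)
  have "mtensor X L L' N"
    by (rule mtensor_mult_cocycle[OF mline_bundle_sheaf[OF L(1)] mline_bundle_sheaf[OF L(2)] mline_bundle_sheaf[OF N] a b
      cocycle_mult[OF a b] e f]) simp
  then show "N \<in> ?T" using N LL LL' by blast
qed

end

section \<open>Line bundles on ringed spaces\<close>

text \<open>Forgets addition in the structure sheaf. Generators, transition functions and Cech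
  cochains of units only see multiplication, so the results on O-sets apply to this space.\<close>

definition mon_of :: "('y, 'r) ringed_space \<Rightarrow> ('y, 'r) monoidal_space" where
  "mon_of Y = \<lparr>mtop = rtop Y,
     msec = (\<lambda>U. \<lparr>carrier = carrier (rsec Y U), monoid.mult = monoid.mult (rsec Y U), one = \<one>\<^bsub>rsec Y U\<^esub>\<rparr>),
     mres = rres Y\<rparr>"

definition oset_of :: "('y, 'r, 'l) omod \<Rightarrow> ('y, 'r, 'l) oset" where
  "oset_of L = \<lparr>osec = (\<lambda>U. carrier (lsec L U)), oact = (\<lambda>U. smult (lsec L U)), ores = lres L\<rparr>"

lemma mon_of_simps [simp]:
  "mtop (mon_of Y) = rtop Y" "mres (mon_of Y) = rres Y"
  "carrier (msec (mon_of Y) U) = carrier (rsec Y U)"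
  "monoid.mult (msec (mon_of Y) U) = monoid.mult (rsec Y U)"
  "\<one>\<^bsub>msec (mon_of Y) U\<^esub> = \<one>\<^bsub>rsec Y U\<^esub>"
  "Units (msec (mon_of Y) U) = Units (rsec Y U)"
  by (simp_all add: mon_of_def Units_def)

lemma oset_of_simps [simp]:
  "osec (oset_of L) U = carrier (lsec L U)" "oact (oset_of L) U = smult (lsec L U)" "ores (oset_of L) = lres L"
  by (simp_all add: oset_of_def)

lemma rgenerator_iff_mgenerator: "rgenerator Y L U e \<longleftrightarrow> mgenerator (mon_of Y) (oset_of L) U e"
  by (simp add: rgenerator_def mgenerator_def)

lemma oset_of_structure_omod: "oset_of (structure_omod Y) = structure_oset (mon_of Y)"
  by (simp add: oset_of_def structure_omod_def structure_oset_def mon_of_def)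

lemma omod_iso_on_imp_oset_iso_on: "omod_iso_on Y U L N \<Longrightarrow> oset_iso_on (mon_of Y) U (oset_of L) (oset_of N)"
  unfolding omod_iso_on_def oset_iso_on_def by (elim exE conjE, rule exI, intro conjI) simp_all

lemma rtensor_imp_mtensor:
  assumes "rtensor Y L L' N"
  shows "mtensor (mon_of Y) (oset_of L) (oset_of L') (oset_of N)"
proof -
  obtain \<beta> where \<beta>: "\<forall>U. openin (rtop Y) U \<longrightarrow>
             (\<forall>l\<in>carrier (lsec L U). \<forall>m\<in>carrier (lsec L U). \<forall>l'\<in>carrier (lsec L' U).
                \<beta> U (l \<oplus>\<^bsub>lsec L U\<^esub> m) l' = \<beta> U l l' \<oplus>\<^bsub>lsec N U\<^esub> \<beta> U m l') \<and>
             (\<forall>l\<in>carrier (lsec L U). \<forall>l'\<in>carrier (lsec L' U). \<forall>m'\<in>carrier (lsec L' U).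
                \<beta> U l (l' \<oplus>\<^bsub>lsec L' U\<^esub> m') = \<beta> U l l' \<oplus>\<^bsub>lsec N U\<^esub> \<beta> U l m') \<and>
             (\<forall>l\<in>carrier (lsec L U). \<forall>l'\<in>carrier (lsec L' U).
                \<beta> U l l' \<in> carrier (lsec N U) \<and>
                (\<forall>a\<in>carrier (rsec Y U).
                   \<beta> U (a \<odot>\<^bsub>lsec L U\<^esub> l) l' = a \<odot>\<^bsub>lsec N U\<^esub> \<beta> U l l' \<and>
                   \<beta> U l (a \<odot>\<^bsub>lsec L' U\<^esub> l') = a \<odot>\<^bsub>lsec N U\<^esub> \<beta> U l l') \<and>
                (\<forall>V. openin (rtop Y) V \<and> V \<subseteq> U \<longrightarrow>
                   lres N U V (\<beta> U l l') = \<beta> V (lres L U V l) (lres L' U V l')) \<and>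
                (rgenerator Y L U l \<and> rgenerator Y L' U l' \<longrightarrow> rgenerator Y N U (\<beta> U l l')))"
    using assms unfolding rtensor_def by (elim exE)
  show ?thesis
    unfolding mtensor_def by (rule exI[of _ \<beta>]) (use \<beta> in \<open>simp add: rgenerator_iff_mgenerator\<close>)
qed

section \<open>Modules over a ringed space as O-sets\<close>

locale ring_space =
  fixes Y :: "('y, 'r) ringed_space"
  assumes ringed_space: "ringed_space Y"
begin

abbreviation "ropn \<equiv> openin (rtop Y)"

lemma sheaf_rsec: "sheaf (rtop Y) (\<lambda>U. carrier (rsec Y U)) (rres Y)"
  using ringed_space by (simp add: ringed_space_def)

lemma cring_sections: "ropn U \<Longrightarrow> cring (rsec Y U)"
  using ringed_space by (simp add: ringed_space_def)

lemma ring_hom_res: "ropn U \<Longrightarrow> ropn V \<Longrightarrow> V \<subseteq> U \<Longrightarrow> rres Y U V \<in> ring_hom (rsec Y U) (rsec Y V)"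
  using ringed_space by (simp add: ringed_space_def)

lemma monoidal_space_mon_of: "monoidal_space (mon_of Y)"
  unfolding monoidal_space_def
proof (intro conjI allI impI)
  show "sheaf (mtop (mon_of Y)) (\<lambda>U. carrier (msec (mon_of Y) U)) (mres (mon_of Y))" using sheaf_rsec by simp
next
  fix U assume "openin (mtop (mon_of Y)) U"
  then interpret cring "rsec Y U" by (simp add: cring_sections)
  show "comm_monoid (msec (mon_of Y) U)"
    by unfold_locales (simp_all add: m_ac)
next
  fix U V assume "openin (mtop (mon_of Y)) U \<and> openin (mtop (mon_of Y)) V \<and> V \<subseteq> U"
  then have *: "rres Y U V \<in> ring_hom (rsec Y U) (rsec Y V)" by (simp add: ring_hom_res)
  show "mres (mon_of Y) U V \<in> hom (msec (mon_of Y) U) (msec (mon_of Y) V)"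
    using ring_hom_closed[OF *] ring_hom_mult[OF *] by (simp add: hom_def Pi_iff)
  show "mres (mon_of Y) U V \<one>\<^bsub>msec (mon_of Y) U\<^esub> = \<one>\<^bsub>msec (mon_of Y) V\<^esub>"
    using ring_hom_one[OF *] by simp
qed

sublocale M: mono_space "mon_of Y"
  by unfold_locales (rule monoidal_space_mon_of)

lemma omod_sheaf_module: "omod_sheaf Y L \<Longrightarrow> ropn U \<Longrightarrow> Module.module (rsec Y U) (lsec L U)"
  by (simp add: omod_sheaf_def)

lemma lres_add:
  "\<lbrakk>omod_sheaf Y L; ropn U; ropn V; V \<subseteq> U; l \<in> carrier (lsec L U); l' \<in> carrier (lsec L U)\<rbrakk> \<Longrightarrow>
    lres L U V (l \<oplus>\<^bsub>lsec L U\<^esub> l') = lres L U V l \<oplus>\<^bsub>lsec L V\<^esub> lres L U V l'"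
  by (simp add: omod_sheaf_def)

lemma omod_imp_oset_sheaf:
  assumes L: "omod_sheaf Y L"
  shows "oset_sheaf (mon_of Y) (oset_of L)"
  unfolding oset_sheaf_def
proof (intro conjI allI impI ballI)
  show "sheaf (mtop (mon_of Y)) (osec (oset_of L)) (ores (oset_of L))"
    using L by (simp add: omod_sheaf_def oset_of_def)
next
  fix U l assume U: "openin (mtop (mon_of Y)) U" and l: "l \<in> osec (oset_of L) U"
  then interpret Module.module "rsec Y U" "lsec L U" by (simp add: omod_sheaf_module[OF L])
  show "oact (oset_of L) U \<one>\<^bsub>msec (mon_of Y) U\<^esub> l = l" using l by simp
  fix a assume a: "a \<in> carrier (msec (mon_of Y) U)"
  then show "oact (oset_of L) U a l \<in> osec (oset_of L) U" using l by simp
  fix b assume "b \<in> carrier (msec (mon_of Y) U)"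
  then show "oact (oset_of L) U (a \<otimes>\<^bsub>msec (mon_of Y) U\<^esub> b) l = oact (oset_of L) U a (oact (oset_of L) U b l)"
    using l a by (simp add: smult_assoc1)
next
  fix U V a l assume "openin (mtop (mon_of Y)) U \<and> openin (mtop (mon_of Y)) V \<and> V \<subseteq> U"
    "a \<in> carrier (msec (mon_of Y) U)" "l \<in> osec (oset_of L) U"
  then show "ores (oset_of L) U V (oact (oset_of L) U a l) = oact (oset_of L) V (mres (mon_of Y) U V a) (ores (oset_of L) U V l)"
    using L by (simp add: omod_sheaf_def)
qed

lemma rline_bundle_sheaf: "rline_bundle Y L \<Longrightarrow> omod_sheaf Y L"
  by (simp add: rline_bundle_def)

lemma rline_imp_mline_bundle: "rline_bundle Y L \<Longrightarrow> mline_bundle (mon_of Y) (oset_of L)"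
  unfolding mline_bundle_def
proof (intro conjI ballI)
  assume L: "rline_bundle Y L"
  show "oset_sheaf (mon_of Y) (oset_of L)" by (rule omod_imp_oset_sheaf[OF rline_bundle_sheaf[OF L]])
  fix x assume "x \<in> topspace (mtop (mon_of Y))"
  then have "\<exists>U. ropn U \<and> x \<in> U \<and> omod_iso_on Y U (structure_omod Y) L"
    using L by (simp add: rline_bundle_def)
  then obtain U where U: "ropn U" "x \<in> U" and iso: "omod_iso_on Y U (structure_omod Y) L" by (elim exE conjE)
  show "\<exists>U. openin (mtop (mon_of Y)) U \<and> x \<in> U \<and> oset_iso_on (mon_of Y) U (structure_oset (mon_of Y)) (oset_of L)"
    using omod_iso_on_imp_oset_iso_on[OF iso] U by (intro exI[of _ U]) (simp add: oset_of_structure_omod)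
qed

text \<open>For a local generator \<open>e\<close> the map \<open>a \<mapsto> a \<cdot> e\<close> is
  bijective by definition and additive by distributivity in the module.\<close>

lemma mline_imp_rline_bundle:
  assumes L: "omod_sheaf Y L" and m: "mline_bundle (mon_of Y) (oset_of L)"
  shows "rline_bundle Y L"
  unfolding rline_bundle_def
proof (intro conjI ballI L)
  note L' = omod_imp_oset_sheaf[OF L]
  fix y assume y: "y \<in> topspace (rtop Y)"
  obtain U e where U: "ropn U" "y \<in> U" and e: "mgenerator (mon_of Y) (oset_of L) U e"
    by (rule M.mline_bundle_local_generator[OF m, of y]) (use y in simp_all)
  have es: "e \<in> carrier (lsec L U)" using M.mgenerator_section[OF e] by simp
  have "omod_iso_on Y U (structure_omod Y) L"
    unfolding omod_iso_on_def
  proof (intro exI[of _ "\<lambda>W a. a \<odot>\<^bsub>lsec L W\<^esub> lres L U W e"] conjI allI impI ballI)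
    fix W assume "ropn W \<and> W \<subseteq> U"
    then have W: "ropn W" "W \<subseteq> U" by simp_all
    have eW: "lres L U W e \<in> carrier (lsec L W)" using M.ores_closed[OF L', of U W e] U W es by simp
    interpret Module.module "rsec Y W" "lsec L W" by (rule omod_sheaf_module[OF L W(1)])
    show "bij_betw (\<lambda>a. a \<odot>\<^bsub>lsec L W\<^esub> lres L U W e) (carrier (lsec (structure_omod Y) W)) (carrier (lsec L W))"
      using M.mgenerator_bij[OF L' _ M.mgenerator_restrict[OF L' _ _ _ e], of W] U W by (simp add: structure_omod_def)
    show "(l \<oplus>\<^bsub>lsec (structure_omod Y) W\<^esub> l') \<odot>\<^bsub>lsec L W\<^esub> lres L U W e =
        l \<odot>\<^bsub>lsec L W\<^esub> lres L U W e \<oplus>\<^bsub>lsec L W\<^esub> l' \<odot>\<^bsub>lsec L W\<^esub> lres L U W e"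
      if "l \<in> carrier (lsec (structure_omod Y) W)" "l' \<in> carrier (lsec (structure_omod Y) W)" for l l'
      using that eW by (simp add: structure_omod_def smult_l_distr)
    show "(a \<odot>\<^bsub>lsec (structure_omod Y) W\<^esub> l) \<odot>\<^bsub>lsec L W\<^esub> lres L U W e = a \<odot>\<^bsub>lsec L W\<^esub> (l \<odot>\<^bsub>lsec L W\<^esub> lres L U W e)"
      if "a \<in> carrier (rsec Y W)" "l \<in> carrier (lsec (structure_omod Y) W)" for a l
      using that eW by (simp add: structure_omod_def smult_assoc1)
  next
    fix V W l assume "ropn V \<and> ropn W \<and> W \<subseteq> V \<and> V \<subseteq> U" and l: "l \<in> carrier (lsec (structure_omod Y) V)"
    then have V: "ropn V" "ropn W" "W \<subseteq> V" "V \<subseteq> U" by simp_all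
    show "lres (structure_omod Y) V W l \<odot>\<^bsub>lsec L W\<^esub> lres L U W e = lres L V W (l \<odot>\<^bsub>lsec L V\<^esub> lres L U V e)"
      using M.ores_oact[OF L', of V W l "lres L U V e"] M.ores_ores[OF L', of U V W e] M.ores_closed[OF L', of U V e] V U l es
      by (simp add: structure_omod_def)
  qed
  then show "\<exists>U. ropn U \<and> y \<in> U \<and> omod_iso_on Y U (structure_omod Y) L" using U by blast
qed

text \<open>Locally \<open>l\<close> and \<open>l'\<close> are multiples \<open>m \<cdot> f\<close>
  and \<open>m' \<cdot> f\<close> of one generator, so their sum is
  \<open>(m + m') \<cdot> f\<close> and homogeneity alone gives additivity. This is what permits
  forgetting addition: isomorphisms and tensor pairings of the underlying O-sets of line bundles are
  automatically those of modules.\<close>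

lemma linear_imp_additive:
  assumes L: "rline_bundle Y L" and N: "omod_sheaf Y N" and W: "ropn W"
    and \<phi>: "\<And>W' l. ropn W' \<Longrightarrow> W' \<subseteq> W \<Longrightarrow> l \<in> carrier (lsec L W') \<Longrightarrow> \<phi> W' l \<in> carrier (lsec N W')"
    and lin: "\<And>W' a l. ropn W' \<Longrightarrow> W' \<subseteq> W \<Longrightarrow> a \<in> carrier (rsec Y W') \<Longrightarrow> l \<in> carrier (lsec L W') \<Longrightarrow>
      \<phi> W' (a \<odot>\<^bsub>lsec L W'\<^esub> l) = a \<odot>\<^bsub>lsec N W'\<^esub> \<phi> W' l"
    and nat: "\<And>W' l. ropn W' \<Longrightarrow> W' \<subseteq> W \<Longrightarrow> l \<in> carrier (lsec L W) \<Longrightarrow> \<phi> W' (lres L W W' l) = lres N W W' (\<phi> W l)"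
    and l: "l \<in> carrier (lsec L W)" and l': "l' \<in> carrier (lsec L W)"
  shows "\<phi> W (l \<oplus>\<^bsub>lsec L W\<^esub> l') = \<phi> W l \<oplus>\<^bsub>lsec N W\<^esub> \<phi> W l'"
proof -
  note Ls = rline_bundle_sheaf[OF L]
  note L' = omod_imp_oset_sheaf[OF Ls] and N' = omod_imp_oset_sheaf[OF N]
  have "\<exists>U e. ropn U \<and> x \<in> U \<and> mgenerator (mon_of Y) (oset_of L) U e" if "x \<in> W" for x
    by (rule M.mline_bundle_local_generator[OF rline_imp_mline_bundle[OF L], of x])
      (use that openin_subset[OF W] in auto)
  then obtain U e where U: "\<And>x. x \<in> W \<Longrightarrow> ropn (U x)" "\<And>x. x \<in> W \<Longrightarrow> x \<in> U x"
    "\<And>x. x \<in> W \<Longrightarrow> mgenerator (mon_of Y) (oset_of L) (U x) (e x)" by metis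
  interpret LW: Module.module "rsec Y W" "lsec L W" by (rule omod_sheaf_module[OF Ls W])
  interpret NW: Module.module "rsec Y W" "lsec N W" by (rule omod_sheaf_module[OF N W])
  note \<phi>W = \<phi>[OF W subset_refl]
  show ?thesis
  proof (rule M.oset_eqI[OF N', of W "\<lambda>x. W \<inter> U x" W])
    fix x assume x: "x \<in> W"
    have o: "ropn (W \<inter> U x)" using W U(1)[OF x] by (rule openin_Int)
    then show "openin (mtop (mon_of Y)) (W \<inter> U x)" by simp
    let ?Z = "W \<inter> U x"
    interpret LZ: Module.module "rsec Y ?Z" "lsec L ?Z" by (rule omod_sheaf_module[OF Ls o])
    interpret NZ: Module.module "rsec Y ?Z" "lsec N ?Z" by (rule omod_sheaf_module[OF N o])
    have sub: "?Z \<subseteq> W" by simp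
    have oM: "openin (mtop (mon_of Y)) ?Z" using o by simp
    have g: "mgenerator (mon_of Y) (oset_of L) ?Z (lres L (U x) ?Z (e x))"
      using M.mgenerator_restrict[OF L' _ _ _ U(3)[OF x], of ?Z] U(1)[OF x] o by simp
    define f where "f = lres L (U x) ?Z (e x)"
    have f: "f \<in> carrier (lsec L ?Z)" using M.mgenerator_section[OF g] by (simp add: f_def)
    have "\<exists>m\<in>carrier (rsec Y ?Z). lres L W ?Z k = m \<odot>\<^bsub>lsec L ?Z\<^esub> f" if k: "k \<in> carrier (lsec L W)" for k
      using M.coord[OF L' oM g, of "lres L W ?Z k"] M.ores_closed[OF L', of W ?Z k] W o k by (force simp: f_def)
    from this[OF l] this[OF l'] obtain m m' where m: "m \<in> carrier (rsec Y ?Z)" "lres L W ?Z l = m \<odot>\<^bsub>lsec L ?Z\<^esub> f"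
      and m': "m' \<in> carrier (rsec Y ?Z)" "lres L W ?Z l' = m' \<odot>\<^bsub>lsec L ?Z\<^esub> f" by blast
    have "lres N W ?Z (\<phi> W (l \<oplus>\<^bsub>lsec L W\<^esub> l')) = \<phi> ?Z ((m \<oplus>\<^bsub>rsec Y ?Z\<^esub> m') \<odot>\<^bsub>lsec L ?Z\<^esub> f)"
      using l l' by (simp add: nat[OF o sub, symmetric] lres_add[OF Ls W o sub] m m' LZ.smult_l_distr[OF m(1) m'(1) f])
    also have "\<dots> = \<phi> ?Z (m \<odot>\<^bsub>lsec L ?Z\<^esub> f) \<oplus>\<^bsub>lsec N ?Z\<^esub> \<phi> ?Z (m' \<odot>\<^bsub>lsec L ?Z\<^esub> f)"
      using m m' f by (simp add: lin[OF o sub] NZ.smult_l_distr \<phi>[OF o sub])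
    also have "\<dots> = lres N W ?Z (\<phi> W l) \<oplus>\<^bsub>lsec N ?Z\<^esub> lres N W ?Z (\<phi> W l')"
      by (simp add: nat[OF o sub l, symmetric] nat[OF o sub l', symmetric] m(2) m'(2))
    also have "\<dots> = lres N W ?Z (\<phi> W l \<oplus>\<^bsub>lsec N W\<^esub> \<phi> W l')"
      by (rule lres_add[OF N W o sub \<phi>W[OF l] \<phi>W[OF l'], symmetric])
    finally show "ores (oset_of N) W ?Z (\<phi> W (l \<oplus>\<^bsub>lsec L W\<^esub> l')) = ores (oset_of N) W ?Z (\<phi> W l \<oplus>\<^bsub>lsec N W\<^esub> \<phi> W l')"
      by simp
  next
    show "W = (\<Union>x\<in>W. W \<inter> U x)" using U(2) by blast
  qed (use \<phi>W l l' in simp_all)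
qed

lemma oset_iso_imp_omod_iso:
  assumes L: "rline_bundle Y L" and N: "omod_sheaf Y N" and iso: "oset_iso_on (mon_of Y) U (oset_of L) (oset_of N)"
  shows "omod_iso_on Y U L N"
proof -
  obtain \<phi> where "\<And>W. M.opn W \<Longrightarrow> W \<subseteq> U \<Longrightarrow> bij_betw (\<phi> W) (osec (oset_of L) W) (osec (oset_of N) W)"
    "\<And>W a l. M.opn W \<Longrightarrow> W \<subseteq> U \<Longrightarrow> a \<in> carrier (msec (mon_of Y) W) \<Longrightarrow> l \<in> osec (oset_of L) W \<Longrightarrow>
      \<phi> W (oact (oset_of L) W a l) = oact (oset_of N) W a (\<phi> W l)"
    "\<And>W W' l. M.opn W \<Longrightarrow> M.opn W' \<Longrightarrow> W' \<subseteq> W \<Longrightarrow> W \<subseteq> U \<Longrightarrow> l \<in> osec (oset_of L) W \<Longrightarrow>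
      \<phi> W' (ores (oset_of L) W W' l) = ores (oset_of N) W W' (\<phi> W l)"
    using iso by (rule M.oset_iso_onE) blast
  note \<phi> = this[unfolded mon_of_simps oset_of_simps]
  have c: "\<phi> W l \<in> carrier (lsec N W)" if "ropn W" "W \<subseteq> U" "l \<in> carrier (lsec L W)" for W l
    using bij_betwE[OF \<phi>(1)[OF that(1,2)]] that(3) by simp
  show ?thesis
    unfolding omod_iso_on_def
  proof (intro exI[of _ \<phi>] conjI allI impI ballI)
    fix W l l' assume W: "ropn W \<and> W \<subseteq> U" and l: "l \<in> carrier (lsec L W)" "l' \<in> carrier (lsec L W)"
    show "\<phi> W (l \<oplus>\<^bsub>lsec L W\<^esub> l') = \<phi> W l \<oplus>\<^bsub>lsec N W\<^esub> \<phi> W l'"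
      by (rule linear_imp_additive[OF L N _ _ _ _ l]) (use W c \<phi>(2,3) in auto)
  qed (use \<phi> in auto)
qed

text \<open>With one argument fixed, and restricted along with the open set, the pairing is
  homogeneous and natural in the other one; \<open>linear_imp_additive\<close> then supplies the two
  missing additivity laws.\<close>

lemma mtensor_imp_rtensor:
  assumes L: "rline_bundle Y L" and L': "rline_bundle Y L'" and N: "omod_sheaf Y N"
    and t: "mtensor (mon_of Y) (oset_of L) (oset_of L') (oset_of N)"
  shows "rtensor Y L L' N"
proof -
  note Ls = omod_imp_oset_sheaf[OF rline_bundle_sheaf[OF L]] and Ls' = omod_imp_oset_sheaf[OF rline_bundle_sheaf[OF L']]
  obtain \<beta> where \<beta>: "\<forall>U. ropn U \<longrightarrow> (\<forall>l\<in>carrier (lsec L U). \<forall>l'\<in>carrier (lsec L' U).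
             \<beta> U l l' \<in> carrier (lsec N U) \<and>
             (\<forall>a\<in>carrier (rsec Y U).
                \<beta> U (a \<odot>\<^bsub>lsec L U\<^esub> l) l' = a \<odot>\<^bsub>lsec N U\<^esub> (\<beta> U l l') \<and>
                \<beta> U l (a \<odot>\<^bsub>lsec L' U\<^esub> l') = a \<odot>\<^bsub>lsec N U\<^esub> (\<beta> U l l')) \<and>
             (\<forall>V. ropn V \<and> V \<subseteq> U \<longrightarrow>
                lres N U V (\<beta> U l l') = \<beta> V (lres L U V l) (lres L' U V l')) \<and>
             (rgenerator Y L U l \<and> rgenerator Y L' U l' \<longrightarrow> rgenerator Y N U (\<beta> U l l')))"
    using t unfolding mtensor_def by (auto simp: rgenerator_iff_mgenerator)
  have b: "\<beta> U l l' \<in> carrier (lsec N U)"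
    "\<And>a. a \<in> carrier (rsec Y U) \<Longrightarrow> \<beta> U (a \<odot>\<^bsub>lsec L U\<^esub> l) l' = a \<odot>\<^bsub>lsec N U\<^esub> (\<beta> U l l')"
    "\<And>a. a \<in> carrier (rsec Y U) \<Longrightarrow> \<beta> U l (a \<odot>\<^bsub>lsec L' U\<^esub> l') = a \<odot>\<^bsub>lsec N U\<^esub> (\<beta> U l l')"
    "\<And>V. ropn V \<Longrightarrow> V \<subseteq> U \<Longrightarrow> lres N U V (\<beta> U l l') = \<beta> V (lres L U V l) (lres L' U V l')"
    if "ropn U" "l \<in> carrier (lsec L U)" "l' \<in> carrier (lsec L' U)" for U l l'
    using \<beta> that by auto
  have rL: "lres L U V l \<in> carrier (lsec L V)" if "ropn U" "ropn V" "V \<subseteq> U" "l \<in> carrier (lsec L U)" for U V l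
    using M.ores_closed[OF Ls, of U V l] that by simp
  have rL': "lres L' U V l \<in> carrier (lsec L' V)" if "ropn U" "ropn V" "V \<subseteq> U" "l \<in> carrier (lsec L' U)" for U V l
    using M.ores_closed[OF Ls', of U V l] that by simp
  show ?thesis
    unfolding rtensor_def
  proof (intro exI[of _ \<beta>] allI impI conjI)
    fix U assume U: "ropn U"
    show "\<forall>l\<in>carrier (lsec L U). \<forall>m\<in>carrier (lsec L U). \<forall>l'\<in>carrier (lsec L' U).
                \<beta> U (l \<oplus>\<^bsub>lsec L U\<^esub> m) l' = \<beta> U l l' \<oplus>\<^bsub>lsec N U\<^esub> \<beta> U m l'"
    proof (intro ballI)
      fix l m l' assume l: "l \<in> carrier (lsec L U)" "m \<in> carrier (lsec L U)" "l' \<in> carrier (lsec L' U)"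
      have "(\<lambda>W k. \<beta> W k (lres L' U W l')) U (l \<oplus>\<^bsub>lsec L U\<^esub> m) =
          (\<lambda>W k. \<beta> W k (lres L' U W l')) U l \<oplus>\<^bsub>lsec N U\<^esub> (\<lambda>W k. \<beta> W k (lres L' U W l')) U m"
        using M.ores_id[OF Ls', of U l'] U l
        by (intro linear_imp_additive[OF L N U]) (simp_all add: b rL')
      then show "\<beta> U (l \<oplus>\<^bsub>lsec L U\<^esub> m) l' = \<beta> U l l' \<oplus>\<^bsub>lsec N U\<^esub> \<beta> U m l'"
        using M.ores_id[OF Ls', of U l'] U l by simp
    qed
    show "\<forall>l\<in>carrier (lsec L U). \<forall>l'\<in>carrier (lsec L' U). \<forall>m'\<in>carrier (lsec L' U).
                \<beta> U l (l' \<oplus>\<^bsub>lsec L' U\<^esub> m') = \<beta> U l l' \<oplus>\<^bsub>lsec N U\<^esub> \<beta> U l m'"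
    proof (intro ballI)
      fix l l' m' assume l: "l \<in> carrier (lsec L U)" "l' \<in> carrier (lsec L' U)" "m' \<in> carrier (lsec L' U)"
      have "(\<lambda>W k. \<beta> W (lres L U W l) k) U (l' \<oplus>\<^bsub>lsec L' U\<^esub> m') =
          (\<lambda>W k. \<beta> W (lres L U W l) k) U l' \<oplus>\<^bsub>lsec N U\<^esub> (\<lambda>W k. \<beta> W (lres L U W l) k) U m'"
        using M.ores_id[OF Ls, of U l] U l
        by (intro linear_imp_additive[OF L' N U]) (simp_all add: b rL)
      then show "\<beta> U l (l' \<oplus>\<^bsub>lsec L' U\<^esub> m') = \<beta> U l l' \<oplus>\<^bsub>lsec N U\<^esub> \<beta> U l m'"
        using M.ores_id[OF Ls, of U l] U l by simp
    qed
  qed (use \<beta> in auto)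
qed

end

section \<open>The module glued from a cocycle\<close>

locale ringed_cover = ring_space Y for Y :: "('y, 'r) ringed_space" +
  fixes I :: "'i set" and V :: "'i \<Rightarrow> 'y set"
  assumes ropn_cover: "\<And>i. i \<in> I \<Longrightarrow> ropn (V i)"
    and rcover: "(\<Union>i\<in>I. V i) = topspace (rtop Y)"
begin

sublocale C: covered_space "mon_of Y" I V
  by unfold_locales (simp_all add: ropn_cover rcover)

text \<open>The O-set glued from the cocycle, with coordinatewise addition. Only the module
  operations matter; the multiplicative fields of the record stay undefined.\<close>

definition ring_bundle_of :: "('i \<times> 'i \<Rightarrow> 'r) \<Rightarrow> ('y \<Rightarrow> 'i) \<Rightarrow> ('y, 'r, 'y \<Rightarrow> 'r) omod" where
  "ring_bundle_of a \<tau> =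
     \<lparr>lsec = (\<lambda>W. \<lparr>carrier = osec (C.bundle_of a \<tau>) W, monoid.mult = undefined, one = undefined,
        zero = (\<lambda>x\<in>topspace (rtop Y). \<zero>\<^bsub>rsec Y (W \<inter> V (\<tau> x))\<^esub>),
        add = (\<lambda>s t. \<lambda>x\<in>topspace (rtop Y). s x \<oplus>\<^bsub>rsec Y (W \<inter> V (\<tau> x))\<^esub> t x),
        smult = oact (C.bundle_of a \<tau>) W\<rparr>),
      lres = ores (C.bundle_of a \<tau>)\<rparr>"

lemma oset_of_ring_bundle: "oset_of (ring_bundle_of a \<tau>) = C.bundle_of a \<tau>"
  by (simp add: oset_of_def ring_bundle_of_def)

context
  fixes a :: "'i \<times> 'i \<Rightarrow> 'r" and \<tau> :: "'y \<Rightarrow> 'i"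
  assumes a: "cocycle (mon_of Y) I V a"
    and idx: "\<forall>x\<in>topspace (mtop (mon_of Y)). \<tau> x \<in> I \<and> x \<in> V (\<tau> x)"
begin

lemma ring_bundle_carrier: "carrier (lsec (ring_bundle_of a \<tau>) W) = osec (C.bundle_of a \<tau>) W"
  and ring_bundle_add: "s \<oplus>\<^bsub>lsec (ring_bundle_of a \<tau>) W\<^esub> t = (\<lambda>x\<in>topspace (rtop Y). s x \<oplus>\<^bsub>rsec Y (W \<inter> V (\<tau> x))\<^esub> t x)"
  and ring_bundle_zero: "\<zero>\<^bsub>lsec (ring_bundle_of a \<tau>) W\<^esub> = (\<lambda>x\<in>topspace (rtop Y). \<zero>\<^bsub>rsec Y (W \<inter> V (\<tau> x))\<^esub>)"
  and ring_bundle_smult: "b \<odot>\<^bsub>lsec (ring_bundle_of a \<tau>) W\<^esub> s = oact (C.bundle_of a \<tau>) W b s"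
  by (simp_all add: ring_bundle_of_def)

text \<open>The twisted compatibility is linear in the coordinates, so sums of sections are
  sections. The sheaf condition, the associativity of the action and its compatibility with
  restriction are inherited from \<open>bundle_of\<close>.\<close>

lemma omod_sheaf_ring_bundle: "omod_sheaf Y (ring_bundle_of a \<tau>)"
  unfolding omod_sheaf_def
proof (intro conjI allI impI ballI)
  let ?B = "C.bundle_of a \<tau>" and ?M = "ring_bundle_of a \<tau>" and ?P = "topspace (rtop Y)"
  note B = C.oset_sheaf_bundle[OF a idx]
  note sec_iff = C.bundle_sec[OF a idx] and act = C.bundle_act[OF a idx] and res = C.bundle_res[OF a idx]
  have \<tau>: "\<tau> x \<in> I" if "x \<in> ?P" for x using idx that by simp
  have o: "ropn (W \<inter> V (\<tau> x))" if "ropn W" "x \<in> ?P" for W x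
    using that \<tau> C.opn_Int_cover[of W "\<tau> x"] by simp
  have sec: "s x \<in> carrier (rsec Y (W \<inter> V (\<tau> x)))" if "s \<in> osec ?B W" "x \<in> ?P" for s x W
    using that by (simp add: sec_iff)
  have ext: "s \<in> extensional ?P" if "s \<in> osec ?B W" for s W
    using that by (simp add: sec_iff)
  have rr: "rres Y W (W \<inter> V (\<tau> x)) \<in> ring_hom (rsec Y W) (rsec Y (W \<inter> V (\<tau> x)))" if "ropn W" "x \<in> ?P" for W x
    by (rule ring_hom_res[OF that(1) o[OF that]]) simp
  show "sheaf (rtop Y) (\<lambda>U. carrier (lsec ?M U)) (lres ?M)"
    using C.bundle_sheaf[OF a idx] by (simp add: ring_bundle_of_def)
  show "Module.module (rsec Y W) (lsec ?M W)" if W: "ropn W" for W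
  proof (rule moduleI)
    interpret R: cring "rsec Y W" by (rule cring_sections[OF W])
    show "cring (rsec Y W)" by (rule cring_sections[OF W])
    have cr: "cring (rsec Y (W \<inter> V (\<tau> x)))" if "x \<in> ?P" for x by (rule cring_sections[OF o[OF W that]])
    have ri: "ring (rsec Y (W \<inter> V (\<tau> x)))" if "x \<in> ?P" for x by (rule cring.axioms(1)[OF cr[OF that]])
    have ab: "abelian_group (rsec Y (W \<inter> V (\<tau> x)))" if "x \<in> ?P" for x by (rule ring.is_abelian_group[OF ri[OF that]])
    have am: "abelian_monoid (rsec Y (W \<inter> V (\<tau> x)))" if "x \<in> ?P" for x by (rule abelian_group.axioms(1)[OF ab[OF that]])
    have smc: "b \<odot>\<^bsub>lsec ?M W\<^esub> s \<in> carrier (lsec ?M W)" if "b \<in> carrier (rsec Y W)" "s \<in> carrier (lsec ?M W)" for b s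
      using M.oact_closed[OF B, of W b s] that W by (simp add: ring_bundle_carrier ring_bundle_smult)
    show "abelian_group (lsec ?M W)"
    proof (rule abelian_groupI)
      fix s t assume s: "s \<in> carrier (lsec ?M W)" and t: "t \<in> carrier (lsec ?M W)"
      then have s': "s \<in> osec ?B W" and t': "t \<in> osec ?B W" by (simp_all add: ring_bundle_carrier)
      have "(\<lambda>x\<in>?P. s x \<oplus>\<^bsub>rsec Y (W \<inter> V (\<tau> x))\<^esub> t x) \<in> osec ?B W" (is "?st \<in> _")
      proof (rule C.bundle_secI'[OF a idx])
        show "?st x \<in> carrier (msec (mon_of Y) (W \<inter> V (\<tau> x)))" if "x \<in> topspace (mtop (mon_of Y))" for x
          using that abelian_monoid.a_closed[OF am[of x] sec[OF s', of x] sec[OF t', of x]] by simp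
        fix x y Z assume "x \<in> topspace (mtop (mon_of Y))" "y \<in> topspace (mtop (mon_of Y))" and Z: "Z = W \<inter> V (\<tau> x) \<inter> V (\<tau> y)"
          and "openin (mtop (mon_of Y)) Z"
        then have x: "x \<in> ?P" "y \<in> ?P" and oZ: "ropn Z" by simp_all
        interpret Z: cring "rsec Y Z" by (rule cring_sections[OF oZ])
        have Zs: "Z \<subseteq> W \<inter> V (\<tau> x)" "Z \<subseteq> W \<inter> V (\<tau> y)" "Z \<subseteq> V (\<tau> x) \<inter> V (\<tau> y)" using Z by auto
        have h: "rres Y (W \<inter> V (\<tau> x)) Z \<in> ring_hom (rsec Y (W \<inter> V (\<tau> x))) (rsec Y Z)"
          "rres Y (W \<inter> V (\<tau> y)) Z \<in> ring_hom (rsec Y (W \<inter> V (\<tau> y))) (rsec Y Z)"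
          by (rule ring_hom_res[OF o[OF W x(1)] oZ Zs(1)], rule ring_hom_res[OF o[OF W x(2)] oZ Zs(2)])
        have c: "rres Y (V (\<tau> x) \<inter> V (\<tau> y)) Z (a (\<tau> x, \<tau> y)) \<in> carrier (rsec Y Z)"
          using M.res_closed[OF C.opn_cover2[OF \<tau>[OF x(1)] \<tau>[OF x(2)]] _ Zs(3) C.cocycle_section[OF a \<tau>[OF x(1)] \<tau>[OF x(2)]]] oZ
          by simp
        have cs: "rres Y (W \<inter> V (\<tau> x)) Z (s x) =
            rres Y (V (\<tau> x) \<inter> V (\<tau> y)) Z (a (\<tau> x, \<tau> y)) \<otimes>\<^bsub>rsec Y Z\<^esub> rres Y (W \<inter> V (\<tau> y)) Z (s y)"
          using s' x unfolding Z by (simp add: sec_iff)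
        have ct: "rres Y (W \<inter> V (\<tau> x)) Z (t x) =
            rres Y (V (\<tau> x) \<inter> V (\<tau> y)) Z (a (\<tau> x, \<tau> y)) \<otimes>\<^bsub>rsec Y Z\<^esub> rres Y (W \<inter> V (\<tau> y)) Z (t y)"
          using t' x unfolding Z by (simp add: sec_iff)
        show "mres (mon_of Y) (W \<inter> V (\<tau> x)) Z (?st x) = mres (mon_of Y) (V (\<tau> x) \<inter> V (\<tau> y)) Z (a (\<tau> x, \<tau> y))
            \<otimes>\<^bsub>msec (mon_of Y) Z\<^esub> mres (mon_of Y) (W \<inter> V (\<tau> y)) Z (?st y)"
          using x by (simp add: ring_hom_add[OF h(1) sec[OF s' x(1)] sec[OF t' x(1)]] cs ct
            ring_hom_add[OF h(2) sec[OF s' x(2)] sec[OF t' x(2)]]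
            Z.r_distr[OF ring_hom_closed[OF h(2) sec[OF s' x(2)]] ring_hom_closed[OF h(2) sec[OF t' x(2)]] c])
      qed (use W in simp_all)
      then show "s \<oplus>\<^bsub>lsec ?M W\<^esub> t \<in> carrier (lsec ?M W)" by (simp add: ring_bundle_carrier ring_bundle_add)
      show "s \<oplus>\<^bsub>lsec ?M W\<^esub> t = t \<oplus>\<^bsub>lsec ?M W\<^esub> s"
        unfolding ring_bundle_add
        by (rule restrict_ext) (use abelian_monoid.a_comm[OF am sec[OF s'] sec[OF t']] in simp)
      fix u assume "u \<in> carrier (lsec ?M W)"
      then have u': "u \<in> osec ?B W" by (simp add: ring_bundle_carrier)
      show "s \<oplus>\<^bsub>lsec ?M W\<^esub> t \<oplus>\<^bsub>lsec ?M W\<^esub> u = s \<oplus>\<^bsub>lsec ?M W\<^esub> (t \<oplus>\<^bsub>lsec ?M W\<^esub> u)"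
        unfolding ring_bundle_add
        by (rule restrict_ext) (use abelian_monoid.a_assoc[OF am sec[OF s'] sec[OF t'] sec[OF u']] in simp)
    next
      show "\<zero>\<^bsub>lsec ?M W\<^esub> \<in> carrier (lsec ?M W)"
        unfolding ring_bundle_carrier ring_bundle_zero
      proof (rule C.bundle_secI'[OF a idx])
        show "(\<lambda>x\<in>?P. \<zero>\<^bsub>rsec Y (W \<inter> V (\<tau> x))\<^esub>) x \<in> carrier (msec (mon_of Y) (W \<inter> V (\<tau> x)))"
          if "x \<in> topspace (mtop (mon_of Y))" for x
          using that abelian_monoid.zero_closed[OF am[of x]] by simp
        fix x y Z assume "x \<in> topspace (mtop (mon_of Y))" "y \<in> topspace (mtop (mon_of Y))" and Z: "Z = W \<inter> V (\<tau> x) \<inter> V (\<tau> y)"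
          and "openin (mtop (mon_of Y)) Z"
        then have x: "x \<in> ?P" "y \<in> ?P" and oZ: "ropn Z" by simp_all
        interpret Z: cring "rsec Y Z" by (rule cring_sections[OF oZ])
        have Zs: "Z \<subseteq> W \<inter> V (\<tau> x)" "Z \<subseteq> W \<inter> V (\<tau> y)" "Z \<subseteq> V (\<tau> x) \<inter> V (\<tau> y)" using Z by auto
        have h: "rres Y (W \<inter> V (\<tau> x)) Z \<in> ring_hom (rsec Y (W \<inter> V (\<tau> x))) (rsec Y Z)"
          "rres Y (W \<inter> V (\<tau> y)) Z \<in> ring_hom (rsec Y (W \<inter> V (\<tau> y))) (rsec Y Z)"
          by (rule ring_hom_res[OF o[OF W x(1)] oZ Zs(1)], rule ring_hom_res[OF o[OF W x(2)] oZ Zs(2)])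
        have c: "rres Y (V (\<tau> x) \<inter> V (\<tau> y)) Z (a (\<tau> x, \<tau> y)) \<in> carrier (rsec Y Z)"
          using M.res_closed[OF C.opn_cover2[OF \<tau>[OF x(1)] \<tau>[OF x(2)]] _ Zs(3) C.cocycle_section[OF a \<tau>[OF x(1)] \<tau>[OF x(2)]]] oZ
          by simp
        show "mres (mon_of Y) (W \<inter> V (\<tau> x)) Z ((\<lambda>x\<in>?P. \<zero>\<^bsub>rsec Y (W \<inter> V (\<tau> x))\<^esub>) x) = mres (mon_of Y) (V (\<tau> x) \<inter> V (\<tau> y)) Z (a (\<tau> x, \<tau> y))
            \<otimes>\<^bsub>msec (mon_of Y) Z\<^esub> mres (mon_of Y) (W \<inter> V (\<tau> y)) Z ((\<lambda>x\<in>?P. \<zero>\<^bsub>rsec Y (W \<inter> V (\<tau> x))\<^esub>) y)"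
          using x c by (simp add: ring_hom_zero[OF h(1) ri[OF x(1)] Z.ring_axioms] ring_hom_zero[OF h(2) ri[OF x(2)] Z.ring_axioms])
      qed (use W in simp_all)
    next
      fix s assume s: "s \<in> carrier (lsec ?M W)"
      then have s': "s \<in> osec ?B W" by (simp add: ring_bundle_carrier)
      show "\<zero>\<^bsub>lsec ?M W\<^esub> \<oplus>\<^bsub>lsec ?M W\<^esub> s = s"
        by (rule extensionalityI[of _ ?P])
          (use ext[OF s'] abelian_monoid.l_zero[OF am sec[OF s']] in \<open>simp_all add: ring_bundle_add ring_bundle_zero\<close>)
      \<comment> \<open>The negative is taken as the multiple by minus one, which is known to be a
        section because the action is closed.\<close>
      let ?n = "(\<ominus>\<^bsub>rsec Y W\<^esub> \<one>\<^bsub>rsec Y W\<^esub>) \<odot>\<^bsub>lsec ?M W\<^esub> s"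
      have "?n \<oplus>\<^bsub>lsec ?M W\<^esub> s = \<zero>\<^bsub>lsec ?M W\<^esub>"
        unfolding ring_bundle_add ring_bundle_zero
      proof (rule restrict_ext)
        fix x assume x: "x \<in> ?P"
        interpret Z: cring "rsec Y (W \<inter> V (\<tau> x))" by (rule cr[OF x])
        let ?h = "rres Y W (W \<inter> V (\<tau> x)) (\<ominus>\<^bsub>rsec Y W\<^esub> \<one>\<^bsub>rsec Y W\<^esub>)"
        have h: "?h \<in> carrier (rsec Y (W \<inter> V (\<tau> x)))" by (rule ring_hom_closed[OF rr[OF W x]]) simp
        have "?h \<oplus>\<^bsub>rsec Y (W \<inter> V (\<tau> x))\<^esub> \<one>\<^bsub>rsec Y (W \<inter> V (\<tau> x))\<^esub> = \<zero>\<^bsub>rsec Y (W \<inter> V (\<tau> x))\<^esub>"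
          using ring_hom_add[OF rr[OF W x], of "\<ominus>\<^bsub>rsec Y W\<^esub> \<one>\<^bsub>rsec Y W\<^esub>" "\<one>\<^bsub>rsec Y W\<^esub>"]
            ring_hom_one[OF rr[OF W x]] ring_hom_zero[OF rr[OF W x] R.ring_axioms Z.ring_axioms] by (simp add: R.l_neg)
        from arg_cong[OF this, of "\<lambda>z. z \<otimes>\<^bsub>rsec Y (W \<inter> V (\<tau> x))\<^esub> s x"]
        show "?n x \<oplus>\<^bsub>rsec Y (W \<inter> V (\<tau> x))\<^esub> s x = \<zero>\<^bsub>rsec Y (W \<inter> V (\<tau> x))\<^esub>"
          using x sec[OF s' x] h by (simp add: ring_bundle_smult act Z.l_distr)
      qed
      then show "\<exists>t\<in>carrier (lsec ?M W). t \<oplus>\<^bsub>lsec ?M W\<^esub> s = \<zero>\<^bsub>lsec ?M W\<^esub>"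
        using smc[OF _ s, of "\<ominus>\<^bsub>rsec Y W\<^esub> \<one>\<^bsub>rsec Y W\<^esub>"] by auto
    qed
    fix b s assume b: "b \<in> carrier (rsec Y W)" and s: "s \<in> carrier (lsec ?M W)"
    then have s': "s \<in> osec ?B W" by (simp add: ring_bundle_carrier)
    show "b \<odot>\<^bsub>lsec ?M W\<^esub> s \<in> carrier (lsec ?M W)" by (rule smc[OF b s])
    fix b' assume b': "b' \<in> carrier (rsec Y W)"
    show "(b \<oplus>\<^bsub>rsec Y W\<^esub> b') \<odot>\<^bsub>lsec ?M W\<^esub> s = b \<odot>\<^bsub>lsec ?M W\<^esub> s \<oplus>\<^bsub>lsec ?M W\<^esub> b' \<odot>\<^bsub>lsec ?M W\<^esub> s"
    proof (rule extensionalityI[of _ ?P])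
      fix x assume x: "x \<in> ?P"
      show "((b \<oplus>\<^bsub>rsec Y W\<^esub> b') \<odot>\<^bsub>lsec ?M W\<^esub> s) x = (b \<odot>\<^bsub>lsec ?M W\<^esub> s \<oplus>\<^bsub>lsec ?M W\<^esub> b' \<odot>\<^bsub>lsec ?M W\<^esub> s) x"
        using x by (simp add: ring_bundle_add ring_bundle_smult act ring_hom_add[OF rr[OF W x] b b']
          ring.ring_simprules(13)[OF ri[OF x]] ring_hom_closed[OF rr[OF W x]] b b' sec[OF s' x])
    qed (simp_all add: ring_bundle_add ring_bundle_smult act)
    show "(b \<otimes>\<^bsub>rsec Y W\<^esub> b') \<odot>\<^bsub>lsec ?M W\<^esub> s = b \<odot>\<^bsub>lsec ?M W\<^esub> (b' \<odot>\<^bsub>lsec ?M W\<^esub> s)"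
      using M.oact_mult[OF B, of W b b' s] b b' W s' by (simp add: ring_bundle_smult)
  next
    fix b s t assume b: "b \<in> carrier (rsec Y W)" and s: "s \<in> carrier (lsec ?M W)" and t: "t \<in> carrier (lsec ?M W)"
    then have s': "s \<in> osec ?B W" and t': "t \<in> osec ?B W" by (simp_all add: ring_bundle_carrier)
    have ri: "ring (rsec Y (W \<inter> V (\<tau> x)))" if "x \<in> ?P" for x by (rule cring.axioms(1)[OF cring_sections[OF o[OF W that]]])
    show "b \<odot>\<^bsub>lsec ?M W\<^esub> (s \<oplus>\<^bsub>lsec ?M W\<^esub> t) = b \<odot>\<^bsub>lsec ?M W\<^esub> s \<oplus>\<^bsub>lsec ?M W\<^esub> b \<odot>\<^bsub>lsec ?M W\<^esub> t"
    proof (rule extensionalityI[of _ ?P])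
      fix x assume x: "x \<in> ?P"
      show "(b \<odot>\<^bsub>lsec ?M W\<^esub> (s \<oplus>\<^bsub>lsec ?M W\<^esub> t)) x = (b \<odot>\<^bsub>lsec ?M W\<^esub> s \<oplus>\<^bsub>lsec ?M W\<^esub> b \<odot>\<^bsub>lsec ?M W\<^esub> t) x"
        using x by (simp add: ring_bundle_add ring_bundle_smult act
          ring.ring_simprules(23)[OF ri[OF x]] ring_hom_closed[OF rr[OF W x]] b sec[OF s' x] sec[OF t' x])
    qed (simp_all add: ring_bundle_add ring_bundle_smult act)
  next
    fix s assume "s \<in> carrier (lsec ?M W)"
    then have s': "s \<in> osec ?B W" by (simp add: ring_bundle_carrier)
    show "\<one>\<^bsub>rsec Y W\<^esub> \<odot>\<^bsub>lsec ?M W\<^esub> s = s"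
      using M.oact_one[OF B, of W s] W s' by (simp add: ring_bundle_smult)
  qed
  {
    fix W W' s t assume "ropn W \<and> ropn W' \<and> W' \<subseteq> W" and st: "s \<in> carrier (lsec ?M W)" "t \<in> carrier (lsec ?M W)"
    then have W: "ropn W" "ropn W'" "W' \<subseteq> W" and s': "s \<in> osec ?B W" and t': "t \<in> osec ?B W"
      by (simp_all add: ring_bundle_carrier)
    have h: "rres Y (W \<inter> V (\<tau> x)) (W' \<inter> V (\<tau> x)) \<in> ring_hom (rsec Y (W \<inter> V (\<tau> x))) (rsec Y (W' \<inter> V (\<tau> x)))" if "x \<in> ?P" for x
      by (rule ring_hom_res[OF o[OF W(1) that] o[OF W(2) that]]) (use W in blast)
    show "lres ?M W W' (s \<oplus>\<^bsub>lsec ?M W\<^esub> t) = lres ?M W W' s \<oplus>\<^bsub>lsec ?M W'\<^esub> lres ?M W W' t"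
    proof (rule extensionalityI[of _ ?P])
      fix x assume x: "x \<in> ?P"
      show "lres ?M W W' (s \<oplus>\<^bsub>lsec ?M W\<^esub> t) x = (lres ?M W W' s \<oplus>\<^bsub>lsec ?M W'\<^esub> lres ?M W W' t) x"
        using x ring_hom_add[OF h[OF x] sec[OF s' x] sec[OF t' x]] by (simp add: ring_bundle_of_def res)
    qed (simp_all add: ring_bundle_of_def res)
  }
  {
    fix W W' b s assume "ropn W \<and> ropn W' \<and> W' \<subseteq> W" "b \<in> carrier (rsec Y W)" "s \<in> carrier (lsec ?M W)"
    then show "lres ?M W W' (b \<odot>\<^bsub>lsec ?M W\<^esub> s) = rres Y W W' b \<odot>\<^bsub>lsec ?M W'\<^esub> lres ?M W W' s"
      using M.ores_oact[OF B, of W W' b s] by (simp add: ring_bundle_of_def)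
  }
qed

end

lemma exists_ring_bundle:
  assumes a: "cocycle (mon_of Y) I V a"
  obtains N :: "('y, 'r, 'y \<Rightarrow> 'r) omod" and e where "rline_bundle Y N" "trivialization (mon_of Y) I V (oset_of N) a e"
proof -
  have "\<forall>x\<in>topspace (mtop (mon_of Y)). \<exists>i. i \<in> I \<and> x \<in> V i" using C.cover by blast
  then obtain \<tau> where \<tau>: "\<forall>x\<in>topspace (mtop (mon_of Y)). \<tau> x \<in> I \<and> x \<in> V (\<tau> x)" by (rule bchoice[THEN exE])
  note N = omod_sheaf_ring_bundle[OF a \<tau>] and t = C.trivialization_bundle[OF a \<tau>]
  have "rline_bundle Y (ring_bundle_of a \<tau>)"
    by (rule mline_imp_rline_bundle[OF N])
      (use C.trivialization_mline_bundle[OF C.oset_sheaf_bundle[OF a \<tau>] t] in \<open>simp add: oset_of_ring_bundle\<close>)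
  then show thesis
    by (rule that) (simp only: oset_of_ring_bundle, rule t)
qed

end

text \<open>Clears the inverse that the Cech differential \<open>cech_d1\<close> contains.\<close>

lemma (in comm_monoid) Units_mult_inv_cancel:
  assumes y: "y \<in> Units G" and x: "x \<in> carrier G" "z \<in> carrier G"
  shows "y \<otimes> (x \<otimes> inv y \<otimes> z) = x \<otimes> z"
proof -
  have "y \<otimes> (x \<otimes> inv y \<otimes> z) = x \<otimes> ((y \<otimes> inv y) \<otimes> z)"
    using assms Units_closed[OF y] Units_inv_closed[OF y] by (simp only: m_assoc m_lcomm m_closed)
  then show ?thesis using assms by simp
qed

section \<open>Coboundaries\<close>

context covered_space
begin

definition coboundary :: "('i \<Rightarrow> 'a) \<Rightarrow> 'i \<times> 'i \<Rightarrow> 'a" where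
  "coboundary u = (\<lambda>(i, j). mres X (V j) (V i \<inter> V j) (u j) \<otimes>\<^bsub>\<O> (V i \<inter> V j)\<^esub>
     inv\<^bsub>\<O> (V i \<inter> V j)\<^esub> mres X (V i) (V i \<inter> V j) (u i))"

lemma coboundary_Units:
  assumes u: "\<forall>i\<in>I. u i \<in> Units (\<O> (V i))" and i: "i \<in> I" "j \<in> I"
  shows "mres X (V i) (V i \<inter> V j) (u i) \<in> Units (\<O> (V i \<inter> V j))"
    "mres X (V j) (V i \<inter> V j) (u j) \<in> Units (\<O> (V i \<inter> V j))"
    "coboundary u (i, j) \<in> Units (\<O> (V i \<inter> V j))"
proof -
  note o = opn_cover2[OF i]
  show *: "mres X (V i) (V i \<inter> V j) (u i) \<in> Units (\<O> (V i \<inter> V j))"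
    "mres X (V j) (V i \<inter> V j) (u j) \<in> Units (\<O> (V i \<inter> V j))"
    using i u by (auto intro!: res_Units opn_cover o)
  show "coboundary u (i, j) \<in> Units (\<O> (V i \<inter> V j))"
    unfolding coboundary_def using Units_mult[OF o *(2) Units_inv_Units'[OF o *(1)]] by simp
qed

lemma coboundary_mult_left:
  assumes u: "\<forall>i\<in>I. u i \<in> Units (\<O> (V i))" and i: "i \<in> I" "j \<in> I"
  shows "coboundary u (i, j) \<otimes>\<^bsub>\<O> (V i \<inter> V j)\<^esub> mres X (V i) (V i \<inter> V j) (u i) = mres X (V j) (V i \<inter> V j) (u j)"
proof -
  note o = opn_cover2[OF i] and c = coboundary_Units[OF u i]
  show ?thesis
    unfolding coboundary_def
    by (simp add: mult_assoc[OF o] Units_section[OF c(1)] Units_section[OF c(2)] Units_inv_closed'[OF o c(1)]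
        Units_inv_left[OF o c(1)] one_right[OF o])
qed

text \<open>A coboundary is the transition function of the generators \<open>u i\<close> of the structure sheaf.\<close>

lemma coboundary_cocycle:
  assumes u: "\<forall>i\<in>I. u i \<in> Units (\<O> (V i))"
  shows "cocycle X I V (coboundary u)"
proof (rule trivialization_cocycle[OF oset_sheaf_structure])
  show "trivialization X I V (structure_oset X) (coboundary u) u"
    unfolding trivialization_def
  proof (intro conjI ballI)
    fix i assume i: "i \<in> I"
    have "mgenerator X (structure_oset X) (V i) (oact (structure_oset X) (V i) (u i) \<one>\<^bsub>\<O> (V i)\<^esub>)"
      by (rule mgenerator_unit_mult[OF oset_sheaf_structure opn_cover[OF i] mgenerator_structure_one[OF opn_cover[OF i]] bspec[OF u i]])
    then show "mgenerator X (structure_oset X) (V i) (u i)"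
      by (simp add: structure_oset_def one_right[OF opn_cover[OF i] Units_section[OF bspec[OF u i]]])
  qed (simp add: structure_oset_def coboundary_mult_left[OF u])
qed (rule Units_section[OF coboundary_Units(3)[OF u]])

text \<open>Multiplication by the unit restricted from \<open>u i\<close> passes between the
  quotient form and the division-free one. The quotient form is the one that cosets of the image of
  \<open>cech_d0\<close> produce.\<close>

lemma cohomologous_iff_coboundary:
  assumes a: "cocycle X I V a" and b: "cocycle X I V b"
  shows "cohomologous X I V a b \<longleftrightarrow>
    (\<exists>u. (\<forall>i\<in>I. u i \<in> Units (\<O> (V i))) \<and> (\<forall>i\<in>I. \<forall>j\<in>I. b (i, j) = coboundary u (i, j) \<otimes>\<^bsub>\<O> (V i \<inter> V j)\<^esub> a (i, j)))"
  unfolding cohomologous_def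
proof (intro arg_cong[of _ _ Ex] ext conj_cong refl ball_cong)
  fix u i j assume u: "\<forall>i\<in>I. u i \<in> Units (\<O> (V i))" and i: "i \<in> I" "j \<in> I"
  note o = opn_cover2[OF i] and c = coboundary_Units[OF u i]
  let ?M = "\<O> (V i \<inter> V j)" and ?ui = "mres X (V i) (V i \<inter> V j) (u i)" and ?uj = "mres X (V j) (V i \<inter> V j) (u j)"
  note aij = cocycle_section[OF a i] and bij = cocycle_section[OF b i]
  note cc = Units_section[OF c(1)] Units_section[OF c(2)] Units_section[OF c(3)]
  have "?ui \<otimes>\<^bsub>?M\<^esub> (coboundary u (i, j) \<otimes>\<^bsub>?M\<^esub> a (i, j)) = (coboundary u (i, j) \<otimes>\<^bsub>?M\<^esub> ?ui) \<otimes>\<^bsub>?M\<^esub> a (i, j)"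
    by (simp add: mult_assoc[OF o] mult_lcomm[OF o] cc aij)
  also have "\<dots> = a (i, j) \<otimes>\<^bsub>?M\<^esub> ?uj"
    unfolding coboundary_mult_left[OF u i] by (rule mult_comm[OF o cc(2) aij])
  finally have *: "?ui \<otimes>\<^bsub>?M\<^esub> (coboundary u (i, j) \<otimes>\<^bsub>?M\<^esub> a (i, j)) = a (i, j) \<otimes>\<^bsub>?M\<^esub> ?uj" .
  show "(b (i, j) \<otimes>\<^bsub>?M\<^esub> ?ui = a (i, j) \<otimes>\<^bsub>?M\<^esub> ?uj) = (b (i, j) = coboundary u (i, j) \<otimes>\<^bsub>?M\<^esub> a (i, j))"
    unfolding *[symmetric] mult_comm[OF o bij cc(1)]
    by (rule Units_cancel[OF o c(1) bij mult_closed[OF o cc(3) aij]])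
qed

lemma cohomologous_mult:
  assumes a: "cocycle X I V a" "cocycle X I V b" and a': "cocycle X I V a'" "cocycle X I V b'"
    and ab: "cohomologous X I V a b" and ab': "cohomologous X I V a' b'"
  shows "cohomologous X I V (\<lambda>(i, j). a (i, j) \<otimes>\<^bsub>\<O> (V i \<inter> V j)\<^esub> a' (i, j)) (\<lambda>(i, j). b (i, j) \<otimes>\<^bsub>\<O> (V i \<inter> V j)\<^esub> b' (i, j))"
proof -
  obtain u where u: "\<forall>i\<in>I. u i \<in> Units (\<O> (V i))"
    "\<And>i j. i \<in> I \<Longrightarrow> j \<in> I \<Longrightarrow> b (i, j) \<otimes>\<^bsub>\<O> (V i \<inter> V j)\<^esub> mres X (V i) (V i \<inter> V j) (u i) =
           a (i, j) \<otimes>\<^bsub>\<O> (V i \<inter> V j)\<^esub> mres X (V j) (V i \<inter> V j) (u j)"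
    using ab unfolding cohomologous_def by blast
  obtain u' where u': "\<forall>i\<in>I. u' i \<in> Units (\<O> (V i))"
    "\<And>i j. i \<in> I \<Longrightarrow> j \<in> I \<Longrightarrow> b' (i, j) \<otimes>\<^bsub>\<O> (V i \<inter> V j)\<^esub> mres X (V i) (V i \<inter> V j) (u' i) =
           a' (i, j) \<otimes>\<^bsub>\<O> (V i \<inter> V j)\<^esub> mres X (V j) (V i \<inter> V j) (u' j)"
    using ab' unfolding cohomologous_def by blast
  show ?thesis
    unfolding cohomologous_def
  proof (intro exI[of _ "\<lambda>i. u i \<otimes>\<^bsub>\<O> (V i)\<^esub> u' i"] conjI ballI)
    show "u i \<otimes>\<^bsub>\<O> (V i)\<^esub> u' i \<in> Units (\<O> (V i))" if "i \<in> I" for i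
      by (rule Units_mult[OF opn_cover[OF that] bspec[OF u(1) that] bspec[OF u'(1) that]])
    fix i j assume i: "i \<in> I" "j \<in> I"
    note o = opn_cover2[OF i] and c = coboundary_Units[OF u(1) i] and c' = coboundary_Units[OF u'(1) i]
    let ?M = "\<O> (V i \<inter> V j)"
    have sh: "(x \<otimes>\<^bsub>?M\<^esub> y) \<otimes>\<^bsub>?M\<^esub> (z \<otimes>\<^bsub>?M\<^esub> w) = (x \<otimes>\<^bsub>?M\<^esub> z) \<otimes>\<^bsub>?M\<^esub> (y \<otimes>\<^bsub>?M\<^esub> w)"
      if "x \<in> carrier ?M" "y \<in> carrier ?M" "z \<in> carrier ?M" "w \<in> carrier ?M" for x y z w
      using that by (simp add: mult_assoc[OF o] mult_closed[OF o] mult_lcomm[OF o, of y])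
    have r: "mres X (V i) (V i \<inter> V j) (u i \<otimes>\<^bsub>\<O> (V i)\<^esub> u' i) =
        mres X (V i) (V i \<inter> V j) (u i) \<otimes>\<^bsub>?M\<^esub> mres X (V i) (V i \<inter> V j) (u' i)"
      "mres X (V j) (V i \<inter> V j) (u j \<otimes>\<^bsub>\<O> (V j)\<^esub> u' j) =
        mres X (V j) (V i \<inter> V j) (u j) \<otimes>\<^bsub>?M\<^esub> mres X (V j) (V i \<inter> V j) (u' j)"
      using i u(1) u'(1) by (simp_all add: res_mult opn_cover o Units_section)
    note s = Units_section[OF c(1)] Units_section[OF c(2)] Units_section[OF c'(1)] Units_section[OF c'(2)]
    show "(case (i, j) of (i, j) \<Rightarrow> b (i, j) \<otimes>\<^bsub>\<O> (V i \<inter> V j)\<^esub> b' (i, j)) \<otimes>\<^bsub>?M\<^esub> mres X (V i) (V i \<inter> V j) (u i \<otimes>\<^bsub>\<O> (V i)\<^esub> u' i) =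
       (case (i, j) of (i, j) \<Rightarrow> a (i, j) \<otimes>\<^bsub>\<O> (V i \<inter> V j)\<^esub> a' (i, j)) \<otimes>\<^bsub>?M\<^esub> mres X (V j) (V i \<inter> V j) (u j \<otimes>\<^bsub>\<O> (V j)\<^esub> u' j)"
      unfolding r prod.case
      by (simp only: sh[OF cocycle_section[OF a(1) i] cocycle_section[OF a'(1) i] s(2,4)]
          sh[OF cocycle_section[OF a(2) i] cocycle_section[OF a'(2) i] s(1,3)] u(2)[OF i] u'(2)[OF i])
  qed
qed

lemma cocycle_cong:
  assumes "\<And>i j. i \<in> I \<Longrightarrow> j \<in> I \<Longrightarrow> a (i, j) = b (i, j)"
  shows "cocycle X I V a \<longleftrightarrow> cocycle X I V b"
  unfolding cocycle_def using assms by simp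

lemma cohomologous_cong:
  assumes "\<And>i j. i \<in> I \<Longrightarrow> j \<in> I \<Longrightarrow> a (i, j) = a' (i, j)" "\<And>i j. i \<in> I \<Longrightarrow> j \<in> I \<Longrightarrow> b (i, j) = b' (i, j)"
  shows "cohomologous X I V a b \<longleftrightarrow> cohomologous X I V a' b'"
  unfolding cohomologous_def using assms by simp

end

section \<open>Cech cohomology and the Picard group of a ringed space\<close>

context ringed_cover
begin

text \<open>Counterpart of \<open>line_class\<close>: the members are modules, the trivializations
  are those of the underlying O-sets.\<close>

definition ring_class :: "('i \<times> 'i \<Rightarrow> 'r) \<Rightarrow> ('y, 'r, 'y \<Rightarrow> 'r) omod set" where
  "ring_class g = {N. rline_bundle Y N \<and> (\<exists>f. trivialization (mon_of Y) I V (oset_of N) g f)}"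

lemma rline_oset_sheaf: "rline_bundle Y L \<Longrightarrow> oset_sheaf (mon_of Y) (oset_of L)"
  by (rule omod_imp_oset_sheaf[OF rline_bundle_sheaf])

text \<open>Equal cocycles give isomorphic O-sets, and by \<open>oset_iso_imp_omod_iso\<close> such
  an isomorphism is one of modules.\<close>

lemma rclass_eq_ring_class:
  assumes L: "rline_bundle Y L" and g: "cocycle (mon_of Y) I V g" and e: "trivialization (mon_of Y) I V (oset_of L) g e"
  shows "rclass Y L = ring_class g"
proof (intro subset_antisym subsetI)
  fix N assume "N \<in> rclass Y L"
  then have N: "rline_bundle Y N" and iso: "omod_iso_on Y (topspace (rtop Y)) L N" by (simp_all add: rclass_def)
  have iso': "oset_iso_on (mon_of Y) (topspace (mtop (mon_of Y))) (oset_of L) (oset_of N)"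
    using omod_iso_on_imp_oset_iso_on[OF iso] by simp
  obtain f where "trivialization (mon_of Y) I V (oset_of N) g f"
    using rline_oset_sheaf[OF L] g e iso' by (rule C.trivialization_iso)
  then show "N \<in> ring_class g" using N by (auto simp: ring_class_def)
next
  fix N assume "N \<in> ring_class g"
  then obtain f where N: "rline_bundle Y N" and f: "trivialization (mon_of Y) I V (oset_of N) g f"
    by (auto simp: ring_class_def)
  have "oset_iso_on (mon_of Y) (topspace (mtop (mon_of Y))) (oset_of L) (oset_of N)"
    by (rule C.oset_iso_on_same_cocycle[OF rline_oset_sheaf[OF L] rline_oset_sheaf[OF N] g e f])
  then have "omod_iso_on Y (topspace (rtop Y)) L N"
    using oset_iso_imp_omod_iso[OF L rline_bundle_sheaf[OF N]] by simp
  then show "N \<in> rclass Y L" using N by (simp add: rclass_def)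
qed

lemma ring_class_nonempty:
  assumes g: "cocycle (mon_of Y) I V g"
  obtains N where "N \<in> ring_class g"
proof -
  obtain N :: "('y, 'r, 'y \<Rightarrow> 'r) omod" and e where "rline_bundle Y N" "trivialization (mon_of Y) I V (oset_of N) g e"
    using g by (rule exists_ring_bundle)
  then have "N \<in> ring_class g" by (auto simp: ring_class_def)
  then show thesis by (rule that)
qed

lemma ring_class_cohomologous:
  assumes g: "cocycle (mon_of Y) I V g" "cocycle (mon_of Y) I V h" and N: "N \<in> ring_class g" "N \<in> ring_class h"
  shows "cohomologous (mon_of Y) I V g h"
proof -
  from N obtain e f where "rline_bundle Y N" "trivialization (mon_of Y) I V (oset_of N) g e" "trivialization (mon_of Y) I V (oset_of N) h f"
    by (auto simp: ring_class_def)
  then show ?thesis by (intro C.cohomologous_of_trivializations[OF rline_oset_sheaf g])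
qed

lemma ring_class_subset:
  assumes g: "cocycle (mon_of Y) I V g" "cocycle (mon_of Y) I V h" "cohomologous (mon_of Y) I V g h"
  shows "ring_class g \<subseteq> ring_class h"
proof
  fix N assume "N \<in> ring_class g"
  then obtain e where N: "rline_bundle Y N" and e: "trivialization (mon_of Y) I V (oset_of N) g e" by (auto simp: ring_class_def)
  obtain f where "trivialization (mon_of Y) I V (oset_of N) h f"
    using rline_oset_sheaf[OF N] g(1,2) e g(3) by (rule C.trivialization_cohomologous)
  then show "N \<in> ring_class h" using N by (auto simp: ring_class_def)
qed

lemma ring_class_eq_iff:
  assumes a: "cocycle (mon_of Y) I V a" and b: "cocycle (mon_of Y) I V b"
  shows "ring_class a = ring_class b \<longleftrightarrow> cohomologous (mon_of Y) I V a b"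
proof
  assume eq: "ring_class a = ring_class b"
  obtain N where "N \<in> ring_class a" using ring_class_nonempty[OF a] .
  then show "cohomologous (mon_of Y) I V a b" using ring_class_cohomologous[OF a b] eq by blast
next
  assume ab: "cohomologous (mon_of Y) I V a b"
  note sub = ring_class_subset[OF a b ab]
  obtain N where N: "N \<in> ring_class a" using ring_class_nonempty[OF a] .
  then have "cohomologous (mon_of Y) I V b a" using ring_class_cohomologous[OF b a] sub by blast
  then show "ring_class a = ring_class b" using sub ring_class_subset[OF b a] by blast
qed

lemma ring_class_tensor:
  assumes a: "cocycle (mon_of Y) I V a" and b: "cocycle (mon_of Y) I V b"
  shows "{N. rline_bundle Y N \<and> (\<exists>L\<in>ring_class a. \<exists>L'\<in>ring_class b. rtensor Y L L' N)} =
    ring_class (\<lambda>(i, j). a (i, j) \<otimes>\<^bsub>rsec Y (V i \<inter> V j)\<^esub> b (i, j))" (is "?T = ring_class ?ab")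
proof (intro subset_antisym subsetI)
  fix N assume "N \<in> ?T"
  then obtain L L' :: "('y, 'r, 'y \<Rightarrow> 'r) omod" and e e' where N: "rline_bundle Y N" and t: "rtensor Y L L' N" and L: "rline_bundle Y L" "rline_bundle Y L'"
    and e: "trivialization (mon_of Y) I V (oset_of L) a e" "trivialization (mon_of Y) I V (oset_of L') b e'"
    by (auto simp: ring_class_def)
  obtain f where "trivialization (mon_of Y) I V (oset_of N) (\<lambda>(i, j). a (i, j) \<otimes>\<^bsub>msec (mon_of Y) (V i \<inter> V j)\<^esub> b (i, j)) f"
    by (rule C.trivialization_tensor[OF rline_oset_sheaf[OF L(1)] rline_oset_sheaf[OF L(2)] rline_oset_sheaf[OF N] a b e rtensor_imp_mtensor[OF t]])
  then show "N \<in> ring_class ?ab" using N by (auto simp: ring_class_def)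
next
  fix N assume "N \<in> ring_class ?ab"
  then obtain f where N: "rline_bundle Y N"
    and f: "trivialization (mon_of Y) I V (oset_of N) (\<lambda>(i, j). a (i, j) \<otimes>\<^bsub>msec (mon_of Y) (V i \<inter> V j)\<^esub> b (i, j)) f" by (auto simp: ring_class_def)
  obtain L where LL: "L \<in> ring_class a" using ring_class_nonempty[OF a] .
  obtain L' where LL': "L' \<in> ring_class b" using ring_class_nonempty[OF b] .
  obtain e e' where L: "rline_bundle Y L" "rline_bundle Y L'"
    and e: "trivialization (mon_of Y) I V (oset_of L) a e" "trivialization (mon_of Y) I V (oset_of L') b e'"
    using LL LL' by (auto simp: ring_class_def)
  have "mtensor (mon_of Y) (oset_of L) (oset_of L') (oset_of N)"
    by (rule C.mtensor_mult_cocycle[OF rline_oset_sheaf[OF L(1)] rline_oset_sheaf[OF L(2)] rline_oset_sheaf[OF N] a b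
      C.cocycle_mult[OF a b] e f]) simp
  then have "rtensor Y L L' N" by (rule mtensor_imp_rtensor[OF L rline_bundle_sheaf[OF N]])
  then show "N \<in> ?T" using N LL LL' by blast
qed

lemma cech_to_pic_eq: "cech_to_pic Y I V Q = (\<Union>g\<in>Q. ring_class g)"
  by (auto simp: cech_to_pic_def ring_class_def trivialization_def rgenerator_iff_mgenerator)

text \<open>Extensionality is imposed because \<open>product_group\<close> consists of extensional
  functions.\<close>

definition cech_cocycles :: "('i \<times> 'i \<Rightarrow> 'r) set" where
  "cech_cocycles = {g \<in> extensional (I \<times> I). cocycle (mon_of Y) I V g}"

lemma unit_group_simps:
  "carrier (unit_group Y W) = Units (rsec Y W)" "\<one>\<^bsub>unit_group Y W\<^esub> = \<one>\<^bsub>rsec Y W\<^esub>"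
  "monoid.mult (unit_group Y W) = monoid.mult (rsec Y W)"
  by (simp_all add: unit_group_def units_of_def)

lemma unit_group_inv: "ropn W \<Longrightarrow> x \<in> Units (rsec Y W) \<Longrightarrow> inv\<^bsub>unit_group Y W\<^esub> x = inv\<^bsub>rsec Y W\<^esub> x"
  unfolding unit_group_def by (rule monoid.units_of_inv) (rule cring.axioms(2)[OF cring_sections, THEN comm_monoid.axioms(1)])

lemma minv_mon_of: "inv\<^bsub>msec (mon_of Y) W\<^esub> x = inv\<^bsub>rsec Y W\<^esub> x"
  by (simp add: m_inv_def)

text \<open>Multiplying the component at \<open>(i, j, l)\<close> by the unit restricted from
  \<open>g (i, l)\<close> turns the condition of being one into the cocycle identity.\<close>

lemma kernel_cech_d1: "kernel (cech_C1 Y I V) (cech_C2 Y I V) (cech_d1 Y I V) = cech_cocycles"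
proof -
  have "cech_d1 Y I V g = \<one>\<^bsub>cech_C2 Y I V\<^esub> \<longleftrightarrow> cocycle (mon_of Y) I V g" if g: "g \<in> carrier (cech_C1 Y I V)" for g
  proof -
    have u: "g (i, j) \<in> Units (rsec Y (V i \<inter> V j))" if "i \<in> I" "j \<in> I" for i j
      using g that by (auto simp: cech_C1_def unit_group_simps PiE_iff)
    have "cech_d1 Y I V g = \<one>\<^bsub>cech_C2 Y I V\<^esub> \<longleftrightarrow> (\<forall>p\<in>I \<times> I \<times> I. cech_d1 Y I V g p = \<one>\<^bsub>cech_C2 Y I V\<^esub> p)"
    proof
      assume eq: "\<forall>p\<in>I \<times> I \<times> I. cech_d1 Y I V g p = \<one>\<^bsub>cech_C2 Y I V\<^esub> p"
      show "cech_d1 Y I V g = \<one>\<^bsub>cech_C2 Y I V\<^esub>"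
      proof (rule extensionalityI[of _ "I \<times> I \<times> I"])
        show "cech_d1 Y I V g p = \<one>\<^bsub>cech_C2 Y I V\<^esub> p" if "p \<in> I \<times> I \<times> I" for p
          using eq that by (rule bspec)
      qed (simp_all add: cech_d1_def cech_C2_def)
    qed simp
    also have "\<dots> \<longleftrightarrow> (\<forall>i\<in>I. \<forall>j\<in>I. \<forall>l\<in>I.
        rres Y (V j \<inter> V l) (V i \<inter> V j \<inter> V l) (g (j, l)) \<otimes>\<^bsub>rsec Y (V i \<inter> V j \<inter> V l)\<^esub>
          rres Y (V i \<inter> V j) (V i \<inter> V j \<inter> V l) (g (i, j)) =
        rres Y (V i \<inter> V l) (V i \<inter> V j \<inter> V l) (g (i, l)))"
      (is "_ \<longleftrightarrow> (\<forall>i\<in>I. \<forall>j\<in>I. \<forall>l\<in>I. ?R i j l)")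
    proof -
      have "cech_d1 Y I V g (i, j, l) = \<one>\<^bsub>cech_C2 Y I V\<^esub> (i, j, l) \<longleftrightarrow> ?R i j l" if i: "i \<in> I" "j \<in> I" "l \<in> I" for i j l
      proof -
        let ?W = "V i \<inter> V j \<inter> V l"
        have W: "ropn ?W" using C.opn_cover3[OF i] by simp
        interpret R: cring "rsec Y ?W" by (rule cring_sections[OF W])
        let ?x = "rres Y (V j \<inter> V l) ?W (g (j, l))" and ?y = "rres Y (V i \<inter> V l) ?W (g (i, l))" and ?z = "rres Y (V i \<inter> V j) ?W (g (i, j))"
        have U: "?x \<in> Units (rsec Y ?W)" "?y \<in> Units (rsec Y ?W)" "?z \<in> Units (rsec Y ?W)"
          using M.res_Units[of "V j \<inter> V l" ?W "g (j, l)"] M.res_Units[of "V i \<inter> V l" ?W "g (i, l)"]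
            M.res_Units[of "V i \<inter> V j" ?W "g (i, j)"] u i W C.opn_cover2[of j l] C.opn_cover2[of i l] C.opn_cover2[of i j]
          by (auto simp: le_infI1)
        then have c: "?x \<in> carrier (rsec Y ?W)" "?y \<in> carrier (rsec Y ?W)" "?z \<in> carrier (rsec Y ?W)"
          by (simp_all add: R.Units_closed)
        have "cech_d1 Y I V g (i, j, l) = \<one>\<^bsub>cech_C2 Y I V\<^esub> (i, j, l) \<longleftrightarrow>
            ?x \<otimes>\<^bsub>rsec Y ?W\<^esub> inv\<^bsub>rsec Y ?W\<^esub> ?y \<otimes>\<^bsub>rsec Y ?W\<^esub> ?z = \<one>\<^bsub>rsec Y ?W\<^esub>"
          using i by (simp add: cech_d1_def cech_C2_def Let_def unit_group_simps unit_group_inv[OF W U(2)])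
        also have "\<dots> \<longleftrightarrow> ?y \<otimes>\<^bsub>rsec Y ?W\<^esub> (?x \<otimes>\<^bsub>rsec Y ?W\<^esub> inv\<^bsub>rsec Y ?W\<^esub> ?y \<otimes>\<^bsub>rsec Y ?W\<^esub> ?z) = ?y \<otimes>\<^bsub>rsec Y ?W\<^esub> \<one>\<^bsub>rsec Y ?W\<^esub>"
          by (rule R.Units_l_cancel[symmetric]) (use U c in simp_all)
        also have "?y \<otimes>\<^bsub>rsec Y ?W\<^esub> (?x \<otimes>\<^bsub>rsec Y ?W\<^esub> inv\<^bsub>rsec Y ?W\<^esub> ?y \<otimes>\<^bsub>rsec Y ?W\<^esub> ?z) = ?x \<otimes>\<^bsub>rsec Y ?W\<^esub> ?z"
          by (rule R.Units_mult_inv_cancel[OF U(2) c(1,3)])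
        finally show ?thesis using c by simp
      qed
      then show ?thesis by auto
    qed
    also have "\<dots> \<longleftrightarrow> cocycle (mon_of Y) I V g" unfolding cocycle_def using u by simp
    finally show ?thesis .
  qed
  moreover have "g \<in> carrier (cech_C1 Y I V)" if "g \<in> cech_cocycles" for g
    using that C.cocycle_Units[of g] by (auto simp: cech_cocycles_def cech_C1_def unit_group_simps PiE_iff)
  moreover have "g \<in> extensional (I \<times> I)" if "g \<in> carrier (cech_C1 Y I V)" for g
    using that by (auto simp: cech_C1_def PiE_iff)
  ultimately show ?thesis
    unfolding kernel_def cech_cocycles_def by blast
qed

definition cech_class :: "('i \<times> 'i \<Rightarrow> 'r) \<Rightarrow> ('i \<times> 'i \<Rightarrow> 'r) set" where
  "cech_class g = {h \<in> cech_cocycles. cohomologous (mon_of Y) I V g h}"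

lemma cech_mult:
  "g \<otimes>\<^bsub>cech_C1 Y I V\<^esub> h = (\<lambda>(i, j)\<in>I \<times> I. g (i, j) \<otimes>\<^bsub>rsec Y (V i \<inter> V j)\<^esub> h (i, j))"
  by (auto simp: cech_C1_def unit_group_simps fun_eq_iff restrict_def)

lemma cech_mult_cocycles:
  assumes "g \<in> cech_cocycles" "h \<in> cech_cocycles"
  shows "(\<lambda>(i, j)\<in>I \<times> I. g (i, j) \<otimes>\<^bsub>rsec Y (V i \<inter> V j)\<^esub> h (i, j)) \<in> cech_cocycles"
  using C.cocycle_mult[of g h] assms
    C.cocycle_cong[of "\<lambda>(i, j)\<in>I \<times> I. g (i, j) \<otimes>\<^bsub>rsec Y (V i \<inter> V j)\<^esub> h (i, j)"
      "\<lambda>(i, j). g (i, j) \<otimes>\<^bsub>rsec Y (V i \<inter> V j)\<^esub> h (i, j)"]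
  by (simp add: cech_cocycles_def)

text \<open>\<open>cech_d0\<close> forms inverses in the group of units, \<open>coboundary\<close>
  forms them in the monoid of sections; on units they agree.\<close>

lemma cech_d0_image:
  "cech_d0 Y I V ` carrier (cech_C0 Y I V) = {restrict (C.coboundary u) (I \<times> I) |u. \<forall>i\<in>I. u i \<in> Units (rsec Y (V i))}"
proof -
  have eq: "cech_d0 Y I V u = restrict (C.coboundary u) (I \<times> I)" if u: "\<forall>i\<in>I. u i \<in> Units (rsec Y (V i))" for u
  proof (rule extensionalityI[of _ "I \<times> I"])
    fix p assume "p \<in> I \<times> I"
    then obtain i j where p: "p = (i, j)" and i: "i \<in> I" "j \<in> I" by blast
    have "rres Y (V i) (V i \<inter> V j) (u i) \<in> Units (rsec Y (V i \<inter> V j))"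
      using C.coboundary_Units(1)[of u i j] u i by simp
    then show "cech_d0 Y I V u p = restrict (C.coboundary u) (I \<times> I) p"
      using i C.opn_cover2[OF i] by (simp add: p cech_d0_def C.coboundary_def Let_def unit_group_simps unit_group_inv minv_mon_of)
  qed (simp_all add: cech_d0_def)
  have C0: "carrier (cech_C0 Y I V) = {u \<in> extensional I. \<forall>i\<in>I. u i \<in> Units (rsec Y (V i))}"
    by (simp add: cech_C0_def unit_group_simps PiE_iff set_eq_iff conj_commute)
  have "restrict (C.coboundary u) (I \<times> I) \<in> cech_d0 Y I V ` carrier (cech_C0 Y I V)" if u: "\<forall>i\<in>I. u i \<in> Units (rsec Y (V i))" for u
  proof (rule image_eqI)
    show "restrict u I \<in> carrier (cech_C0 Y I V)" using u by (simp add: C0)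
    have "restrict (C.coboundary u) (I \<times> I) = restrict (C.coboundary (restrict u I)) (I \<times> I)"
      by (rule restrict_ext) (auto simp: C.coboundary_def)
    then show "restrict (C.coboundary u) (I \<times> I) = cech_d0 Y I V (restrict u I)"
      using eq[of "restrict u I"] u by simp
  qed
  then show ?thesis using eq by (auto simp: C0)
qed

text \<open>The coset multiplies \<open>g\<close> by coboundaries, which is the quotient form of
  being cohomologous to \<open>g\<close>.\<close>

lemma cech_coset:
  assumes g: "g \<in> cech_cocycles"
  shows "cech_d0 Y I V ` carrier (cech_C0 Y I V) #>\<^bsub>cech_C1 Y I V\<^esub> g = cech_class g"
proof -
  have gc: "cocycle (mon_of Y) I V g" using g by (simp add: cech_cocycles_def)
  have eq: "restrict (C.coboundary u) (I \<times> I) \<otimes>\<^bsub>cech_C1 Y I V\<^esub> g =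
      (\<lambda>(i, j)\<in>I \<times> I. C.coboundary u (i, j) \<otimes>\<^bsub>rsec Y (V i \<inter> V j)\<^esub> g (i, j))" for u
    unfolding cech_mult by (rule restrict_ext) auto
  have "h \<in> cech_class g \<longleftrightarrow> (\<exists>u. (\<forall>i\<in>I. u i \<in> Units (rsec Y (V i))) \<and>
      h = (\<lambda>(i, j)\<in>I \<times> I. C.coboundary u (i, j) \<otimes>\<^bsub>rsec Y (V i \<inter> V j)\<^esub> g (i, j)))" (is "_ \<longleftrightarrow> ?E") for h
  proof
    assume h: "h \<in> cech_class g"
    then have hc: "cocycle (mon_of Y) I V h" and he: "h \<in> extensional (I \<times> I)" and "cohomologous (mon_of Y) I V g h"
      by (simp_all add: cech_class_def cech_cocycles_def)
    then obtain u where u: "\<forall>i\<in>I. u i \<in> Units (rsec Y (V i))"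
      "\<forall>i\<in>I. \<forall>j\<in>I. h (i, j) = C.coboundary u (i, j) \<otimes>\<^bsub>rsec Y (V i \<inter> V j)\<^esub> g (i, j)"
      unfolding C.cohomologous_iff_coboundary[OF gc hc] by auto
    have "h = (\<lambda>(i, j)\<in>I \<times> I. C.coboundary u (i, j) \<otimes>\<^bsub>rsec Y (V i \<inter> V j)\<^esub> g (i, j))"
      by (rule extensionalityI[OF he]) (use u in auto)
    then show ?E using u(1) by blast
  next
    assume ?E
    then obtain u where u: "\<forall>i\<in>I. u i \<in> Units (rsec Y (V i))"
      and h: "h = (\<lambda>(i, j)\<in>I \<times> I. C.coboundary u (i, j) \<otimes>\<^bsub>rsec Y (V i \<inter> V j)\<^esub> g (i, j))" by blast
    have "cocycle (mon_of Y) I V (\<lambda>(i, j). C.coboundary u (i, j) \<otimes>\<^bsub>msec (mon_of Y) (V i \<inter> V j)\<^esub> g (i, j))"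
      by (rule C.cocycle_mult[OF C.coboundary_cocycle gc]) (use u in simp)
    then have hc: "cocycle (mon_of Y) I V h"
      using C.cocycle_cong[of h "\<lambda>(i, j). C.coboundary u (i, j) \<otimes>\<^bsub>msec (mon_of Y) (V i \<inter> V j)\<^esub> g (i, j)"] by (simp add: h)
    then have "cohomologous (mon_of Y) I V g h"
      unfolding C.cohomologous_iff_coboundary[OF gc hc] using u by (intro exI[of _ u]) (simp add: h)
    then show "h \<in> cech_class g" using hc by (simp add: cech_class_def cech_cocycles_def h)
  qed
  note mem = this
  have "h \<in> cech_d0 Y I V ` carrier (cech_C0 Y I V) #>\<^bsub>cech_C1 Y I V\<^esub> g \<longleftrightarrow>
      (\<exists>u. (\<forall>i\<in>I. u i \<in> Units (rsec Y (V i))) \<and> h = restrict (C.coboundary u) (I \<times> I) \<otimes>\<^bsub>cech_C1 Y I V\<^esub> g)" for h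
    unfolding r_coset_def cech_d0_image by auto
  note mem' = this
  show ?thesis by (rule Set.set_eqI) (simp only: mem' eq mem)
qed

lemma carrier_cech_H1: "carrier (cech_H1 Y I V) = cech_class ` cech_cocycles"
  by (auto simp: cech_H1_def FactGroup_def RCOSETS_def kernel_cech_d1 cech_coset)

text \<open>\<open>ring_class_eq_iff\<close> rewrites being cohomologous as an equality of classes
  of modules, so reflexivity, symmetry and transitivity need no computation with units.\<close>

lemma cech_class_eq_iff:
  assumes "g \<in> cech_cocycles" "h \<in> cech_cocycles"
  shows "cech_class g = cech_class h \<longleftrightarrow> cohomologous (mon_of Y) I V g h"
proof -
  have g: "cocycle (mon_of Y) I V g" and h: "cocycle (mon_of Y) I V h" using assms by (simp_all add: cech_cocycles_def)
  have *: "cech_class f = {h \<in> cech_cocycles. ring_class f = ring_class h}" if "cocycle (mon_of Y) I V f" for f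
    using ring_class_eq_iff[OF that] by (auto simp: cech_class_def cech_cocycles_def)
  show ?thesis
    unfolding *[OF g] *[OF h] ring_class_eq_iff[OF g h, symmetric] using assms by auto
qed

lemma cech_class_mult:
  assumes g: "g \<in> cech_cocycles" and h: "h \<in> cech_cocycles"
  shows "cech_class g \<otimes>\<^bsub>cech_H1 Y I V\<^esub> cech_class h =
    cech_class (\<lambda>(i, j)\<in>I \<times> I. g (i, j) \<otimes>\<^bsub>rsec Y (V i \<inter> V j)\<^esub> h (i, j))"
proof -
  let ?m = "\<lambda>x y. \<lambda>(i, j)\<in>I \<times> I. x (i, j) \<otimes>\<^bsub>rsec Y (V i \<inter> V j)\<^esub> y (i, j)"
  have gc: "cocycle (mon_of Y) I V g" and hc: "cocycle (mon_of Y) I V h" using g h by (simp_all add: cech_cocycles_def)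
  have m: "cech_class g \<otimes>\<^bsub>cech_H1 Y I V\<^esub> cech_class h = (\<Union>x\<in>cech_class g. \<Union>y\<in>cech_class h. {?m x y})"
    by (simp add: cech_H1_def FactGroup_def set_mult_def cech_mult)
  show ?thesis
    unfolding m
  proof (intro subset_antisym subsetI)
    fix z assume "z \<in> (\<Union>x\<in>cech_class g. \<Union>y\<in>cech_class h. {?m x y})"
    then obtain x y where z: "z = ?m x y" and x: "x \<in> cech_cocycles" "cohomologous (mon_of Y) I V g x"
      and y: "y \<in> cech_cocycles" "cohomologous (mon_of Y) I V h y" by (auto simp: cech_class_def)
    have "cohomologous (mon_of Y) I V (\<lambda>(i, j). g (i, j) \<otimes>\<^bsub>msec (mon_of Y) (V i \<inter> V j)\<^esub> h (i, j))
        (\<lambda>(i, j). x (i, j) \<otimes>\<^bsub>msec (mon_of Y) (V i \<inter> V j)\<^esub> y (i, j))"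
      by (rule C.cohomologous_mult) (use gc hc x y in \<open>simp_all add: cech_cocycles_def\<close>)
    then have "cohomologous (mon_of Y) I V (?m g h) z"
      by (rule iffD1[OF C.cohomologous_cong, rotated 2]) (simp_all add: z)
    then show "z \<in> cech_class (?m g h)"
      using cech_mult_cocycles[OF x(1) y(1)] by (simp add: cech_class_def z)
  next
    fix z assume "z \<in> cech_class (?m g h)"
    then have zc: "cocycle (mon_of Y) I V z" and ze: "z \<in> extensional (I \<times> I)" and coh: "cohomologous (mon_of Y) I V (?m g h) z"
      by (simp_all add: cech_class_def cech_cocycles_def)
    have ghc: "cocycle (mon_of Y) I V (?m g h)" using cech_mult_cocycles[OF g h] by (simp add: cech_cocycles_def)
    obtain u where u: "\<forall>i\<in>I. u i \<in> Units (rsec Y (V i))"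
      and zu: "\<forall>i\<in>I. \<forall>j\<in>I. z (i, j) = C.coboundary u (i, j) \<otimes>\<^bsub>rsec Y (V i \<inter> V j)\<^esub> (g (i, j) \<otimes>\<^bsub>rsec Y (V i \<inter> V j)\<^esub> h (i, j))"
      using coh unfolding C.cohomologous_iff_coboundary[OF ghc zc] by auto
    \<comment> \<open>The whole coboundary is absorbed into the first factor; the second factor
      remains \<open>h\<close> itself.\<close>
    define x where "x = (\<lambda>(i, j)\<in>I \<times> I. C.coboundary u (i, j) \<otimes>\<^bsub>rsec Y (V i \<inter> V j)\<^esub> g (i, j))"
    have "cocycle (mon_of Y) I V (\<lambda>(i, j). C.coboundary u (i, j) \<otimes>\<^bsub>msec (mon_of Y) (V i \<inter> V j)\<^esub> g (i, j))"
      by (rule C.cocycle_mult[OF C.coboundary_cocycle gc]) (use u in simp)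
    then have xc: "cocycle (mon_of Y) I V x"
      by (rule iffD1[OF C.cocycle_cong, rotated]) (simp add: x_def)
    have "cohomologous (mon_of Y) I V g x"
      unfolding C.cohomologous_iff_coboundary[OF gc xc] using u by (intro exI[of _ u]) (simp add: x_def)
    then have x: "x \<in> cech_class g" using xc by (simp add: cech_class_def cech_cocycles_def x_def)
    have "cohomologous (mon_of Y) I V h h" using ring_class_eq_iff[OF hc hc] by simp
    then have y: "h \<in> cech_class h" using h by (simp add: cech_class_def)
    have "z = ?m x h"
    proof (rule extensionalityI[OF ze])
      fix p assume "p \<in> I \<times> I"
      then obtain i j where p: "p = (i, j)" and i: "i \<in> I" "j \<in> I" by blast
      show "z p = ?m x h p"
        using i zu M.mult_assoc[OF C.opn_cover2[OF i] M.Units_section[OF C.coboundary_Units(3)[of u, OF _ i]]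
          C.cocycle_section[OF gc i] C.cocycle_section[OF hc i]] u by (simp add: p x_def)
    qed simp
    then show "z \<in> (\<Union>x\<in>cech_class g. \<Union>y\<in>cech_class h. {?m x y})" using x y by blast
  qed
qed

text \<open>The union over the coset collapses because all cocycles in it have the same
  \<open>ring_class\<close>.\<close>

lemma cech_to_pic_class:
  assumes g: "g \<in> cech_cocycles"
  shows "cech_to_pic Y I V (cech_class g) = ring_class g"
proof -
  have gc: "cocycle (mon_of Y) I V g" using g by (simp add: cech_cocycles_def)
  have "g \<in> cech_class g" using g ring_class_eq_iff[OF gc gc] by (simp add: cech_class_def)
  moreover have "ring_class h = ring_class g" if "h \<in> cech_class g" for h
    using that ring_class_eq_iff[OF gc, of h] by (simp add: cech_class_def cech_cocycles_def)
  ultimately show ?thesis unfolding cech_to_pic_eq by blast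
qed

end

section \<open>Affine monoid schemes\<close>

lemma (in monoid) Units_nat_pow: "x \<in> Units G \<Longrightarrow> x [^] (n::nat) \<in> Units G"
  by (induction n) auto

lemma (in comm_monoid) Units_factor:
  assumes "x \<otimes> a \<in> Units G" "x \<in> carrier G" "a \<in> carrier G"
  shows "x \<in> Units G"
proof -
  let ?y = "a \<otimes> inv (x \<otimes> a)"
  have y: "?y \<in> carrier G" using assms by simp
  have xy: "x \<otimes> ?y = \<one>" using assms by (simp add: m_assoc[symmetric] Units_closed)
  then have "?y \<otimes> x = \<one>" using assms(2) y by (metis m_comm)
  then show ?thesis using xy y assms(2) unfolding Units_def by blast
qed

section \<open>Prime ideals and the spectrum of a monoid\<close>

lemma mprime_one: "mprime P M \<Longrightarrow> \<one>\<^bsub>M\<^esub> \<notin> P"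
  by (auto simp: mprime_def dest: submonoid.one_closed)

lemma mprime_mult_iff:
  assumes "comm_monoid M" "mprime P M" "f \<in> carrier M" "g \<in> carrier M"
  shows "f \<otimes>\<^bsub>M\<^esub> g \<in> P \<longleftrightarrow> f \<in> P \<or> g \<in> P"
proof -
  have "g \<otimes>\<^bsub>M\<^esub> f = f \<otimes>\<^bsub>M\<^esub> g" using assms(1,3,4) by (simp add: comm_monoid.m_comm)
  then show ?thesis
    using assms(2-) submonoid.m_closed[of "carrier M - P" M f g] by (auto simp: mprime_def mideal_def) metis
qed

lemma mprime_power:
  assumes "comm_monoid M" "mprime P M" "f \<in> carrier M" "f [^]\<^bsub>M\<^esub> (n::nat) \<in> P"
  shows "f \<in> P"
  using assms(4)
proof (induction n)
  case 0
  then show ?case using mprime_one[OF assms(2)] by (simp add: nat_pow_def)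
next
  case (Suc n)
  interpret comm_monoid M by (rule assms(1))
  show ?case using Suc mprime_mult_iff[OF assms(1,2) nat_pow_closed[OF assms(3)] assms(3), of n] by auto
qed

lemma mprime_Units:
  assumes "comm_monoid M" "mprime P M" "f \<in> Units M"
  shows "f \<notin> P"
proof
  interpret comm_monoid M by (rule assms(1))
  assume "f \<in> P"
  then have "f \<otimes>\<^bsub>M\<^esub> inv\<^bsub>M\<^esub> f \<in> P"
    using mprime_mult_iff[OF assms(1,2) Units_closed[OF assms(3)] Units_inv_closed[OF assms(3)]] by simp
  then show False using mprime_one[OF assms(2)] assms(3) by simp
qed

text \<open>The generic point: it lies in \<open>mbasic M f\<close> for every \<open>f\<close>,
  which makes the spectrum irreducible.\<close>

lemma mprime_empty:
  assumes "comm_monoid M"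
  shows "mprime {} M"
proof -
  interpret comm_monoid M by (rule assms)
  have "submonoid (carrier M - {}) M" by unfold_locales simp_all
  then show ?thesis by (simp add: mprime_def mideal_def)
qed

text \<open>The closed point: for \<open>f\<close> in the carrier, \<open>mbasic M f\<close>
  contains it only if \<open>f\<close> is a unit, and is then the whole spectrum.\<close>

lemma mprime_nonunits:
  assumes "comm_monoid M"
  shows "mprime (carrier M - Units M) M"
proof -
  interpret comm_monoid M by (rule assms)
  have "mideal (carrier M - Units M) M"
    unfolding mideal_def
  proof (intro conjI ballI)
    fix x a assume "x \<in> carrier M - Units M" "a \<in> carrier M"
    then show "x \<otimes>\<^bsub>M\<^esub> a \<in> carrier M - Units M" using Units_factor[of x a] by auto
  qed blast
  moreover have "carrier M - (carrier M - Units M) = Units M" using Units_closed by blast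
  moreover have "submonoid (Units M) M" by unfold_locales auto
  ultimately show ?thesis by (simp add: mprime_def)
qed

lemma mbasic_mult:
  assumes "comm_monoid M" "f \<in> carrier M" "g \<in> carrier M"
  shows "mbasic M (f \<otimes>\<^bsub>M\<^esub> g) = mbasic M f \<inter> mbasic M g"
proof -
  have "f \<otimes>\<^bsub>M\<^esub> g \<notin> P \<longleftrightarrow> f \<notin> P \<and> g \<notin> P" if "mprime P M" for P
    using mprime_mult_iff[OF assms(1) that assms(2,3)] by simp
  then show ?thesis unfolding mbasic_def by blast
qed

lemma mbasic_one: "comm_monoid M \<Longrightarrow> mbasic M \<one>\<^bsub>M\<^esub> = {P. mprime P M}"
  unfolding mbasic_def using mprime_one[of _ M] by blast

lemma ex_subset_image_Union: "(\<exists>\<U>\<subseteq>f ` A. S = \<Union>\<U>) \<longleftrightarrow> (\<exists>F\<subseteq>A. S = (\<Union>x\<in>F. f x))"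
  by (auto simp: subset_image_iff)

lemma openin_mspec:
  assumes "comm_monoid M"
  shows "openin (mspec M) S \<longleftrightarrow> (\<exists>F\<subseteq>carrier M. S = (\<Union>f\<in>F. mbasic M f))"
proof -
  have "istopology (arbitrary union_of (\<lambda>S. S \<in> mbasic M ` carrier M))"
  proof (rule istopology_base)
    fix S T assume "S \<in> mbasic M ` carrier M" "T \<in> mbasic M ` carrier M"
    then obtain f g where "f \<in> carrier M" "g \<in> carrier M" "S = mbasic M f" "T = mbasic M g" by blast
    then show "S \<inter> T \<in> mbasic M ` carrier M"
      using mbasic_mult[OF assms, of f g] assms by (auto simp: comm_monoid_def monoid.m_closed intro!: image_eqI[of _ _ "f \<otimes>\<^bsub>M\<^esub> g"])
  qed
  then have "openin (mspec M) S \<longleftrightarrow> (arbitrary union_of (\<lambda>S. S \<in> mbasic M ` carrier M)) S"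
    by (simp add: mspec_def topology_inverse')
  also have "\<dots> \<longleftrightarrow> (\<exists>\<U>\<subseteq>mbasic M ` carrier M. S = \<Union>\<U>)"
    by (auto simp: union_of_def arbitrary_def)
  also have "\<dots> \<longleftrightarrow> (\<exists>F\<subseteq>carrier M. S = (\<Union>f\<in>F. mbasic M f))"
    by (rule ex_subset_image_Union)
  finally show ?thesis .
qed

lemma topspace_mspec:
  assumes "comm_monoid M"
  shows "topspace (mspec M) = {P. mprime P M}"
proof
  show "topspace (mspec M) \<subseteq> {P. mprime P M}"
    using openin_topspace[of "mspec M"] unfolding openin_mspec[OF assms] by (auto simp: mbasic_def)
  have "openin (mspec M) (mbasic M \<one>\<^bsub>M\<^esub>)"
    unfolding openin_mspec[OF assms] using assms
    by (intro exI[of _ "{\<one>\<^bsub>M\<^esub>}"]) (auto simp: comm_monoid_def monoid.one_closed)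
  then show "{P. mprime P M} \<subseteq> topspace (mspec M)"
    using openin_subset mbasic_one[OF assms] by blast
qed

text \<open>An injective map that matches two bases matches all open sets. Spectra carry topologies
  given by bases, so this is how the chart of a basic open set is shown to be a
  homeomorphism.\<close>

lemma homeomorphic_map_base:
  assumes inj: "inj_on h (topspace S)" and surj: "h ` topspace S = topspace T"
    and opS: "\<And>A. openin S A \<longleftrightarrow> (\<exists>F\<subseteq>\<B>. A = \<Union>F)"
    and opT: "\<And>A. openin T A \<longleftrightarrow> (\<exists>F\<subseteq>(`) h ` \<B>. A = \<Union>F)"
  shows "homeomorphic_map S T h"
proof -
  have B: "B \<subseteq> topspace S" if "B \<in> \<B>" for B
    using opS[of B] that openin_subset[of S B] by (metis Sup_upper cSup_singleton empty_subsetI insert_subset)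
  have "openin T (h ` A) \<longleftrightarrow> openin S A" if A: "A \<subseteq> topspace S" for A
  proof
    assume "openin S A"
    then obtain F where "F \<subseteq> \<B>" "A = \<Union>F" unfolding opS by blast
    then show "openin T (h ` A)" unfolding opT by (intro exI[of _ "(`) h ` F"]) auto
  next
    assume "openin T (h ` A)"
    then obtain F where F: "F \<subseteq> (`) h ` \<B>" "h ` A = \<Union>F" unfolding opT by blast
    then obtain G where G: "G \<subseteq> \<B>" "F = (`) h ` G" by (auto simp: subset_image_iff)
    have eq: "h ` A = h ` \<Union>G" using F G by auto
    have "\<Union>G \<subseteq> topspace S" using G B by blast
    from inj_on_image_eq_iff[OF inj A this] have "A = \<Union>G" using eq by (rule iffD1)
    then show "openin S A" unfolding opS using G(1) by (intro exI[of _ G]) simp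
  qed
  note op = this
  have "quotient_map S T h"
    unfolding quotient_map_def
  proof (intro conjI allI impI surj)
    fix W assume W: "W \<subseteq> topspace T"
    have "h ` {x \<in> topspace S. h x \<in> W} = W" using W unfolding surj[symmetric] by auto
    then show "openin S {x \<in> topspace S. h x \<in> W} = openin T W"
      using op[of "{x \<in> topspace S. h x \<in> W}"] by simp
  qed
  then show ?thesis using inj by (simp add: homeomorphic_map_def)
qed

section \<open>Charts of a monoid scheme\<close>

context mono_space
begin

context
  fixes U M h \<theta>
  assumes chart: "mchart X U M h \<theta>"
begin

lemma chart_comm_monoid: "comm_monoid M"
  and chart_opn: "opn U"
  and chart_homeo: "homeomorphic_map (mspec M) (subtopology (mtop X) U) h"
  and chart_hom: "\<theta> \<in> hom M (\<O> U)" "\<theta> \<one>\<^bsub>M\<^esub> = \<one>\<^bsub>\<O> U\<^esub>"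
  and chart_localization: "f \<in> carrier M \<Longrightarrow> is_localization M f (\<O> (h ` mbasic M f)) (mres X U (h ` mbasic M f) \<circ> \<theta>)"
  using chart by (simp_all add: mchart_def)

lemma chart_surj: "h ` {P. mprime P M} = U"
  using homeomorphic_imp_surjective_map[OF chart_homeo] openin_subset[OF chart_opn]
  by (simp add: topspace_mspec[OF chart_comm_monoid] inf_absorb2)

lemma chart_inj: "inj_on h {P. mprime P M}"
  using homeomorphic_imp_injective_map[OF chart_homeo] by (simp add: topspace_mspec[OF chart_comm_monoid])

lemma chart_open_iff: "opn W \<and> W \<subseteq> U \<longleftrightarrow> (\<exists>F\<subseteq>carrier M. W = (\<Union>f\<in>F. h ` mbasic M f))"
proof
  assume W: "opn W \<and> W \<subseteq> U"
  let ?A = "{P \<in> topspace (mspec M). h P \<in> W}"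
  have "openin (subtopology (mtop X) U) W" using W chart_opn by (auto simp: openin_open_subtopology)
  then have "openin (mspec M) ?A"
    using openin_continuous_map_preimage[OF homeomorphic_imp_continuous_map[OF chart_homeo]] by blast
  then obtain F where F: "F \<subseteq> carrier M" "?A = (\<Union>f\<in>F. mbasic M f)"
    unfolding openin_mspec[OF chart_comm_monoid] by blast
  have "W = h ` ?A" using chart_surj W by (auto simp: topspace_mspec[OF chart_comm_monoid])
  then show "\<exists>F\<subseteq>carrier M. W = (\<Union>f\<in>F. h ` mbasic M f)" using F by (auto simp: image_UN)
next
  assume "\<exists>F\<subseteq>carrier M. W = (\<Union>f\<in>F. h ` mbasic M f)"
  then obtain F where F: "F \<subseteq> carrier M" "W = h ` (\<Union>f\<in>F. mbasic M f)" by (auto simp: image_UN)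
  have "openin (subtopology (mtop X) U) W"
    unfolding F(2) using homeomorphic_imp_open_map[OF chart_homeo] F(1)
    by (auto simp: open_map_def openin_mspec[OF chart_comm_monoid])
  then show "opn W \<and> W \<subseteq> U" using chart_opn by (simp add: openin_open_subtopology)
qed

lemma chart_basic_opn: "f \<in> carrier M \<Longrightarrow> opn (h ` mbasic M f)" "f \<in> carrier M \<Longrightarrow> h ` mbasic M f \<subseteq> U"
  using chart_open_iff[of "h ` mbasic M f"] by auto

lemma chart_basic_Int:
  assumes "f \<in> carrier M" "g \<in> carrier M"
  shows "h ` mbasic M (f \<otimes>\<^bsub>M\<^esub> g) = h ` mbasic M f \<inter> h ` mbasic M g"
  unfolding mbasic_mult[OF chart_comm_monoid assms]
  by (rule inj_on_image_Int[OF chart_inj]) (auto simp: mbasic_def)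

lemma chart_generic: "opn W \<Longrightarrow> W \<subseteq> U \<Longrightarrow> W \<noteq> {} \<Longrightarrow> h {} \<in> W"
  using chart_open_iff[of W] mprime_empty[OF chart_comm_monoid] by (auto simp: mbasic_def)

lemma chart_closed_point:
  obtains x where "x \<in> U" "\<And>W. opn W \<Longrightarrow> x \<in> W \<Longrightarrow> U \<subseteq> W"
proof -
  let ?P = "carrier M - Units M"
  note P = mprime_nonunits[OF chart_comm_monoid]
  have hP: "h ?P \<in> U" using chart_surj P by blast
  show thesis
  proof (rule that[OF hP])
    fix W assume W: "opn W" "h ?P \<in> W"
    have "opn (W \<inter> U) \<and> W \<inter> U \<subseteq> U" using W chart_opn by (simp add: openin_Int)
    then obtain F where F: "F \<subseteq> carrier M" "W \<inter> U = (\<Union>f\<in>F. h ` mbasic M f)" unfolding chart_open_iff by blast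
    have "h ?P \<in> W \<inter> U" using W hP by simp
    then obtain f where f: "f \<in> F" "h ?P \<in> h ` mbasic M f" using F(2) by blast
    then obtain Q where Q: "Q \<in> mbasic M f" "h ?P = h Q" by blast
    then have "Q = ?P" using inj_onD[OF chart_inj] P by (auto simp: mbasic_def)
    then have "f \<in> Units M" using Q f F by (auto simp: mbasic_def)
    then have "mbasic M f = {P. mprime P M}" using mprime_Units[OF chart_comm_monoid] by (auto simp: mbasic_def)
    then have "h ` mbasic M f = U" using chart_surj by simp
    then show "U \<subseteq> W" using F f by blast
  qed
qed

text \<open>The chart of a basic open set: primes of \<open>M\<close> that do not contain \<open>f\<close> are the primes of \<open>M\<^sub>f\<close>.\<close>

lemma basic_open_affine:
  assumes f: "f \<in> carrier M"
  shows "maffine X (h ` mbasic M f)"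
proof -
  define D where "D = h ` mbasic M f"
  define N where "N = \<O> D"
  define \<phi> where "\<phi> = mres X U D \<circ> \<theta>"
  interpret M: comm_monoid M by (rule chart_comm_monoid)
  have D: "opn D" "D \<subseteq> U" using chart_basic_opn[OF f] by (simp_all add: D_def)
  interpret N: comm_monoid N unfolding N_def by (rule comm_monoid_sections[OF D(1)])
  have loc: "is_localization M f N \<phi>" using chart_localization[OF f] by (simp add: N_def \<phi>_def D_def)
  then have hom: "\<phi> \<in> hom M N" and \<phi>1: "\<phi> \<one>\<^bsub>M\<^esub> = \<one>\<^bsub>N\<^esub>" and \<phi>f: "\<phi> f \<in> Units N"
    and sur: "\<And>n. n \<in> carrier N \<Longrightarrow> \<exists>a\<in>carrier M. \<exists>m::nat. \<phi> f [^]\<^bsub>N\<^esub> m \<otimes>\<^bsub>N\<^esub> n = \<phi> a"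
    and inj: "\<And>a b. a \<in> carrier M \<Longrightarrow> b \<in> carrier M \<Longrightarrow> \<phi> a = \<phi> b \<Longrightarrow>
        \<exists>m::nat. f [^]\<^bsub>M\<^esub> m \<otimes>\<^bsub>M\<^esub> a = f [^]\<^bsub>M\<^esub> m \<otimes>\<^bsub>M\<^esub> b"
    by (auto simp: is_localization_def)
  have \<phi>c: "\<phi> a \<in> carrier N" if "a \<in> carrier M" for a using hom_in_carrier[OF hom that] .
  have \<phi>m: "\<phi> (a \<otimes>\<^bsub>M\<^esub> b) = \<phi> a \<otimes>\<^bsub>N\<^esub> \<phi> b" if "a \<in> carrier M" "b \<in> carrier M" for a b using hom_mult[OF hom that] .
  have \<phi>p: "\<phi> (a [^]\<^bsub>M\<^esub> (m::nat)) = \<phi> a [^]\<^bsub>N\<^esub> m" if "a \<in> carrier M" for a m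
    by (induction m) (simp_all add: \<phi>1 \<phi>m that)
  have up: "\<phi> f [^]\<^bsub>N\<^esub> (m::nat) \<in> Units N" for m using \<phi>f by (rule N.Units_nat_pow)
  have pre: "mprime {a \<in> carrier M. \<phi> a \<in> Q} M \<and> f \<notin> {a \<in> carrier M. \<phi> a \<in> Q}" if Q: "mprime Q N" for Q
  proof -
    have "{a \<in> carrier M. \<phi> a \<in> Q} \<subseteq> carrier M" by blast
    moreover have "x \<otimes>\<^bsub>M\<^esub> a \<in> {a \<in> carrier M. \<phi> a \<in> Q}" if "x \<in> {a \<in> carrier M. \<phi> a \<in> Q}" "a \<in> carrier M" for x a
      using that by (simp add: \<phi>m mprime_mult_iff[OF N.comm_monoid_axioms Q] \<phi>c)
    moreover have "submonoid (carrier M - {a \<in> carrier M. \<phi> a \<in> Q}) M"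
      by unfold_locales (auto simp: \<phi>m \<phi>1 mprime_mult_iff[OF N.comm_monoid_axioms Q] \<phi>c mprime_one[OF Q])
    ultimately show ?thesis
      using mprime_Units[OF N.comm_monoid_axioms Q \<phi>f] by (simp add: mprime_def mideal_def)
  qed
  \<comment> \<open>Powers of \<open>\<phi> f\<close> are units and lie in no prime, so only the
    numerator of a fraction decides about membership.\<close>
  have mem_iff: "n \<in> Q \<longleftrightarrow> \<phi> a \<in> Q" if Q: "mprime Q N" and n: "n \<in> carrier N" and a: "\<phi> f [^]\<^bsub>N\<^esub> (m::nat) \<otimes>\<^bsub>N\<^esub> n = \<phi> a" for Q n a m
    unfolding a[symmetric]
    using mprime_mult_iff[OF N.comm_monoid_axioms Q N.Units_closed[OF up] n] mprime_Units[OF N.comm_monoid_axioms Q up] by simp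
  define h' where "h' Q = h {a \<in> carrier M. \<phi> a \<in> Q}" for Q
  have inj': "inj_on h' {Q. mprime Q N}"
  proof (rule inj_onI)
    fix Q Q' assume "Q \<in> {Q. mprime Q N}" "Q' \<in> {Q. mprime Q N}" and eq: "h' Q = h' Q'"
    then have Q: "mprime Q N" "mprime Q' N" by simp_all
    have e: "{a \<in> carrier M. \<phi> a \<in> Q} = {a \<in> carrier M. \<phi> a \<in> Q'}"
      using inj_onD[OF chart_inj eq[unfolded h'_def]] pre[OF Q(1)] pre[OF Q(2)] by simp
    have "n \<in> Q \<longleftrightarrow> n \<in> Q'" if n: "n \<in> carrier N" for n
    proof -
      obtain a and m :: nat where a: "a \<in> carrier M" "\<phi> f [^]\<^bsub>N\<^esub> m \<otimes>\<^bsub>N\<^esub> n = \<phi> a" using sur[OF n] by blast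
      show ?thesis using mem_iff[OF Q(1) n a(2)] mem_iff[OF Q(2) n a(2)] e a(1) by blast
    qed
    moreover have "Q \<subseteq> carrier N" "Q' \<subseteq> carrier N" using Q by (auto simp: mprime_def mideal_def)
    ultimately show "Q = Q'" by blast
  qed
  have ext: "\<exists>Q. mprime Q N \<and> P = {a \<in> carrier M. \<phi> a \<in> Q}" if P: "mprime P M" "f \<notin> P" for P
  proof -
    have PM: "P \<subseteq> carrier M" using P by (simp add: mprime_def mideal_def)
    \<comment> \<open>Membership in \<open>P\<close> does not depend on the numerator chosen: an
      equality in the localization becomes one in \<open>M\<close> after multiplication by a power
      of \<open>f\<close>, and powers of \<open>f\<close> lie outside \<open>P\<close>.\<close>
    have key: "b \<in> P" if eq: "\<phi> f [^]\<^bsub>N\<^esub> (m::nat) \<otimes>\<^bsub>N\<^esub> \<phi> b = \<phi> a" and a: "a \<in> P" and b: "b \<in> carrier M" for m a b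
    proof -
      have aM: "a \<in> carrier M" using a PM by blast
      have "\<phi> (f [^]\<^bsub>M\<^esub> m \<otimes>\<^bsub>M\<^esub> b) = \<phi> a" using eq f b by (simp add: \<phi>m \<phi>p)
      then obtain s :: nat where s: "f [^]\<^bsub>M\<^esub> s \<otimes>\<^bsub>M\<^esub> (f [^]\<^bsub>M\<^esub> m \<otimes>\<^bsub>M\<^esub> b) = f [^]\<^bsub>M\<^esub> s \<otimes>\<^bsub>M\<^esub> a"
        using inj[of "f [^]\<^bsub>M\<^esub> m \<otimes>\<^bsub>M\<^esub> b" a] f b aM by auto
      have "f [^]\<^bsub>M\<^esub> s \<otimes>\<^bsub>M\<^esub> a \<in> P" using mprime_mult_iff[OF M.comm_monoid_axioms P(1), of "f [^]\<^bsub>M\<^esub> s" a] a aM f by simp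
      then have "f [^]\<^bsub>M\<^esub> s \<in> P \<or> f [^]\<^bsub>M\<^esub> m \<in> P \<or> b \<in> P"
        unfolding s[symmetric] using mprime_mult_iff[OF M.comm_monoid_axioms P(1)] f b by simp
      then show ?thesis using mprime_power[OF M.comm_monoid_axioms P(1) f] P(2) by blast
    qed
    \<comment> \<open>The extension of \<open>P\<close> to the localization: fractions with some
      numerator in \<open>P\<close>. By \<open>key\<close> every other numerator is then in
      \<open>P\<close> too.\<close>
    define Q where "Q = {n \<in> carrier N. \<exists>a\<in>P. \<exists>m::nat. \<phi> f [^]\<^bsub>N\<^esub> m \<otimes>\<^bsub>N\<^esub> n = \<phi> a}"
    have Qiff: "n \<in> Q \<longleftrightarrow> a \<in> P" if n: "n \<in> carrier N" and a: "a \<in> carrier M" and eq: "\<phi> f [^]\<^bsub>N\<^esub> (m::nat) \<otimes>\<^bsub>N\<^esub> n = \<phi> a" for n a m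
    proof
      assume "n \<in> Q"
      then obtain b and r :: nat where b: "b \<in> P" "\<phi> f [^]\<^bsub>N\<^esub> r \<otimes>\<^bsub>N\<^esub> n = \<phi> b" by (auto simp: Q_def)
      have bM: "b \<in> carrier M" using b PM by blast
      have "\<phi> f [^]\<^bsub>N\<^esub> r \<otimes>\<^bsub>N\<^esub> \<phi> a = \<phi> f [^]\<^bsub>N\<^esub> m \<otimes>\<^bsub>N\<^esub> \<phi> b"
        unfolding eq[symmetric] b(2)[symmetric] using n f \<phi>c by (simp add: N.m_lcomm)
      also have "\<dots> = \<phi> (f [^]\<^bsub>M\<^esub> m \<otimes>\<^bsub>M\<^esub> b)" using f bM by (simp add: \<phi>m \<phi>p)
      finally show "a \<in> P"
        by (rule key) (use mprime_mult_iff[OF M.comm_monoid_axioms P(1), of "f [^]\<^bsub>M\<^esub> m" b] b bM f a in simp_all)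
    next
      assume "a \<in> P"
      then show "n \<in> Q" using n eq by (auto simp: Q_def)
    qed
    have Qmult: "n \<otimes>\<^bsub>N\<^esub> n' \<in> Q \<longleftrightarrow> n \<in> Q \<or> n' \<in> Q" if n: "n \<in> carrier N" "n' \<in> carrier N" for n n'
    proof -
      obtain a and m :: nat where a: "a \<in> carrier M" "\<phi> f [^]\<^bsub>N\<^esub> m \<otimes>\<^bsub>N\<^esub> n = \<phi> a" using sur[OF n(1)] by blast
      obtain a' and m' :: nat where a': "a' \<in> carrier M" "\<phi> f [^]\<^bsub>N\<^esub> m' \<otimes>\<^bsub>N\<^esub> n' = \<phi> a'" using sur[OF n(2)] by blast
      have "\<phi> f [^]\<^bsub>N\<^esub> (m + m') \<otimes>\<^bsub>N\<^esub> (n \<otimes>\<^bsub>N\<^esub> n') = \<phi> (a \<otimes>\<^bsub>M\<^esub> a')"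
        unfolding \<phi>m[OF a(1) a'(1)] a(2)[symmetric] a'(2)[symmetric]
        using n f \<phi>c by (simp add: N.nat_pow_mult[symmetric] N.m_ac)
      then have "n \<otimes>\<^bsub>N\<^esub> n' \<in> Q \<longleftrightarrow> a \<otimes>\<^bsub>M\<^esub> a' \<in> P" using Qiff[of "n \<otimes>\<^bsub>N\<^esub> n'" "a \<otimes>\<^bsub>M\<^esub> a'"] n a(1) a'(1) by simp
      then show ?thesis
        using Qiff[OF n(1) a] Qiff[OF n(2) a'] mprime_mult_iff[OF M.comm_monoid_axioms P(1) a(1) a'(1)] by simp
    qed
    have Qone: "\<one>\<^bsub>N\<^esub> \<notin> Q"
      using Qiff[of "\<one>\<^bsub>N\<^esub>" "\<one>\<^bsub>M\<^esub>" 0] mprime_one[OF P(1)] by (simp add: \<phi>1)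
    have QN: "Q \<subseteq> carrier N" by (auto simp: Q_def)
    have "submonoid (carrier N - Q) N" by unfold_locales (auto simp: Qmult Qone)
    moreover have "mideal Q N" using QN Qmult by (auto simp: mideal_def)
    ultimately have "mprime Q N" by (simp add: mprime_def)
    moreover have "P = {a \<in> carrier M. \<phi> a \<in> Q}"
      using PM Qiff[OF \<phi>c, of _ _ 0] \<phi>c by auto
    ultimately show ?thesis by blast
  qed
  \<comment> \<open>A prime of the localization avoids \<open>n = a / f ^ m\<close> exactly when it
    avoids the image of \<open>a\<close>, and it comes from a prime of \<open>M\<close> avoiding
    \<open>f\<close>; hence the index \<open>f \<otimes> a\<close>.\<close>
  have basic: "h' ` mbasic N n = h ` mbasic M (f \<otimes>\<^bsub>M\<^esub> a)"
    if n: "n \<in> carrier N" and a: "a \<in> carrier M" "\<phi> f [^]\<^bsub>N\<^esub> (m::nat) \<otimes>\<^bsub>N\<^esub> n = \<phi> a" for n a m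
  proof (intro subset_antisym subsetI)
    fix x assume "x \<in> h' ` mbasic N n"
    then obtain Q where Q: "mprime Q N" "n \<notin> Q" "x = h' Q" by (auto simp: mbasic_def)
    then have "{a \<in> carrier M. \<phi> a \<in> Q} \<in> mbasic M (f \<otimes>\<^bsub>M\<^esub> a)"
      using pre[OF Q(1)] mem_iff[OF Q(1) n a(2)] a(1) f by (simp add: mbasic_mult[OF M.comm_monoid_axioms]) (simp add: mbasic_def)
    then show "x \<in> h ` mbasic M (f \<otimes>\<^bsub>M\<^esub> a)" using Q by (auto simp: h'_def)
  next
    fix x assume "x \<in> h ` mbasic M (f \<otimes>\<^bsub>M\<^esub> a)"
    then obtain P where P: "mprime P M" "f \<notin> P" "a \<notin> P" "x = h P"
      using f a(1) by (auto simp: mbasic_mult[OF M.comm_monoid_axioms]) (auto simp: mbasic_def)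
    obtain Q where Q: "mprime Q N" "P = {a \<in> carrier M. \<phi> a \<in> Q}" using ext[OF P(1,2)] by blast
    have "n \<notin> Q" using mem_iff[OF Q(1) n a(2)] P(3) Q(2) a(1) by simp
    then show "x \<in> h' ` mbasic N n" using P(4) Q by (auto simp: mbasic_def h'_def)
  qed
  have D_eq: "h' ` {Q. mprime Q N} = D"
    using basic[OF N.one_closed M.one_closed, of 0] f
    by (simp add: \<phi>1 mbasic_one[OF N.comm_monoid_axioms] D_def)
  have openD: "opn W \<and> W \<subseteq> D \<longleftrightarrow> (\<exists>F\<subseteq>(`) h' ` (mbasic N ` carrier N). W = \<Union>F)" for W
  proof
    assume W: "opn W \<and> W \<subseteq> D"
    then have "opn W \<and> W \<subseteq> U" using D(2) by auto
    then obtain F where F: "F \<subseteq> carrier M" "W = (\<Union>g\<in>F. h ` mbasic M g)" unfolding chart_open_iff by blast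
    have "h' ` mbasic N (\<phi> g) = h ` mbasic M g" if g: "g \<in> F" for g
    proof -
      have gM: "g \<in> carrier M" using g F by blast
      have sub: "h ` mbasic M g \<subseteq> D" using W g unfolding F(2) by auto
      have "h' ` mbasic N (\<phi> g) = D \<inter> h ` mbasic M g"
        using basic[OF \<phi>c[OF gM] gM, of 0] \<phi>c[OF gM] by (simp add: chart_basic_Int[OF f gM] D_def)
      then show ?thesis using sub by (simp add: inf_absorb2)
    qed
    then have "W = \<Union>((`) h' ` (mbasic N ` (\<phi> ` F)))" using F(2) by (simp add: image_image)
    moreover have "\<phi> ` F \<subseteq> carrier N" using \<phi>c F(1) by auto
    then have "(`) h' ` (mbasic N ` (\<phi> ` F)) \<subseteq> (`) h' ` (mbasic N ` carrier N)" by (intro image_mono)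
    ultimately show "\<exists>F\<subseteq>(`) h' ` (mbasic N ` carrier N). W = \<Union>F"
      by (intro exI[of _ "(`) h' ` (mbasic N ` (\<phi> ` F))"]) simp
  next
    assume "\<exists>F\<subseteq>(`) h' ` (mbasic N ` carrier N). W = \<Union>F"
    then obtain F where F: "F \<subseteq> (`) h' ` (mbasic N ` carrier N)" "W = \<Union>F" by blast
    have "opn B \<and> B \<subseteq> D" if "B \<in> F" for B
    proof -
      have "B \<in> (`) h' ` (mbasic N ` carrier N)" using F(1) that by (rule subsetD)
      then obtain n where n: "n \<in> carrier N" "B = h' ` mbasic N n" by (elim imageE) simp
      obtain a and m :: nat where a: "a \<in> carrier M" "\<phi> f [^]\<^bsub>N\<^esub> m \<otimes>\<^bsub>N\<^esub> n = \<phi> a" using sur[OF n(1)] by blast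
      have "B = h ` mbasic M (f \<otimes>\<^bsub>M\<^esub> a)" unfolding n(2) by (rule basic[OF n(1) a])
      then show ?thesis
        using chart_basic_opn(1)[of "f \<otimes>\<^bsub>M\<^esub> a"] chart_basic_Int[OF f a(1)] f a(1) by (simp add: D_def)
    qed
    note B = this
    show "opn W \<and> W \<subseteq> D"
      unfolding F(2) by (intro conjI openin_Union Union_least) (simp_all add: B)
  qed
  have "homeomorphic_map (mspec N) (subtopology (mtop X) D) h'"
  proof (rule homeomorphic_map_base[where \<B> = "mbasic N ` carrier N"])
    show "inj_on h' (topspace (mspec N))" using inj' by (simp add: topspace_mspec[OF N.comm_monoid_axioms])
    show "h' ` topspace (mspec N) = topspace (subtopology (mtop X) D)"
      using D_eq openin_subset[OF D(1)] by (simp add: topspace_mspec[OF N.comm_monoid_axioms] inf_absorb2)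
    show "openin (mspec N) A \<longleftrightarrow> (\<exists>F\<subseteq>mbasic N ` carrier N. A = \<Union>F)" for A
      unfolding openin_mspec[OF N.comm_monoid_axioms] ex_subset_image_Union ..
    show "openin (subtopology (mtop X) D) A \<longleftrightarrow> (\<exists>F\<subseteq>(`) h' ` (mbasic N ` carrier N). A = \<Union>F)" for A
      unfolding openin_open_subtopology[OF D(1)] by (rule openD)
  qed
  \<comment> \<open>Inverting \<open>n = a / f ^ m\<close> after \<open>f\<close> amounts to
    inverting \<open>f \<otimes> a\<close> in \<open>M\<close>, for which the given chart provides
    the localization.\<close>
  moreover have "is_localization N n (\<O> (h' ` mbasic N n)) (mres X D (h' ` mbasic N n) \<circ> id)" if n: "n \<in> carrier N" for n
  proof -
    obtain a and m :: nat where a: "a \<in> carrier M" "\<phi> f [^]\<^bsub>N\<^esub> m \<otimes>\<^bsub>N\<^esub> n = \<phi> a" using sur[OF n] by blast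
    define E where "E = h' ` mbasic N n"
    have E: "E = h ` mbasic M (f \<otimes>\<^bsub>M\<^esub> a)" unfolding E_def by (rule basic[OF n a])
    have fa: "f \<otimes>\<^bsub>M\<^esub> a \<in> carrier M" using f a by simp
    have oE: "opn E" and ED: "E \<subseteq> D" unfolding E using chart_basic_opn(1)[OF fa] chart_basic_Int[OF f a(1)] by (auto simp: D_def)
    interpret E: comm_monoid "\<O> E" by (rule comm_monoid_sections[OF oE])
    define \<psi> where "\<psi> = mres X D E"
    have \<psi>c: "\<psi> x \<in> carrier (\<O> E)" if "x \<in> carrier N" for x using res_closed[OF D(1) oE ED] that by (simp add: \<psi>_def N_def)
    have \<psi>m: "\<psi> (x \<otimes>\<^bsub>N\<^esub> y) = \<psi> x \<otimes>\<^bsub>\<O> E\<^esub> \<psi> y" if "x \<in> carrier N" "y \<in> carrier N" for x y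
      using res_mult[OF D(1) oE ED] that by (simp add: \<psi>_def N_def)
    have \<psi>1: "\<psi> \<one>\<^bsub>N\<^esub> = \<one>\<^bsub>\<O> E\<^esub>" using res_one[OF D(1) oE ED] by (simp add: \<psi>_def N_def)
    have \<psi>p: "\<psi> (x [^]\<^bsub>N\<^esub> (k::nat)) = \<psi> x [^]\<^bsub>\<O> E\<^esub> k" if "x \<in> carrier N" for x k
      by (induction k) (simp_all add: \<psi>1 \<psi>m that)
    have \<psi>u: "\<psi> x \<in> Units (\<O> E)" if "x \<in> Units N" for x using res_Units[OF D(1) oE ED] that by (simp add: \<psi>_def N_def)
    have "mres X U E (\<theta> x) = \<psi> (\<phi> x)" if "x \<in> carrier M" for x
      using res_res[OF chart_opn D(1) oE ED D(2)] hom_in_carrier[OF chart_hom(1) that] by (simp add: \<psi>_def \<phi>_def)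
    then have locE: "\<And>x. x \<in> carrier M \<Longrightarrow> (mres X U E \<circ> \<theta>) x = \<psi> (\<phi> x)" by simp
    have L: "is_localization M (f \<otimes>\<^bsub>M\<^esub> a) (\<O> E) (mres X U E \<circ> \<theta>)" using chart_localization[OF fa] by (simp add: E)
    have u: "\<psi> (\<phi> (f \<otimes>\<^bsub>M\<^esub> a)) \<in> Units (\<O> E)"
      using L locE[OF fa] by (simp add: is_localization_def)
    \<comment> \<open>Clearing the denominator of \<open>n\<close> costs \<open>m\<close> factors
      \<open>\<phi> f\<close>, and the index \<open>f \<otimes> a\<close> contributes one more: the
      image of \<open>f \<otimes> a\<close> is \<open>n\<close> times the unit
      \<open>F\<close>.\<close>
    define F where "F = \<phi> f [^]\<^bsub>N\<^esub> (Suc m)"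
    have Fu: "F \<in> Units N" unfolding F_def by (rule up)
    then have Fc: "F \<in> carrier N" by (rule N.Units_closed)
    have fan: "\<phi> (f \<otimes>\<^bsub>M\<^esub> a) = F \<otimes>\<^bsub>N\<^esub> n"
      unfolding \<phi>m[OF f a(1)] a(2)[symmetric] F_def using n f \<phi>c by (simp add: N.m_ac)
    have nu: "\<psi> n \<in> Units (\<O> E)"
    proof -
      have "\<psi> n \<otimes>\<^bsub>\<O> E\<^esub> \<psi> F \<in> Units (\<O> E)"
        using u n Fc unfolding fan by (simp add: \<psi>m E.m_comm \<psi>c)
      then show ?thesis by (rule E.Units_factor) (use n Fc \<psi>c in auto)
    qed
    have sE: "\<exists>x\<in>carrier N. \<exists>r::nat. \<psi> n [^]\<^bsub>\<O> E\<^esub> r \<otimes>\<^bsub>\<O> E\<^esub> y = \<psi> x" if y: "y \<in> carrier (\<O> E)" for y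
    proof -
      obtain b and r :: nat where b: "b \<in> carrier M" "\<psi> (\<phi> (f \<otimes>\<^bsub>M\<^esub> a)) [^]\<^bsub>\<O> E\<^esub> r \<otimes>\<^bsub>\<O> E\<^esub> y = \<psi> (\<phi> b)"
        using L y locE fa unfolding is_localization_def by metis
      let ?v = "F [^]\<^bsub>N\<^esub> r"
      have v: "?v \<in> Units N" by (rule N.Units_nat_pow[OF Fu])
      have "\<psi> (\<phi> (f \<otimes>\<^bsub>M\<^esub> a)) [^]\<^bsub>\<O> E\<^esub> r = \<psi> (?v \<otimes>\<^bsub>N\<^esub> n [^]\<^bsub>N\<^esub> r)"
        using n Fc by (simp add: fan \<psi>p[symmetric] N.nat_pow_distrib)
      then have "\<psi> ?v \<otimes>\<^bsub>\<O> E\<^esub> (\<psi> n [^]\<^bsub>\<O> E\<^esub> r \<otimes>\<^bsub>\<O> E\<^esub> y) = \<psi> (\<phi> b)"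
        using b(2) n y Fc by (simp add: \<psi>m \<psi>p \<psi>c E.m_assoc)
      moreover have "\<psi> (inv\<^bsub>N\<^esub> ?v \<otimes>\<^bsub>N\<^esub> \<phi> b) = \<psi> (inv\<^bsub>N\<^esub> ?v) \<otimes>\<^bsub>\<O> E\<^esub> \<psi> (\<phi> b)"
        by (rule \<psi>m) (use v b(1) \<phi>c in auto)
      moreover have "\<psi> (inv\<^bsub>N\<^esub> ?v) \<otimes>\<^bsub>\<O> E\<^esub> \<psi> ?v = \<one>\<^bsub>\<O> E\<^esub>"
        using \<psi>m[OF N.Units_inv_closed[OF v] N.Units_closed[OF v]] by (simp add: N.Units_l_inv[OF v] \<psi>1)
      moreover have "\<psi> (inv\<^bsub>N\<^esub> ?v) \<in> carrier (\<O> E)" "\<psi> ?v \<in> carrier (\<O> E)" "\<psi> n [^]\<^bsub>\<O> E\<^esub> r \<otimes>\<^bsub>\<O> E\<^esub> y \<in> carrier (\<O> E)"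
        using N.Units_inv_closed[OF v] n y \<psi>c Fc by auto
      ultimately have "\<psi> n [^]\<^bsub>\<O> E\<^esub> r \<otimes>\<^bsub>\<O> E\<^esub> y = \<psi> (inv\<^bsub>N\<^esub> ?v \<otimes>\<^bsub>N\<^esub> \<phi> b)"
        by (metis E.m_assoc E.l_one)
      moreover have "inv\<^bsub>N\<^esub> ?v \<otimes>\<^bsub>N\<^esub> \<phi> b \<in> carrier N" using v b(1) \<phi>c by auto
      ultimately show ?thesis by blast
    qed
    have iE: "\<exists>r::nat. n [^]\<^bsub>N\<^esub> r \<otimes>\<^bsub>N\<^esub> x = n [^]\<^bsub>N\<^esub> r \<otimes>\<^bsub>N\<^esub> y"
      if x: "x \<in> carrier N" and y: "y \<in> carrier N" and eq: "\<psi> x = \<psi> y" for x y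
    proof -
      obtain b and p :: nat where b: "b \<in> carrier M" "\<phi> f [^]\<^bsub>N\<^esub> p \<otimes>\<^bsub>N\<^esub> x = \<phi> b" using sur[OF x] by blast
      obtain c and q :: nat where c: "c \<in> carrier M" "\<phi> f [^]\<^bsub>N\<^esub> q \<otimes>\<^bsub>N\<^esub> y = \<phi> c" using sur[OF y] by blast
      \<comment> \<open>Cross-multiplication: with \<open>x = b / f ^ p\<close> and
        \<open>y = c / f ^ q\<close>, the elements \<open>?b\<close> and \<open>?c\<close> map to
        \<open>x\<close> and \<open>y\<close> times the same unit \<open>?w\<close>.\<close>
      let ?b = "f [^]\<^bsub>M\<^esub> q \<otimes>\<^bsub>M\<^esub> b" and ?c = "f [^]\<^bsub>M\<^esub> p \<otimes>\<^bsub>M\<^esub> c" and ?w = "\<phi> f [^]\<^bsub>N\<^esub> q \<otimes>\<^bsub>N\<^esub> \<phi> f [^]\<^bsub>N\<^esub> p"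
      have w: "?w \<in> Units N" by (rule N.Units_m_closed[OF up up])
      have bx: "\<phi> ?b = ?w \<otimes>\<^bsub>N\<^esub> x" and cy: "\<phi> ?c = ?w \<otimes>\<^bsub>N\<^esub> y"
        using f b(1) c(1) x y \<phi>c by (simp_all add: \<phi>m \<phi>p b(2)[symmetric] c(2)[symmetric] N.m_ac)
      have "(mres X U E \<circ> \<theta>) ?b = (mres X U E \<circ> \<theta>) ?c"
        using f b(1) c(1) locE[of ?b] locE[of ?c] eq \<psi>m[OF N.Units_closed[OF w] x] \<psi>m[OF N.Units_closed[OF w] y]
        by (simp add: bx cy del: comp_apply)
      then obtain s :: nat where "(f \<otimes>\<^bsub>M\<^esub> a) [^]\<^bsub>M\<^esub> s \<otimes>\<^bsub>M\<^esub> ?b = (f \<otimes>\<^bsub>M\<^esub> a) [^]\<^bsub>M\<^esub> s \<otimes>\<^bsub>M\<^esub> ?c"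
        using L f b(1) c(1) unfolding is_localization_def by (metis M.m_closed M.nat_pow_closed)
      then have "\<phi> ((f \<otimes>\<^bsub>M\<^esub> a) [^]\<^bsub>M\<^esub> s \<otimes>\<^bsub>M\<^esub> ?b) = \<phi> ((f \<otimes>\<^bsub>M\<^esub> a) [^]\<^bsub>M\<^esub> s \<otimes>\<^bsub>M\<^esub> ?c)" by simp
      then have e1: "\<phi> (f \<otimes>\<^bsub>M\<^esub> a) [^]\<^bsub>N\<^esub> s \<otimes>\<^bsub>N\<^esub> (?w \<otimes>\<^bsub>N\<^esub> x) = \<phi> (f \<otimes>\<^bsub>M\<^esub> a) [^]\<^bsub>N\<^esub> s \<otimes>\<^bsub>N\<^esub> (?w \<otimes>\<^bsub>N\<^esub> y)"
        using fa f b(1) c(1) \<phi>m[of "(f \<otimes>\<^bsub>M\<^esub> a) [^]\<^bsub>M\<^esub> s" ?b] \<phi>m[of "(f \<otimes>\<^bsub>M\<^esub> a) [^]\<^bsub>M\<^esub> s" ?c] by (simp add: \<phi>p bx cy)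
      let ?v = "F [^]\<^bsub>N\<^esub> s"
      have v: "?v \<in> Units N" by (rule N.Units_nat_pow[OF Fu])
      have fs: "\<phi> (f \<otimes>\<^bsub>M\<^esub> a) [^]\<^bsub>N\<^esub> s = ?v \<otimes>\<^bsub>N\<^esub> n [^]\<^bsub>N\<^esub> s"
        using n Fc by (simp add: fan N.nat_pow_distrib)
      have cl: "?v \<in> carrier N" "?w \<in> carrier N" "n [^]\<^bsub>N\<^esub> s \<in> carrier N" using v w n by auto
      have r: "?v \<otimes>\<^bsub>N\<^esub> n [^]\<^bsub>N\<^esub> s \<otimes>\<^bsub>N\<^esub> (?w \<otimes>\<^bsub>N\<^esub> z) = (?v \<otimes>\<^bsub>N\<^esub> ?w) \<otimes>\<^bsub>N\<^esub> (n [^]\<^bsub>N\<^esub> s \<otimes>\<^bsub>N\<^esub> z)" if "z \<in> carrier N" for z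
        using cl that by (simp only: N.m_ac N.m_closed)
      have "(?v \<otimes>\<^bsub>N\<^esub> ?w) \<otimes>\<^bsub>N\<^esub> (n [^]\<^bsub>N\<^esub> s \<otimes>\<^bsub>N\<^esub> x) = (?v \<otimes>\<^bsub>N\<^esub> ?w) \<otimes>\<^bsub>N\<^esub> (n [^]\<^bsub>N\<^esub> s \<otimes>\<^bsub>N\<^esub> y)"
        using e1 unfolding fs r[OF x] r[OF y] .
      then have "n [^]\<^bsub>N\<^esub> s \<otimes>\<^bsub>N\<^esub> x = n [^]\<^bsub>N\<^esub> s \<otimes>\<^bsub>N\<^esub> y"
        using N.Units_l_cancel[OF N.Units_m_closed[OF v w], of "n [^]\<^bsub>N\<^esub> s \<otimes>\<^bsub>N\<^esub> x" "n [^]\<^bsub>N\<^esub> s \<otimes>\<^bsub>N\<^esub> y"] n x y by simp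
      then show ?thesis by blast
    qed
    have "\<psi> \<in> hom N (\<O> E)" using \<psi>c \<psi>m by (simp add: hom_def)
    then have "is_localization N n (\<O> E) \<psi>" unfolding is_localization_def using \<psi>1 nu sE iE by blast
    then show ?thesis by (simp add: \<psi>_def E_def)
  qed
  ultimately have "mchart X D N h' id"
    unfolding mchart_def N_def using D(1) comm_monoid_sections[OF D(1)] by (auto simp: hom_def)
  then show ?thesis unfolding maffine_def D_def by blast
qed

end

lemma maffine_opn: "maffine X U \<Longrightarrow> opn U"
  by (auto simp: maffine_def mchart_def)

lemma maffine_closed_point:
  assumes "maffine X U"
  obtains x where "x \<in> U" "\<And>W. opn W \<Longrightarrow> x \<in> W \<Longrightarrow> U \<subseteq> W"
proof -
  obtain M :: "'a monoid" and h \<theta> where c: "mchart X U M h \<theta>" using assms by (auto simp: maffine_def)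
  show thesis by (rule chart_closed_point[OF c]) (rule that)
qed

text \<open>All non-empty open subsets of a chart contain its generic point.\<close>

lemma maffine_irreducible:
  assumes "maffine X U" "opn V" "V \<subseteq> U" "V \<noteq> {}" "opn W" "W \<subseteq> U" "W \<noteq> {}"
  shows "V \<inter> W \<noteq> {}"
proof -
  obtain M :: "'a monoid" and h \<theta> where c: "mchart X U M h \<theta>" using assms by (auto simp: maffine_def)
  show ?thesis using chart_generic[OF c] assms by blast
qed

text \<open>In a chart around \<open>x\<close> the intersection with \<open>V\<close> is a union of
  basic open sets, and these are affine by \<open>basic_open_affine\<close>.\<close>

lemma maffine_basis:
  assumes X: "monoid_scheme_space X" and V: "opn V" "x \<in> V"
  obtains W where "maffine X W" "x \<in> W" "W \<subseteq> V"
proof -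
  have "x \<in> pts" using openin_subset[OF V(1)] V(2) by blast
  then obtain U where U: "maffine X U" "x \<in> U" using X by (auto simp: monoid_scheme_space_def)
  then obtain M :: "'a monoid" and h \<theta> where c: "mchart X U M h \<theta>" by (auto simp: maffine_def)
  have "opn (V \<inter> U) \<and> V \<inter> U \<subseteq> U" using V(1) maffine_opn[OF U(1)] by (simp add: openin_Int)
  then obtain F where F: "F \<subseteq> carrier M" "V \<inter> U = (\<Union>f\<in>F. h ` mbasic M f)" unfolding chart_open_iff[OF c] by blast
  then obtain f where f: "f \<in> F" "x \<in> h ` mbasic M f" using V(2) U(2) by blast
  show thesis
    by (rule that[of "h ` mbasic M f"]) (use basic_open_affine[OF c, of f] f F in auto)
qed

lemma mline_bundle_trivial_on_affine:
  assumes L: "mline_bundle X L" and U: "maffine X U"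
  obtains e where "mgenerator X L U e"
proof -
  obtain x where x: "x \<in> U" "\<And>W. opn W \<Longrightarrow> x \<in> W \<Longrightarrow> U \<subseteq> W" using maffine_closed_point[OF U] by metis
  have "x \<in> pts" using openin_subset[OF maffine_opn[OF U]] x(1) by blast
  then obtain W e where W: "opn W" "x \<in> W" and e: "mgenerator X L W e"
    by (rule mline_bundle_local_generator[OF L])
  show thesis
    by (rule that) (rule mgenerator_restrict[OF mline_bundle_sheaf[OF L] W(1) maffine_opn[OF U] x(2)[OF W] e])
qed

end

section \<open>Monoid algebras\<close>

text \<open>Root-closed cancellative partial orders on a commutative monoid.  Starting from equality, any
  finite set of incomparable pairs can be made comparable one after the other; this replaces the
  total orders on torsion-free abelian groups in the proof that units of monoid algebras are monomials.\<close>

definition (in comm_monoid) root_order :: "('a \<Rightarrow> 'a \<Rightarrow> bool) \<Rightarrow> bool" where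
  "root_order pr \<longleftrightarrow>
     (\<forall>a\<in>carrier G. pr a a) \<and>
     (\<forall>a\<in>carrier G. \<forall>b\<in>carrier G. pr a b \<longrightarrow> pr b a \<longrightarrow> a = b) \<and>
     (\<forall>a\<in>carrier G. \<forall>b\<in>carrier G. \<forall>c\<in>carrier G. pr a b \<longrightarrow> pr b c \<longrightarrow> pr a c) \<and>
     (\<forall>a\<in>carrier G. \<forall>b\<in>carrier G. \<forall>c\<in>carrier G. pr (c \<otimes> a) (c \<otimes> b) \<longleftrightarrow> pr a b) \<and>
     (\<forall>a\<in>carrier G. \<forall>b\<in>carrier G. \<forall>n::nat. n > 0 \<longrightarrow> pr (a [^] n) (b [^] n) \<longrightarrow> pr a b)"

context comm_monoid
begin

context
  fixes pr assumes pr: "root_order pr"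
begin

lemma root_order_refl: "a \<in> carrier G \<Longrightarrow> pr a a"
  and root_order_antisym: "a \<in> carrier G \<Longrightarrow> b \<in> carrier G \<Longrightarrow> pr a b \<Longrightarrow> pr b a \<Longrightarrow> a = b"
  and root_order_trans: "a \<in> carrier G \<Longrightarrow> b \<in> carrier G \<Longrightarrow> c \<in> carrier G \<Longrightarrow> pr a b \<Longrightarrow> pr b c \<Longrightarrow> pr a c"
  and root_order_mult_iff: "a \<in> carrier G \<Longrightarrow> b \<in> carrier G \<Longrightarrow> c \<in> carrier G \<Longrightarrow> pr (c \<otimes> a) (c \<otimes> b) \<longleftrightarrow> pr a b"
  and root_order_root: "a \<in> carrier G \<Longrightarrow> b \<in> carrier G \<Longrightarrow> n > 0 \<Longrightarrow> pr (a [^] (n::nat)) (b [^] n) \<Longrightarrow> pr a b"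
  using pr unfolding root_order_def by metis+

lemma root_order_mult:
  assumes "a \<in> carrier G" "b \<in> carrier G" "c \<in> carrier G" "d \<in> carrier G" "pr a b" "pr c d"
  shows "pr (a \<otimes> c) (b \<otimes> d)"
proof (rule root_order_trans[of _ "a \<otimes> d"])
  show "pr (a \<otimes> c) (a \<otimes> d)" using assms root_order_mult_iff by simp
  show "pr (a \<otimes> d) (b \<otimes> d)" using assms root_order_mult_iff[of a b d] by (simp add: m_comm)
qed (use assms in simp_all)

lemma root_order_power:
  assumes "a \<in> carrier G" "b \<in> carrier G" "pr a b"
  shows "pr (a [^] (n::nat)) (b [^] n)"
  by (induction n) (use assms in \<open>simp_all add: root_order_refl root_order_mult\<close>)

text \<open>\<open>pr'\<close> is the least root-closed cancellative order that contains
  \<open>pr\<close> and puts \<open>y\<close> below \<open>x\<close>: if \<open>a ^ r x ^ n\<close>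
  lies below \<open>b ^ r y ^ n\<close>, then replacing \<open>y\<close> by the larger
  \<open>x\<close>, cancelling \<open>x ^ n\<close> and extracting an \<open>r\<close>-th root puts
  \<open>a\<close> below \<open>b\<close>. Carrying both exponents along avoids passing to a group
  of fractions or to roots.\<close>

lemma root_order_extend:
  assumes x: "x \<in> carrier G" and y: "y \<in> carrier G" and xy: "\<not> pr x y"
  shows "\<exists>pr'. root_order pr' \<and> (\<forall>a b. a \<in> carrier G \<longrightarrow> b \<in> carrier G \<longrightarrow> pr a b \<longrightarrow> pr' a b) \<and> pr' y x"
proof -
  define pr' where "pr' a b \<longleftrightarrow> (\<exists>r n. r > (0::nat) \<and> pr (a [^] r \<otimes> x [^] (n::nat)) (b [^] r \<otimes> y [^] n))" for a b
  have pw: "pr (a [^] (r * s) \<otimes> x [^] (n * s)) (b [^] (r * s) \<otimes> y [^] (n * s))"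
    if "a \<in> carrier G" "b \<in> carrier G" "pr (a [^] r \<otimes> x [^] n) (b [^] r \<otimes> y [^] n)" for a b and r n s :: nat
    using root_order_power[OF _ _ that(3), of s] that x y by (simp add: nat_pow_distrib nat_pow_pow)
  have "root_order pr'"
    unfolding root_order_def
  proof (intro conjI ballI impI allI)
    fix a assume a: "a \<in> carrier G"
    show "pr' a a" unfolding pr'_def by (rule exI[of _ 1], rule exI[of _ 0]) (simp add: a root_order_refl)
    fix b assume b: "b \<in> carrier G"
    show "a = b" if ab: "pr' a b" "pr' b a"
    proof -
      obtain r n :: nat where r: "r > 0" "pr (a [^] r \<otimes> x [^] n) (b [^] r \<otimes> y [^] n)" using ab(1) unfolding pr'_def by (elim exE conjE)
      obtain s m :: nat where s: "s > 0" "pr (b [^] s \<otimes> x [^] m) (a [^] s \<otimes> y [^] m)" using ab(2) unfolding pr'_def by (elim exE conjE)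
      have 1: "pr (a [^] (r * s) \<otimes> x [^] (n * s)) (b [^] (r * s) \<otimes> y [^] (n * s))" by (rule pw[OF a b r(2)])
      have 2: "pr (b [^] (r * s) \<otimes> x [^] (m * r)) (a [^] (r * s) \<otimes> y [^] (m * r))"
        using pw[OF b a s(2), of r] by (simp add: mult.commute)
      let ?A = "a [^] (r * s)" and ?B = "b [^] (r * s)"
      have "pr (?A \<otimes> x [^] (n * s) \<otimes> (?B \<otimes> x [^] (m * r))) (?B \<otimes> y [^] (n * s) \<otimes> (?A \<otimes> y [^] (m * r)))"
        by (rule root_order_mult[OF _ _ _ _ 1 2]) (use a b x y in simp_all)
      also have "?A \<otimes> x [^] (n * s) \<otimes> (?B \<otimes> x [^] (m * r)) = (?A \<otimes> ?B) \<otimes> x [^] (n * s + m * r)"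
        using a b x by (simp add: nat_pow_mult[symmetric] m_ac)
      also have "?B \<otimes> y [^] (n * s) \<otimes> (?A \<otimes> y [^] (m * r)) = (?A \<otimes> ?B) \<otimes> y [^] (n * s + m * r)"
        using a b y by (simp add: nat_pow_mult[symmetric] m_ac)
      finally have "pr (x [^] (n * s + m * r)) (y [^] (n * s + m * r))"
        using a b x y by (simp add: root_order_mult_iff)
      \<comment> \<open>A positive exponent would yield \<open>pr x y\<close> by extracting the
        root. This is where \<open>\<not> pr x y\<close> enters; with both exponents zero, only the
        original relations between powers of \<open>a\<close> and \<open>b\<close> remain.\<close>
      then have "n * s + m * r = 0" using root_order_root[OF x y] xy by blast
      then have "n = 0" "m = 0" using r(1) s(1) by simp_all
      then have "pr a b" "pr b a"
        using r s a b root_order_root[OF a b r(1)] root_order_root[OF b a s(1)] by simp_all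
      then show "a = b" by (rule root_order_antisym[OF a b])
    qed
    fix c assume c: "c \<in> carrier G"
    show "pr' a c" if ab: "pr' a b" "pr' b c"
    proof -
      obtain r n :: nat where r: "r > 0" "pr (a [^] r \<otimes> x [^] n) (b [^] r \<otimes> y [^] n)" using ab(1) unfolding pr'_def by (elim exE conjE)
      obtain s m :: nat where s: "s > 0" "pr (b [^] s \<otimes> x [^] m) (c [^] s \<otimes> y [^] m)" using ab(2) unfolding pr'_def by (elim exE conjE)
      have 1: "pr (a [^] (r * s) \<otimes> x [^] (n * s)) (b [^] (r * s) \<otimes> y [^] (n * s))" by (rule pw[OF a b r(2)])
      have 2: "pr (b [^] (r * s) \<otimes> x [^] (m * r)) (c [^] (r * s) \<otimes> y [^] (m * r))"
        using pw[OF b c s(2), of r] by (simp add: mult.commute)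
      let ?A = "a [^] (r * s)" and ?B = "b [^] (r * s)" and ?C = "c [^] (r * s)"
      have "pr (?A \<otimes> x [^] (n * s) \<otimes> x [^] (m * r)) (?B \<otimes> y [^] (n * s) \<otimes> x [^] (m * r))"
        by (rule root_order_mult[OF _ _ _ _ 1 root_order_refl]) (use a b x y in simp_all)
      moreover have "pr (?B \<otimes> x [^] (m * r) \<otimes> y [^] (n * s)) (?C \<otimes> y [^] (m * r) \<otimes> y [^] (n * s))"
        by (rule root_order_mult[OF _ _ _ _ 2 root_order_refl]) (use b c x y in simp_all)
      moreover have "?B \<otimes> y [^] (n * s) \<otimes> x [^] (m * r) = ?B \<otimes> x [^] (m * r) \<otimes> y [^] (n * s)"
        using b x y by (simp add: m_ac)
      ultimately have "pr (?A \<otimes> x [^] (n * s) \<otimes> x [^] (m * r)) (?C \<otimes> y [^] (m * r) \<otimes> y [^] (n * s))"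
        using root_order_trans[of "?A \<otimes> x [^] (n * s) \<otimes> x [^] (m * r)" "?B \<otimes> x [^] (m * r) \<otimes> y [^] (n * s)"
          "?C \<otimes> y [^] (m * r) \<otimes> y [^] (n * s)"] a b c x y by simp
      then have "pr (?A \<otimes> x [^] (n * s + m * r)) (?C \<otimes> y [^] (n * s + m * r))"
        using a c x y by (simp add: nat_pow_mult[symmetric] m_assoc add.commute[of "n * s"])
          (simp add: m_ac)
      moreover have "r * s > 0" using r s by simp
      ultimately show "pr' a c"
        unfolding pr'_def by (intro exI[of _ "r * s"] exI[of _ "n * s + m * r"] conjI)
    qed
    show "pr' (c \<otimes> a) (c \<otimes> b) \<longleftrightarrow> pr' a b"
    proof -
      have "pr ((c \<otimes> a) [^] r \<otimes> x [^] n) ((c \<otimes> b) [^] r \<otimes> y [^] n) \<longleftrightarrow> pr (a [^] r \<otimes> x [^] n) (b [^] r \<otimes> y [^] n)" for r n :: nat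
        using a b c x y root_order_mult_iff[of "a [^] r \<otimes> x [^] n" "b [^] r \<otimes> y [^] n" "c [^] r"]
        by (simp add: nat_pow_distrib m_assoc)
      then show ?thesis by (simp add: pr'_def)
    qed
    fix n :: nat assume n: "n > 0"
    show "pr' a b" if "pr' (a [^] n) (b [^] n)"
    proof -
      obtain r m :: nat where r: "r > 0" "pr ((a [^] n) [^] r \<otimes> x [^] (m::nat)) ((b [^] n) [^] r \<otimes> y [^] m)"
        using \<open>pr' (a [^] n) (b [^] n)\<close> unfolding pr'_def by (elim exE conjE)
      then show "pr' a b" unfolding pr'_def using a b n by (intro exI[of _ "n * r"] exI[of _ m]) (simp add: nat_pow_pow)
    qed
  qed
  moreover have "pr' a b" if "a \<in> carrier G" "b \<in> carrier G" "pr a b" for a b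
    unfolding pr'_def by (rule exI[of _ 1], rule exI[of _ 0]) (use that in simp)
  moreover have "pr' y x"
    unfolding pr'_def by (rule exI[of _ 1], rule exI[of _ 1]) (use x y in \<open>simp add: m_comm root_order_refl\<close>)
  ultimately show ?thesis by blast
qed

end

lemma root_order_total_on:
  assumes cancel: "\<forall>a\<in>carrier G. \<forall>x\<in>carrier G. \<forall>y\<in>carrier G. a \<otimes> x = a \<otimes> y \<longrightarrow> x = y"
    and torsion: "\<forall>x\<in>carrier G. \<forall>y\<in>carrier G. \<forall>n::nat. n > 0 \<and> x [^] n = y [^] n \<longrightarrow> x = y"
    and A: "finite A" "A \<subseteq> carrier G"
  shows "\<exists>pr. root_order pr \<and> (\<forall>x\<in>A. \<forall>y\<in>A. pr x y \<or> pr y x)"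
proof -
  have "\<exists>pr. root_order pr \<and> (\<forall>(x, y)\<in>B. pr x y \<or> pr y x)" if "finite B" "B \<subseteq> carrier G \<times> carrier G" for B
    using that
  proof (induction B rule: finite_induct)
    case empty
    \<comment> \<open>For equality, the cancellation clause and the root clause are the cancellation
      law and torsion-freeness.\<close>
    have "root_order (=)" unfolding root_order_def using cancel torsion by blast
    then show ?case by blast
  next
    case (insert p B)
    then obtain pr where pr: "root_order pr" "\<forall>(x, y)\<in>B. pr x y \<or> pr y x" by auto
    obtain x y where p: "p = (x, y)" and x: "x \<in> carrier G" and y: "y \<in> carrier G" using insert.prems by auto
    show ?case
    proof (cases "pr x y")
      case True
      then show ?thesis using pr p by (intro exI[of _ pr]) simp
    next
      case False
      then obtain pr' where pr': "root_order pr'" "\<And>a b. a \<in> carrier G \<Longrightarrow> b \<in> carrier G \<Longrightarrow> pr a b \<Longrightarrow> pr' a b" "pr' y x"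
        using root_order_extend[OF pr(1) x y] by blast
      \<comment> \<open>The extension only enlarges the order, so pairs made comparable earlier stay
        comparable.\<close>
      have "pr' a b \<or> pr' b a" if ab: "(a, b) \<in> B" for a b
      proof -
        have "a \<in> carrier G" "b \<in> carrier G" using ab insert.prems by auto
        then show ?thesis using pr(2) pr'(2)[of a b] pr'(2)[of b a] ab by blast
      qed
      then show ?thesis using pr'(1,3) p by (intro exI[of _ pr']) auto
    qed
  qed
  from this[of "A \<times> A"] obtain pr where "root_order pr" "\<forall>(x, y)\<in>A \<times> A. pr x y \<or> pr y x" using A by auto
  then show ?thesis by blast
qed

lemma root_order_maximum:
  assumes pr: "root_order pr" and A: "finite A" "A \<noteq> {}" "A \<subseteq> carrier G"
    and tot: "\<And>x y. x \<in> A \<Longrightarrow> y \<in> A \<Longrightarrow> pr x y \<or> pr y x"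
  shows "\<exists>m\<in>A. \<forall>a\<in>A. pr a m" "\<exists>m\<in>A. \<forall>a\<in>A. pr m a"
proof -
  note r = root_order_refl[OF pr] and t = root_order_trans[OF pr]
  have "\<exists>m\<in>B. \<forall>a\<in>B. pr a m" if "finite B" "B \<noteq> {}" "B \<subseteq> A" for B
    using that
  proof (induction B rule: finite_ne_induct)
    case (singleton x)
    then show ?case using r A by auto
  next
    case (insert x B)
    then obtain m where m: "m \<in> B" "\<forall>a\<in>B. pr a m" by auto
    have c: "x \<in> A" "m \<in> A" "B \<subseteq> A" using insert m by auto
    from tot[OF c(1,2)] show ?case
    proof
      assume "pr x m" then show ?thesis using m by auto
    next
      assume mx: "pr m x"
      have "pr a x" if "a \<in> B" for a using t[of a m x] m that mx c A(3) by blast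
      then show ?thesis using r c A(3) by auto
    qed
  qed
  from this[OF A(1,2)] show "\<exists>m\<in>A. \<forall>a\<in>A. pr a m" by simp
  have "\<exists>m\<in>B. \<forall>a\<in>B. pr m a" if "finite B" "B \<noteq> {}" "B \<subseteq> A" for B
    using that
  proof (induction B rule: finite_ne_induct)
    case (singleton x)
    then show ?case using r A by auto
  next
    case (insert x B)
    then obtain m where m: "m \<in> B" "\<forall>a\<in>B. pr m a" by auto
    have c: "x \<in> A" "m \<in> A" "B \<subseteq> A" using insert m by auto
    from tot[OF c(1,2)] show ?case
    proof
      assume "pr m x" then show ?thesis using m by auto
    next
      assume mx: "pr x m"
      have "pr x a" if "a \<in> B" for a using t[of x m a] m that mx c A(3) by blast
      then show ?thesis using r c A(3) by auto
    qed
  qed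
  from this[OF A(1,2)] show "\<exists>m\<in>A. \<forall>a\<in>A. pr m a" by simp
qed

end

section \<open>Finitely supported functions, push-forward and convolution\<close>

definition monomial :: "('k, 'm) ring_scheme \<Rightarrow> 'k \<Rightarrow> 's \<Rightarrow> 's \<Rightarrow> 'k" where
  "monomial k c x = (\<lambda>y. if y = x then c else \<zero>\<^bsub>k\<^esub>)"

abbreviation (input) supp :: "('k, 'm) ring_scheme \<Rightarrow> ('s \<Rightarrow> 'k) \<Rightarrow> 's set" where
  "supp k F \<equiv> {x. F x \<noteq> \<zero>\<^bsub>k\<^esub>}"

lemma single_monomial: "single k x = monomial k \<one>\<^bsub>k\<^esub> x"
  by (simp add: single_def monomial_def)

context domain
begin

definition fadd :: "('s \<Rightarrow> 'a) \<Rightarrow> ('s \<Rightarrow> 'a) \<Rightarrow> 's \<Rightarrow> 'a" where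
  "fadd F G = (\<lambda>x. F x \<oplus> G x)"

lemma fin_suppD:
  assumes "F \<in> fin_supp R S"
  shows "F x \<in> carrier R" "finite (supp R F)" "F x \<noteq> \<zero> \<Longrightarrow> x \<in> S"
  using assms by (auto simp: fin_supp_def)

lemma zero_fin_supp: "(\<lambda>x. \<zero>) \<in> fin_supp R S"
  by (simp add: fin_supp_def)

lemma monomial_fin_supp: "c \<in> carrier R \<Longrightarrow> x \<in> S \<Longrightarrow> monomial R c x \<in> fin_supp R S"
  by (auto simp: fin_supp_def monomial_def)

lemma single_fin_supp: "x \<in> S \<Longrightarrow> single R x \<in> fin_supp R S"
  by (simp add: single_monomial monomial_fin_supp)

lemma fadd_fin_supp:
  assumes "F \<in> fin_supp R S" "G \<in> fin_supp R S"
  shows "fadd F G \<in> fin_supp R S"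
proof -
  have "supp R (fadd F G) \<subseteq> supp R F \<union> supp R G" using assms by (auto simp: fadd_def)
  moreover have "finite (supp R F \<union> supp R G)" "supp R F \<union> supp R G \<subseteq> S" using assms by (auto simp: fin_supp_def)
  ultimately show ?thesis
    using assms finite_subset[of "supp R (fadd F G)"] by (auto simp: fin_supp_def fadd_def)
qed

text \<open>Finitely supported functions are finite sums of monomials, so additive identities need
  to be checked on monomials only.\<close>

lemma fin_supp_induct [consumes 1, case_names zero add]:
  assumes F: "F \<in> fin_supp R S" and zero: "P (\<lambda>x. \<zero>)"
    and add: "\<And>c x F. c \<in> carrier R \<Longrightarrow> x \<in> S \<Longrightarrow> F \<in> fin_supp R S \<Longrightarrow> P F \<Longrightarrow> P (fadd (monomial R c x) F)"
  shows "P F"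
proof -
  have "P F" if "finite A" "supp R F \<subseteq> A" "F \<in> fin_supp R S" for A F
    using that
  proof (induction A arbitrary: F rule: finite_induct)
    case empty
    then have "F = (\<lambda>x. \<zero>)" by auto
    then show ?case using zero by simp
  next
    case (insert x A)
    let ?G = "\<lambda>y. if y = x then \<zero> else F y"
    have "supp R ?G \<subseteq> supp R F" by auto
    then have G: "?G \<in> fin_supp R S"
      using insert.prems(2) finite_subset[of "supp R ?G" "supp R F"] by (auto simp: fin_supp_def)
    have sub: "supp R ?G \<subseteq> A" using insert.prems(1) by auto
    show ?case
    proof (cases "F x = \<zero>")
      case True
      then have "?G = F" by auto
      then show ?thesis using insert.IH[OF sub G] by simp
    next
      case False
      have "fadd (monomial R (F x) x) ?G = F"
        using fin_suppD(1)[OF insert.prems(2)] by (auto simp: fadd_def monomial_def)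
      moreover have "P (fadd (monomial R (F x) x) ?G)"
        by (rule add[OF _ _ G insert.IH[OF sub G]]) (use fin_suppD[OF insert.prems(2)] False in auto)
      ultimately show ?thesis by simp
    qed
  qed
  then show ?thesis using fin_suppD(2)[OF F] F by blast
qed

text \<open>Terms outside the support vanish. A freely chosen finite index set is needed to compare
  the sums for \<open>F\<close>, \<open>G\<close> and \<open>fadd F G\<close>, whose supports
  differ.\<close>

lemma push_forward_eq:
  assumes F: "F \<in> fin_supp R S" and B: "finite B" "supp R F \<subseteq> B"
  shows "push_forward R \<phi> F y = finsum R F {x \<in> B. \<phi> x = y}"
  unfolding push_forward_def
  by (rule add.finprod_mono_neutral_cong_left) (use B fin_suppD[OF F] in auto)

lemma push_forward_fadd:
  assumes F: "F \<in> fin_supp R S" and G: "G \<in> fin_supp R S"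
  shows "push_forward R \<phi> (fadd F G) = fadd (push_forward R \<phi> F) (push_forward R \<phi> G)"
proof
  fix y
  let ?B = "supp R F \<union> supp R G"
  have B: "finite ?B" using fin_suppD(2)[OF F] fin_suppD(2)[OF G] by simp
  have sub: "supp R (fadd F G) \<subseteq> ?B" using fin_suppD(1)[OF F] fin_suppD(1)[OF G] by (auto simp: fadd_def)
  show "push_forward R \<phi> (fadd F G) y = fadd (push_forward R \<phi> F) (push_forward R \<phi> G) y"
    unfolding push_forward_eq[OF fadd_fin_supp[OF F G] B sub] unfolding fadd_def
    unfolding push_forward_eq[OF F B Un_upper1] push_forward_eq[OF G B Un_upper2]
    by (rule finsum_addf) (use fin_suppD(1)[OF F] fin_suppD(1)[OF G] in auto)
qed

lemma push_forward_monomial: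
  assumes "c \<in> carrier R"
  shows "push_forward R \<phi> (monomial R c x) = monomial R c (\<phi> x)"
proof
  fix y
  have "push_forward R \<phi> (monomial R c x) y = finsum R (monomial R c x) {z \<in> {x}. \<phi> z = y}"
    by (rule push_forward_eq[OF monomial_fin_supp[OF assms UNIV_I]]) (auto simp: monomial_def)
  also have "{z \<in> {x}. \<phi> z = y} = (if \<phi> x = y then {x} else {})" by auto
  also have "finsum R (monomial R c x) \<dots> = monomial R c (\<phi> x) y"
    using assms by (auto simp: monomial_def)
  finally show "push_forward R \<phi> (monomial R c x) y = monomial R c (\<phi> x) y" .
qed

lemma push_forward_zero: "push_forward R \<phi> (\<lambda>x. \<zero>) = (\<lambda>x. \<zero>)"
  by (simp add: push_forward_def)

lemma push_forward_fin_supp: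
  assumes F: "F \<in> fin_supp R S" and \<phi>: "\<And>x. x \<in> S \<Longrightarrow> \<phi> x \<in> T"
  shows "push_forward R \<phi> F \<in> fin_supp R T"
  using F
proof (induction rule: fin_supp_induct)
  case zero
  show ?case by (simp add: push_forward_zero zero_fin_supp)
next
  case (add c x F)
  have m: "monomial R c x \<in> fin_supp R S" by (rule monomial_fin_supp[OF add(1,2)])
  show ?case
    unfolding push_forward_fadd[OF m add(3)] push_forward_monomial[OF add(1)]
    by (rule fadd_fin_supp[OF monomial_fin_supp[OF add(1) \<phi>[OF add(2)]] add(4)])
qed

lemma push_forward_comp:
  assumes F: "F \<in> fin_supp R S"
  shows "push_forward R \<psi> (push_forward R \<phi> F) = push_forward R (\<psi> \<circ> \<phi>) F"
  using F
proof (induction rule: fin_supp_induct)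
  case zero
  show ?case by (simp add: push_forward_zero)
next
  case (add c x F)
  have m: "monomial R c x \<in> fin_supp R S" by (rule monomial_fin_supp[OF add(1,2)])
  have "push_forward R \<phi> F \<in> fin_supp R UNIV" by (rule push_forward_fin_supp[OF add(3)]) simp
  then have "push_forward R \<psi> (fadd (monomial R c (\<phi> x)) (push_forward R \<phi> F)) =
      fadd (push_forward R \<psi> (monomial R c (\<phi> x))) (push_forward R \<psi> (push_forward R \<phi> F))"
    by (rule push_forward_fadd[OF monomial_fin_supp[OF add(1) UNIV_I]])
  then show ?case
    by (simp add: push_forward_fadd[OF m add(3)] push_forward_monomial[OF add(1)] add(4))
qed

lemma push_forward_cong:
  assumes F: "F \<in> fin_supp R S" and eq: "\<And>x. x \<in> S \<Longrightarrow> \<phi> x = \<psi> x"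
  shows "push_forward R \<phi> F = push_forward R \<psi> F"
proof -
  have "{x. F x \<noteq> \<zero> \<and> \<phi> x = y} = {x. F x \<noteq> \<zero> \<and> \<psi> x = y}" for y using fin_suppD(3)[OF F] eq by auto
  then show ?thesis by (simp add: push_forward_def)
qed

lemma push_forward_id:
  assumes F: "F \<in> fin_supp R S" and id: "\<And>x. x \<in> S \<Longrightarrow> \<phi> x = x"
  shows "push_forward R \<phi> F = F"
  using F
proof (induction rule: fin_supp_induct)
  case zero
  show ?case by (simp add: push_forward_zero)
next
  case (add c x F)
  have m: "monomial R c x \<in> fin_supp R S" by (rule monomial_fin_supp[OF add(1,2)])
  show ?case
    by (simp add: push_forward_fadd[OF m add(3)] push_forward_monomial[OF add(1)] add(4) id[OF add(2)])
qed

lemma convolve_eq: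
  assumes F: "F \<in> fin_supp R S" and G: "G \<in> fin_supp R T"
    and B: "finite B" "supp R F \<subseteq> B" and C: "finite C" "supp R G \<subseteq> C"
  shows "convolve R p F G z = finsum R (\<lambda>(a, x). F a \<otimes> G x) {(a, x) \<in> B \<times> C. p a x = z}"
  unfolding convolve_def
  by (rule add.finprod_mono_neutral_cong_left)
    (use B C fin_suppD[OF F] fin_suppD[OF G] in \<open>auto intro: finite_subset[of _ "B \<times> C"]\<close>)

lemma convolve_fadd:
  assumes F: "F \<in> fin_supp R S" "F' \<in> fin_supp R S" and G: "G \<in> fin_supp R T" "G' \<in> fin_supp R T"
  shows "convolve R p (fadd F F') G = fadd (convolve R p F G) (convolve R p F' G)"
    "convolve R p F (fadd G G') = fadd (convolve R p F G) (convolve R p F G')"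
proof -
  let ?B = "supp R F \<union> supp R F'" and ?C = "supp R G \<union> supp R G'"
  have B: "finite ?B" using fin_suppD(2)[OF F(1)] fin_suppD(2)[OF F(2)] by simp
  have C: "finite ?C" using fin_suppD(2)[OF G(1)] fin_suppD(2)[OF G(2)] by simp
  note c = fin_suppD(1)[OF F(1)] fin_suppD(1)[OF F(2)] fin_suppD(1)[OF G(1)] fin_suppD(1)[OF G(2)]
  have sF: "supp R (fadd F F') \<subseteq> ?B" and sG: "supp R (fadd G G') \<subseteq> ?C" using c by (auto simp: fadd_def)
  show "convolve R p (fadd F F') G = fadd (convolve R p F G) (convolve R p F' G)"
  proof
    fix z
    let ?D = "{(a, x) \<in> ?B \<times> ?C. p a x = z}"
    have "convolve R p (fadd F F') G z = finsum R (\<lambda>(a, x). (F a \<oplus> F' a) \<otimes> G x) ?D"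
      unfolding convolve_eq[OF fadd_fin_supp[OF F] G(1) B sF C Un_upper1] by (simp add: fadd_def)
    also have "\<dots> = finsum R (\<lambda>q. (case q of (a, x) \<Rightarrow> F a \<otimes> G x) \<oplus> (case q of (a, x) \<Rightarrow> F' a \<otimes> G x)) ?D"
      by (rule finsum_cong') (auto simp: c l_distr)
    also have "\<dots> = finsum R (\<lambda>(a, x). F a \<otimes> G x) ?D \<oplus> finsum R (\<lambda>(a, x). F' a \<otimes> G x) ?D"
      by (rule finsum_addf) (auto simp: c)
    also have "\<dots> = fadd (convolve R p F G) (convolve R p F' G) z"
      unfolding fadd_def convolve_eq[OF F(1) G(1) B Un_upper1 C Un_upper1] convolve_eq[OF F(2) G(1) B Un_upper2 C Un_upper1] ..
    finally show "convolve R p (fadd F F') G z = fadd (convolve R p F G) (convolve R p F' G) z" .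
  qed
  show "convolve R p F (fadd G G') = fadd (convolve R p F G) (convolve R p F G')"
  proof
    fix z
    let ?D = "{(a, x) \<in> ?B \<times> ?C. p a x = z}"
    have "convolve R p F (fadd G G') z = finsum R (\<lambda>(a, x). F a \<otimes> (G x \<oplus> G' x)) ?D"
      unfolding convolve_eq[OF F(1) fadd_fin_supp[OF G] B Un_upper1 C sG] by (simp add: fadd_def)
    also have "\<dots> = finsum R (\<lambda>q. (case q of (a, x) \<Rightarrow> F a \<otimes> G x) \<oplus> (case q of (a, x) \<Rightarrow> F a \<otimes> G' x)) ?D"
      by (rule finsum_cong') (auto simp: c r_distr)
    also have "\<dots> = finsum R (\<lambda>(a, x). F a \<otimes> G x) ?D \<oplus> finsum R (\<lambda>(a, x). F a \<otimes> G' x) ?D"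
      by (rule finsum_addf) (auto simp: c)
    also have "\<dots> = fadd (convolve R p F G) (convolve R p F G') z"
      unfolding fadd_def convolve_eq[OF F(1) G(1) B Un_upper1 C Un_upper1] convolve_eq[OF F(1) G(2) B Un_upper1 C Un_upper2] ..
    finally show "convolve R p F (fadd G G') z = fadd (convolve R p F G) (convolve R p F G') z" .
  qed
qed

lemma convolve_zero: "convolve R p (\<lambda>x. \<zero>) G = (\<lambda>x. \<zero>)" "convolve R p F (\<lambda>x. \<zero>) = (\<lambda>x. \<zero>)"
  by (simp_all add: convolve_def)

lemma convolve_monomial:
  assumes "c \<in> carrier R" "d \<in> carrier R"
  shows "convolve R p (monomial R c a) (monomial R d x) = monomial R (c \<otimes> d) (p a x)"
proof
  fix z
  have "convolve R p (monomial R c a) (monomial R d x) z =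
      finsum R (\<lambda>(a', x'). monomial R c a a' \<otimes> monomial R d x x') {(a', x') \<in> {a} \<times> {x}. p a' x' = z}"
    by (rule convolve_eq[OF monomial_fin_supp[OF assms(1) UNIV_I] monomial_fin_supp[OF assms(2) UNIV_I]])
      (auto simp: monomial_def)
  also have "{(a', x') \<in> {a} \<times> {x}. p a' x' = z} = (if p a x = z then {(a, x)} else {})" by auto
  also have "finsum R (\<lambda>(a', x'). monomial R c a a' \<otimes> monomial R d x x') \<dots> = monomial R (c \<otimes> d) (p a x) z"
    using assms by (auto simp: monomial_def)
  finally show "convolve R p (monomial R c a) (monomial R d x) z = monomial R (c \<otimes> d) (p a x) z" .
qed

text \<open>Biadditive identities are decided on pairs of monomials, where
  \<open>convolve_monomial\<close> computes the product.\<close>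

lemma bilinear_induct [consumes 2, case_names zero_left zero_right add_left add_right monomial]:
  assumes F: "F \<in> fin_supp R S" and G: "G \<in> fin_supp R T"
    and zl: "\<And>G. P (\<lambda>x. \<zero>) G" and zr: "\<And>F. P F (\<lambda>x. \<zero>)"
    and al: "\<And>F F' G. F \<in> fin_supp R S \<Longrightarrow> F' \<in> fin_supp R S \<Longrightarrow> G \<in> fin_supp R T \<Longrightarrow> P F G \<Longrightarrow> P F' G \<Longrightarrow> P (fadd F F') G"
    and ar: "\<And>F G G'. F \<in> fin_supp R S \<Longrightarrow> G \<in> fin_supp R T \<Longrightarrow> G' \<in> fin_supp R T \<Longrightarrow> P F G \<Longrightarrow> P F G' \<Longrightarrow> P F (fadd G G')"
    and mon: "\<And>c d a x. c \<in> carrier R \<Longrightarrow> d \<in> carrier R \<Longrightarrow> a \<in> S \<Longrightarrow> x \<in> T \<Longrightarrow> P (monomial R c a) (monomial R d x)"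
  shows "P F G"
  using F
proof (induction rule: fin_supp_induct)
  case (add c a F)
  have m: "monomial R c a \<in> fin_supp R S" by (rule monomial_fin_supp[OF add(1,2)])
  have "P (monomial R c a) G"
    using G
  proof (induction rule: fin_supp_induct)
    case (add d x G)
    then show ?case using ar[OF m monomial_fin_supp] mon \<open>c \<in> carrier R\<close> \<open>a \<in> S\<close> by blast
  qed (rule zr)
  then show ?case by (rule al[OF m add(3) G _ add(4)])
qed (rule zl)

lemma convolve_fin_supp:
  assumes F: "F \<in> fin_supp R S" and G: "G \<in> fin_supp R T" and p: "\<And>a x. a \<in> S \<Longrightarrow> x \<in> T \<Longrightarrow> p a x \<in> U"
  shows "convolve R p F G \<in> fin_supp R U"
  using F G
proof (induction rule: bilinear_induct)
  case (add_left F F' G)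
  then show ?case using convolve_fadd(1)[of F S F' G T G p] fadd_fin_supp by simp
next
  case (add_right F G G')
  then show ?case using convolve_fadd(2)[of F S F G T G' p] fadd_fin_supp by simp
next
  case (monomial c d a x)
  then show ?case by (simp add: convolve_monomial monomial_fin_supp p)
qed (simp_all add: convolve_zero zero_fin_supp)

text \<open>On monomials this is the hypothesis on the maps. With \<open>\<phi>\<close> the identity
  it makes the passage to coordinates linear over the monoid algebra.\<close>

lemma push_forward_convolve:
  assumes F: "F \<in> fin_supp R S" and G: "G \<in> fin_supp R T" and q: "\<And>a x. a \<in> S \<Longrightarrow> x \<in> T \<Longrightarrow> \<psi> (p a x) = q (\<phi> a) (\<chi> x)"
  shows "push_forward R \<psi> (convolve R p F G) = convolve R q (push_forward R \<phi> F) (push_forward R \<chi> G)"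
proof -
  have c: "convolve R p F G \<in> fin_supp R UNIV" if "F \<in> fin_supp R S" "G \<in> fin_supp R T" for F G
    by (rule convolve_fin_supp[OF that]) simp
  have f: "push_forward R \<phi> F \<in> fin_supp R UNIV" if "F \<in> fin_supp R S" for F
    by (rule push_forward_fin_supp[OF that UNIV_I])
  have g: "push_forward R \<chi> G \<in> fin_supp R UNIV" if "G \<in> fin_supp R T" for G
    by (rule push_forward_fin_supp[OF that UNIV_I])
  show ?thesis
    using F G
  proof (induction rule: bilinear_induct)
    case (add_left F F' G)
    then show ?case
      by (simp add: convolve_fadd(1)[OF add_left(1,2,3,3)] push_forward_fadd[OF c[OF add_left(1,3)] c[OF add_left(2,3)]]
        push_forward_fadd[OF add_left(1,2)] convolve_fadd(1)[OF f[OF add_left(1)] f[OF add_left(2)] g[OF add_left(3)] g[OF add_left(3)]])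
  next
    case (add_right F G G')
    then show ?case
      by (simp add: convolve_fadd(2)[OF add_right(1,1,2,3)] push_forward_fadd[OF c[OF add_right(1,2)] c[OF add_right(1,3)]]
        push_forward_fadd[OF add_right(2,3)] convolve_fadd(2)[OF f[OF add_right(1)] f[OF add_right(1)] g[OF add_right(2)] g[OF add_right(3)]])
  next
    case (monomial c d a x)
    then show ?case by (simp add: convolve_monomial push_forward_monomial q)
  qed (simp_all add: convolve_zero push_forward_zero)
qed

lemma convolve_single_right:
  assumes F: "F \<in> fin_supp R S"
  shows "convolve R p F (single R x) = push_forward R (\<lambda>a. p a x) F"
  using F
proof (induction rule: fin_supp_induct)
  case zero
  show ?case by (simp add: push_forward_zero convolve_zero)
next
  case (add c a F)
  have m: "monomial R c a \<in> fin_supp R S" by (rule monomial_fin_supp[OF add(1,2)])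
  have s: "single R x \<in> fin_supp R UNIV" by (rule single_fin_supp) simp
  show ?case
    unfolding push_forward_fadd[OF m add(3)] convolve_fadd(1)[OF m add(3) s s] add(4)
    by (simp add: single_monomial convolve_monomial push_forward_monomial add(1))
qed

text \<open>The product of the largest monomials, and that of the smallest ones, cannot cancel.\<close>

lemma monoid_algebra_unit:
  assumes M: "comm_monoid M"
    and cancel: "\<forall>a\<in>carrier M. \<forall>x\<in>carrier M. \<forall>y\<in>carrier M. a \<otimes>\<^bsub>M\<^esub> x = a \<otimes>\<^bsub>M\<^esub> y \<longrightarrow> x = y"
    and torsion: "\<forall>x\<in>carrier M. \<forall>y\<in>carrier M. \<forall>n::nat. n > 0 \<and> x [^]\<^bsub>M\<^esub> n = y [^]\<^bsub>M\<^esub> n \<longrightarrow> x = y"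
    and F: "F \<in> fin_supp R (carrier M)" and G: "G \<in> fin_supp R (carrier M)"
    and FG: "convolve R (monoid.mult M) F G = single R \<one>\<^bsub>M\<^esub>"
  obtains c m where "c \<in> Units R" "m \<in> Units M" "F = monomial R c m"
proof -
  interpret M: comm_monoid M by (rule M)
  let ?A = "supp R F" and ?B = "supp R G"
  have sub: "?A \<subseteq> carrier M" "?B \<subseteq> carrier M" and fin: "finite ?A" "finite ?B"
    using F G by (auto simp: fin_supp_def)
  have ne: "?A \<noteq> {}" "?B \<noteq> {}"
  proof -
    have "convolve R (monoid.mult M) F G \<one>\<^bsub>M\<^esub> \<noteq> \<zero>" unfolding FG by (simp add: single_def)
    then have "F \<noteq> (\<lambda>x. \<zero>)" "G \<noteq> (\<lambda>x. \<zero>)"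
      using fun_cong[OF convolve_zero(1), of "monoid.mult M" G] fun_cong[OF convolve_zero(2), of "monoid.mult M" F] by metis+
    then show "?A \<noteq> {}" "?B \<noteq> {}" by auto
  qed
  \<comment> \<open>Comparability is arranged on the two finite supports, which is enough to have
    extreme elements there.\<close>
  obtain pr where pr: "M.root_order pr" and tot: "\<And>x y. x \<in> ?A \<union> ?B \<Longrightarrow> y \<in> ?A \<union> ?B \<Longrightarrow> pr x y \<or> pr y x"
    using M.root_order_total_on[OF cancel torsion finite_UnI[OF fin] Un_least[OF sub]] by blast
  obtain a1 a2 where a1: "a1 \<in> ?A" "\<forall>a\<in>?A. pr a a1" and a2: "a2 \<in> ?A" "\<forall>a\<in>?A. pr a2 a"
    using M.root_order_maximum[OF pr fin(1) ne(1) sub(1)] tot by blast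
  obtain b1 b2 where b1: "b1 \<in> ?B" "\<forall>b\<in>?B. pr b b1" and b2: "b2 \<in> ?B" "\<forall>b\<in>?B. pr b2 b"
    using M.root_order_maximum[OF pr fin(2) ne(2) sub(2)] tot by blast
  have c: "a1 \<in> carrier M" "a2 \<in> carrier M" "b1 \<in> carrier M" "b2 \<in> carrier M" using a1 a2 b1 b2 sub by blast+
  \<comment> \<open>Sandwich: \<open>a \<otimes> b\<close> lies below \<open>a \<otimes> b'\<close>,
    which lies below \<open>a' \<otimes> b' = a \<otimes> b\<close>; antisymmetry and cancellation
    finish.\<close>
  have ext: "a = a' \<and> b = b'"
    if "a \<in> carrier M" "a' \<in> carrier M" "b \<in> carrier M" "b' \<in> carrier M" "pr a a'" "pr b b'" "a \<otimes>\<^bsub>M\<^esub> b = a' \<otimes>\<^bsub>M\<^esub> b'" for a a' b b'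
  proof -
    have 1: "pr (a \<otimes>\<^bsub>M\<^esub> b) (a \<otimes>\<^bsub>M\<^esub> b')" using that(1-6) M.root_order_mult_iff[OF pr] by simp
    have 2: "pr (a \<otimes>\<^bsub>M\<^esub> b') (a \<otimes>\<^bsub>M\<^esub> b)"
      unfolding that(7) using that(1-6) M.root_order_mult_iff[OF pr, of a a' b'] by (simp add: M.m_comm)
    have "a \<otimes>\<^bsub>M\<^esub> b = a \<otimes>\<^bsub>M\<^esub> b'" by (rule M.root_order_antisym[OF pr _ _ 1 2]) (use that in simp_all)
    then have b: "b = b'" using cancel that by blast
    then have "b \<otimes>\<^bsub>M\<^esub> a = b \<otimes>\<^bsub>M\<^esub> a'" using that by (simp add: M.m_comm)
    then show ?thesis using cancel that b by blast
  qed
  have val: "convolve R (monoid.mult M) F G (a0 \<otimes>\<^bsub>M\<^esub> b0) = F a0 \<otimes> G b0"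
    if "a0 \<in> ?A" "b0 \<in> ?B" "\<forall>a\<in>?A. \<forall>b\<in>?B. a \<otimes>\<^bsub>M\<^esub> b = a0 \<otimes>\<^bsub>M\<^esub> b0 \<longrightarrow> a = a0 \<and> b = b0" for a0 b0
  proof -
    have "{(a, b). F a \<noteq> \<zero> \<and> G b \<noteq> \<zero> \<and> a \<otimes>\<^bsub>M\<^esub> b = a0 \<otimes>\<^bsub>M\<^esub> b0} = {(a0, b0)}" using that by auto
    then show ?thesis using fin_suppD(1)[OF F] fin_suppD(1)[OF G] by (simp add: convolve_def)
  qed
  \<comment> \<open>A product reached by a single pair has coefficient
    \<open>F a0 \<otimes> G b0\<close>, non-zero in a domain, so it must be the only exponent on the
    right-hand side of \<open>FG\<close>.\<close>
  have one: "a0 \<otimes>\<^bsub>M\<^esub> b0 = \<one>\<^bsub>M\<^esub>" "F a0 \<otimes> G b0 = \<one>"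
    if ab: "a0 \<in> ?A" "b0 \<in> ?B" and u: "\<forall>a\<in>?A. \<forall>b\<in>?B. a \<otimes>\<^bsub>M\<^esub> b = a0 \<otimes>\<^bsub>M\<^esub> b0 \<longrightarrow> a = a0 \<and> b = b0" for a0 b0
  proof -
    have "F a0 \<otimes> G b0 \<noteq> \<zero>" using ab fin_suppD(1)[OF F] fin_suppD(1)[OF G] integral by blast
    moreover have "F a0 \<otimes> G b0 = single R \<one>\<^bsub>M\<^esub> (a0 \<otimes>\<^bsub>M\<^esub> b0)" using val[OF ab u] FG by simp
    ultimately show "a0 \<otimes>\<^bsub>M\<^esub> b0 = \<one>\<^bsub>M\<^esub>" "F a0 \<otimes> G b0 = \<one>" by (auto simp: single_def split: if_splits)
  qed
  have "\<forall>a\<in>?A. \<forall>b\<in>?B. a \<otimes>\<^bsub>M\<^esub> b = a1 \<otimes>\<^bsub>M\<^esub> b1 \<longrightarrow> a = a1 \<and> b = b1"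
  proof (intro ballI impI)
    fix a b assume ab: "a \<in> ?A" "b \<in> ?B" and eq: "a \<otimes>\<^bsub>M\<^esub> b = a1 \<otimes>\<^bsub>M\<^esub> b1"
    show "a = a1 \<and> b = b1"
      by (rule ext[OF subsetD[OF sub(1) ab(1)] c(1) subsetD[OF sub(2) ab(2)] c(3) bspec[OF a1(2) ab(1)] bspec[OF b1(2) ab(2)] eq])
  qed
  note o1 = one[OF a1(1) b1(1) this]
  have "\<forall>a\<in>?A. \<forall>b\<in>?B. a \<otimes>\<^bsub>M\<^esub> b = a2 \<otimes>\<^bsub>M\<^esub> b2 \<longrightarrow> a = a2 \<and> b = b2"
  proof (intro ballI impI)
    fix a b assume ab: "a \<in> ?A" "b \<in> ?B" and eq: "a \<otimes>\<^bsub>M\<^esub> b = a2 \<otimes>\<^bsub>M\<^esub> b2"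
    show "a = a2 \<and> b = b2"
      using ext[OF c(2) subsetD[OF sub(1) ab(1)] c(4) subsetD[OF sub(2) ab(2)] bspec[OF a2(2) ab(1)] bspec[OF b2(2) ab(2)] eq[symmetric]]
      by simp
  qed
  note o2 = one[OF a2(1) b2(1) this]
  \<comment> \<open>The product of the largest and the product of the smallest elements are both
    one, so the smallest and the largest element of the support of \<open>F\<close> coincide and
    \<open>F\<close> has a single term.\<close>
  have "a2 = a1"
    using ext[OF c(2,1,4,3) bspec[OF a1(2) a2(1)] bspec[OF b1(2) b2(1)]] o1(1) o2(1) by simp
  then have "a = a1" if "a \<in> ?A" for a
    using that a1(2) a2(2) M.root_order_antisym[OF pr, of a a1] sub(1) c(1) by blast
  then have "F x = monomial R (F a1) a1 x" for x unfolding monomial_def by (cases "F x = \<zero>") auto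
  then have "F = monomial R (F a1) a1" by (rule HOL.ext)
  moreover have "F a1 \<in> Units R"
    by (rule Units_factor[of _ "G b1"]) (simp_all add: o1 fin_suppD(1)[OF F] fin_suppD(1)[OF G])
  moreover have "a1 \<in> Units M"
    by (rule M.Units_factor[of _ b1]) (simp_all add: o1 c)
  ultimately show thesis using that by blast
qed

end

section \<open>The scheme $X_k$\<close>

lemma openin_generated:
  assumes int: "\<And>f g. f \<in> C \<Longrightarrow> g \<in> C \<Longrightarrow> \<exists>h\<in>C. B f \<inter> B g = B h"
  shows "openin (topology (arbitrary union_of (\<lambda>S. S \<in> B ` C))) S \<longleftrightarrow> (\<exists>F\<subseteq>C. S = (\<Union>f\<in>F. B f))"
proof -
  have "istopology (arbitrary union_of (\<lambda>S. S \<in> B ` C))"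
    by (rule istopology_base) (use int in force)
  then have "openin (topology (arbitrary union_of (\<lambda>S. S \<in> B ` C))) S \<longleftrightarrow> (arbitrary union_of (\<lambda>S. S \<in> B ` C)) S"
    by (simp add: topology_inverse')
  also have "\<dots> \<longleftrightarrow> (\<exists>\<U>\<subseteq>B ` C. S = \<Union>\<U>)"
    by (auto simp: union_of_def arbitrary_def)
  finally show ?thesis unfolding ex_subset_image_Union .
qed

lemma homeomorphic_open_iff:
  assumes h: "homeomorphic_map S (subtopology T U) h" and U: "openin T U"
    and S: "\<And>A. openin S A \<longleftrightarrow> (\<exists>F\<subseteq>C. A = (\<Union>f\<in>F. B f))"
  shows "openin T W \<and> W \<subseteq> U \<longleftrightarrow> (\<exists>F\<subseteq>C. W = (\<Union>f\<in>F. h ` B f))"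
proof
  assume W: "openin T W \<and> W \<subseteq> U"
  let ?A = "{P \<in> topspace S. h P \<in> W}"
  have "openin (subtopology T U) W" using W U by (simp add: openin_open_subtopology)
  then have "openin S ?A"
    using openin_continuous_map_preimage[OF homeomorphic_imp_continuous_map[OF h]] by blast
  then obtain F where F: "F \<subseteq> C" "?A = (\<Union>f\<in>F. B f)" unfolding S by (elim exE conjE)
  have "h ` topspace S = U"
    using homeomorphic_imp_surjective_map[OF h] openin_subset[OF U] by (simp add: inf_absorb2)
  then have "W = h ` ?A" using W by auto
  then show "\<exists>F\<subseteq>C. W = (\<Union>f\<in>F. h ` B f)" using F(1) unfolding F(2) image_UN by (intro exI[of _ F]) simp
next
  assume "\<exists>F\<subseteq>C. W = (\<Union>f\<in>F. h ` B f)"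
  then obtain F where F: "F \<subseteq> C" "W = h ` (\<Union>f\<in>F. B f)" unfolding image_UN by (elim exE conjE)
  have "openin S (\<Union>f\<in>F. B f)" unfolding S using F(1) by (intro exI[of _ F]) simp
  then have "openin (subtopology T U) W"
    unfolding F(2) using homeomorphic_imp_open_map[OF h] by (simp add: open_map_def)
  then show "openin T W \<and> W \<subseteq> U" using U by (simp add: openin_open_subtopology)
qed

lemma primeideal_mult_iff:
  assumes P: "primeideal P R" and f: "f \<in> carrier R" "g \<in> carrier R"
  shows "f \<otimes>\<^bsub>R\<^esub> g \<in> P \<longleftrightarrow> f \<in> P \<or> g \<in> P"
proof -
  interpret primeideal P R by (rule P)
  show ?thesis using I_prime[OF f] I_l_closed[of g f] I_r_closed[of f g] f by blast
qed

lemma rbasic_mult: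
  assumes "f \<in> carrier R" "g \<in> carrier R"
  shows "rbasic R (f \<otimes>\<^bsub>R\<^esub> g) = rbasic R f \<inter> rbasic R g"
proof -
  have "f \<otimes>\<^bsub>R\<^esub> g \<notin> P \<longleftrightarrow> f \<notin> P \<and> g \<notin> P" if "primeideal P R" for P
    using primeideal_mult_iff[OF that assms] by simp
  then show ?thesis unfolding rbasic_def by blast
qed

lemma rbasic_one: "rbasic R \<one>\<^bsub>R\<^esub> = {P. primeideal P R}"
proof -
  have "\<one>\<^bsub>R\<^esub> \<notin> P" if "primeideal P R" for P
    using that primeideal.I_notcarr[OF that] ideal.one_imp_carrier[of P R] by (auto simp: primeideal_def)
  then show ?thesis unfolding rbasic_def by blast
qed

lemma openin_rspec:
  assumes "cring R"
  shows "openin (rspec R) S \<longleftrightarrow> (\<exists>F\<subseteq>carrier R. S = (\<Union>f\<in>F. rbasic R f))"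
  unfolding rspec_def
proof (rule openin_generated)
  fix f g assume fg: "f \<in> carrier R" "g \<in> carrier R"
  interpret cring R by (rule assms)
  show "\<exists>h\<in>carrier R. rbasic R f \<inter> rbasic R g = rbasic R h"
    using rbasic_mult[OF fg] fg by (intro bexI[of _ "f \<otimes>\<^bsub>R\<^esub> g"]) simp_all
qed

lemma topspace_rspec:
  assumes "cring R"
  shows "topspace (rspec R) = rbasic R \<one>\<^bsub>R\<^esub>"
proof
  interpret cring R by (rule assms)
  obtain F where "topspace (rspec R) = (\<Union>f\<in>F. rbasic R f)"
    using openin_topspace[of "rspec R"] unfolding openin_rspec[OF assms] by (elim exE conjE)
  then show "topspace (rspec R) \<subseteq> rbasic R \<one>\<^bsub>R\<^esub>" by (auto simp: rbasic_one) (auto simp: rbasic_def)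
  have "openin (rspec R) (rbasic R \<one>\<^bsub>R\<^esub>)"
    unfolding openin_rspec[OF assms] by (intro exI[of _ "{\<one>\<^bsub>R\<^esub>}"]) simp
  then show "rbasic R \<one>\<^bsub>R\<^esub> \<subseteq> topspace (rspec R)" by (rule openin_subset)
qed

section \<open>Functions on X_k over affine opens\<close>

locale base_changed =
  k: domain k + X: mono_space X + Y: ring_space Y
  for k :: "'k ring" and X :: "('p, 'a) monoidal_space" and Y :: "('y, 'r) ringed_space" +
  fixes \<gamma> :: "('p, 'a, 'k, 'y, 'r) gluing"
  assumes scheme: "monoid_scheme_space X"
    and cancel: "\<And>U. maffine X U \<Longrightarrow> \<forall>a\<in>carrier (msec X U). \<forall>x\<in>carrier (msec X U). \<forall>y\<in>carrier (msec X U).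
           a \<otimes>\<^bsub>msec X U\<^esub> x = a \<otimes>\<^bsub>msec X U\<^esub> y \<longrightarrow> x = y"
    and torsion: "\<And>U. maffine X U \<Longrightarrow> \<forall>x\<in>carrier (msec X U). \<forall>y\<in>carrier (msec X U). \<forall>n::nat.
           n > 0 \<and> x [^]\<^bsub>msec X U\<^esub> n = y [^]\<^bsub>msec X U\<^esub> n \<longrightarrow> x = y"
    and base_change: "base_change k X Y \<gamma>"
begin

abbreviation "alg U \<equiv> monoid_algebra k (msec X U)"
abbreviation "ov U \<equiv> over_k k X \<gamma> U"

lemma alg_simps:
  "carrier (alg U) = fin_supp k (carrier (msec X U))" "monoid.mult (alg U) = convolve k (monoid.mult (msec X U))"
  "\<one>\<^bsub>alg U\<^esub> = single k \<one>\<^bsub>msec X U\<^esub>" "\<zero>\<^bsub>alg U\<^esub> = (\<lambda>_. \<zero>\<^bsub>k\<^esub>)" "F \<oplus>\<^bsub>alg U\<^esub> G = k.fadd F G"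
  by (simp_all add: monoid_algebra_def k.fadd_def)

lemma base_change_charts: "\<forall>U. maffine X U \<longrightarrow> rchart Y (ov U) (alg U) (gpt \<gamma> U) (gsec \<gamma> U)"
  and topspace_Y: "topspace (rtop Y) = \<Union>(over_k k X \<gamma> ` {U. maffine X U})"
  and base_change_restrict: "\<forall>U V. maffine X U \<and> maffine X V \<and> V \<subseteq> U \<longrightarrow>
        (\<forall>P. primeideal P (alg V) \<longrightarrow>
           gpt \<gamma> V P = gpt \<gamma> U {f \<in> carrier (alg U). push_forward k (mres X U V) f \<in> P}) \<and>
        (\<forall>f\<in>carrier (alg U). gsec \<gamma> V (push_forward k (mres X U V) f) = rres Y (ov U) (ov V) (gsec \<gamma> U f))"
  and base_change_Int: "\<forall>U V. maffine X U \<and> maffine X V \<longrightarrow>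
        ov U \<inter> ov V = \<Union>(over_k k X \<gamma> ` {W. maffine X W \<and> W \<subseteq> U \<inter> V})"
proof -
  note b = base_change[unfolded base_change_def]
  show "\<forall>U. maffine X U \<longrightarrow> rchart Y (ov U) (alg U) (gpt \<gamma> U) (gsec \<gamma> U)" by (rule b[THEN conjunct2, THEN conjunct1])
  show "topspace (rtop Y) = \<Union>(over_k k X \<gamma> ` {U. maffine X U})" by (rule b[THEN conjunct2, THEN conjunct2, THEN conjunct1])
  show "\<forall>U V. maffine X U \<and> maffine X V \<and> V \<subseteq> U \<longrightarrow>
        (\<forall>P. primeideal P (alg V) \<longrightarrow>
           gpt \<gamma> V P = gpt \<gamma> U {f \<in> carrier (alg U). push_forward k (mres X U V) f \<in> P}) \<and>
        (\<forall>f\<in>carrier (alg U). gsec \<gamma> V (push_forward k (mres X U V) f) = rres Y (ov U) (ov V) (gsec \<gamma> U f))"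
    by (rule b[THEN conjunct2, THEN conjunct2, THEN conjunct2, THEN conjunct1])
  show "\<forall>U V. maffine X U \<and> maffine X V \<longrightarrow>
        ov U \<inter> ov V = \<Union>(over_k k X \<gamma> ` {W. maffine X W \<and> W \<subseteq> U \<inter> V})"
    by (rule b[THEN conjunct2, THEN conjunct2, THEN conjunct2, THEN conjunct2])
qed

lemma ov_Int: "maffine X U \<Longrightarrow> maffine X V \<Longrightarrow> ov U \<inter> ov V = \<Union>(over_k k X \<gamma> ` {W. maffine X W \<and> W \<subseteq> U \<inter> V})"
  using base_change_Int by simp

text \<open>\<open>V\<close> is itself among the affine opens inside \<open>U \<inter> V\<close>, so
  the overlap condition of the gluing data places \<open>ov V\<close> inside
  \<open>ov U\<close>.\<close>

lemma ov_subset: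
  assumes "maffine X U" "maffine X V" "V \<subseteq> U"
  shows "ov V \<subseteq> ov U"
proof -
  have "ov V \<subseteq> \<Union>(over_k k X \<gamma> ` {W. maffine X W \<and> W \<subseteq> U \<inter> V})" using assms by auto
  then have "ov V \<subseteq> ov U \<inter> ov V" unfolding ov_Int[OF assms(1,2)] .
  then show ?thesis by simp
qed

lemma gsec_restrict:
  "maffine X U \<Longrightarrow> maffine X V \<Longrightarrow> V \<subseteq> U \<Longrightarrow> F \<in> carrier (alg U) \<Longrightarrow>
    rres Y (ov U) (ov V) (gsec \<gamma> U F) = gsec \<gamma> V (push_forward k (mres X U V) F)"
  using base_change_restrict by simp

context
  fixes U assumes U: "maffine X U"
begin

lemma rchart_ov: "rchart Y (ov U) (alg U) (gpt \<gamma> U) (gsec \<gamma> U)"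
  using base_change_charts U by simp

lemma ov_open: "openin (rtop Y) (ov U)"
  and cring_alg: "cring (alg U)"
  and gsec_hom: "gsec \<gamma> U \<in> ring_hom (alg U) (rsec Y (ov U))"
  and gpt_homeo: "homeomorphic_map (rspec (alg U)) (subtopology (rtop Y) (ov U)) (gpt \<gamma> U)"
  and ov_localization: "F \<in> carrier (alg U) \<Longrightarrow> is_localization (alg U) F (rsec Y (gpt \<gamma> U ` rbasic (alg U) F))
    (rres Y (ov U) (gpt \<gamma> U ` rbasic (alg U) F) \<circ> gsec \<gamma> U)"
  using rchart_ov by (simp_all add: rchart_def)

lemma ov_eq: "ov U = gpt \<gamma> U ` rbasic (alg U) \<one>\<^bsub>alg U\<^esub>"
  by (simp add: over_k_def topspace_rspec[OF cring_alg])

lemma ov_open_iff: "openin (rtop Y) W \<and> W \<subseteq> ov U \<longleftrightarrow> (\<exists>F\<subseteq>carrier (alg U). W = (\<Union>f\<in>F. gpt \<gamma> U ` rbasic (alg U) f))"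
  by (rule homeomorphic_open_iff[OF gpt_homeo ov_open openin_rspec[OF cring_alg]])

lemma basic_open:
  assumes "F \<in> carrier (alg U)"
  shows "openin (rtop Y) (gpt \<gamma> U ` rbasic (alg U) F)" "gpt \<gamma> U ` rbasic (alg U) F \<subseteq> ov U"
proof -
  have "openin (rtop Y) (gpt \<gamma> U ` rbasic (alg U) F) \<and> gpt \<gamma> U ` rbasic (alg U) F \<subseteq> ov U"
    unfolding ov_open_iff using assms by (intro exI[of _ "{F}"]) simp
  then show "openin (rtop Y) (gpt \<gamma> U ` rbasic (alg U) F)" "gpt \<gamma> U ` rbasic (alg U) F \<subseteq> ov U" by simp_all
qed

lemma basic_Int:
  assumes "F \<in> carrier (alg U)" "G \<in> carrier (alg U)"
  shows "gpt \<gamma> U ` rbasic (alg U) F \<inter> gpt \<gamma> U ` rbasic (alg U) G = gpt \<gamma> U ` rbasic (alg U) (F \<otimes>\<^bsub>alg U\<^esub> G)"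
proof -
  have inj: "inj_on (gpt \<gamma> U) (rbasic (alg U) \<one>\<^bsub>alg U\<^esub>)"
    using homeomorphic_imp_injective_map[OF gpt_homeo] by (simp add: topspace_rspec[OF cring_alg])
  show ?thesis
    unfolding rbasic_mult[OF assms]
    by (rule inj_on_image_Int[OF inj, symmetric]) (auto simp: rbasic_one, auto simp: rbasic_def)
qed

lemma gsec_closed: "F \<in> carrier (alg U) \<Longrightarrow> gsec \<gamma> U F \<in> carrier (rsec Y (ov U))"
  by (rule ring_hom_closed[OF gsec_hom])

text \<open>The chart at \<open>f = 1\<close>: powers of one disappear from the localization
  conditions, and what remains is injectivity and surjectivity.\<close>

lemma gsec_bij: "bij_betw (gsec \<gamma> U) (carrier (alg U)) (carrier (rsec Y (ov U)))"
proof -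
  interpret R: cring "alg U" by (rule cring_alg)
  interpret S: cring "rsec Y (ov U)" by (rule Y.cring_sections[OF ov_open])
  let ?\<phi> = "rres Y (ov U) (ov U) \<circ> gsec \<gamma> U"
  have \<phi>: "?\<phi> F = gsec \<gamma> U F" if "F \<in> carrier (alg U)" for F
    using Y.M.res_id[of "ov U" "gsec \<gamma> U F"] ov_open gsec_closed[OF that] by simp
  have loc: "is_localization (alg U) \<one>\<^bsub>alg U\<^esub> (rsec Y (ov U)) ?\<phi>"
    using ov_localization[OF R.one_closed] by (simp flip: ov_eq)
  show ?thesis
  proof (rule bij_betwI')
    fix F G assume F: "F \<in> carrier (alg U)" and G: "G \<in> carrier (alg U)"
    show "gsec \<gamma> U F = gsec \<gamma> U G \<longleftrightarrow> F = G"
    proof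
      assume "gsec \<gamma> U F = gsec \<gamma> U G"
      then have "?\<phi> F = ?\<phi> G" using \<phi> F G by simp
      then have "\<exists>m::nat. \<one>\<^bsub>alg U\<^esub> [^]\<^bsub>alg U\<^esub> m \<otimes>\<^bsub>alg U\<^esub> F = \<one>\<^bsub>alg U\<^esub> [^]\<^bsub>alg U\<^esub> m \<otimes>\<^bsub>alg U\<^esub> G"
        using loc F G unfolding is_localization_def by blast
      then show "F = G" using F G by simp
    qed simp
  next
    fix F assume "F \<in> carrier (alg U)" then show "gsec \<gamma> U F \<in> carrier (rsec Y (ov U))" by (rule gsec_closed)
  next
    fix t assume t: "t \<in> carrier (rsec Y (ov U))"
    have "\<exists>F\<in>carrier (alg U). \<exists>m::nat. ?\<phi> \<one>\<^bsub>alg U\<^esub> [^]\<^bsub>rsec Y (ov U)\<^esub> m \<otimes>\<^bsub>rsec Y (ov U)\<^esub> t = ?\<phi> F"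
      using loc t unfolding is_localization_def by blast
    then obtain F and m :: nat where F: "F \<in> carrier (alg U)"
      "?\<phi> \<one>\<^bsub>alg U\<^esub> [^]\<^bsub>rsec Y (ov U)\<^esub> m \<otimes>\<^bsub>rsec Y (ov U)\<^esub> t = ?\<phi> F" by blast
    moreover have "?\<phi> \<one>\<^bsub>alg U\<^esub> = \<one>\<^bsub>rsec Y (ov U)\<^esub>" using \<phi>[OF R.one_closed] ring_hom_one[OF gsec_hom] by simp
    ultimately have "t = gsec \<gamma> U F" using t \<phi>[OF F(1)] by simp
    then show "\<exists>F\<in>carrier (alg U). t = gsec \<gamma> U F" using F(1) by blast
  qed
qed

lemma gsec_inj: "F \<in> carrier (alg U) \<Longrightarrow> G \<in> carrier (alg U) \<Longrightarrow> gsec \<gamma> U F = gsec \<gamma> U G \<Longrightarrow> F = G"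
  using bij_betw_imp_inj_on[OF gsec_bij] by (rule inj_onD)

lemma gsec_surj:
  assumes "t \<in> carrier (rsec Y (ov U))"
  obtains F where "F \<in> carrier (alg U)" "t = gsec \<gamma> U F"
  using assms bij_betw_imp_surj_on[OF gsec_bij] by blast

text \<open>The inverse is transported to the algebra by \<open>gsec_bij\<close>, and
  \<open>monoid_algebra_unit\<close> applies; cancellation and torsion-freeness of the sections over
  the affine \<open>U\<close> enter here.\<close>

lemma gsec_unit:
  assumes t: "t \<in> Units (rsec Y (ov U))"
  obtains c m where "c \<in> Units k" "m \<in> Units (msec X U)" "t = gsec \<gamma> U (monomial k c m)"
proof -
  interpret R: cring "alg U" by (rule cring_alg)
  interpret S: cring "rsec Y (ov U)" by (rule Y.cring_sections[OF ov_open])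
  obtain F where F: "F \<in> carrier (alg U)" "t = gsec \<gamma> U F" using gsec_surj[OF S.Units_closed[OF t]] .
  obtain G where G: "G \<in> carrier (alg U)" "inv\<^bsub>rsec Y (ov U)\<^esub> t = gsec \<gamma> U G"
    using gsec_surj[OF S.Units_inv_closed[OF t]] .
  have "gsec \<gamma> U (F \<otimes>\<^bsub>alg U\<^esub> G) = gsec \<gamma> U \<one>\<^bsub>alg U\<^esub>"
    using ring_hom_mult[OF gsec_hom F(1) G(1)] ring_hom_one[OF gsec_hom] S.Units_r_inv[OF t] by (simp add: F(2)[symmetric] G(2)[symmetric])
  then have "F \<otimes>\<^bsub>alg U\<^esub> G = \<one>\<^bsub>alg U\<^esub>" by (rule gsec_inj[rotated 2]) (use F G in simp_all)
  then have FG: "convolve k (monoid.mult (msec X U)) F G = single k \<one>\<^bsub>msec X U\<^esub>" by (simp add: alg_simps)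
  obtain c m where "c \<in> Units k" "m \<in> Units (msec X U)" "F = monomial k c m"
    by (rule k.monoid_algebra_unit[OF X.comm_monoid_sections[OF X.maffine_opn[OF U]] cancel[OF U] torsion[OF U]
      F(1)[unfolded alg_simps] G(1)[unfolded alg_simps] FG])
  then show thesis using F(2) that by blast
qed

end

text \<open>\<open>kop W\<close> is the open subset \<open>W\<^sub>k\<close> of \<open>X\<^sub>k\<close> for an arbitrary open \<open>W\<close>, and \<open>iota W c m\<close> below is the section
  \<open>c \<cdot> m\<close> over it, glued from monomials on affine opens.\<close>

definition kop :: "'p set \<Rightarrow> 'y set" where
  "kop W = \<Union>(over_k k X \<gamma> ` {V. maffine X V \<and> V \<subseteq> W})"

lemma kop_eq: "kop W = (\<Union>V\<in>{V. maffine X V \<and> V \<subseteq> W}. ov V)"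
  by (simp add: kop_def)

lemma kop_affine: "maffine X U \<Longrightarrow> kop U = ov U"
  unfolding kop_def using ov_subset[of U] by auto

lemma kop_open: "openin (rtop Y) (kop W)"
  unfolding kop_def using ov_open by blast

lemma kop_mono: "W' \<subseteq> W \<Longrightarrow> kop W' \<subseteq> kop W"
  unfolding kop_def by blast

lemma ov_subset_kop: "maffine X V \<Longrightarrow> V \<subseteq> W \<Longrightarrow> ov V \<subseteq> kop W"
  unfolding kop_def by blast

text \<open>For affine opens this is the overlap condition of the gluing data; the general case
  follows because \<open>kop\<close> is a union over affine opens.\<close>

lemma kop_Int: "kop W \<inter> kop W' = kop (W \<inter> W')"
proof
  show "kop W \<inter> kop W' \<subseteq> kop (W \<inter> W')"
  proof
    fix y assume "y \<in> kop W \<inter> kop W'"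
    then obtain V V' where V: "maffine X V" "V \<subseteq> W" "maffine X V'" "V' \<subseteq> W'" "y \<in> ov V \<inter> ov V'"
      unfolding kop_def by blast
    then show "y \<in> kop (W \<inter> W')" unfolding ov_Int[OF V(1,3)] kop_def by blast
  qed
qed (use kop_mono[of "W \<inter> W'" W] kop_mono[of "W \<inter> W'" W'] in simp)

text \<open>The gluing data cover X_k by the sets of all affine opens \<open>W\<close> of
  \<open>X\<close>. The closed point of \<open>W\<close> lies in some \<open>U i\<close>, which then
  contains all of \<open>W\<close>, so the given affine opens suffice.\<close>

lemma kop_cover:
  assumes "maffine_cover X I U"
  shows "(\<Union>i\<in>I. ov (U i)) = topspace (rtop Y)"
proof
  show "(\<Union>i\<in>I. ov (U i)) \<subseteq> topspace (rtop Y)"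
    using assms unfolding topspace_Y maffine_cover_def by blast
  show "topspace (rtop Y) \<subseteq> (\<Union>i\<in>I. ov (U i))"
    unfolding topspace_Y
  proof (rule Union_least)
    fix S assume "S \<in> over_k k X \<gamma> ` {U. maffine X U}"
    then obtain W where W: "maffine X W" "S = ov W" by blast
    obtain x where x: "x \<in> W" "\<And>V. openin (mtop X) V \<Longrightarrow> x \<in> V \<Longrightarrow> W \<subseteq> V" using W(1) by (rule X.maffine_closed_point) blast
    have "x \<in> topspace (mtop X)" using openin_subset[OF X.maffine_opn[OF W(1)]] x(1) by blast
    then obtain i where i: "i \<in> I" "x \<in> U i" "maffine X (U i)" using assms unfolding maffine_cover_def by blast
    then have "ov W \<subseteq> ov (U i)" using ov_subset[OF i(3) W(1)] x(2)[OF X.maffine_opn] by blast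
    then show "S \<subseteq> (\<Union>i\<in>I. ov (U i))" using W(2) i(1) by blast
  qed
qed

lemma affine_cover_of_open: "openin (mtop X) W \<Longrightarrow> W = (\<Union>V\<in>{V. maffine X V \<and> V \<subseteq> W}. V)"
proof
  assume W: "openin (mtop X) W"
  show "W \<subseteq> (\<Union>V\<in>{V. maffine X V \<and> V \<subseteq> W}. V)"
  proof
    fix x assume "x \<in> W"
    with scheme W obtain V where "maffine X V" "x \<in> V" "V \<subseteq> W" by (rule X.maffine_basis)
    then show "x \<in> (\<Union>V\<in>{V. maffine X V \<and> V \<subseteq> W}. V)" by blast
  qed
qed blast

lemma monomial_alg: "c \<in> carrier k \<Longrightarrow> m \<in> carrier (msec X U) \<Longrightarrow> monomial k c m \<in> carrier (alg U)"
  by (simp add: alg_simps k.monomial_fin_supp)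

lemma kop_section_eqI:
  assumes "s \<in> carrier (rsec Y (kop W))" "t \<in> carrier (rsec Y (kop W))"
    and "\<And>V. maffine X V \<Longrightarrow> V \<subseteq> W \<Longrightarrow> rres Y (kop W) (ov V) s = rres Y (kop W) (ov V) t"
  shows "s = t"
  by (rule Y.M.section_eqI[of "{V. maffine X V \<and> V \<subseteq> W}" "over_k k X \<gamma>", unfolded mon_of_simps, OF _ kop_eq assms(1,2)])
    (use ov_open assms(3) in simp_all)

lemma exists_iota:
  assumes W: "openin (mtop X) W" and c: "c \<in> carrier k" and m: "m \<in> carrier (msec X W)"
  shows "\<exists>t\<in>carrier (rsec Y (kop W)). \<forall>V\<in>{V. maffine X V \<and> V \<subseteq> W}.
    rres Y (kop W) (ov V) t = gsec \<gamma> V (monomial k c (mres X W V m))"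
proof (rule Y.M.section_glue[of "{V. maffine X V \<and> V \<subseteq> W}" "over_k k X \<gamma>", unfolded mon_of_simps, OF _ kop_eq])
  fix V assume "V \<in> {V. maffine X V \<and> V \<subseteq> W}"
  then have V: "maffine X V" "V \<subseteq> W" by simp_all
  note mc = monomial_alg[OF c X.res_closed[OF W X.maffine_opn[OF V(1)] V(2) m]]
  show "openin (rtop Y) (ov V)" by (rule ov_open[OF V(1)])
  show "gsec \<gamma> V (monomial k c (mres X W V m)) \<in> carrier (rsec Y (ov V))" by (rule gsec_closed[OF V(1) mc])
  fix V' assume "V' \<in> {V. maffine X V \<and> V \<subseteq> W}"
  then have V': "maffine X V'" "V' \<subseteq> W" by simp_all
  note mc' = monomial_alg[OF c X.res_closed[OF W X.maffine_opn[OF V'(1)] V'(2) m]]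
  let ?s = "\<lambda>V. gsec \<gamma> V (monomial k c (mres X W V m))"
  \<comment> \<open>The overlap is described by the affine opens \<open>Z\<close> inside
    \<open>V \<inter> V'\<close>; agreement is tested on these, where both monomials restrict to the
    same one.\<close>
  have eq: "ov V \<inter> ov V' = kop (V \<inter> V')" using kop_Int[of V V'] by (simp add: kop_affine V V')
  have o: "openin (rtop Y) (ov V \<inter> ov V')" unfolding eq by (rule kop_open)
  have sub: "kop (V \<inter> V') \<subseteq> ov V" "kop (V \<inter> V') \<subseteq> ov V'" unfolding eq[symmetric] by simp_all
  have r: "rres Y (kop (V \<inter> V')) (ov Z) (rres Y (ov A) (ov V \<inter> ov V') (?s A)) = ?s Z"
    if A: "A = V \<or> A = V'" and Z: "maffine X Z" "Z \<subseteq> V \<inter> V'" for A Z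
  proof -
    have AA: "maffine X A" "A \<subseteq> W" "Z \<subseteq> A" "V \<inter> V' \<subseteq> A" using A V V' Z by auto
    have mA: "mres X W A m \<in> carrier (msec X A)" by (rule X.res_closed[OF W X.maffine_opn[OF AA(1)] AA(2) m])
    have "rres Y (kop (V \<inter> V')) (ov Z) (rres Y (ov A) (ov V \<inter> ov V') (?s A)) = rres Y (ov A) (ov Z) (?s A)"
      using Y.M.res_res[of "ov A" "ov V \<inter> ov V'" "ov Z" "?s A"] ov_open[OF AA(1)] ov_open[OF Z(1)] o
        ov_subset_kop[OF Z] gsec_closed[OF AA(1) monomial_alg[OF c mA]] A sub by (auto simp: eq)
    also have "\<dots> = ?s Z"
      by (simp add: gsec_restrict[OF AA(1) Z(1) AA(3) monomial_alg[OF c mA]] k.push_forward_monomial[OF c]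
          X.res_res[OF W X.maffine_opn[OF AA(1)] X.maffine_opn[OF Z(1)] AA(3,2) m])
    finally show ?thesis .
  qed
  have cl: "rres Y (ov A) (ov V \<inter> ov V') (?s A) \<in> carrier (rsec Y (kop (V \<inter> V')))" if A: "A = V \<or> A = V'" for A
    using Y.M.res_closed[of "ov A" "ov V \<inter> ov V'" "?s A"] ov_open[OF V(1)] ov_open[OF V'(1)] o A sub gsec_closed[OF V(1) mc] gsec_closed[OF V'(1) mc']
    by (auto simp: eq)
  show "rres Y (ov V) (ov V \<inter> ov V') (?s V) = rres Y (ov V') (ov V \<inter> ov V') (?s V')"
    by (rule kop_section_eqI[of _ "V \<inter> V'"]) (simp_all add: r cl)
qed

definition iota :: "'p set \<Rightarrow> 'k \<Rightarrow> 'a \<Rightarrow> 'r" where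
  "iota W c m = (SOME t. t \<in> carrier (rsec Y (kop W)) \<and> (\<forall>V\<in>{V. maffine X V \<and> V \<subseteq> W}.
    rres Y (kop W) (ov V) t = gsec \<gamma> V (monomial k c (mres X W V m))))"

lemma iota:
  assumes "openin (mtop X) W" "c \<in> carrier k" "m \<in> carrier (msec X W)"
  shows "iota W c m \<in> carrier (rsec Y (kop W))"
    "maffine X V \<Longrightarrow> V \<subseteq> W \<Longrightarrow> rres Y (kop W) (ov V) (iota W c m) = gsec \<gamma> V (monomial k c (mres X W V m))"
proof -
  have "iota W c m \<in> carrier (rsec Y (kop W)) \<and> (\<forall>V\<in>{V. maffine X V \<and> V \<subseteq> W}.
      rres Y (kop W) (ov V) (iota W c m) = gsec \<gamma> V (monomial k c (mres X W V m)))"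
    unfolding iota_def by (rule someI_ex) (use exists_iota[OF assms] in blast)
  then show "iota W c m \<in> carrier (rsec Y (kop W))"
    "maffine X V \<Longrightarrow> V \<subseteq> W \<Longrightarrow> rres Y (kop W) (ov V) (iota W c m) = gsec \<gamma> V (monomial k c (mres X W V m))" by simp_all
qed

lemma iota_eqI:
  assumes "openin (mtop X) W" "c \<in> carrier k" "m \<in> carrier (msec X W)" "t \<in> carrier (rsec Y (kop W))"
    and "\<And>V. maffine X V \<Longrightarrow> V \<subseteq> W \<Longrightarrow> rres Y (kop W) (ov V) t = gsec \<gamma> V (monomial k c (mres X W V m))"
  shows "t = iota W c m"
  by (rule kop_section_eqI[OF assms(4) iota(1)[OF assms(1-3)]]) (simp add: iota(2)[OF assms(1-3)] assms(5))

lemma iota_affine: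
  assumes U: "maffine X U" and c: "c \<in> carrier k" and m: "m \<in> carrier (msec X U)"
  shows "iota U c m = gsec \<gamma> U (monomial k c m)"
proof -
  note o = X.maffine_opn[OF U]
  have "rres Y (kop U) (ov U) (iota U c m) = gsec \<gamma> U (monomial k c m)"
    using iota(2)[OF o c m U subset_refl] by (simp add: X.res_id[OF o m])
  then show ?thesis
    using Y.M.res_id[of "ov U" "iota U c m"] ov_open[OF U] iota(1)[OF o c m] by (simp add: kop_affine[OF U])
qed

lemma iota_restrict:
  assumes W: "openin (mtop X) W" "openin (mtop X) W'" "W' \<subseteq> W" and c: "c \<in> carrier k" and m: "m \<in> carrier (msec X W)"
  shows "rres Y (kop W) (kop W') (iota W c m) = iota W' c (mres X W W' m)"
proof (rule iota_eqI[OF W(2) c X.res_closed[OF W m]])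
  note i = iota[OF W(1) c m]
  show "rres Y (kop W) (kop W') (iota W c m) \<in> carrier (rsec Y (kop W'))"
    using Y.M.res_closed[of "kop W" "kop W'" "iota W c m"] i(1) kop_mono[OF W(3)] by (simp add: kop_open)
  fix V assume V: "maffine X V" "V \<subseteq> W'"
  then have "rres Y (kop W') (ov V) (rres Y (kop W) (kop W') (iota W c m)) = rres Y (kop W) (ov V) (iota W c m)"
    using Y.M.res_res[of "kop W" "kop W'" "ov V" "iota W c m"] i(1) kop_mono[OF W(3)] ov_subset_kop[OF V] ov_open[OF V(1)]
    by (simp add: kop_open)
  then show "rres Y (kop W') (ov V) (rres Y (kop W) (kop W') (iota W c m)) = gsec \<gamma> V (monomial k c (mres X W' V (mres X W W' m)))"
    using i(2)[OF V(1)] V W(3) by (simp add: X.res_res[OF W(1,2) X.maffine_opn[OF V(1)] V(2) W(3) m])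
qed

lemma iota_mult:
  assumes W: "openin (mtop X) W" and c: "c \<in> carrier k" "d \<in> carrier k" and m: "m \<in> carrier (msec X W)" "n \<in> carrier (msec X W)"
  shows "iota W c m \<otimes>\<^bsub>rsec Y (kop W)\<^esub> iota W d n = iota W (c \<otimes>\<^bsub>k\<^esub> d) (m \<otimes>\<^bsub>msec X W\<^esub> n)"
proof (rule iota_eqI[OF W k.m_closed[OF c] X.mult_closed[OF W m]])
  note i = iota[OF W c(1) m(1)] and j = iota[OF W c(2) m(2)]
  interpret S: cring "rsec Y (kop W)" by (rule Y.cring_sections[OF kop_open])
  show "iota W c m \<otimes>\<^bsub>rsec Y (kop W)\<^esub> iota W d n \<in> carrier (rsec Y (kop W))" using i(1) j(1) by simp
  fix V assume V: "maffine X V" "V \<subseteq> W"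
  note r = X.res_closed[OF W X.maffine_opn[OF V(1)] V(2)]
  have "rres Y (kop W) (ov V) (iota W c m \<otimes>\<^bsub>rsec Y (kop W)\<^esub> iota W d n) =
      gsec \<gamma> V (monomial k c (mres X W V m) \<otimes>\<^bsub>alg V\<^esub> monomial k d (mres X W V n))"
    using ring_hom_mult[OF Y.ring_hom_res[OF kop_open ov_open[OF V(1)] ov_subset_kop[OF V]] i(1) j(1)] i(2)[OF V] j(2)[OF V]
      ring_hom_mult[OF gsec_hom[OF V(1)] monomial_alg[OF c(1) r[OF m(1)]] monomial_alg[OF c(2) r[OF m(2)]]] by simp
  then show "rres Y (kop W) (ov V) (iota W c m \<otimes>\<^bsub>rsec Y (kop W)\<^esub> iota W d n) =
      gsec \<gamma> V (monomial k (c \<otimes>\<^bsub>k\<^esub> d) (mres X W V (m \<otimes>\<^bsub>msec X W\<^esub> n)))"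
    by (simp add: alg_simps k.convolve_monomial[OF c] X.res_mult[OF W X.maffine_opn[OF V(1)] V(2) m])
qed

lemma iota_one:
  assumes W: "openin (mtop X) W"
  shows "iota W \<one>\<^bsub>k\<^esub> \<one>\<^bsub>msec X W\<^esub> = \<one>\<^bsub>rsec Y (kop W)\<^esub>"
proof (rule iota_eqI[OF W k.one_closed X.one_closed[OF W], symmetric])
  interpret S: cring "rsec Y (kop W)" by (rule Y.cring_sections[OF kop_open])
  show "\<one>\<^bsub>rsec Y (kop W)\<^esub> \<in> carrier (rsec Y (kop W))" by simp
  fix V assume V: "maffine X V" "V \<subseteq> W"
  show "rres Y (kop W) (ov V) \<one>\<^bsub>rsec Y (kop W)\<^esub> = gsec \<gamma> V (monomial k \<one>\<^bsub>k\<^esub> (mres X W V \<one>\<^bsub>msec X W\<^esub>))"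
    using ring_hom_one[OF Y.ring_hom_res[OF kop_open ov_open[OF V(1)] ov_subset_kop[OF V]]] ring_hom_one[OF gsec_hom[OF V(1)]]
    by (simp add: X.res_one[OF W X.maffine_opn[OF V(1)] V(2)] alg_simps single_monomial)
qed

lemma iota_Units:
  assumes W: "openin (mtop X) W" and c: "c \<in> Units k" and m: "m \<in> Units (msec X W)"
  shows "iota W c m \<in> Units (rsec Y (kop W))"
proof -
  interpret S: cring "rsec Y (kop W)" by (rule Y.cring_sections[OF kop_open])
  note ic = k.Units_inv_closed[OF c] and im = X.Units_inv_closed'[OF W m]
  have "iota W c m \<otimes>\<^bsub>rsec Y (kop W)\<^esub> iota W (inv\<^bsub>k\<^esub> c) (inv\<^bsub>msec X W\<^esub> m) = \<one>\<^bsub>rsec Y (kop W)\<^esub>"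
    by (simp add: iota_mult[OF W k.Units_closed[OF c] ic X.Units_section[OF m] im] k.Units_r_inv[OF c] X.Units_inv_right[OF W m] iota_one[OF W])
  note one = this
  show ?thesis
    by (rule S.Units_factor[of _ "iota W (inv\<^bsub>k\<^esub> c) (inv\<^bsub>msec X W\<^esub> m)"])
      (simp_all add: one iota(1)[OF W k.Units_closed[OF c] X.Units_section[OF m]] iota(1)[OF W ic im])
qed

lemma monomial_inject: "monomial k c m = monomial k d n \<Longrightarrow> c \<noteq> \<zero>\<^bsub>k\<^esub> \<Longrightarrow> c = d \<and> m = n"
  unfolding monomial_def by metis

lemma Units_nonzero:
  assumes "c \<in> Units k"
  shows "c \<noteq> \<zero>\<^bsub>k\<^esub>"
  using k.Units_r_inv[OF assms] k.l_null[OF k.Units_inv_closed[OF assms]] k.one_not_zero by metis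

text \<open>The sections are compared on affine opens inside \<open>W\<close>, where
  \<open>gsec\<close> is injective and a monomial with non-zero coefficient determines coefficient
  and exponent. Over the empty set there is no such affine open and the scalar is lost, hence the
  condition on \<open>W\<close>.\<close>

lemma iota_inject:
  assumes W: "openin (mtop X) W" and c: "c \<in> Units k" "d \<in> Units k" and m: "m \<in> carrier (msec X W)" "n \<in> carrier (msec X W)"
    and eq: "iota W c m = iota W d n"
  shows "m = n" "W \<noteq> {} \<Longrightarrow> c = d"
proof -
  have *: "c = d \<and> mres X W V m = mres X W V n" if V: "maffine X V" "V \<subseteq> W" for V
  proof -
    note r = X.res_closed[OF W X.maffine_opn[OF V(1)] V(2)]
    have "gsec \<gamma> V (monomial k c (mres X W V m)) = gsec \<gamma> V (monomial k d (mres X W V n))"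
      using iota(2)[OF W k.Units_closed[OF c(1)] m(1) V] iota(2)[OF W k.Units_closed[OF c(2)] m(2) V] eq by simp
    then have "monomial k c (mres X W V m) = monomial k d (mres X W V n)"
      by (rule gsec_inj[OF V(1) monomial_alg[OF k.Units_closed[OF c(1)] r[OF m(1)]] monomial_alg[OF k.Units_closed[OF c(2)] r[OF m(2)]]])
    then show ?thesis by (rule monomial_inject) (rule Units_nonzero[OF c(1)])
  qed
  show "m = n"
    by (rule X.section_eqI[OF _ affine_cover_of_open[OF W] m]) (use * X.maffine_opn in auto)
  show "c = d" if "W \<noteq> {}"
  proof -
    from that obtain V where "maffine X V" "V \<subseteq> W" using affine_cover_of_open[OF W] by blast
    then show ?thesis using * by blast
  qed
qed

text \<open>On every affine open inside \<open>W\<close> the section is a monomial. Uniqueness of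
  monomials makes scalars and exponents compatible with restriction: the exponents glue, and the
  scalars are constant because non-empty opens inside the irreducible \<open>U\<close> meet. The
  lemma serves for the intersections of two members of an affine cover.\<close>

lemma kop_unit:
  assumes W: "openin (mtop X) W" and U: "maffine X U" "W \<subseteq> U" and t: "t \<in> Units (rsec Y (kop W))"
  obtains c m where "c \<in> Units k" "m \<in> Units (msec X W)" "t = iota W c m"
proof -
  let ?\<V> = "{V. maffine X V \<and> V \<subseteq> W}"
  have tc: "t \<in> carrier (rsec Y (kop W))" using t by (simp add: Units_def)
  have "\<forall>V\<in>?\<V>. \<exists>p. fst p \<in> Units k \<and> snd p \<in> Units (msec X V) \<and>
      rres Y (kop W) (ov V) t = gsec \<gamma> V (monomial k (fst p) (snd p))"
  proof
    fix V assume V: "V \<in> ?\<V>"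
    have "rres Y (kop W) (ov V) t \<in> Units (rsec Y (ov V))"
      using Y.M.res_Units[of "kop W" "ov V" t] t V ov_open[of V] ov_subset_kop[of V W] by (simp add: kop_open)
    note u = this
    have "maffine X V" using V by simp
    from this u obtain c m where "c \<in> Units k" "m \<in> Units (msec X V)" "rres Y (kop W) (ov V) t = gsec \<gamma> V (monomial k c m)"
      by (rule gsec_unit)
    then show "\<exists>p. fst p \<in> Units k \<and> snd p \<in> Units (msec X V) \<and>
        rres Y (kop W) (ov V) t = gsec \<gamma> V (monomial k (fst p) (snd p))"
      by (intro exI[of _ "(c, m)"]) simp
  qed
  then obtain p where p: "\<forall>V\<in>?\<V>. fst (p V) \<in> Units k \<and> snd (p V) \<in> Units (msec X V) \<and>
      rres Y (kop W) (ov V) t = gsec \<gamma> V (monomial k (fst (p V)) (snd (p V)))" by (rule bchoice[THEN exE])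
  define c m where "c V = fst (p V)" and "m V = snd (p V)" for V
  have c: "\<And>V. V \<in> ?\<V> \<Longrightarrow> c V \<in> Units k" and m: "\<And>V. V \<in> ?\<V> \<Longrightarrow> m V \<in> Units (msec X V)"
    and cm: "\<And>V. V \<in> ?\<V> \<Longrightarrow> rres Y (kop W) (ov V) t = gsec \<gamma> V (monomial k (c V) (m V))"
    using p by (simp_all add: c_def m_def)
  \<comment> \<open>A monomial with non-zero coefficient determines both its parts, so restricting
    the monomial from \<open>V\<close> to \<open>Z\<close> can only give the one already chosen on
    \<open>Z\<close>.\<close>
  have sub: "c Z = c V \<and> m Z = mres X V Z (m V)" if V: "V \<in> ?\<V>" and Z: "maffine X Z" "Z \<subseteq> V" for V Z
  proof -
    have V': "maffine X V" "V \<subseteq> W" and Z': "Z \<in> ?\<V>" using V Z by auto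
    note mV = X.Units_section[OF m[OF V]] and cV = k.Units_closed[OF c[OF V]]
    have "gsec \<gamma> Z (monomial k (c Z) (m Z)) = rres Y (ov V) (ov Z) (gsec \<gamma> V (monomial k (c V) (m V)))"
      unfolding cm[OF Z', symmetric] cm[OF V, symmetric]
      using Y.M.res_res[of "kop W" "ov V" "ov Z" t] tc ov_open[OF V'(1)] ov_open[OF Z(1)] ov_subset_kop[OF V'] ov_subset[OF V'(1) Z]
      by (simp add: kop_open)
    also have "\<dots> = gsec \<gamma> Z (monomial k (c V) (mres X V Z (m V)))"
      by (simp add: gsec_restrict[OF V'(1) Z monomial_alg[OF cV mV]] k.push_forward_monomial[OF cV])
    finally have "monomial k (c Z) (m Z) = monomial k (c V) (mres X V Z (m V))"
      by (rule gsec_inj[OF Z(1) monomial_alg[OF k.Units_closed[OF c[OF Z']] X.Units_section[OF m[OF Z']]]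
        monomial_alg[OF cV X.res_closed[OF X.maffine_opn[OF V'(1)] X.maffine_opn[OF Z(1)] Z(2) mV]]])
    then show ?thesis by (rule monomial_inject) (rule Units_nonzero[OF c[OF Z']])
  qed
  \<comment> \<open>When \<open>W\<close> is empty there is no affine open inside it, and any unit
    serves as the scalar.\<close>
  have "\<exists>c0\<in>Units k. \<forall>V\<in>?\<V>. c V = c0"
  proof (cases "?\<V> = {}")
    case True
    then show ?thesis using k.Units_one_closed by blast
  next
    case False
    then obtain V0 where V0: "V0 \<in> ?\<V>" by blast
    have "c V = c V0" if V: "V \<in> ?\<V>" for V
    proof -
      have ne: "Z \<noteq> {}" if "Z \<in> ?\<V>" for Z using that X.maffine_closed_point[of Z] by blast
      have "V \<inter> V0 \<noteq> {}"
        by (rule X.maffine_irreducible[OF U(1)]) (use V V0 ne U X.maffine_opn in blast)+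
      then obtain x where x: "x \<in> V \<inter> V0" by blast
      have "openin (mtop X) (V \<inter> V0)" using V V0 X.maffine_opn by (simp add: openin_Int)
      with scheme obtain Z where "maffine X Z" "Z \<subseteq> V \<inter> V0" using x by (rule X.maffine_basis)
      then show ?thesis using sub[OF V, of Z] sub[OF V0, of Z] by simp
    qed
    then show ?thesis using c[OF V0] by blast
  qed
  then obtain c0 where c0: "c0 \<in> Units k" "\<forall>V\<in>?\<V>. c V = c0" by (elim bexE)
  have "\<exists>m0\<in>carrier (msec X W). \<forall>V\<in>?\<V>. mres X W V m0 = m V"
  proof (rule X.section_glue[OF _ affine_cover_of_open[OF W]])
    fix V assume V: "V \<in> ?\<V>"
    then have V': "maffine X V" "V \<subseteq> W" by simp_all
    show "openin (mtop X) V" by (rule X.maffine_opn[OF V'(1)])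
    show "m V \<in> carrier (msec X V)" by (rule X.Units_section[OF m[OF V]])
    fix V2 assume V2: "V2 \<in> ?\<V>"
    then have V2': "maffine X V2" "V2 \<subseteq> W" by simp_all
    have o: "openin (mtop X) (V \<inter> V2)" using V' V2' X.maffine_opn by (simp add: openin_Int)
    show "mres X V (V \<inter> V2) (m V) = mres X V2 (V \<inter> V2) (m V2)"
    proof (rule X.section_eqI[OF _ affine_cover_of_open[OF o]])
      fix Z assume "Z \<in> {Z. maffine X Z \<and> Z \<subseteq> V \<inter> V2}"
      then have Z: "maffine X Z" "Z \<subseteq> V" "Z \<subseteq> V2" "Z \<subseteq> V \<inter> V2" by simp_all
      show "openin (mtop X) Z" by (rule X.maffine_opn[OF Z(1)])
      show "mres X (V \<inter> V2) Z (mres X V (V \<inter> V2) (m V)) = mres X (V \<inter> V2) Z (mres X V2 (V \<inter> V2) (m V2))"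
        using sub[OF V Z(1,2)] sub[OF V2 Z(1,3)]
          X.res_res[OF X.maffine_opn[OF V'(1)] o X.maffine_opn[OF Z(1)] Z(4) Int_lower1 X.Units_section[OF m[OF V]]]
          X.res_res[OF X.maffine_opn[OF V2'(1)] o X.maffine_opn[OF Z(1)] Z(4) Int_lower2 X.Units_section[OF m[OF V2]]] by simp
    next
      show "mres X V (V \<inter> V2) (m V) \<in> carrier (msec X (V \<inter> V2))"
        by (rule X.res_closed[OF X.maffine_opn[OF V'(1)] o Int_lower1 X.Units_section[OF m[OF V]]])
      show "mres X V2 (V \<inter> V2) (m V2) \<in> carrier (msec X (V \<inter> V2))"
        by (rule X.res_closed[OF X.maffine_opn[OF V2'(1)] o Int_lower2 X.Units_section[OF m[OF V2]]])
    qed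
  qed
  then obtain m0 where m0: "m0 \<in> carrier (msec X W)" "\<forall>V\<in>?\<V>. mres X W V m0 = m V" by (elim bexE)
  have "m0 \<in> Units (msec X W)"
    by (rule X.Units_local[OF _ affine_cover_of_open[OF W] m0(1)]) (use X.maffine_opn m0(2) m in auto)
  moreover have "t = iota W c0 m0"
    by (rule iota_eqI[OF W k.Units_closed[OF c0(1)] m0(1) tc]) (use cm c0(2) m0(2) in simp)
  ultimately show thesis using c0(1) that by blast
qed

section \<open>Linearization of line bundles\<close>

lemma free_module_simps:
  "carrier (free_module k S act) = fin_supp k S" "s \<oplus>\<^bsub>free_module k S act\<^esub> t = k.fadd s t"
  "\<zero>\<^bsub>free_module k S act\<^esub> = (\<lambda>_. \<zero>\<^bsub>k\<^esub>)" "a \<odot>\<^bsub>free_module k S act\<^esub> s = convolve k act a s"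
  by (simp_all add: free_module_def k.fadd_def)

context
  fixes U :: "'p set" and L :: "('p, 'a, 'l) oset" and e :: 'l
  assumes U: "maffine X U" and L: "oset_sheaf X L" and e: "mgenerator X L U e"
begin

text \<open>The generator \<open>e\<close> identifies the sections over \<open>U\<close> with the
  monoid via \<open>a \<mapsto> a \<cdot> e\<close>. Extended linearly, this is an isomorphism of
  the algebra \<open>alg U\<close> with the free module on \<open>osec L U\<close>;
  \<open>expand\<close> and \<open>coords\<close> are its two directions.\<close>

definition expand :: "('a \<Rightarrow> 'k) \<Rightarrow> 'l \<Rightarrow> 'k" where
  "expand r = push_forward k (\<lambda>a. oact L U a e) r"

definition coords :: "('l \<Rightarrow> 'k) \<Rightarrow> 'a \<Rightarrow> 'k" where
  "coords s = push_forward k (X.coord L U e) s"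

lemma coord_oact: "a \<in> carrier (msec X U) \<Longrightarrow> X.coord L U e (oact L U a e) = a"
  by (rule X.coord_eqI[OF L X.maffine_opn[OF U] e]) simp_all

lemma act_gen_closed: "a \<in> carrier (msec X U) \<Longrightarrow> oact L U a e \<in> osec L U"
  by (rule X.oact_closed[OF L X.maffine_opn[OF U] _ X.mgenerator_section[OF e]])

lemma expand_closed: "r \<in> carrier (alg U) \<Longrightarrow> expand r \<in> fin_supp k (osec L U)"
  unfolding expand_def alg_simps by (rule k.push_forward_fin_supp) (use act_gen_closed in simp_all)

lemma coords_closed: "s \<in> fin_supp k (osec L U) \<Longrightarrow> coords s \<in> carrier (alg U)"
  unfolding coords_def alg_simps by (rule k.push_forward_fin_supp) (use X.coord(1)[OF L X.maffine_opn[OF U] e] in simp_all)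

lemma coords_expand: "r \<in> carrier (alg U) \<Longrightarrow> coords (expand r) = r"
  unfolding expand_def coords_def alg_simps
  by (simp add: k.push_forward_comp) (rule k.push_forward_id, assumption, simp add: coord_oact)

lemma expand_coords: "s \<in> fin_supp k (osec L U) \<Longrightarrow> expand (coords s) = s"
  unfolding expand_def coords_def
  by (simp add: k.push_forward_comp) (rule k.push_forward_id, assumption, simp add: X.coord(2)[OF L X.maffine_opn[OF U] e])

lemma coords_zero: "coords (\<lambda>_. \<zero>\<^bsub>k\<^esub>) = (\<lambda>_. \<zero>\<^bsub>k\<^esub>)" and expand_zero: "expand (\<lambda>_. \<zero>\<^bsub>k\<^esub>) = (\<lambda>_. \<zero>\<^bsub>k\<^esub>)"
  by (simp_all add: coords_def expand_def k.push_forward_zero)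

lemma coords_add: "s \<in> fin_supp k (osec L U) \<Longrightarrow> t \<in> fin_supp k (osec L U) \<Longrightarrow> coords (k.fadd s t) = k.fadd (coords s) (coords t)"
  unfolding coords_def by (rule k.push_forward_fadd)

lemma smult_closed: "a \<in> carrier (alg U) \<Longrightarrow> s \<in> fin_supp k (osec L U) \<Longrightarrow> convolve k (oact L U) a s \<in> fin_supp k (osec L U)"
  unfolding alg_simps by (rule k.convolve_fin_supp) (use X.oact_closed[OF L X.maffine_opn[OF U]] in simp_all)

text \<open>Taking the coordinate of a single section is equivariant for the monoid;
  \<open>push_forward_convolve\<close> extends this to linear combinations.\<close>

lemma coords_smult:
  assumes a: "a \<in> carrier (alg U)" and s: "s \<in> fin_supp k (osec L U)"
  shows "coords (convolve k (oact L U) a s) = a \<otimes>\<^bsub>alg U\<^esub> coords s"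
proof -
  note o = X.maffine_opn[OF U] and c = X.coord[OF L X.maffine_opn[OF U] e] and es = X.mgenerator_section[OF e]
  have "X.coord L U e (oact L U b x) = id b \<otimes>\<^bsub>msec X U\<^esub> X.coord L U e x" if "b \<in> carrier (msec X U)" "x \<in> osec L U" for b x
    by (rule X.coord_eqI[OF L o e]) (simp_all add: that c X.mult_closed[OF o] X.oact_mult[OF L o _ _ es])
  then have "coords (convolve k (oact L U) a s) = convolve k (monoid.mult (msec X U)) (push_forward k id a) (coords s)"
    unfolding coords_def by (rule k.push_forward_convolve[OF a[unfolded alg_simps] s])
  also have "push_forward k id a = a" by (rule k.push_forward_id[OF a[unfolded alg_simps]]) simp
  finally show ?thesis by (simp add: alg_simps)
qed

lemma expand_smult:
  assumes a: "a \<in> carrier (alg U)" and r: "r \<in> carrier (alg U)"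
  shows "convolve k (oact L U) a (expand r) = expand (a \<otimes>\<^bsub>alg U\<^esub> r)"
  using expand_coords[OF smult_closed[OF a expand_closed[OF r]]] coords_smult[OF a expand_closed[OF r]] coords_expand[OF r] by simp

lemma expand_eq_smult: "r \<in> carrier (alg U) \<Longrightarrow> expand r = convolve k (oact L U) r (single k e)"
  unfolding expand_def alg_simps by (rule k.convolve_single_right[symmetric])

end

text \<open>The content of \<open>is_localization\<close> for the ring homomorphism
  \<open>\<rho>\<close>, with the criterion for equality specialised to zero, because
  \<open>is_module_localization\<close> speaks of kernels.\<close>

lemma localization_cases:
  assumes U: "maffine X U" and F: "F \<in> carrier (alg U)"
  defines "D \<equiv> gpt \<gamma> U ` rbasic (alg U) F"
  defines "\<rho> \<equiv> rres Y (ov U) D \<circ> gsec \<gamma> U"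
  shows "openin (rtop Y) D" "D \<subseteq> ov U" "\<rho> \<in> ring_hom (alg U) (rsec Y D)"
    "\<And>m::nat. \<rho> F [^]\<^bsub>rsec Y D\<^esub> m \<in> Units (rsec Y D)"
    "\<And>n. n \<in> carrier (rsec Y D) \<Longrightarrow> \<exists>a\<in>carrier (alg U). \<exists>m::nat. \<rho> F [^]\<^bsub>rsec Y D\<^esub> m \<otimes>\<^bsub>rsec Y D\<^esub> n = \<rho> a"
    "\<And>a. a \<in> carrier (alg U) \<Longrightarrow> \<rho> a = \<zero>\<^bsub>rsec Y D\<^esub> \<Longrightarrow> \<exists>m::nat. F [^]\<^bsub>alg U\<^esub> m \<otimes>\<^bsub>alg U\<^esub> a = \<zero>\<^bsub>alg U\<^esub>"
proof -
  interpret R: cring "alg U" by (rule cring_alg[OF U])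
  show D: "openin (rtop Y) D" "D \<subseteq> ov U" using basic_open[OF U F] by (simp_all add: D_def)
  interpret S: cring "rsec Y D" by (rule Y.cring_sections[OF D(1)])
  have loc: "is_localization (alg U) F (rsec Y D) \<rho>" using ov_localization[OF U F] by (simp add: D_def \<rho>_def)
  have h1: "rres Y (ov U) D \<in> ring_hom (rsec Y (ov U)) (rsec Y D)" by (rule Y.ring_hom_res[OF ov_open[OF U] D])
  show h: "\<rho> \<in> ring_hom (alg U) (rsec Y D)" unfolding \<rho>_def by (rule ring_hom_trans[OF gsec_hom[OF U] h1])
  show "\<rho> F [^]\<^bsub>rsec Y D\<^esub> m \<in> Units (rsec Y D)" for m :: nat
    using loc by (intro S.Units_nat_pow) (simp add: is_localization_def)
  show "\<exists>a\<in>carrier (alg U). \<exists>m::nat. \<rho> F [^]\<^bsub>rsec Y D\<^esub> m \<otimes>\<^bsub>rsec Y D\<^esub> n = \<rho> a" if "n \<in> carrier (rsec Y D)" for n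
    using loc that by (simp add: is_localization_def)
  fix a assume a: "a \<in> carrier (alg U)" "\<rho> a = \<zero>\<^bsub>rsec Y D\<^esub>"
  have "\<rho> \<zero>\<^bsub>alg U\<^esub> = \<zero>\<^bsub>rsec Y D\<^esub>" by (rule ring_hom_zero[OF h R.ring_axioms S.ring_axioms])
  moreover have "\<forall>a\<in>carrier (alg U). \<forall>b\<in>carrier (alg U). \<rho> a = \<rho> b \<longrightarrow>
        (\<exists>m::nat. F [^]\<^bsub>alg U\<^esub> m \<otimes>\<^bsub>alg U\<^esub> a = F [^]\<^bsub>alg U\<^esub> m \<otimes>\<^bsub>alg U\<^esub> b)"
    using loc unfolding is_localization_def by (elim conjE)
  ultimately have "\<exists>m::nat. F [^]\<^bsub>alg U\<^esub> m \<otimes>\<^bsub>alg U\<^esub> a = F [^]\<^bsub>alg U\<^esub> m \<otimes>\<^bsub>alg U\<^esub> \<zero>\<^bsub>alg U\<^esub>"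
    using a by simp
  then show "\<exists>m::nat. F [^]\<^bsub>alg U\<^esub> m \<otimes>\<^bsub>alg U\<^esub> a = \<zero>\<^bsub>alg U\<^esub>" using F by simp
qed

text \<open>In the coordinates of \<open>e\<close> the map sends \<open>r\<close> to
  \<open>\<rho> r\<close> times the generator \<open>n0\<close> of \<open>N\<close> over
  \<open>D\<close>, so each clause reduces to the corresponding one for the localization of the
  algebra at \<open>F\<close>.\<close>

lemma module_localization_of_generator:
  assumes U: "maffine X U" and L: "oset_sheaf X L" and e: "mgenerator X L U e"
    and N: "omod_sheaf Y N" and n: "mgenerator (mon_of Y) (oset_of N) (ov U) n" and F: "F \<in> carrier (alg U)"
  defines "D \<equiv> gpt \<gamma> U ` rbasic (alg U) F"
  shows "is_module_localization (alg U) F (free_module k (osec L U) (oact L U)) (rsec Y D) (rres Y (ov U) D \<circ> gsec \<gamma> U)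
    (lsec N D) (lres N (ov U) D \<circ> (\<lambda>s. gsec \<gamma> U (coords U L e s) \<odot>\<^bsub>lsec N (ov U)\<^esub> n))"
proof -
  note loc = localization_cases[OF U F, folded D_def] and N' = Y.omod_imp_oset_sheaf[OF N]
  define \<rho> where "\<rho> = rres Y (ov U) D \<circ> gsec \<gamma> U"
  note loc = loc[folded \<rho>_def]
  note cc = coords_closed[OF U L e]
  define n0 where "n0 = lres N (ov U) D n"
  interpret R: cring "alg U" by (rule cring_alg[OF U])
  interpret S: cring "rsec Y D" by (rule Y.cring_sections[OF loc(1)])
  interpret M: Module.module "rsec Y D" "lsec N D" by (rule Y.omod_sheaf_module[OF N loc(1)])
  have oD: "openin (mtop (mon_of Y)) D" "openin (mtop (mon_of Y)) (ov U)" using loc(1) ov_open[OF U] by simp_all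
  have g: "mgenerator (mon_of Y) (oset_of N) D n0"
    using Y.M.mgenerator_restrict[OF N' oD(2,1) loc(2) n] by (simp add: n0_def)
  have n0: "n0 \<in> carrier (lsec N D)" using Y.M.mgenerator_section[OF g] by simp
  have ns: "n \<in> carrier (lsec N (ov U))" using Y.M.mgenerator_section[OF n] by simp
  have \<kappa>: "(lres N (ov U) D \<circ> (\<lambda>s. gsec \<gamma> U (coords U L e s) \<odot>\<^bsub>lsec N (ov U)\<^esub> n)) s = \<rho> (coords U L e s) \<odot>\<^bsub>lsec N D\<^esub> n0"
    if "s \<in> fin_supp k (osec L U)" for s
    using Y.M.ores_oact[OF N' oD(2,1) loc(2), of "gsec \<gamma> U (coords U L e s)" n] gsec_closed[OF U cc[OF that]] ns
    by (simp add: \<rho>_def n0_def)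
  note \<rho>c = ring_hom_closed[OF loc(3)]
  show ?thesis
    unfolding is_module_localization_def \<rho>_def[symmetric] free_module_simps
  proof (intro conjI ballI impI)
    fix s assume s: "s \<in> fin_supp k (osec L U)"
    show "(lres N (ov U) D \<circ> (\<lambda>s. gsec \<gamma> U (coords U L e s) \<odot>\<^bsub>lsec N (ov U)\<^esub> n)) s \<in> carrier (lsec N D)"
      unfolding \<kappa>[OF s] using \<rho>c[OF cc[OF s]] n0 by simp
    show "(lres N (ov U) D \<circ> (\<lambda>s. gsec \<gamma> U (coords U L e s) \<odot>\<^bsub>lsec N (ov U)\<^esub> n)) (k.fadd s t) =
        (lres N (ov U) D \<circ> (\<lambda>s. gsec \<gamma> U (coords U L e s) \<odot>\<^bsub>lsec N (ov U)\<^esub> n)) s \<oplus>\<^bsub>lsec N D\<^esub>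
        (lres N (ov U) D \<circ> (\<lambda>s. gsec \<gamma> U (coords U L e s) \<odot>\<^bsub>lsec N (ov U)\<^esub> n)) t" if t: "t \<in> fin_supp k (osec L U)" for t
      unfolding \<kappa>[OF s] \<kappa>[OF t] \<kappa>[OF k.fadd_fin_supp[OF s t]] coords_add[OF U L e s t] alg_simps(5)[where U = U, symmetric]
      using ring_hom_add[OF loc(3) cc[OF s] cc[OF t]] M.smult_l_distr[OF \<rho>c[OF cc[OF s]] \<rho>c[OF cc[OF t]] n0] by simp
    show "(lres N (ov U) D \<circ> (\<lambda>s. gsec \<gamma> U (coords U L e s) \<odot>\<^bsub>lsec N (ov U)\<^esub> n)) (convolve k (oact L U) a s) =
        \<rho> a \<odot>\<^bsub>lsec N D\<^esub> (lres N (ov U) D \<circ> (\<lambda>s. gsec \<gamma> U (coords U L e s) \<odot>\<^bsub>lsec N (ov U)\<^esub> n)) s" if a: "a \<in> carrier (alg U)" for a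
      unfolding \<kappa>[OF s] \<kappa>[OF smult_closed[OF U L e a s]] coords_smult[OF U L e a s]
      using ring_hom_mult[OF loc(3) a cc[OF s]] M.smult_assoc1[OF \<rho>c[OF a] \<rho>c[OF cc[OF s]] n0] by simp
  next
    fix x assume x: "x \<in> carrier (lsec N D)"
    define y where "y = Y.M.coord (oset_of N) D n0 x"
    have y: "y \<in> carrier (rsec Y D)" "y \<odot>\<^bsub>lsec N D\<^esub> n0 = x"
      using Y.M.coord[OF N' oD(1) g, of x] x by (simp_all add: y_def)
    obtain a and m :: nat where a: "a \<in> carrier (alg U)" "\<rho> F [^]\<^bsub>rsec Y D\<^esub> m \<otimes>\<^bsub>rsec Y D\<^esub> y = \<rho> a"
      using loc(5)[OF y(1)] by (elim bexE exE)
    have ea: "expand U L e a \<in> fin_supp k (osec L U)" by (rule expand_closed[OF U L e a(1)])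
    have "\<rho> F [^]\<^bsub>rsec Y D\<^esub> m \<odot>\<^bsub>lsec N D\<^esub> x = \<rho> a \<odot>\<^bsub>lsec N D\<^esub> n0"
      unfolding y(2)[symmetric] a(2)[symmetric] using M.smult_assoc1[OF S.Units_closed[OF loc(4)[of m]] y(1) n0] by simp
    also have "\<dots> = (lres N (ov U) D \<circ> (\<lambda>s. gsec \<gamma> U (coords U L e s) \<odot>\<^bsub>lsec N (ov U)\<^esub> n)) (expand U L e a)"
      unfolding \<kappa>[OF ea] coords_expand[OF U L e a(1)] ..
    finally show "\<exists>s\<in>fin_supp k (osec L U). \<exists>m::nat. \<rho> F [^]\<^bsub>rsec Y D\<^esub> m \<odot>\<^bsub>lsec N D\<^esub> x =
        (lres N (ov U) D \<circ> (\<lambda>s. gsec \<gamma> U (coords U L e s) \<odot>\<^bsub>lsec N (ov U)\<^esub> n)) s" using ea by blast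
  next
    fix s assume s: "s \<in> fin_supp k (osec L U)"
      and z: "(lres N (ov U) D \<circ> (\<lambda>s. gsec \<gamma> U (coords U L e s) \<odot>\<^bsub>lsec N (ov U)\<^esub> n)) s = \<zero>\<^bsub>lsec N D\<^esub>"
    have "oact (oset_of N) D (\<rho> (coords U L e s)) n0 = oact (oset_of N) D \<zero>\<^bsub>rsec Y D\<^esub> n0"
      using z n0 unfolding \<kappa>[OF s] by simp
    then have "\<rho> (coords U L e s) = \<zero>\<^bsub>rsec Y D\<^esub>"
      by (rule Y.M.mgenerator_cancel[OF N' oD(1) g, rotated -1]) (use \<rho>c[OF cc[OF s]] in simp_all)
    then obtain m :: nat where m: "F [^]\<^bsub>alg U\<^esub> m \<otimes>\<^bsub>alg U\<^esub> coords U L e s = \<zero>\<^bsub>alg U\<^esub>"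
      using loc(6)[OF cc[OF s]] by (elim exE meta_impE)
    have Fm: "F [^]\<^bsub>alg U\<^esub> m \<in> carrier (alg U)" using F by simp
    have "convolve k (oact L U) (F [^]\<^bsub>alg U\<^esub> m) s = expand U L e (coords U L e (convolve k (oact L U) (F [^]\<^bsub>alg U\<^esub> m) s))"
      by (rule expand_coords[OF U L e smult_closed[OF U L e Fm s], symmetric])
    also have "\<dots> = (\<lambda>_. \<zero>\<^bsub>k\<^esub>)"
      unfolding coords_smult[OF U L e Fm s] m unfolding alg_simps by (rule expand_zero[OF U L e])
    finally show "\<exists>m::nat. convolve k (oact L U) (F [^]\<^bsub>alg U\<^esub> m) s = (\<lambda>_. \<zero>\<^bsub>k\<^esub>)" by blast
  qed
qed

text \<open>Converse of \<open>module_localization_of_generator\<close>. By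
  \<open>mgenerator_basis\<close> bijectivity may be checked on basic open sets: injectivity comes
  from the clause on the kernel, surjectivity from clearing denominators, both read in the
  coordinates of \<open>e\<close>.\<close>

lemma generator_of_module_localization:
  assumes U: "maffine X U" and L: "oset_sheaf X L" and e: "mgenerator X L U e" and N: "omod_sheaf Y N"
    and \<kappa>U: "\<kappa> (single k e) \<in> carrier (lsec N (ov U))"
    and loc: "\<And>F. F \<in> carrier (alg U) \<Longrightarrow> is_module_localization (alg U) F (free_module k (osec L U) (oact L U))
      (rsec Y (gpt \<gamma> U ` rbasic (alg U) F)) (rres Y (ov U) (gpt \<gamma> U ` rbasic (alg U) F) \<circ> gsec \<gamma> U)
      (lsec N (gpt \<gamma> U ` rbasic (alg U) F)) (lres N (ov U) (gpt \<gamma> U ` rbasic (alg U) F) \<circ> \<kappa>)"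
  shows "mgenerator (mon_of Y) (oset_of N) (ov U) (\<kappa> (single k e))"
proof (rule Y.M.mgenerator_basis[where \<B> = "(\<lambda>F. gpt \<gamma> U ` rbasic (alg U) F) ` carrier (alg U)"])
  interpret R: cring "alg U" by (rule cring_alg[OF U])
  let ?B = "\<lambda>F. gpt \<gamma> U ` rbasic (alg U) F"
  show N': "oset_sheaf (mon_of Y) (oset_of N)" by (rule Y.omod_imp_oset_sheaf[OF N])
  show "openin (mtop (mon_of Y)) (ov U)" using ov_open[OF U] by simp
  show "\<kappa> (single k e) \<in> osec (oset_of N) (ov U)" using \<kappa>U by simp
  show "openin (mtop (mon_of Y)) B \<and> B \<subseteq> ov U" if "B \<in> ?B ` carrier (alg U)" for B
    using that basic_open[OF U] by auto
  show "B \<inter> C \<in> ?B ` carrier (alg U)" if BC: "B \<in> ?B ` carrier (alg U)" "C \<in> ?B ` carrier (alg U)" for B C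
  proof -
    obtain F G where "F \<in> carrier (alg U)" "G \<in> carrier (alg U)" "B = ?B F" "C = ?B G" using BC by blast
    then show ?thesis using basic_Int[OF U, of F G] by (intro image_eqI[of _ _ "F \<otimes>\<^bsub>alg U\<^esub> G"]) simp_all
  qed
  show "\<exists>\<C>\<subseteq>?B ` carrier (alg U). V = \<Union>\<C>" if "openin (mtop (mon_of Y)) V" "V \<subseteq> ov U" for V
    unfolding ex_subset_image_Union ov_open_iff[OF U, symmetric] using that by simp
  fix B assume "B \<in> ?B ` carrier (alg U)"
  then obtain F where F: "F \<in> carrier (alg U)" and B: "B = ?B F" by blast
  note lc = localization_cases[OF U F, folded B]
  define \<rho> where "\<rho> = rres Y (ov U) B \<circ> gsec \<gamma> U"
  note lc = lc[folded \<rho>_def]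
  interpret S: cring "rsec Y B" by (rule Y.cring_sections[OF lc(1)])
  interpret M: Module.module "rsec Y B" "lsec N B" by (rule Y.omod_sheaf_module[OF N lc(1)])
  define \<kappa>B where "\<kappa>B = lres N (ov U) B \<circ> \<kappa>"
  have ml: "is_module_localization (alg U) F (free_module k (osec L U) (oact L U)) (rsec Y B) \<rho> (lsec N B) \<kappa>B"
    using loc[OF F] by (simp add: B \<rho>_def \<kappa>B_def)
  note ml' = ml[unfolded is_module_localization_def free_module_simps]
  have es: "single k e \<in> fin_supp k (osec L U)" by (rule k.single_fin_supp[OF X.mgenerator_section[OF e]])
  define n0 where "n0 = \<kappa>B (single k e)"
  have n0: "n0 \<in> carrier (lsec N B)" using ml' es unfolding n0_def by simp
  have lin: "\<kappa>B (expand U L e r) = \<rho> r \<odot>\<^bsub>lsec N B\<^esub> n0" if "r \<in> carrier (alg U)" for r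
    using ml' es that unfolding expand_eq_smult[OF U L e that] n0_def by simp
  note \<rho>c = ring_hom_closed[OF lc(3)]
  have "bij_betw (\<lambda>a. a \<odot>\<^bsub>lsec N B\<^esub> n0) (carrier (rsec Y B)) (carrier (lsec N B))"
  proof (rule bij_betwI')
    fix a b assume a: "a \<in> carrier (rsec Y B)" and b: "b \<in> carrier (rsec Y B)"
    show "a \<odot>\<^bsub>lsec N B\<^esub> n0 = b \<odot>\<^bsub>lsec N B\<^esub> n0 \<longleftrightarrow> a = b"
    proof
      assume eq: "a \<odot>\<^bsub>lsec N B\<^esub> n0 = b \<odot>\<^bsub>lsec N B\<^esub> n0"
      \<comment> \<open>The localization clause only describes the kernel, so injectivity is reduced
        to the vanishing of a difference.\<close>
      define d where "d = a \<oplus>\<^bsub>rsec Y B\<^esub> (\<ominus>\<^bsub>rsec Y B\<^esub> b)"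
      have dc: "d \<in> carrier (rsec Y B)" using a b by (simp add: d_def)
      have "d \<odot>\<^bsub>lsec N B\<^esub> n0 = b \<odot>\<^bsub>lsec N B\<^esub> n0 \<oplus>\<^bsub>lsec N B\<^esub> (\<ominus>\<^bsub>rsec Y B\<^esub> b) \<odot>\<^bsub>lsec N B\<^esub> n0"
        using M.smult_l_distr[OF a S.a_inv_closed[OF b] n0] eq by (simp add: d_def)
      also have "\<dots> = (b \<oplus>\<^bsub>rsec Y B\<^esub> (\<ominus>\<^bsub>rsec Y B\<^esub> b)) \<odot>\<^bsub>lsec N B\<^esub> n0"
        by (rule M.smult_l_distr[OF b S.a_inv_closed[OF b] n0, symmetric])
      also have "\<dots> = \<zero>\<^bsub>lsec N B\<^esub>" using b n0 by (simp add: S.r_neg)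
      finally have dn: "d \<odot>\<^bsub>lsec N B\<^esub> n0 = \<zero>\<^bsub>lsec N B\<^esub>" .
      obtain r and m :: nat where r: "r \<in> carrier (alg U)" "\<rho> F [^]\<^bsub>rsec Y B\<^esub> m \<otimes>\<^bsub>rsec Y B\<^esub> d = \<rho> r"
        using lc(5)[OF dc] by (elim bexE exE)
      have "\<kappa>B (expand U L e r) = \<zero>\<^bsub>lsec N B\<^esub>"
        unfolding lin[OF r(1)] r(2)[symmetric] using M.smult_assoc1[OF S.Units_closed[OF lc(4)[of m]] dc n0] dn
          S.Units_closed[OF lc(4)[of m]] by simp
      then obtain q :: nat where "convolve k (oact L U) (F [^]\<^bsub>alg U\<^esub> q) (expand U L e r) = (\<lambda>_. \<zero>\<^bsub>k\<^esub>)"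
        using ml' expand_closed[OF U L e r(1)] by blast
      then have "expand U L e (F [^]\<^bsub>alg U\<^esub> q \<otimes>\<^bsub>alg U\<^esub> r) = (\<lambda>_. \<zero>\<^bsub>k\<^esub>)"
        using expand_smult[OF U L e R.nat_pow_closed[OF F] r(1)] by simp
      then have "F [^]\<^bsub>alg U\<^esub> q \<otimes>\<^bsub>alg U\<^esub> r = \<zero>\<^bsub>alg U\<^esub>"
        using coords_expand[OF U L e R.m_closed[OF R.nat_pow_closed[OF F] r(1)], of q] coords_zero[OF U L e] by (simp add: alg_simps)
      then have "\<rho> (F [^]\<^bsub>alg U\<^esub> q) \<otimes>\<^bsub>rsec Y B\<^esub> \<rho> r = \<zero>\<^bsub>rsec Y B\<^esub>"
        using ring_hom_mult[OF lc(3) R.nat_pow_closed[OF F, of q] r(1)] ring_hom_zero[OF lc(3) R.ring_axioms S.ring_axioms] by simp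
      moreover have "\<rho> (F [^]\<^bsub>alg U\<^esub> q) = \<rho> F [^]\<^bsub>rsec Y B\<^esub> q"
        by (induction q) (simp_all add: ring_hom_one[OF lc(3)] ring_hom_mult[OF lc(3)] F)
      ultimately have "\<rho> r = \<zero>\<^bsub>rsec Y B\<^esub>"
        using S.Units_l_cancel[OF lc(4)[of q] \<rho>c[OF r(1)] S.zero_closed] S.Units_closed[OF lc(4)[of q]] by simp
      then have "d = \<zero>\<^bsub>rsec Y B\<^esub>"
        using S.Units_l_cancel[OF lc(4)[of m] dc S.zero_closed] S.Units_closed[OF lc(4)[of m]] r(2) by simp
      then show "a = b" using S.minus_equality[of a "\<ominus>\<^bsub>rsec Y B\<^esub> b"] a b by (simp add: d_def)
    qed simp
  next
    fix a assume "a \<in> carrier (rsec Y B)"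
    then show "a \<odot>\<^bsub>lsec N B\<^esub> n0 \<in> carrier (lsec N B)" using n0 by simp
  next
    fix x assume x: "x \<in> carrier (lsec N B)"
    have "\<exists>s\<in>fin_supp k (osec L U). \<exists>m::nat. \<rho> F [^]\<^bsub>rsec Y B\<^esub> m \<odot>\<^bsub>lsec N B\<^esub> x = \<kappa>B s"
      using ml' x by simp
    then obtain s and m :: nat where s: "s \<in> fin_supp k (osec L U)" "\<rho> F [^]\<^bsub>rsec Y B\<^esub> m \<odot>\<^bsub>lsec N B\<^esub> x = \<kappa>B s" by (elim bexE exE)
    let ?u = "\<rho> F [^]\<^bsub>rsec Y B\<^esub> m" and ?r = "coords U L e s"
    note u = lc(4)[of m] and rc = coords_closed[OF U L e s(1)]
    have "?u \<odot>\<^bsub>lsec N B\<^esub> x = \<rho> ?r \<odot>\<^bsub>lsec N B\<^esub> n0"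
      using lin[OF rc] s(2) by (simp add: expand_coords[OF U L e s(1)])
    then have "inv\<^bsub>rsec Y B\<^esub> ?u \<odot>\<^bsub>lsec N B\<^esub> (?u \<odot>\<^bsub>lsec N B\<^esub> x) = inv\<^bsub>rsec Y B\<^esub> ?u \<odot>\<^bsub>lsec N B\<^esub> (\<rho> ?r \<odot>\<^bsub>lsec N B\<^esub> n0)" by simp
    then have "x = (inv\<^bsub>rsec Y B\<^esub> ?u \<otimes>\<^bsub>rsec Y B\<^esub> \<rho> ?r) \<odot>\<^bsub>lsec N B\<^esub> n0"
      using M.smult_assoc1[OF S.Units_inv_closed[OF u] S.Units_closed[OF u] x] S.Units_l_inv[OF u] x
        M.smult_assoc1[OF S.Units_inv_closed[OF u] \<rho>c[OF rc] n0] by simp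
    then show "\<exists>a\<in>carrier (rsec Y B). x = a \<odot>\<^bsub>lsec N B\<^esub> n0"
      using S.m_closed[OF S.Units_inv_closed[OF u] \<rho>c[OF rc]] by blast
  qed
  then show "bij_betw (\<lambda>a. oact (oset_of N) B a (ores (oset_of N) (ov U) B (\<kappa> (single k e))))
      (carrier (msec (mon_of Y) B)) (osec (oset_of N) B)"
    by (simp add: n0_def \<kappa>B_def)
qed

end

section \<open>Cocycles of monoid sections and cocycles of units on X_k\<close>

locale affine_cover = base_changed k X Y \<gamma>
  for k :: "'k ring" and X :: "('p, 'a) monoidal_space" and Y :: "('y, 'r) ringed_space" and \<gamma> +
  fixes I :: "'i set" and U :: "'i \<Rightarrow> 'p set"
  assumes affine: "i \<in> I \<Longrightarrow> maffine X (U i)" and covers: "(\<Union>i\<in>I. U i) = topspace (mtop X)"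
begin

sublocale XC: covered_space X I U
  by unfold_locales (simp_all add: X.maffine_opn affine covers)

sublocale YC: ringed_cover Y I "\<lambda>i. over_k k X \<gamma> (U i)"
  by unfold_locales (simp_all add: ov_open affine kop_cover maffine_cover_def covers)

text \<open>All scalars are one. The function is extensional on \<open>I \<times> I\<close> so that
  it is an element of the group \<open>cech_C1\<close>.\<close>

definition iota_cocycle :: "('i \<times> 'i \<Rightarrow> 'a) \<Rightarrow> 'i \<times> 'i \<Rightarrow> 'r" where
  "iota_cocycle a = (\<lambda>(i, j)\<in>I \<times> I. iota (U i \<inter> U j) \<one>\<^bsub>k\<^esub> (a (i, j)))"

lemma ov1: "i \<in> I \<Longrightarrow> ov (U i) = kop (U i)"
  by (simp add: kop_affine affine)

lemma ov2: "i \<in> I \<Longrightarrow> j \<in> I \<Longrightarrow> ov (U i) \<inter> ov (U j) = kop (U i \<inter> U j)"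
  by (simp add: ov1 kop_Int)

lemma ov3: "i \<in> I \<Longrightarrow> j \<in> I \<Longrightarrow> l \<in> I \<Longrightarrow> ov (U i) \<inter> ov (U j) \<inter> ov (U l) = kop (U i \<inter> U j \<inter> U l)"
  by (simp add: ov1 kop_Int)

lemma iota_cocycle_cocycle:
  assumes a: "cocycle X I U a"
  shows "cocycle (mon_of Y) I (\<lambda>i. ov (U i)) (iota_cocycle a)"
  unfolding cocycle_def
proof (intro conjI ballI)
  fix i j assume i: "i \<in> I" "j \<in> I"
  show "iota_cocycle a (i, j) \<in> Units (msec (mon_of Y) (ov (U i) \<inter> ov (U j)))"
    using iota_Units[OF XC.opn_cover2[OF i] k.Units_one_closed XC.cocycle_Units[OF a i]] i by (simp add: iota_cocycle_def ov2)
next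
  fix i j l assume i: "i \<in> I" "j \<in> I" "l \<in> I"
  let ?T = "U i \<inter> U j \<inter> U l"
  have T: "openin (mtop X) ?T" "?T \<subseteq> U i \<inter> U j" "?T \<subseteq> U j \<inter> U l" "?T \<subseteq> U i \<inter> U l" using i by (auto simp: XC.opn_cover3)
  have r: "rres Y (kop (U p \<inter> U q)) (kop ?T) (iota (U p \<inter> U q) \<one>\<^bsub>k\<^esub> (a (p, q))) = iota ?T \<one>\<^bsub>k\<^esub> (mres X (U p \<inter> U q) ?T (a (p, q)))"
    if "p \<in> I" "q \<in> I" "?T \<subseteq> U p \<inter> U q" for p q
    by (rule iota_restrict[OF XC.opn_cover2[OF that(1,2)] T(1) that(3) k.one_closed XC.cocycle_section[OF a that(1,2)]])
  have c: "mres X (U p \<inter> U q) ?T (a (p, q)) \<in> carrier (msec X ?T)" if "p \<in> I" "q \<in> I" "?T \<subseteq> U p \<inter> U q" for p q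
    by (rule X.res_closed[OF XC.opn_cover2[OF that(1,2)] T(1) that(3) XC.cocycle_section[OF a that(1,2)]])
  have "mres X (U j \<inter> U l) ?T (a (j, l)) \<otimes>\<^bsub>msec X ?T\<^esub> mres X (U i \<inter> U j) ?T (a (i, j)) = mres X (U i \<inter> U l) ?T (a (i, l))"
    using a i unfolding cocycle_def by simp
  then have "iota ?T \<one>\<^bsub>k\<^esub> (mres X (U j \<inter> U l) ?T (a (j, l))) \<otimes>\<^bsub>rsec Y (kop ?T)\<^esub> iota ?T \<one>\<^bsub>k\<^esub> (mres X (U i \<inter> U j) ?T (a (i, j))) =
      iota ?T \<one>\<^bsub>k\<^esub> (mres X (U i \<inter> U l) ?T (a (i, l)))"
    using iota_mult[OF T(1) k.one_closed k.one_closed c[OF i(2,3) T(3)] c[OF i(1,2) T(2)]] by simp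
  then show "mres (mon_of Y) (ov (U j) \<inter> ov (U l)) (ov (U i) \<inter> ov (U j) \<inter> ov (U l)) (iota_cocycle a (j, l))
      \<otimes>\<^bsub>msec (mon_of Y) (ov (U i) \<inter> ov (U j) \<inter> ov (U l))\<^esub>
      mres (mon_of Y) (ov (U i) \<inter> ov (U j)) (ov (U i) \<inter> ov (U j) \<inter> ov (U l)) (iota_cocycle a (i, j)) =
      mres (mon_of Y) (ov (U i) \<inter> ov (U l)) (ov (U i) \<inter> ov (U j) \<inter> ov (U l)) (iota_cocycle a (i, l))"
    unfolding ov3[OF i] unfolding ov2[OF i(1,2)] ov2[OF i(2,3)] ov2[OF i(1,3)]
    using i by (simp add: iota_cocycle_def r[OF i(2,3) T(3)] r[OF i(1,2) T(2)] r[OF i(1,3) T(4)])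
qed

lemma iota_cocycle_mult:
  assumes a: "cocycle X I U a" and b: "cocycle X I U b"
  shows "iota_cocycle (\<lambda>(i, j). a (i, j) \<otimes>\<^bsub>msec X (U i \<inter> U j)\<^esub> b (i, j)) =
    (\<lambda>(i, j)\<in>I \<times> I. iota_cocycle a (i, j) \<otimes>\<^bsub>rsec Y (ov (U i) \<inter> ov (U j))\<^esub> iota_cocycle b (i, j))"
  unfolding iota_cocycle_def
proof (rule restrict_ext)
  fix p assume "p \<in> I \<times> I"
  then obtain i j where p: "p = (i, j)" and i: "i \<in> I" "j \<in> I" by blast
  show "(case p of (i, j) \<Rightarrow> iota (U i \<inter> U j) \<one>\<^bsub>k\<^esub> ((\<lambda>(i, j). a (i, j) \<otimes>\<^bsub>msec X (U i \<inter> U j)\<^esub> b (i, j)) (i, j))) =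
    (case p of (i, j) \<Rightarrow> (\<lambda>(i, j)\<in>I \<times> I. iota (U i \<inter> U j) \<one>\<^bsub>k\<^esub> (a (i, j))) (i, j) \<otimes>\<^bsub>rsec Y (ov (U i) \<inter> ov (U j))\<^esub>
      (\<lambda>(i, j)\<in>I \<times> I. iota (U i \<inter> U j) \<one>\<^bsub>k\<^esub> (b (i, j))) (i, j))"
    using i iota_mult[OF XC.opn_cover2[OF i] k.one_closed k.one_closed XC.cocycle_section[OF a i] XC.cocycle_section[OF b i]]
    by (simp add: p ov2)
qed

lemma rres_iota:
  assumes i: "i \<in> I" "j \<in> I" and c: "c \<in> carrier k" and m: "m \<in> carrier (msec X (U i))" and n: "n \<in> carrier (msec X (U j))"
  shows "rres Y (ov (U i)) (kop (U i \<inter> U j)) (iota (U i) c m) = iota (U i \<inter> U j) c (mres X (U i) (U i \<inter> U j) m)"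
    "rres Y (ov (U j)) (kop (U i \<inter> U j)) (iota (U j) c n) = iota (U i \<inter> U j) c (mres X (U j) (U i \<inter> U j) n)"
  using iota_restrict[OF XC.opn_cover[OF i(1)] XC.opn_cover2[OF i] Int_lower1 c m]
    iota_restrict[OF XC.opn_cover[OF i(2)] XC.opn_cover2[OF i] Int_lower2 c n] by (simp_all add: ov1 i)

text \<open>A cochain of units on X_k consists of monomials by \<open>kop_unit\<close>. Keeping the
  exponents and dropping the scalars gives a cochain on \<open>X\<close>, because the exponents in
  an equality of monomial sections agree over every open set, the empty one included.\<close>

lemma iota_cohomologous:
  assumes a: "cocycle X I U a" and b: "cocycle X I U b"
  shows "cohomologous (mon_of Y) I (\<lambda>i. ov (U i)) (iota_cocycle a) (iota_cocycle b) \<longleftrightarrow> cohomologous X I U a b"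
proof
  assume "cohomologous (mon_of Y) I (\<lambda>i. ov (U i)) (iota_cocycle a) (iota_cocycle b)"
  then obtain u where u: "\<forall>i\<in>I. u i \<in> Units (rsec Y (ov (U i)))"
    and eq: "\<forall>i\<in>I. \<forall>j\<in>I. iota_cocycle b (i, j) \<otimes>\<^bsub>rsec Y (ov (U i) \<inter> ov (U j))\<^esub> rres Y (ov (U i)) (ov (U i) \<inter> ov (U j)) (u i) =
           iota_cocycle a (i, j) \<otimes>\<^bsub>rsec Y (ov (U i) \<inter> ov (U j))\<^esub> rres Y (ov (U j)) (ov (U i) \<inter> ov (U j)) (u j)"
    unfolding cohomologous_def mon_of_simps by (elim exE conjE)
  have "\<forall>i\<in>I. \<exists>p. fst p \<in> Units k \<and> snd p \<in> Units (msec X (U i)) \<and> u i = iota (U i) (fst p) (snd p)"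
  proof
    fix i assume i: "i \<in> I"
    then have ui: "u i \<in> Units (rsec Y (kop (U i)))" using u by (simp add: ov1)
    obtain c m where "c \<in> Units k" "m \<in> Units (msec X (U i))" "u i = iota (U i) c m"
      by (rule kop_unit[OF XC.opn_cover[OF i] affine[OF i] subset_refl ui])
    then show "\<exists>p. fst p \<in> Units k \<and> snd p \<in> Units (msec X (U i)) \<and> u i = iota (U i) (fst p) (snd p)"
      by (intro exI[of _ "(c, m)"]) simp
  qed
  then obtain p where p: "\<forall>i\<in>I. fst (p i) \<in> Units k \<and> snd (p i) \<in> Units (msec X (U i)) \<and> u i = iota (U i) (fst (p i)) (snd (p i))"
    by (rule bchoice[THEN exE])
  show "cohomologous X I U a b"
    unfolding cohomologous_def
  proof (intro exI[of _ "\<lambda>i. snd (p i)"] conjI ballI)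
    show "snd (p i) \<in> Units (msec X (U i))" if "i \<in> I" for i using p that by simp
    fix i j assume i: "i \<in> I" "j \<in> I"
    let ?c = "\<lambda>i. fst (p i)" and ?m = "\<lambda>i. snd (p i)" and ?W = "U i \<inter> U j"
    have c: "?c i \<in> Units k" "?c j \<in> Units k" and m: "?m i \<in> carrier (msec X (U i))" "?m j \<in> carrier (msec X (U j))"
      using p i X.Units_section by simp_all
    note kc = k.Units_closed[OF c(1)] k.Units_closed[OF c(2)] and o = XC.opn_cover2[OF i]
    note aij = XC.cocycle_section[OF a i] and bij = XC.cocycle_section[OF b i]
    note mi = X.res_closed[OF XC.opn_cover[OF i(1)] o Int_lower1 m(1)] and mj = X.res_closed[OF XC.opn_cover[OF i(2)] o Int_lower2 m(2)]
    have "iota ?W (?c i) (b (i, j) \<otimes>\<^bsub>msec X ?W\<^esub> mres X (U i) ?W (?m i)) = iota ?W (?c j) (a (i, j) \<otimes>\<^bsub>msec X ?W\<^esub> mres X (U j) ?W (?m j))"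
      using eq[THEN bspec, OF i(1), THEN bspec, OF i(2)] p i
      by (simp add: rres_iota(1)[OF i kc(1) m] rres_iota(2)[OF i kc(2) m] iota_cocycle_def ov2
        iota_mult[OF o k.one_closed kc(1) bij mi] iota_mult[OF o k.one_closed kc(2) aij mj] kc)
    then show "b (i, j) \<otimes>\<^bsub>msec X ?W\<^esub> mres X (U i) ?W (?m i) = a (i, j) \<otimes>\<^bsub>msec X ?W\<^esub> mres X (U j) ?W (?m j)"
      by (rule iota_inject(1)[OF o c X.mult_closed[OF o bij mi] X.mult_closed[OF o aij mj]])
  qed
next
  assume "cohomologous X I U a b"
  then obtain m where m: "\<forall>i\<in>I. m i \<in> Units (msec X (U i))"
    and eq: "\<forall>i\<in>I. \<forall>j\<in>I. b (i, j) \<otimes>\<^bsub>msec X (U i \<inter> U j)\<^esub> mres X (U i) (U i \<inter> U j) (m i) =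
           a (i, j) \<otimes>\<^bsub>msec X (U i \<inter> U j)\<^esub> mres X (U j) (U i \<inter> U j) (m j)"
    unfolding cohomologous_def by (elim exE conjE)
  show "cohomologous (mon_of Y) I (\<lambda>i. ov (U i)) (iota_cocycle a) (iota_cocycle b)"
    unfolding cohomologous_def mon_of_simps
  proof (intro exI[of _ "\<lambda>i. iota (U i) \<one>\<^bsub>k\<^esub> (m i)"] conjI ballI)
    show "iota (U i) \<one>\<^bsub>k\<^esub> (m i) \<in> Units (rsec Y (ov (U i)))" if "i \<in> I" for i
      using iota_Units[OF XC.opn_cover[OF that] k.Units_one_closed, of "m i"] m that by (simp add: ov1)
    fix i j assume i: "i \<in> I" "j \<in> I"
    have mc: "m i \<in> carrier (msec X (U i))" "m j \<in> carrier (msec X (U j))" using m i X.Units_section by simp_all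
    note o = XC.opn_cover2[OF i]
    note aij = XC.cocycle_section[OF a i] and bij = XC.cocycle_section[OF b i]
    note mi = X.res_closed[OF XC.opn_cover[OF i(1)] o Int_lower1 mc(1)] and mj = X.res_closed[OF XC.opn_cover[OF i(2)] o Int_lower2 mc(2)]
    show "iota_cocycle b (i, j) \<otimes>\<^bsub>rsec Y (ov (U i) \<inter> ov (U j))\<^esub> rres Y (ov (U i)) (ov (U i) \<inter> ov (U j)) (iota (U i) \<one>\<^bsub>k\<^esub> (m i)) =
           iota_cocycle a (i, j) \<otimes>\<^bsub>rsec Y (ov (U i) \<inter> ov (U j))\<^esub> rres Y (ov (U j)) (ov (U i) \<inter> ov (U j)) (iota (U j) \<one>\<^bsub>k\<^esub> (m j))"
      using eq i
      by (simp add: rres_iota[OF i k.one_closed mc] iota_cocycle_def ov2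
        iota_mult[OF o k.one_closed k.one_closed bij mi] iota_mult[OF o k.one_closed k.one_closed aij mj])
  qed
qed

text \<open>The scalar parts of a cocycle form a cocycle on each connected component, where all the
  \<open>U i\<close> meet; it is the coboundary of its row at a base index of the component.\<close>

lemma exists_iota_cohomologous:
  assumes g: "cocycle (mon_of Y) I (\<lambda>i. ov (U i)) g"
  obtains a where "cocycle X I U a" "cohomologous (mon_of Y) I (\<lambda>i. ov (U i)) (iota_cocycle a) g"
proof -
  have "\<forall>q\<in>I \<times> I. \<exists>p. fst p \<in> Units k \<and> snd p \<in> Units (msec X (U (fst q) \<inter> U (snd q))) \<and> g q = iota (U (fst q) \<inter> U (snd q)) (fst p) (snd p)"
  proof
    fix q assume "q \<in> I \<times> I"
    then obtain i j where q: "q = (i, j)" and i: "i \<in> I" "j \<in> I" by blast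
    have "g (i, j) \<in> Units (rsec Y (kop (U i \<inter> U j)))"
      using YC.C.cocycle_Units[OF g i] by (simp add: ov2 i)
    then obtain c m where "c \<in> Units k" "m \<in> Units (msec X (U i \<inter> U j))" "g (i, j) = iota (U i \<inter> U j) c m"
      by (rule kop_unit[OF XC.opn_cover2[OF i] affine[OF i(1)] Int_lower1])
    then show "\<exists>p. fst p \<in> Units k \<and> snd p \<in> Units (msec X (U (fst q) \<inter> U (snd q))) \<and> g q = iota (U (fst q) \<inter> U (snd q)) (fst p) (snd p)"
      by (intro exI[of _ "(c, m)"]) (simp add: q)
  qed
  then obtain p where p: "\<forall>q\<in>I \<times> I. fst (p q) \<in> Units k \<and> snd (p q) \<in> Units (msec X (U (fst q) \<inter> U (snd q))) \<and>
      g q = iota (U (fst q) \<inter> U (snd q)) (fst (p q)) (snd (p q))"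
    by (rule bchoice[THEN exE])
  define c m where "c i j = fst (p (i, j))" and "m q = snd (p q)" for i j q
  have c: "c i j \<in> Units k" and m: "m (i, j) \<in> Units (msec X (U i \<inter> U j))" and gm: "g (i, j) = iota (U i \<inter> U j) (c i j) (m (i, j))"
    if "i \<in> I" "j \<in> I" for i j
    using p[THEN bspec, of "(i, j)"] that by (simp_all add: c_def m_def)
  \<comment> \<open>The cocycle identity of \<open>g\<close> is an equality of two monomial
    sections. Their exponents always agree, their scalars only where the triple intersection is
    non-empty.\<close>
  have tri: "mres X (U j \<inter> U l) (U i \<inter> U j \<inter> U l) (m (j, l)) \<otimes>\<^bsub>msec X (U i \<inter> U j \<inter> U l)\<^esub> mres X (U i \<inter> U j) (U i \<inter> U j \<inter> U l) (m (i, j)) =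
      mres X (U i \<inter> U l) (U i \<inter> U j \<inter> U l) (m (i, l))"
    "U i \<inter> U j \<inter> U l \<noteq> {} \<Longrightarrow> c j l \<otimes>\<^bsub>k\<^esub> c i j = c i l" if i: "i \<in> I" "j \<in> I" "l \<in> I" for i j l
  proof -
    let ?T = "U i \<inter> U j \<inter> U l"
    have T: "openin (mtop X) ?T" "?T \<subseteq> U i \<inter> U j" "?T \<subseteq> U j \<inter> U l" "?T \<subseteq> U i \<inter> U l" using i by (auto simp: XC.opn_cover3)
    have r: "rres Y (kop (U p \<inter> U q)) (kop ?T) (g (p, q)) = iota ?T (c p q) (mres X (U p \<inter> U q) ?T (m (p, q)))"
      if "p \<in> I" "q \<in> I" "?T \<subseteq> U p \<inter> U q" for p q
      unfolding gm[OF that(1,2)]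
      by (rule iota_restrict[OF XC.opn_cover2[OF that(1,2)] T(1) that(3) k.Units_closed[OF c[OF that(1,2)]] X.Units_section[OF m[OF that(1,2)]]])
    have mc: "mres X (U p \<inter> U q) ?T (m (p, q)) \<in> carrier (msec X ?T)" if "p \<in> I" "q \<in> I" "?T \<subseteq> U p \<inter> U q" for p q
      by (rule X.res_closed[OF XC.opn_cover2[OF that(1,2)] T(1) that(3) X.Units_section[OF m[OF that(1,2)]]])
    note kc = k.Units_closed[OF c[OF i(2,3)]] k.Units_closed[OF c[OF i(1,2)]]
    have "rres Y (ov (U j) \<inter> ov (U l)) (ov (U i) \<inter> ov (U j) \<inter> ov (U l)) (g (j, l)) \<otimes>\<^bsub>rsec Y (ov (U i) \<inter> ov (U j) \<inter> ov (U l))\<^esub>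
        rres Y (ov (U i) \<inter> ov (U j)) (ov (U i) \<inter> ov (U j) \<inter> ov (U l)) (g (i, j)) =
        rres Y (ov (U i) \<inter> ov (U l)) (ov (U i) \<inter> ov (U j) \<inter> ov (U l)) (g (i, l))"
      using g i unfolding cocycle_def mon_of_simps by simp
    then have eq: "iota ?T (c j l \<otimes>\<^bsub>k\<^esub> c i j) (mres X (U j \<inter> U l) ?T (m (j, l)) \<otimes>\<^bsub>msec X ?T\<^esub> mres X (U i \<inter> U j) ?T (m (i, j))) =
        iota ?T (c i l) (mres X (U i \<inter> U l) ?T (m (i, l)))"
      unfolding ov3[OF i] unfolding ov2[OF i(1,2)] ov2[OF i(2,3)] ov2[OF i(1,3)]
        r[OF i(2,3) T(3)] r[OF i(1,2) T(2)] r[OF i(1,3) T(4)] iota_mult[OF T(1) kc mc[OF i(2,3) T(3)] mc[OF i(1,2) T(2)]] .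
    note inj = iota_inject[OF T(1) k.Units_m_closed[OF c[OF i(2,3)] c[OF i(1,2)]] c[OF i(1,3)]
      X.mult_closed[OF T(1) mc[OF i(2,3) T(3)] mc[OF i(1,2) T(2)]] mc[OF i(1,3) T(4)] eq]
    show "mres X (U j \<inter> U l) ?T (m (j, l)) \<otimes>\<^bsub>msec X ?T\<^esub> mres X (U i \<inter> U j) ?T (m (i, j)) = mres X (U i \<inter> U l) ?T (m (i, l))"
      by (rule inj(1))
    show "c j l \<otimes>\<^bsub>k\<^esub> c i j = c i l" if "?T \<noteq> {}" by (rule inj(2)[OF that])
  qed
  have mcoc: "cocycle X I U m" unfolding cocycle_def using m tri(1) by simp
  \<comment> \<open>Both intersections are non-empty open subsets of the irreducible
    \<open>U j\<close>, hence meet. So meeting is a transitive relation on \<open>I\<close>.\<close>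
  have triple: "U i \<inter> U j \<inter> U l \<noteq> {}" if i: "i \<in> I" "j \<in> I" "l \<in> I" and ne: "U i \<inter> U j \<noteq> {}" "U j \<inter> U l \<noteq> {}" for i j l
  proof -
    have "(U i \<inter> U j) \<inter> (U j \<inter> U l) \<noteq> {}"
      by (rule X.maffine_irreducible[OF affine[OF i(2)]]) (use ne XC.opn_cover2 i in simp_all)
    then show ?thesis by blast
  qed
  \<comment> \<open>The choice depends only on the set of indices whose open sets meet
    \<open>U i\<close>. That set is the same for any two indices that meet, so \<open>base\<close>
    is constant on components.\<close>
  define base where "base i = (SOME j. j \<in> I \<and> U j \<inter> U i \<noteq> {})" for i
  have base: "base i \<in> I \<and> U (base i) \<inter> U i \<noteq> {}" if i: "i \<in> I" for i
    unfolding base_def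
  proof (rule someI[of _ i])
    obtain x where "x \<in> U i" using affine[OF i] by (rule X.maffine_closed_point)
    then show "i \<in> I \<and> U i \<inter> U i \<noteq> {}" using i by blast
  qed
  have base_eq: "base i = base j" if i: "i \<in> I" "j \<in> I" "U i \<inter> U j \<noteq> {}" for i j
  proof -
    have "(l \<in> I \<and> U l \<inter> U i \<noteq> {}) = (l \<in> I \<and> U l \<inter> U j \<noteq> {})" for l
      using triple[of l i j] triple[of l j i] i by blast
    then show ?thesis by (simp add: base_def)
  qed
  \<comment> \<open>The row of the scalar cocycle at the base index. Whenever \<open>U i\<close> and
    \<open>U j\<close> meet, the scalar identity for \<open>base i\<close>, \<open>i\<close>,
    \<open>j\<close> writes \<open>c i j\<close> as the quotient of \<open>?d j\<close> by
    \<open>?d i\<close>.\<close>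
  let ?d = "\<lambda>i. c (base i) i"
  have d: "?d i \<in> Units k" if "i \<in> I" for i using c base that by simp
  have "cohomologous (mon_of Y) I (\<lambda>i. ov (U i)) (iota_cocycle m) g"
    unfolding cohomologous_def mon_of_simps
  proof (intro exI[of _ "\<lambda>i. iota (U i) (?d i) \<one>\<^bsub>msec X (U i)\<^esub>"] conjI ballI)
    show "iota (U i) (?d i) \<one>\<^bsub>msec X (U i)\<^esub> \<in> Units (rsec Y (ov (U i)))" if "i \<in> I" for i
      using iota_Units[OF XC.opn_cover[OF that] d[OF that] X.Units_one[OF XC.opn_cover[OF that]]] that by (simp add: ov1)
    fix i j assume i: "i \<in> I" "j \<in> I"
    let ?W = "U i \<inter> U j"
    note o = XC.opn_cover2[OF i] and kd = k.Units_closed[OF d[OF i(1)]] k.Units_closed[OF d[OF i(2)]] and kc = k.Units_closed[OF c[OF i]]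
    note mij = X.Units_section[OF m[OF i]] and ones = X.one_closed[OF XC.opn_cover[OF i(1)]] X.one_closed[OF XC.opn_cover[OF i(2)]]
    have "iota ?W (c i j \<otimes>\<^bsub>k\<^esub> ?d i) (m (i, j)) = iota ?W (?d j) (m (i, j))"
    \<comment> \<open>Over an empty overlap all scalars give the same section, so no relation
      between \<open>c i j\<close>, \<open>?d i\<close> and \<open>?d j\<close> is required
      there.\<close>
    proof (cases "?W = {}")
      case True
      have no: "\<not> V \<subseteq> ?W" if "maffine X V" for V
        using X.maffine_closed_point[OF that] True by blast
      show ?thesis
        by (rule kop_section_eqI[OF iota(1)[OF o k.m_closed[OF kc kd(1)] mij] iota(1)[OF o kd(2) mij]]) (use no in blast)
    next
      case False
      have "U (base i) \<inter> U i \<inter> U j \<noteq> {}" using triple[of "base i" i j] base[OF i(1)] i False by blast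
      then have "c i j \<otimes>\<^bsub>k\<^esub> ?d i = ?d j" using tri(2)[of "base i" i j] base[OF i(1)] i base_eq[OF i False] by simp
      then show ?thesis by simp
    qed
    then show "g (i, j) \<otimes>\<^bsub>rsec Y (ov (U i) \<inter> ov (U j))\<^esub> rres Y (ov (U i)) (ov (U i) \<inter> ov (U j)) (iota (U i) (?d i) \<one>\<^bsub>msec X (U i)\<^esub>) =
           iota_cocycle m (i, j) \<otimes>\<^bsub>rsec Y (ov (U i) \<inter> ov (U j))\<^esub> rres Y (ov (U j)) (ov (U i) \<inter> ov (U j)) (iota (U j) (?d j) \<one>\<^bsub>msec X (U j)\<^esub>)"
      using i by (simp add: rres_iota(1)[OF i kd(1) ones] rres_iota(2)[OF i kd(2) ones] iota_cocycle_def ov2 gm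
        X.res_one[OF XC.opn_cover[OF i(1)] o Int_lower1] X.res_one[OF XC.opn_cover[OF i(2)] o Int_lower2]
        iota_mult[OF o kc kd(1) mij X.one_closed[OF o]] iota_mult[OF o k.one_closed kd(2) mij X.one_closed[OF o]] X.one_right[OF o mij] kd)
  qed
  then show thesis by (rule that[OF mcoc])
qed

end

section \<open>Linearization read off from trivializations\<close>

context base_changed
begin

text \<open>\<open>linearization\<close> is stated over all affine opens; making these a cover in
  their own right lets it be expressed by a trivialization.\<close>

lemma affines_cover: "affine_cover k X Y \<gamma> {U. maffine X U} (\<lambda>U. U)"
proof (intro affine_cover.intro base_changed_axioms affine_cover_axioms.intro)
  show "(\<Union>U\<in>{U. maffine X U}. U) = topspace (mtop X)"
    using scheme openin_subset[OF X.maffine_opn] unfolding monoid_scheme_space_def by blast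
qed simp

text \<open>The images \<open>f U\<close> of the basis elements \<open>e U\<close> generate
  \<open>N\<close> over \<open>ov U\<close>, and compatibility of \<open>\<kappa>\<close> with
  restriction turns the transition functions of \<open>L\<close> into monomials with coefficient
  one.\<close>

lemma trivialization_of_linearization:
  assumes L: "oset_sheaf X L" and a: "cocycle X {U. maffine X U} (\<lambda>U. U) a"
    and e: "trivialization X {U. maffine X U} (\<lambda>U. U) L a e"
    and N: "omod_sheaf Y N" and lin: "linearization k X Y \<gamma> L N"
  obtains f where "trivialization (mon_of Y) {U. maffine X U} (\<lambda>U. ov U) (oset_of N)
    (\<lambda>(U, V). iota (U \<inter> V) \<one>\<^bsub>k\<^esub> (a (U, V))) f"
proof -
  interpret J: affine_cover k X Y \<gamma> "{U. maffine X U}" "\<lambda>U. U" by (rule affines_cover)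
  note N' = Y.omod_imp_oset_sheaf[OF N]
  obtain \<kappa> where \<kappa>1: "\<forall>U. maffine X U \<longrightarrow>
             (\<forall>s\<in>fin_supp k (osec L U). \<kappa> U s \<in> carrier (lsec N (ov U))) \<and>
             (\<forall>f\<in>carrier (alg U). is_module_localization (alg U) f (free_module k (osec L U) (oact L U))
                  (rsec Y (gpt \<gamma> U ` rbasic (alg U) f)) (rres Y (ov U) (gpt \<gamma> U ` rbasic (alg U) f) \<circ> gsec \<gamma> U)
                  (lsec N (gpt \<gamma> U ` rbasic (alg U) f)) (lres N (ov U) (gpt \<gamma> U ` rbasic (alg U) f) \<circ> \<kappa> U))"
    and \<kappa>2: "\<forall>U V. maffine X U \<and> maffine X V \<and> V \<subseteq> U \<longrightarrow>
             (\<forall>s\<in>fin_supp k (osec L U). \<kappa> V (push_forward k (ores L U V) s) = lres N (ov U) (ov V) (\<kappa> U s))"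
    using lin unfolding linearization_def Let_def by (elim exE conjE)
  have \<kappa>c: "\<kappa> U s \<in> carrier (lsec N (ov U))" if "maffine X U" "s \<in> fin_supp k (osec L U)" for U s
    using \<kappa>1[THEN spec, of U] that by simp
  have loc: "is_module_localization (alg U) F (free_module k (osec L U) (oact L U))
      (rsec Y (gpt \<gamma> U ` rbasic (alg U) F)) (rres Y (ov U) (gpt \<gamma> U ` rbasic (alg U) F) \<circ> gsec \<gamma> U)
      (lsec N (gpt \<gamma> U ` rbasic (alg U) F)) (lres N (ov U) (gpt \<gamma> U ` rbasic (alg U) F) \<circ> \<kappa> U)"
    if "maffine X U" "F \<in> carrier (alg U)" for U F
    using \<kappa>1[THEN spec, of U] that by simp
  \<comment> \<open>The localization clause at \<open>f = 1\<close>, where the basic open set is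
    \<open>ov U\<close> itself, contains the linearity of \<open>\<kappa> U\<close>.\<close>
  have lin\<kappa>: "\<kappa> U (convolve k (oact L U) r s) = gsec \<gamma> U r \<odot>\<^bsub>lsec N (ov U)\<^esub> \<kappa> U s"
    if U: "maffine X U" and r: "r \<in> carrier (alg U)" and s: "s \<in> fin_supp k (osec L U)" for U r s
  proof -
    interpret R: cring "alg U" by (rule cring_alg[OF U])
    have "is_module_localization (alg U) \<one>\<^bsub>alg U\<^esub> (free_module k (osec L U) (oact L U))
      (rsec Y (ov U)) (rres Y (ov U) (ov U) \<circ> gsec \<gamma> U) (lsec N (ov U)) (lres N (ov U) (ov U) \<circ> \<kappa> U)"
      using loc[OF U R.one_closed, folded ov_eq[OF U]] .
    then have "(lres N (ov U) (ov U) \<circ> \<kappa> U) (convolve k (oact L U) r s) =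
        (rres Y (ov U) (ov U) \<circ> gsec \<gamma> U) r \<odot>\<^bsub>lsec N (ov U)\<^esub> (lres N (ov U) (ov U) \<circ> \<kappa> U) s"
      using r s unfolding is_module_localization_def free_module_simps by simp
    moreover have "convolve k (oact L U) r s \<in> fin_supp k (osec L U)"
      using r s X.oact_closed[OF L X.maffine_opn[OF U]] unfolding alg_simps by (intro k.convolve_fin_supp)
    ultimately show ?thesis
      using Y.M.ores_id[OF N', of "ov U"] Y.M.res_id[of "ov U"] \<kappa>c[OF U] ov_open[OF U] gsec_closed[OF U r] s by simp
  qed
  have eg: "mgenerator X L U (e U)" and es: "e U \<in> osec L U" if "maffine X U" for U
    using J.XC.trivialization_mgenerator[OF e] J.XC.trivialization_section[OF e] that by simp_all
  define f where "f U = \<kappa> U (single k (e U))" for U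
  have f: "f U \<in> carrier (lsec N (ov U))" if "maffine X U" for U
    unfolding f_def by (rule \<kappa>c[OF that k.single_fin_supp[OF es[OF that]]])
  have res: "lres N (ov U) (ov Z) (f U) = \<kappa> Z (single k (ores L U Z (e U)))" if "maffine X U" "maffine X Z" "Z \<subseteq> U" for U Z
  proof -
    have "\<kappa> Z (push_forward k (ores L U Z) (single k (e U))) = lres N (ov U) (ov Z) (f U)"
      using \<kappa>2[THEN spec, THEN spec, of U Z] that k.single_fin_supp[OF es[OF that(1)]] by (simp add: f_def)
    then show ?thesis by (simp add: single_monomial k.push_forward_monomial)
  qed
  have "trivialization (mon_of Y) {U. maffine X U} (\<lambda>U. ov U) (oset_of N) (\<lambda>(U, V). iota (U \<inter> V) \<one>\<^bsub>k\<^esub> (a (U, V))) f"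
    unfolding trivialization_def
  proof (intro conjI ballI)
    fix U assume "U \<in> {U. maffine X U}"
    then have U: "maffine X U" by simp
    show "mgenerator (mon_of Y) (oset_of N) (ov U) (f U)"
      using f[OF U] unfolding f_def by (rule generator_of_module_localization[OF U L eg[OF U] N _ loc[OF U]])
  next
    fix U V assume "U \<in> {U. maffine X U}" "V \<in> {U. maffine X U}"
    then have U: "maffine X U" "maffine X V" by simp_all
    let ?W = "U \<inter> V"
    have W: "ov U \<inter> ov V = kop ?W" "openin (mtop X) ?W" using U J.ov2 J.XC.opn_cover2 by simp_all
    have aW: "a (U, V) \<in> carrier (msec X ?W)" using J.XC.cocycle_section[OF a] U by simp
    note io = iota[OF W(2) k.one_closed aW]
    have sub: "kop ?W \<subseteq> ov U" "kop ?W \<subseteq> ov V" using W(1) by blast+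
    have o: "openin (mtop (mon_of Y)) (kop ?W)" "openin (mtop (mon_of Y)) (ov U)" "openin (mtop (mon_of Y)) (ov V)"
      using kop_open ov_open U by simp_all
    have fs: "f U \<in> osec (oset_of N) (ov U)" "f V \<in> osec (oset_of N) (ov V)" using f U by simp_all
    note rU = Y.M.ores_closed[OF N' o(2,1) sub(1) fs(1)] and rV = Y.M.ores_closed[OF N' o(3,1) sub(2) fs(2)]
    have io1: "iota ?W \<one>\<^bsub>k\<^esub> (a (U, V)) \<in> carrier (msec (mon_of Y) (kop ?W))" using io(1) by simp
    have "ores (oset_of N) (ov V) (kop ?W) (f V) =
        oact (oset_of N) (kop ?W) (iota ?W \<one>\<^bsub>k\<^esub> (a (U, V))) (ores (oset_of N) (ov U) (kop ?W) (f U))"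
    \<comment> \<open>The maps \<open>\<kappa>\<close> live on affine opens only, so the transition
      over \<open>kop ?W\<close> is tested on the affine opens inside \<open>?W\<close>.\<close>
    proof (rule Y.M.oset_eqI[OF N' _ kop_eq rV Y.M.oact_closed[OF N' o(1) io1 rU]])
      fix Z assume "Z \<in> {Z. maffine X Z \<and> Z \<subseteq> ?W}"
      then have Z: "maffine X Z" "Z \<subseteq> ?W" "Z \<subseteq> U" "Z \<subseteq> V" by auto
      show oZ: "openin (mtop (mon_of Y)) (ov Z)" using ov_open[OF Z(1)] by simp
      note sZ = ov_subset_kop[OF Z(1,2)]
      note b = X.res_closed[OF W(2) X.maffine_opn[OF Z(1)] Z(2) aW]
      note eZ = X.ores_closed[OF L X.maffine_opn[OF U(1)] X.maffine_opn[OF Z(1)] Z(3) es[OF U(1)]]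
      have "ores L V Z (e V) = oact L Z (mres X ?W Z (a (U, V))) (ores L U Z (e U))"
        by (rule J.XC.trivialization_on[OF L e _ _ aW X.maffine_opn[OF Z(1)] Z(3,4)]) (simp_all add: U)
      then have "lres N (ov V) (ov Z) (f V) = \<kappa> Z (convolve k (oact L Z) (single k (mres X ?W Z (a (U, V)))) (single k (ores L U Z (e U))))"
        by (simp add: res[OF U(2) Z(1,4)] single_monomial k.convolve_monomial)
      also have "\<dots> = gsec \<gamma> Z (single k (mres X ?W Z (a (U, V)))) \<odot>\<^bsub>lsec N (ov Z)\<^esub> lres N (ov U) (ov Z) (f U)"
        using lin\<kappa>[OF Z(1) _ k.single_fin_supp[OF eZ]] k.single_fin_supp[OF b] by (simp add: alg_simps res[OF U(1) Z(1,3)])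
      finally show "ores (oset_of N) (kop ?W) (ov Z) (ores (oset_of N) (ov V) (kop ?W) (f V)) =
          ores (oset_of N) (kop ?W) (ov Z) (oact (oset_of N) (kop ?W) (iota ?W \<one>\<^bsub>k\<^esub> (a (U, V))) (ores (oset_of N) (ov U) (kop ?W) (f U)))"
        using Y.M.ores_ores[OF N' o(3,1) oZ sZ sub(2) fs(2)] Y.M.ores_ores[OF N' o(2,1) oZ sZ sub(1) fs(1)]
          Y.M.ores_oact[OF N' o(1) oZ sZ io1 rU] io(2)[OF Z(1,2)] by (simp add: single_monomial)
    qed
    then show "ores (oset_of N) (ov V) (ov U \<inter> ov V) (f V) =
        oact (oset_of N) (ov U \<inter> ov V) (case (U, V) of (U, V) \<Rightarrow> iota (U \<inter> V) \<one>\<^bsub>k\<^esub> (a (U, V))) (ores (oset_of N) (ov U) (ov U \<inter> ov V) (f U))"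
      by (simp add: W(1))
  qed
  then show thesis by (rule that)
qed

text \<open>\<open>\<kappa> U\<close> sends a formal sum to its coordinate in \<open>e U\<close>
  times \<open>f U\<close>. On passing to \<open>V \<subseteq> U\<close> the coordinate gains the
  factor \<open>b\<close> with \<open>e U = b \<cdot> e V\<close>, and the monomial of
  \<open>b\<close> times \<open>f V\<close> is the restriction of \<open>f U\<close>; this is the
  compatibility with restriction.\<close>

lemma linearization_of_trivialization:
  assumes L: "oset_sheaf X L" and a: "cocycle X {U. maffine X U} (\<lambda>U. U) a"
    and e: "trivialization X {U. maffine X U} (\<lambda>U. U) L a e"
    and N: "omod_sheaf Y N"
    and f: "trivialization (mon_of Y) {U. maffine X U} (\<lambda>U. ov U) (oset_of N) (\<lambda>(U, V). iota (U \<inter> V) \<one>\<^bsub>k\<^esub> (a (U, V))) f"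
  shows "linearization k X Y \<gamma> L N"
proof -
  interpret J: affine_cover k X Y \<gamma> "{U. maffine X U}" "\<lambda>U. U" by (rule affines_cover)
  note N' = Y.omod_imp_oset_sheaf[OF N]
  have eg: "mgenerator X L U (e U)" and es: "e U \<in> osec L U" if "maffine X U" for U
    using J.XC.trivialization_mgenerator[OF e] J.XC.trivialization_section[OF e] that by simp_all
  have fg: "mgenerator (mon_of Y) (oset_of N) (ov U) (f U)" if "maffine X U" for U
    using f that unfolding trivialization_def by simp
  have fs: "f U \<in> carrier (lsec N (ov U))" if "maffine X U" for U
    using Y.M.mgenerator_section[OF fg[OF that]] by simp
  let ?\<kappa> = "\<lambda>U s. gsec \<gamma> U (coords U L (e U) s) \<odot>\<^bsub>lsec N (ov U)\<^esub> f U"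
  note cc = coords_closed[OF _ L eg]
  show ?thesis
    unfolding linearization_def Let_def
  proof (intro exI[of _ ?\<kappa>] conjI allI impI ballI)
    fix U s assume U: "maffine X U" and s: "s \<in> fin_supp k (osec L U)"
    interpret M: Module.module "rsec Y (ov U)" "lsec N (ov U)" by (rule Y.omod_sheaf_module[OF N ov_open[OF U]])
    show "?\<kappa> U s \<in> carrier (lsec N (ov U))" by (rule M.smult_closed[OF gsec_closed[OF U cc[OF U U s]] fs[OF U]])
  next
    fix U F assume U: "maffine X U" and F: "F \<in> carrier (alg U)"
    show "is_module_localization (alg U) F (free_module k (osec L U) (oact L U)) (rsec Y (gpt \<gamma> U ` rbasic (alg U) F))
        (rres Y (ov U) (gpt \<gamma> U ` rbasic (alg U) F) \<circ> gsec \<gamma> U) (lsec N (gpt \<gamma> U ` rbasic (alg U) F))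
        (lres N (ov U) (gpt \<gamma> U ` rbasic (alg U) F) \<circ> ?\<kappa> U)"
      by (rule module_localization_of_generator[OF U L eg[OF U] N fg[OF U] F])
  next
    fix U V s assume "maffine X U \<and> maffine X V \<and> V \<subseteq> U" and s: "s \<in> fin_supp k (osec L U)"
    then have U: "maffine X U" "maffine X V" "V \<subseteq> U" by simp_all
    note oU = X.maffine_opn[OF U(1)] and oV = X.maffine_opn[OF U(2)]
    have VU: "V \<inter> U = V" "ov V \<inter> ov U = ov V" using U(3) ov_subset[OF U] by blast+
    \<comment> \<open>The order of the pair matters: \<open>a (V, U)\<close> lives over
      \<open>V \<inter> U = V\<close> and expresses the restriction of \<open>e U\<close> through
      \<open>e V\<close>.\<close>
    define b where "b = a (V, U)"
    have b: "b \<in> carrier (msec X V)" using J.XC.cocycle_section[OF a, of V U] U by (simp add: b_def VU)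
    have eb: "ores L U V (e U) = oact L V b (e V)"
    proof -
      have "\<forall>U\<in>{U. maffine X U}. \<forall>V\<in>{U. maffine X U}. ores L V (U \<inter> V) (e V) = oact L (U \<inter> V) (a (U, V)) (ores L U (U \<inter> V) (e U))"
        using e unfolding trivialization_def by (rule conjunct2)
      then have "ores L U (V \<inter> U) (e U) = oact L (V \<inter> U) (a (V, U)) (ores L V (V \<inter> U) (e V))"
        using U by simp
      then show ?thesis unfolding VU by (simp add: b_def X.ores_id[OF L oV es[OF U(2)]])
    qed
    interpret M: Module.module "rsec Y (ov V)" "lsec N (ov V)" by (rule Y.omod_sheaf_module[OF N ov_open[OF U(2)]])
    have "\<forall>U\<in>{U. maffine X U}. \<forall>V\<in>{U. maffine X U}. ores (oset_of N) (ov V) (ov U \<inter> ov V) (f V) =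
        oact (oset_of N) (ov U \<inter> ov V) (case (U, V) of (U, V) \<Rightarrow> iota (U \<inter> V) \<one>\<^bsub>k\<^esub> (a (U, V))) (ores (oset_of N) (ov U) (ov U \<inter> ov V) (f U))"
      using f unfolding trivialization_def by (rule conjunct2)
    then have "lres N (ov U) (ov V \<inter> ov U) (f U) = iota (V \<inter> U) \<one>\<^bsub>k\<^esub> (a (V, U)) \<odot>\<^bsub>lsec N (ov V \<inter> ov U)\<^esub> lres N (ov V) (ov V \<inter> ov U) (f V)"
      using U by simp
    then have fb: "lres N (ov U) (ov V) (f U) = gsec \<gamma> V (single k b) \<odot>\<^bsub>lsec N (ov V)\<^esub> f V"
      using Y.M.ores_id[OF N', of "ov V" "f V"] ov_open[OF U(2)] fs[OF U(2)]
      unfolding VU by (simp add: b_def[symmetric] iota_affine[OF U(2) k.one_closed b] single_monomial)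
    define P where "P = push_forward k (mres X U V) (coords U L (e U) s)"
    have P: "P \<in> carrier (alg V)"
      unfolding P_def alg_simps
      by (rule k.push_forward_fin_supp[OF cc[OF U(1) U(1) s, unfolded alg_simps] X.res_closed[OF oU oV U(3)]])
    have sb: "single k b \<in> carrier (alg V)" unfolding alg_simps by (rule k.single_fin_supp[OF b])
    note co = X.coord[OF L oU eg[OF U(1)]]
    \<comment> \<open>All the maps are push-forwards along maps of sets, so the change of
      coordinates is checked on single sections \<open>x\<close> of \<open>L\<close> over
      \<open>U\<close>.\<close>
    have "coords V L (e V) (push_forward k (ores L U V) s) = push_forward k (X.coord L V (e V) \<circ> ores L U V) s"
      unfolding coords_def[OF U(2) L eg[OF U(2)]] by (rule k.push_forward_comp[OF s])
    also have "\<dots> = push_forward k ((\<lambda>x. x \<otimes>\<^bsub>msec X V\<^esub> b) \<circ> (mres X U V \<circ> X.coord L U (e U))) s"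
    proof (rule k.push_forward_cong[OF s])
      fix x assume x: "x \<in> osec L U"
      note r = X.res_closed[OF oU oV U(3) co(1)[OF x]]
      have "oact L V (mres X U V (X.coord L U (e U) x) \<otimes>\<^bsub>msec X V\<^esub> b) (e V) = ores L U V x"
        using X.ores_oact[OF L oU oV U(3) co(1)[OF x] es[OF U(1)]]
        by (simp add: X.oact_mult[OF L oV r b es[OF U(2)]] eb[symmetric] co(2)[OF x])
      then show "(X.coord L V (e V) \<circ> ores L U V) x = ((\<lambda>x. x \<otimes>\<^bsub>msec X V\<^esub> b) \<circ> (mres X U V \<circ> X.coord L U (e U))) x"
        by (simp add: X.coord_eqI[OF L oV eg[OF U(2)] X.mult_closed[OF oV r b]])
    qed
    also have "\<dots> = push_forward k (\<lambda>x. x \<otimes>\<^bsub>msec X V\<^esub> b) P"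
      unfolding P_def coords_def[OF U(1) L eg[OF U(1)]] k.push_forward_comp[OF s] ..
    also have "\<dots> = P \<otimes>\<^bsub>alg V\<^esub> single k b"
      unfolding alg_simps by (rule k.convolve_single_right[OF P[unfolded alg_simps], symmetric])
    finally have "?\<kappa> V (push_forward k (ores L U V) s) = gsec \<gamma> V P \<odot>\<^bsub>lsec N (ov V)\<^esub> lres N (ov U) (ov V) (f U)"
      using ring_hom_mult[OF gsec_hom[OF U(2)] P sb] M.smult_assoc1[OF gsec_closed[OF U(2) P] gsec_closed[OF U(2) sb] fs[OF U(2)]]
      by (simp add: fb)
    also have "gsec \<gamma> V P = rres Y (ov U) (ov V) (gsec \<gamma> U (coords U L (e U) s))"
      unfolding P_def by (rule gsec_restrict[OF U cc[OF U(1) U(1) s], symmetric])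
    also have "\<dots> \<odot>\<^bsub>lsec N (ov V)\<^esub> lres N (ov U) (ov V) (f U) = lres N (ov U) (ov V) (?\<kappa> U s)"
      using Y.M.ores_oact[OF N', of "ov U" "ov V" "gsec \<gamma> U (coords U L (e U) s)" "f U"]
        ov_open U ov_subset[OF U] gsec_closed[OF U(1) cc[OF U(1) U(1) s]] fs[OF U(1)] by simp
    finally show "?\<kappa> V (push_forward k (ores L U V) s) = lres N (ov U) (ov V) (?\<kappa> U s)" .
  qed
qed

end

context affine_cover
begin

lemma trivialization_iota_cocycle:
  "trivialization (mon_of Y) I (\<lambda>i. ov (U i)) M (iota_cocycle a) f \<longleftrightarrow>
    trivialization (mon_of Y) I (\<lambda>i. ov (U i)) M (\<lambda>(i, j). iota (U i \<inter> U j) \<one>\<^bsub>k\<^esub> (a (i, j))) f"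
  by (simp add: trivialization_def iota_cocycle_def)

lemma mline_bundle_trivialization:
  assumes L: "mline_bundle X L"
  obtains a e where "cocycle X I U a" "trivialization X I U L a e"
proof -
  have "\<forall>i\<in>I. \<exists>e. mgenerator X L (U i) e"
  proof
    fix i assume "i \<in> I"
    obtain e where "mgenerator X L (U i) e"
      by (rule X.mline_bundle_trivial_on_affine[OF L affine[OF \<open>i \<in> I\<close>]])
    then show "\<exists>e. mgenerator X L (U i) e" ..
  qed
  then obtain e where e: "\<forall>i\<in>I. mgenerator X L (U i) (e i)" by (rule bchoice[THEN exE])
  show thesis
    by (rule XC.exists_trivialization[OF X.mline_bundle_sheaf[OF L], where e = e]) (use e that in simp_all)
qed

text \<open>Restricted to the members of the cover, \<open>b\<close> gives transition functions of
  the same \<open>L\<close>, hence a cocycle cohomologous to \<open>a\<close>. By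
  \<open>iota_cohomologous\<close> this carries over to X_k, where the trivialization of
  \<open>N\<close> can be rescaled accordingly.\<close>

lemma restrict_trivialization:
  assumes L: "oset_sheaf X L" and a: "cocycle X I U a" and e: "trivialization X I U L a e"
    and b: "cocycle X {U. maffine X U} (\<lambda>U. U) b" and d: "trivialization X {U. maffine X U} (\<lambda>U. U) L b d"
    and N: "rline_bundle Y N"
    and g: "trivialization (mon_of Y) {U. maffine X U} (\<lambda>U. ov U) (oset_of N) (\<lambda>(U, V). iota (U \<inter> V) \<one>\<^bsub>k\<^esub> (b (U, V))) g"
  shows "\<exists>f. trivialization (mon_of Y) I (\<lambda>i. ov (U i)) (oset_of N) (iota_cocycle a) f"
proof -
  define b' where "b' = (\<lambda>(i, j). b (U i, U j))"
  have b': "cocycle X I U b'" using b affine unfolding cocycle_def b'_def by simp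
  have d': "trivialization X I U L b' (\<lambda>i. d (U i))" using d affine unfolding trivialization_def b'_def by simp
  have coh: "cohomologous (mon_of Y) I (\<lambda>i. ov (U i)) (iota_cocycle b') (iota_cocycle a)"
    unfolding iota_cohomologous[OF b' a] by (rule XC.cohomologous_of_trivializations[OF L b' a d' e])
  have g': "trivialization (mon_of Y) I (\<lambda>i. ov (U i)) (oset_of N) (iota_cocycle b') (\<lambda>i. g (U i))"
    using g affine unfolding trivialization_iota_cocycle unfolding trivialization_def b'_def by simp
  show ?thesis
    by (rule YC.C.trivialization_cohomologous[OF YC.rline_oset_sheaf[OF N] iota_cocycle_cocycle[OF b'] iota_cocycle_cocycle[OF a] g' coh]) blast
qed

lemma linearization_iff:
  assumes L: "mline_bundle X L" and a: "cocycle X I U a" and e: "trivialization X I U L a e" and N: "rline_bundle Y N"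
  shows "linearization k X Y \<gamma> L N \<longleftrightarrow> (\<exists>f. trivialization (mon_of Y) I (\<lambda>i. ov (U i)) (oset_of N) (iota_cocycle a) f)"
proof -
  interpret J: affine_cover k X Y \<gamma> "{U. maffine X U}" "\<lambda>U. U" by (rule affines_cover)
  note L' = X.mline_bundle_sheaf[OF L]
  obtain b d where b: "cocycle X {U. maffine X U} (\<lambda>U. U) b" and d: "trivialization X {U. maffine X U} (\<lambda>U. U) L b d"
    using L by (rule J.mline_bundle_trivialization)
  note to_I = restrict_trivialization[OF L' a e b d]
  show ?thesis
  proof
    assume "linearization k X Y \<gamma> L N"
    then obtain g where "trivialization (mon_of Y) {U. maffine X U} (\<lambda>U. ov U) (oset_of N) (\<lambda>(U, V). iota (U \<inter> V) \<one>\<^bsub>k\<^esub> (b (U, V))) g"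
      by (rule trivialization_of_linearization[OF L' b d Y.rline_bundle_sheaf[OF N]])
    then show "\<exists>f. trivialization (mon_of Y) I (\<lambda>i. ov (U i)) (oset_of N) (iota_cocycle a) f" by (rule to_I[OF N])
  next
    assume "\<exists>f. trivialization (mon_of Y) I (\<lambda>i. ov (U i)) (oset_of N) (iota_cocycle a) f"
    then obtain f where f: "trivialization (mon_of Y) I (\<lambda>i. ov (U i)) (oset_of N) (iota_cocycle a) f" ..
    \<comment> \<open>An auxiliary bundle glued from the linearized cocycle on all affine opens. On
      the cover \<open>U\<close> it has the same cocycle as \<open>N\<close>, so the two are
      isomorphic and \<open>N\<close> inherits the trivialization on all affine opens.\<close>
    obtain N' :: "('y, 'r, 'y \<Rightarrow> 'r) omod" and g where N': "rline_bundle Y N'"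
      and g: "trivialization (mon_of Y) {U. maffine X U} (\<lambda>U. ov U) (oset_of N') (J.iota_cocycle b) g"
      using J.iota_cocycle_cocycle[OF b] by (rule J.YC.exists_ring_bundle)
    obtain f' where f': "trivialization (mon_of Y) I (\<lambda>i. ov (U i)) (oset_of N') (iota_cocycle a) f'"
      using to_I[OF N' g[unfolded J.trivialization_iota_cocycle]] ..
    have "oset_iso_on (mon_of Y) (topspace (mtop (mon_of Y))) (oset_of N') (oset_of N)"
      by (rule YC.C.oset_iso_on_same_cocycle[OF YC.rline_oset_sheaf[OF N'] YC.rline_oset_sheaf[OF N] iota_cocycle_cocycle[OF a] f' f])
    then obtain g' where "trivialization (mon_of Y) {U. maffine X U} (\<lambda>U. ov U) (oset_of N) (J.iota_cocycle b) g'"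
      by (rule J.YC.C.trivialization_iso[OF YC.rline_oset_sheaf[OF N'] J.iota_cocycle_cocycle[OF b] g])
    then show "linearization k X Y \<gamma> L N"
      unfolding J.trivialization_iota_cocycle
      by (rule linearization_of_trivialization[OF L' b d Y.rline_bundle_sheaf[OF N]])
  qed
qed

section \<open>Comparison of the Picard groups\<close>

text \<open>Every line bundle is trivial on the affine members of the cover, so cocycles on this one
  cover account for the whole Picard group.\<close>

lemma carrier_mPic: "carrier (mPic X) = XC.line_class ` {a. cocycle X I U a}"
proof (intro subset_antisym subsetI)
  fix c assume "c \<in> carrier (mPic X)"
  then obtain L :: "('p, 'a, 'p \<Rightarrow> 'a) oset" where L: "mline_bundle X L" and c: "c = mclass X L" by (auto simp: mPic_def)
  obtain a e where "cocycle X I U a" "trivialization X I U L a e" using L by (rule mline_bundle_trivialization)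
  then show "c \<in> XC.line_class ` {a. cocycle X I U a}"
    unfolding c using XC.mclass_eq_line_class[OF X.mline_bundle_sheaf[OF L]] by blast
next
  fix c assume "c \<in> XC.line_class ` {a. cocycle X I U a}"
  then obtain a where a: "cocycle X I U a" and c: "c = XC.line_class a" by blast
  obtain L :: "('p, 'a, 'p \<Rightarrow> 'a) oset" and e where L: "oset_sheaf X L" and e: "trivialization X I U L a e"
    using a by (rule XC.exists_bundle)
  have "c = mclass X L" unfolding c by (rule XC.mclass_eq_line_class[OF L a e, symmetric])
  then show "c \<in> carrier (mPic X)" using XC.trivialization_mline_bundle[OF L e] by (auto simp: mPic_def)
qed

lemma mPic_mult:
  "cocycle X I U a \<Longrightarrow> cocycle X I U b \<Longrightarrow>
    XC.line_class a \<otimes>\<^bsub>mPic X\<^esub> XC.line_class b = XC.line_class (\<lambda>(i, j). a (i, j) \<otimes>\<^bsub>msec X (U i \<inter> U j)\<^esub> b (i, j))"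
  by (simp add: mPic_def XC.line_class_tensor)

text \<open>By \<open>linearization_iff\<close> the condition on \<open>N\<close> is the same for
  every representative \<open>L\<close>, and a representative exists.\<close>

lemma pic_map_line_class:
  assumes a: "cocycle X I U a"
  shows "pic_map k X Y \<gamma> (XC.line_class a) = YC.ring_class (iota_cocycle a)"
proof -
  have iff: "linearization k X Y \<gamma> L N \<longleftrightarrow> (\<exists>f. trivialization (mon_of Y) I (\<lambda>i. ov (U i)) (oset_of N) (iota_cocycle a) f)"
    if "L \<in> XC.line_class a" "rline_bundle Y N" for L and N :: "('y, 'r, 'y \<Rightarrow> 'r) omod"
    using that linearization_iff[OF _ a] by (auto simp: XC.line_class_def)
  obtain L where "L \<in> XC.line_class a" using a by (rule XC.line_class_nonempty)
  then show ?thesis unfolding pic_map_def YC.ring_class_def using iff by blast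
qed

lemma iota_cocycle_cech: "cocycle X I U a \<Longrightarrow> iota_cocycle a \<in> YC.cech_cocycles"
  by (simp add: YC.cech_cocycles_def iota_cocycle_cocycle) (simp add: iota_cocycle_def)

lemma cech_class_iota_eq_iff:
  assumes "cocycle X I U a" "cocycle X I U b"
  shows "YC.cech_class (iota_cocycle a) = YC.cech_class (iota_cocycle b) \<longleftrightarrow> XC.line_class a = XC.line_class b"
  by (simp add: YC.cech_class_eq_iff iota_cocycle_cech iota_cohomologous XC.line_class_eq_iff assms)

text \<open>Defined through a chosen cocycle; \<open>cech_class_iota_eq_iff\<close> makes the result
  independent of the choice.\<close>

definition pic_to_cech :: "('p, 'a, 'p \<Rightarrow> 'a) oset set \<Rightarrow> ('i \<times> 'i \<Rightarrow> 'r) set" where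
  "pic_to_cech c = YC.cech_class (iota_cocycle (SOME a. cocycle X I U a \<and> XC.line_class a = c))"

lemma pic_to_cech_line_class:
  assumes a: "cocycle X I U a"
  shows "pic_to_cech (XC.line_class a) = YC.cech_class (iota_cocycle a)"
proof -
  let ?b = "SOME b. cocycle X I U b \<and> XC.line_class b = XC.line_class a"
  have "cocycle X I U ?b \<and> XC.line_class ?b = XC.line_class a" by (rule someI[of _ a]) (simp add: a)
  then show ?thesis using cech_class_iota_eq_iff[of ?b a] a unfolding pic_to_cech_def by simp
qed

text \<open>Injective because \<open>iota_cohomologous\<close> brings cohomologous cocycles with
  trivial scalars back to \<open>X\<close>; surjective because
  \<open>exists_iota_cohomologous\<close> removes the scalars from any cocycle.\<close>

lemma pic_to_cech_iso: "pic_to_cech \<in> iso (mPic X) (cech_H1 Y I (\<lambda>i. ov (U i)))"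
proof -
  have "pic_to_cech ` carrier (mPic X) = carrier (cech_H1 Y I (\<lambda>i. ov (U i)))"
  proof (intro subset_antisym subsetI)
    fix c assume "c \<in> pic_to_cech ` carrier (mPic X)"
    then show "c \<in> carrier (cech_H1 Y I (\<lambda>i. ov (U i)))"
      using iota_cocycle_cech by (auto simp: carrier_mPic YC.carrier_cech_H1 pic_to_cech_line_class)
  next
    fix c assume "c \<in> carrier (cech_H1 Y I (\<lambda>i. ov (U i)))"
    then obtain g where g: "g \<in> YC.cech_cocycles" and c: "c = YC.cech_class g" by (auto simp: YC.carrier_cech_H1)
    have "cocycle (mon_of Y) I (\<lambda>i. ov (U i)) g" using g by (simp add: YC.cech_cocycles_def)
    then obtain a where a: "cocycle X I U a" and coh: "cohomologous (mon_of Y) I (\<lambda>i. ov (U i)) (iota_cocycle a) g"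
      by (rule exists_iota_cohomologous)
    have "pic_to_cech (XC.line_class a) = c"
      using coh by (simp add: c pic_to_cech_line_class[OF a] YC.cech_class_eq_iff iota_cocycle_cech[OF a] g)
    then show "c \<in> pic_to_cech ` carrier (mPic X)" using a by (auto simp: carrier_mPic)
  qed
  moreover have "inj_on pic_to_cech (carrier (mPic X))"
    by (rule inj_onI) (auto simp: carrier_mPic pic_to_cech_line_class cech_class_iota_eq_iff)
  moreover have "pic_to_cech (c \<otimes>\<^bsub>mPic X\<^esub> d) = pic_to_cech c \<otimes>\<^bsub>cech_H1 Y I (\<lambda>i. ov (U i))\<^esub> pic_to_cech d"
    if "c \<in> carrier (mPic X)" "d \<in> carrier (mPic X)" for c d
  proof -
    from that obtain a b where a: "cocycle X I U a" and b: "cocycle X I U b"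
      and c: "c = XC.line_class a" "d = XC.line_class b" by (auto simp: carrier_mPic)
    show ?thesis
      by (simp add: c mPic_mult a b pic_to_cech_line_class XC.cocycle_mult iota_cocycle_mult YC.cech_class_mult iota_cocycle_cech)
  qed
  ultimately show ?thesis unfolding iso_def hom_def bij_betw_def by auto
qed

lemma cech_to_pic_pic_to_cech:
  assumes "c \<in> carrier (mPic X)"
  shows "cech_to_pic Y I (\<lambda>i. ov (U i)) (pic_to_cech c) = pic_map k X Y \<gamma> c"
  using assms
  by (auto simp: carrier_mPic pic_to_cech_line_class YC.cech_to_pic_class iota_cocycle_cech pic_map_line_class)

text \<open>On classes of cocycles the map is \<open>a \<mapsto> iota_cocycle a\<close>. For
  injectivity, bundles in the same class of X_k have cohomologous cocycles on the fixed cover, and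
  \<open>iota_cohomologous\<close> returns to \<open>X\<close>.\<close>

lemma pic_map_mon: "pic_map k X Y \<gamma> \<in> mon (mPic X) (rPic Y)"
proof -
  have "YC.ring_class (iota_cocycle a) \<in> carrier (rPic Y)" if a: "cocycle X I U a" for a
  proof -
    obtain N :: "('y, 'r, 'y \<Rightarrow> 'r) omod" and e where N: "rline_bundle Y N"
      and e: "trivialization (mon_of Y) I (\<lambda>i. ov (U i)) (oset_of N) (iota_cocycle a) e"
      using iota_cocycle_cocycle[OF a] by (rule YC.exists_ring_bundle)
    show ?thesis using YC.rclass_eq_ring_class[OF N iota_cocycle_cocycle[OF a] e] N by (auto simp: rPic_def)
  qed
  moreover have "YC.ring_class (iota_cocycle (\<lambda>(i, j). a (i, j) \<otimes>\<^bsub>msec X (U i \<inter> U j)\<^esub> b (i, j))) =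
      YC.ring_class (iota_cocycle a) \<otimes>\<^bsub>rPic Y\<^esub> YC.ring_class (iota_cocycle b)"
    if a: "cocycle X I U a" and b: "cocycle X I U b" for a b
    unfolding iota_cocycle_mult[OF a b]
    by (simp add: rPic_def YC.ring_class_tensor iota_cocycle_cocycle a b)
      (simp add: YC.ring_class_def trivialization_def)
  moreover have "inj_on (pic_map k X Y \<gamma>) (carrier (mPic X))"
  proof (rule inj_onI)
    fix c d assume "c \<in> carrier (mPic X)" "d \<in> carrier (mPic X)" and eq: "pic_map k X Y \<gamma> c = pic_map k X Y \<gamma> d"
    then obtain a b where "cocycle X I U a" "cocycle X I U b" "c = XC.line_class a" "d = XC.line_class b"
      by (auto simp: carrier_mPic)
    then show "c = d"
      using eq by (simp add: pic_map_line_class YC.ring_class_eq_iff iota_cocycle_cocycle iota_cohomologous XC.line_class_eq_iff)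
  qed
  ultimately show ?thesis
    unfolding mon_def hom_def by (auto simp: carrier_mPic pic_map_line_class mPic_mult XC.cocycle_mult)
qed

end

theorem proposition8p1:
  fixes k :: "'k ring"
    and X :: "('p, 'a) monoidal_space"
    and I :: "'i set" and U :: "'i \<Rightarrow> 'p set"
    and Xk :: "('y, 'r) ringed_space"
    and \<gamma> :: "('p, 'a, 'k, 'y, 'r) gluing"
  assumes "domain k"
    and "cancellative_scheme X" and "torsion_free_scheme X"
    and "maffine_cover X I U"
    and "base_change k X Xk \<gamma>"
  shows "(\<exists>\<phi>. \<phi> \<in> iso (mPic X) (cech_H1 Xk I (\<lambda>i. over_k k X \<gamma> (U i))) \<and>
             (\<forall>c\<in>carrier (mPic X).
                cech_to_pic Xk I (\<lambda>i. over_k k X \<gamma> (U i)) (\<phi> c) = pic_map k X Xk \<gamma> c)) \<and>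
         pic_map k X Xk \<gamma> \<in> mon (mPic X) (rPic Xk)"
proof -
  interpret affine_cover k X Xk \<gamma> I U
  proof (intro affine_cover.intro base_changed.intro base_changed_axioms.intro affine_cover_axioms.intro mono_space.intro ring_space.intro)
    show "domain k" by (rule assms(1))
    show "monoid_scheme_space X" using assms(2) by (simp add: cancellative_scheme_def)
    then show "monoidal_space X" by (simp add: monoid_scheme_space_def)
    show "base_change k X Xk \<gamma>" by (rule assms(5))
    then show "ringed_space Xk" by (simp add: base_change_def)
    show "i \<in> I \<Longrightarrow> maffine X (U i)" "(\<Union>i\<in>I. U i) = topspace (mtop X)" for i
      using assms(4) by (simp_all add: maffine_cover_def)
    fix V assume V: "maffine X V"
    show "\<forall>a\<in>carrier (msec X V). \<forall>x\<in>carrier (msec X V). \<forall>y\<in>carrier (msec X V).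
        a \<otimes>\<^bsub>msec X V\<^esub> x = a \<otimes>\<^bsub>msec X V\<^esub> y \<longrightarrow> x = y"
      using assms(2) V unfolding cancellative_scheme_def by blast
    show "\<forall>x\<in>carrier (msec X V). \<forall>y\<in>carrier (msec X V). \<forall>n::nat.
        n > 0 \<and> x [^]\<^bsub>msec X V\<^esub> n = y [^]\<^bsub>msec X V\<^esub> n \<longrightarrow> x = y"
      using assms(3) V unfolding torsion_free_scheme_def by blast
  qed
  show ?thesis using pic_to_cech_iso cech_to_pic_pic_to_cech pic_map_mon by blast
qed

end
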